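(* Let $\mathcal{U}_1,\dots,\mathcal{U}_n$ be two-qubit unitary channels, where $\mathcal{U}_j$ acts on $A_jB_j$ with $A_j$ and $B_j$ single qubits. Then $$\gamma^{\mathrm{BB}}_{\mathrm{LO}^\star}(\mathcal{U}_1,\dots,\mathcal{U}_n)=\gamma^{\mathrm{BB}}_{\mathrm{LOCC}^\star}(\mathcal{U}_1,\dots,\mathcal{U}_n)=\gamma_{\mathrm{LO}^\star}(\mathcal{U}_1\otimes\mathcal{U}_2\otimes\cdots\otimes\mathcal{U}_n),$$ where on the right-hand side the bipartition is $A_1\cdots A_n$ versus $B_1\cdots B_n$.
   Context: All Hilbert spaces are finite-dimensional. $\mathrm{HP}(A\to B)$ is the real vector space of Hermitian-preserving linear maps from operators on $\mathcal H_A$ to operators on $\mathcal H_B$; CP, TP, CPTP mean completely positive, trace-preserving, and both. Quasiprobability extent: for $S\subset \mathrm{HP}(A\to B)$ and $\mathcal{E}\in\mathrm{HP}(A\to B)$, $\gamma_S(\mathcal{E})=\inf\{\sum_{i=1}^m|a_i| : m\ge 1,\ \mathcal{E}=\sum_{i=1}^m a_i\mathcal{F}_i,\ \mathcal{F}_i\in S,\ a_i\in\mathbb{R}\}$ ($=\infty$ if no decomposition exists). A quantum instrument from $A$ to $B$ is a countable family $(\mathcal{E}_i)_i$ of non-zero CP maps whose sum is TP. For a set $Q$ of instruments, let $Q^{*}:=\{\sum_i\beta_i\mathcal{E}_i : (\mathcal{E}_i)_i\in Q,\ \beta_i\in[-1,1]\}$. $\mathrm{LO}^\star(A;B)$ is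 $Q^*$ for $Q$ the set of all instruments $(\mathcal{E}_i\otimes\mathcal{F}_j)_{i,j}$, with $(\mathcal{E}_i)_i$ an instrument from $A$ to $A$ and $(\mathcal{F}_j)_j$ an instrument from $B$ to $B$. $\mathrm{LOCC}^\star(A;B)$ is $Q^*$ for $Q$ the set of all LOCC (local operations and classical communication, unboundedly many rounds) instruments from $AB$ to $AB$, in the standard sense: a one-way local instrument w.r.t. one party is an instrument in which that party applies an arbitrary local instrument and, conditioned on its outcome, the other party applies a CPTP map; an instrument is LOCC-linked to $(\mathcal{I}_j)_j$ if it is a coarse-graining (merging of outcomes) of $(\mathcal{J}_{j'|j}\circ\mathcal{I}_j)_{j,j'}$ where for each $j$, $(\mathcal{J}_{j'|j})_{j'}$ is a one-way local instrument w.r.t. some party (possibly depending on $j$); one-round LOCC instruments are coarse-grainings of one-way local instruments, $r$-round ones are those LOCC-linked to an $(r-1)$-round one; an instrument $\mathcal I$ is LOCC if there is a sequence $\mathcal{I}_1,\mathcal{I}_2,\dots$ with $\mathcal{I}_n$ an $n$-round LOCC instrument that is LOCC-linked to $\mathcal{I}_{n-1}$, such that suitable coarse-grainings of $\mathcal{I}_n$ converge to $\mathcal{I}$. Black box quasiprobability extent: let $S$ be $\mathrm{LO}^\star$ or $\mathrm{LOCC}^\star$ and let $\mathcal{E}_j$ be Hermitian-preserving maps on $A_jB_j$, $j=1,\dots,n$. A black box decomposition consists of ancilla systems $E_A,E_B$ initialized in a fixed product state $|0\rangle\langle 0|_{E_AE_B}$, coefficients $a\in\mathbb{R}^m$ and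 maps $\mathcal{F}_j^{(i)}\in S(A_jE_A;B_jE_B)$, $1\le i\le m$, $1\le j\le n$, such that for every bipartite system $AB$, every embedding of the $A_j$ as subsystems of $A$ and of the $B_j$ as subsystems of $B$, and every choice of CPTP maps $\mathcal{B}_1,\dots,\mathcal{B}_{n-1}$ on $AB$, $$\mathcal{E}_n\circ\mathcal{B}_{n-1}\circ\mathcal{E}_{n-1}\circ\cdots\circ\mathcal{B}_1\circ\mathcal{E}_1(\rho)=\sum_{i=1}^m a_i\,\mathrm{tr}_{E_AE_B}\big[\mathcal{F}_n^{(i)}\circ\mathcal{B}_{n-1}\circ\mathcal{F}_{n-1}^{(i)}\circ\cdots\circ\mathcal{B}_1\circ\mathcal{F}_1^{(i)}(\rho\otimes|0\rangle\langle 0|_{E_AE_B})\big]$$ for all $\rho$ (maps are implicitly tensored with identity channels). $\gamma^{\mathrm{BB}}_S(\mathcal{E}_1,\dots,\mathcal{E}_n)$ is the infimum of $\|a\|_1=\sum_i|a_i|$ over all black box decompositions. *)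

theory Defs
  imports "HOL-Analysis.Analysis"
begin

text \<open>
  A Hilbert space of dimension d is presented by an orthonormal basis, labelled by a finite set
  with d elements. This allows dimensions to be quantified inside definitions (ancillas,
  surrounding systems), and the tensor product of two systems is the one labelled by the
  Cartesian product of the label sets. Operators are matrices over the labels; those on the system
  with label set \<open>X\<close> vanish outside \<open>X \<times> X\<close>. A map between operator spaces is a function that is
  only looked at on \<open>ops X\<close>: all notions below are insensitive to its values elsewhere.
\<close>

type_synonym 'a oper = "'a \<Rightarrow> 'a \<Rightarrow> complex"
type_synonym ('a, 'b) opmap = "'a oper \<Rightarrow> 'b oper"

definition ops :: "'a set \<Rightarrow> 'a oper set" where
  "ops X = {M. \<forall>i j. M i j \<noteq> 0 \<longrightarrow> i \<in> X \<and> j \<in> X}"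

definition matrix_unit :: "'a \<Rightarrow> 'a \<Rightarrow> 'a oper" where
  "matrix_unit u v = (\<lambda>i j. if i = u \<and> j = v then 1 else 0)"

definition trace_on :: "'a set \<Rightarrow> 'a oper \<Rightarrow> complex" where
  "trace_on X M = (\<Sum>i\<in>X. M i i)"

definition psd :: "'a set \<Rightarrow> 'a oper \<Rightarrow> bool" where
  "psd X M \<longleftrightarrow> M \<in> ops X \<and>
     (\<forall>v :: 'a \<Rightarrow> complex. (\<Sum>i\<in>X. \<Sum>j\<in>X. cnj (v i) * M i j * v j) \<in> \<real>\<^sub>\<ge>\<^sub>0)"

definition linear_map :: "'a set \<Rightarrow> 'b set \<Rightarrow> ('a, 'b) opmap \<Rightarrow> bool" where
  "linear_map X Y E \<longleftrightarrow>
     (\<forall>M\<in>ops X. E M \<in> ops Y) \<and>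
     (\<forall>M\<in>ops X. \<forall>N\<in>ops X. E (\<lambda>i j. M i j + N i j) = (\<lambda>i j. E M i j + E N i j)) \<and>
     (\<forall>c. \<forall>M\<in>ops X. E (\<lambda>i j. c * M i j) = (\<lambda>i j. c * E M i j))"

text \<open>
  The tensor product of two linear maps, as \<open>(E \<otimes> id) \<circ> (id \<otimes> F)\<close>: a matrix over pairs of labels is
  a matrix of blocks, and each factor is applied to the blocks in its own labels.
\<close>

definition tensor_map ::
  "('a, 'c) opmap \<Rightarrow> ('b, 'd) opmap \<Rightarrow> ('a \<times> 'b, 'c \<times> 'd) opmap" where
  "tensor_map E F M =
     (\<lambda>(c, d) (c', d'). E (\<lambda>a a'. F (\<lambda>b b'. M (a, b) (a', b')) d d') c c')"

definition cp :: "'a set \<Rightarrow> 'b set \<Rightarrow> ('a, 'b) opmap \<Rightarrow> bool" where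
  "cp X Y E \<longleftrightarrow> linear_map X Y E \<and>
     (\<forall>k::nat. \<forall>M. psd (X \<times> {..<k}) M \<longrightarrow> psd (Y \<times> {..<k}) (tensor_map E id M))"

definition tp :: "'a set \<Rightarrow> 'b set \<Rightarrow> ('a, 'b) opmap \<Rightarrow> bool" where
  "tp X Y E \<longleftrightarrow> linear_map X Y E \<and> (\<forall>M\<in>ops X. trace_on Y (E M) = trace_on X M)"

definition cptp :: "'a set \<Rightarrow> 'b set \<Rightarrow> ('a, 'b) opmap \<Rightarrow> bool" where
  "cptp X Y E \<longleftrightarrow> cp X Y E \<and> tp X Y E"

definition unitary :: "'a set \<Rightarrow> 'b set \<Rightarrow> ('b \<Rightarrow> 'a \<Rightarrow> complex) \<Rightarrow> bool" where
  "unitary X Y W \<longleftrightarrow>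
     (\<forall>i\<in>X. \<forall>j\<in>X. (\<Sum>k\<in>Y. cnj (W k i) * W k j) = (if i = j then 1 else 0)) \<and>
     (\<forall>i\<in>Y. \<forall>j\<in>Y. (\<Sum>k\<in>X. W i k * cnj (W j k)) = (if i = j then 1 else 0))"

definition adjoint_matrix :: "('b \<Rightarrow> 'a \<Rightarrow> complex) \<Rightarrow> ('a \<Rightarrow> 'b \<Rightarrow> complex)" where
  "adjoint_matrix W = (\<lambda>i j. cnj (W j i))"

text \<open>The map \<open>M \<mapsto> W M W\<^sup>*\<close>; for unitary \<open>W\<close> and \<open>Y = X\<close> this is the unitary channel of \<open>W\<close>.\<close>

definition conj_map :: "'a set \<Rightarrow> 'b set \<Rightarrow> ('b \<Rightarrow> 'a \<Rightarrow> complex) \<Rightarrow> ('a, 'b) opmap" where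
  "conj_map X Y W M = (\<lambda>i j. if i \<in> Y \<and> j \<in> Y
     then (\<Sum>k\<in>X. \<Sum>l\<in>X. W i k * M k l * cnj (W j l)) else 0)"


text \<open>
  Instruments. A countable family of non-zero maps is encoded as a family over a countable index
  type (\<open>nat\<close> or \<open>nat \<times> nat\<close>) in which the zero map marks the unused indices. Sums of maps are
  taken entrywise; for CP maps with a TP sum they converge absolutely.
\<close>

definition map_has_sum ::
  "'a set \<Rightarrow> ('i \<Rightarrow> ('a, 'b) opmap) \<Rightarrow> 'i set \<Rightarrow> ('a, 'b) opmap \<Rightarrow> bool" where
  "map_has_sum X E I G \<longleftrightarrow>
     (\<forall>M\<in>ops X. \<forall>y y'. ((\<lambda>i. E i M y y') has_sum G M y y') I)"

definition instrument :: "'a set \<Rightarrow> 'b set \<Rightarrow> ('i \<Rightarrow> ('a, 'b) opmap) \<Rightarrow> bool" where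
  "instrument X Y E \<longleftrightarrow> (\<forall>i. cp X Y (E i)) \<and> (\<exists>T. tp X Y T \<and> map_has_sum X E UNIV T)"

definition star :: "'a set \<Rightarrow> ('i \<Rightarrow> ('a, 'b) opmap) set \<Rightarrow> ('a, 'b) opmap set" where
  "star X Q = {G. \<exists>E\<in>Q. \<exists>\<beta> :: 'i \<Rightarrow> real. (\<forall>i. \<beta> i \<in> {-1..1}) \<and>
     map_has_sum X (\<lambda>i M y y'. complex_of_real (\<beta> i) * E i M y y') UNIV G}"

definition lo_instruments ::
  "'a set \<Rightarrow> 'b set \<Rightarrow> (nat \<times> nat \<Rightarrow> ('a \<times> 'b, 'a \<times> 'b) opmap) set" where
  "lo_instruments A B = {(\<lambda>(i, j). tensor_map (E i) (F j)) | E F.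
     instrument A A E \<and> instrument B B F}"

definition lo_star :: "'a set \<Rightarrow> 'b set \<Rightarrow> ('a \<times> 'b, 'a \<times> 'b) opmap set" where
  "lo_star A B = star (A \<times> B) (lo_instruments A B)"

definition one_way_local ::
  "'a set \<Rightarrow> 'b set \<Rightarrow> (nat \<Rightarrow> ('a \<times> 'b, 'a \<times> 'b) opmap) \<Rightarrow> bool" where
  "one_way_local A B J \<longleftrightarrow>
     (\<exists>E T. instrument A A E \<and> (\<forall>k. cptp B B (T k)) \<and> J = (\<lambda>k. tensor_map (E k) (T k))) \<or>
     (\<exists>T F. (\<forall>k. cptp A A (T k)) \<and> instrument B B F \<and> J = (\<lambda>k. tensor_map (T k) (F k)))"

text \<open>\<open>F\<close> arises from \<open>E\<close> by merging all outcomes with the same image under \<open>f\<close>.\<close>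

definition coarse_graining ::
  "'a set \<Rightarrow> ('i \<Rightarrow> ('a, 'b) opmap) \<Rightarrow> ('k \<Rightarrow> ('a, 'b) opmap) \<Rightarrow> bool" where
  "coarse_graining X E F \<longleftrightarrow> (\<exists>f :: 'i \<Rightarrow> 'k. \<forall>k. map_has_sum X E {i. f i = k} (F k))"

text \<open>\<open>locc_linked A B I I'\<close> reads: \<open>I'\<close> is LOCC-linked to \<open>I\<close>.\<close>

definition locc_linked ::
  "'a set \<Rightarrow> 'b set \<Rightarrow> (nat \<Rightarrow> ('a \<times> 'b, 'a \<times> 'b) opmap)
     \<Rightarrow> (nat \<Rightarrow> ('a \<times> 'b, 'a \<times> 'b) opmap) \<Rightarrow> bool" where
  "locc_linked A B I I' \<longleftrightarrow> (\<exists>J. (\<forall>j. one_way_local A B (J j)) \<and>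
     coarse_graining (A \<times> B) (\<lambda>(j, j'). J j j' \<circ> I j) I')"

inductive locc_round ::
  "'a set \<Rightarrow> 'b set \<Rightarrow> nat \<Rightarrow> (nat \<Rightarrow> ('a \<times> 'b, 'a \<times> 'b) opmap) \<Rightarrow> bool"
  for A B where
  one_round: "one_way_local A B J \<Longrightarrow> coarse_graining (A \<times> B) J I \<Longrightarrow> locc_round A B 1 I"
| next_round: "locc_round A B r I \<Longrightarrow> locc_linked A B I I' \<Longrightarrow> locc_round A B (Suc r) I'"

text \<open>
  Summed norm distance of two families. Up to factors depending only on the dimension, this is the
  diamond norm distance of the channels \<open>\<rho> \<mapsto> \<Sum>k. E k \<rho> \<otimes> |k\<rangle>\<langle>k|\<close>, the usual metric on instruments.
  (The sum over \<open>k\<close> is in \<open>ennreal\<close>, hence defined whether or not it is finite.)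
\<close>

definition family_dist ::
  "'a set \<Rightarrow> 'b set \<Rightarrow> (nat \<Rightarrow> ('a, 'b) opmap) \<Rightarrow> (nat \<Rightarrow> ('a, 'b) opmap) \<Rightarrow> ennreal" where
  "family_dist X Y E F = (\<Sum>k. ennreal (\<Sum>u\<in>X. \<Sum>v\<in>X. \<Sum>y\<in>Y. \<Sum>y'\<in>Y.
     cmod (E k (matrix_unit u v) y y' - F k (matrix_unit u v) y y')))"

definition locc_instruments ::
  "'a set \<Rightarrow> 'b set \<Rightarrow> (nat \<Rightarrow> ('a \<times> 'b, 'a \<times> 'b) opmap) set" where
  "locc_instruments A B = {I. instrument (A \<times> B) (A \<times> B) I \<and>
     (\<exists>S C. (\<forall>n\<ge>1. locc_round A B n (S n)) \<and>
            (\<forall>n\<ge>1. locc_linked A B (S n) (S (Suc n))) \<and>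
            (\<forall>n\<ge>1. coarse_graining (A \<times> B) (S n) (C n)) \<and>
            (\<lambda>n. family_dist (A \<times> B) (A \<times> B) (C n) I) \<longlonglongrightarrow> 0)}"

definition locc_star :: "'a set \<Rightarrow> 'b set \<Rightarrow> ('a \<times> 'b, 'a \<times> 'b) opmap set" where
  "locc_star A B = star (A \<times> B) (locc_instruments A B)"


definition quasi_extent :: "'a set \<Rightarrow> ('a, 'b) opmap set \<Rightarrow> ('a, 'b) opmap \<Rightarrow> ereal" where
  "quasi_extent X S E = Inf {ereal (\<Sum>i=1..m. \<bar>a i\<bar>) | (m::nat) (a :: nat \<Rightarrow> real) F.
     m \<ge> 1 \<and> (\<forall>i\<in>{1..m}. F i \<in> S) \<and>
     (\<forall>M\<in>ops X. E M = (\<lambda>y y'. \<Sum>i=1..m. complex_of_real (a i) * F i M y y'))}"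

text \<open>
  The tensor product of maps \<open>E j\<close> on bipartite systems \<open>X j \<times> Y j\<close>, \<open>j = 1, \<dots>, n\<close>, regrouped as a
  map on the bipartite system of all \<open>X j\<close> versus all \<open>Y j\<close>. Basis labels of the two sides are
  extensional functions on \<open>{1..n}\<close>, and the map is given by its values on matrix units.
\<close>

definition tensor_maps ::
  "nat \<Rightarrow> (nat \<Rightarrow> 'a set) \<Rightarrow> (nat \<Rightarrow> 'b set) \<Rightarrow> (nat \<Rightarrow> ('a \<times> 'b, 'a \<times> 'b) opmap)
     \<Rightarrow> ((nat \<Rightarrow> 'a) \<times> (nat \<Rightarrow> 'b), (nat \<Rightarrow> 'a) \<times> (nat \<Rightarrow> 'b)) opmap" where
  "tensor_maps n X Y E M = (\<lambda>p p'.
     let Z = (\<Pi>\<^sub>E j\<in>{1..n}. X j) \<times> (\<Pi>\<^sub>E j\<in>{1..n}. Y j) in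
     if p \<in> Z \<and> p' \<in> Z then
       (\<Sum>q\<in>Z. \<Sum>q'\<in>Z. M q q' *
          (\<Prod>j=1..n. E j (matrix_unit (fst q j, snd q j) (fst q' j, snd q' j))
                        (fst p j, snd p j) (fst p' j, snd p' j)))
     else 0)"


text \<open>\<open>E n \<circ> B (n - 1) \<circ> E (n - 1) \<circ> \<dots> \<circ> B 1 \<circ> E 1\<close>\<close>

fun circuit :: "(nat \<Rightarrow> ('a, 'a) opmap) \<Rightarrow> (nat \<Rightarrow> ('a, 'a) opmap) \<Rightarrow> nat \<Rightarrow> ('a, 'a) opmap" where
  "circuit E B 0 = id"
| "circuit E B (Suc 0) = E 1"
| "circuit E B (Suc (Suc k)) = E (Suc (Suc k)) \<circ> B (Suc k) \<circ> circuit E B (Suc k)"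

text \<open>
  An embedding of a system with labels \<open>X\<close> as a subsystem of one with labels \<open>A\<close> is a unitary
  identification \<open>V\<close> of \<open>A\<close> with \<open>X \<otimes> R\<close> for some complementary system \<open>R\<close>.
  Given such embeddings \<open>V\<close>, \<open>V'\<close> of \<open>X\<close>, \<open>Y\<close> into the two sides of a bipartite system, with
  complements \<open>R\<close>, \<open>R'\<close>, a map \<open>E\<close> on \<open>X \<otimes> Y\<close> acts on \<open>A \<otimes> B\<close> as \<open>E \<otimes> id\<close>. A map on
  \<open>(X \<otimes> P) \<otimes> (Y \<otimes> Q)\<close>, with ancillas \<open>P\<close>, \<open>Q\<close>, acts likewise on \<open>(A \<otimes> B) \<otimes> (P \<otimes> Q)\<close>.
\<close>

definition act_on_subsystem ::
  "'a set \<Rightarrow> 'x set \<Rightarrow> 'r set \<Rightarrow> ('x \<times> 'r \<Rightarrow> 'a \<Rightarrow> complex) \<Rightarrow> ('x, 'x) opmap \<Rightarrow> ('a, 'a) opmap" where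
  "act_on_subsystem A X R W E =
     conj_map (X \<times> R) A (adjoint_matrix W) \<circ> tensor_map E id \<circ> conj_map A (X \<times> R) W"

definition joint_embedding ::
  "('x \<times> 'r \<Rightarrow> 'a \<Rightarrow> complex) \<Rightarrow> ('y \<times> 's \<Rightarrow> 'b \<Rightarrow> complex)
     \<Rightarrow> (('x \<times> 'y) \<times> ('r \<times> 's) \<Rightarrow> 'a \<times> 'b \<Rightarrow> complex)" where
  "joint_embedding V V' = (\<lambda>((x, y), (r, s)) (a, b). V (x, r) a * V' (y, s) b)"

definition joint_embedding_ancilla ::
  "('x \<times> 'r \<Rightarrow> 'a \<Rightarrow> complex) \<Rightarrow> ('y \<times> 's \<Rightarrow> 'b \<Rightarrow> complex)
     \<Rightarrow> (('x \<times> 'p) \<times> ('y \<times> 'q)) \<times> ('r \<times> 's) \<Rightarrow> ('a \<times> 'b) \<times> ('p \<times> 'q) \<Rightarrow> complex" where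
  "joint_embedding_ancilla V V' = (\<lambda>(((x, p), (y, q)), (r, s)) ((a, b), (p', q')).
     V (x, r) a * V' (y, s) b * (if p = p' \<and> q = q' then 1 else 0))"

definition attach_state :: "'p oper \<Rightarrow> 'a oper \<Rightarrow> ('a \<times> 'p) oper" where
  "attach_state \<sigma> M = (\<lambda>(i, p) (j, q). M i j * \<sigma> p q)"

definition partial_trace :: "'p set \<Rightarrow> ('a \<times> 'p) oper \<Rightarrow> 'a oper" where
  "partial_trace P M = (\<lambda>i j. \<Sum>p\<in>P. M (i, p) (j, p))"

text \<open>
  The ancillas have labels \<open>{..<p}\<close> and \<open>{..<q}\<close> and start in the basis state \<open>(0, 0)\<close>. Each subsystem
  is embedded separately, so images of different subsystems may but need not overlap.
\<close>

definition black_box_decomposition ::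
  "(('a \<times> nat) set \<Rightarrow> ('b \<times> nat) set
       \<Rightarrow> (('a \<times> nat) \<times> ('b \<times> nat), ('a \<times> nat) \<times> ('b \<times> nat)) opmap set)
     \<Rightarrow> nat \<Rightarrow> (nat \<Rightarrow> 'a set) \<Rightarrow> (nat \<Rightarrow> 'b set) \<Rightarrow> (nat \<Rightarrow> ('a \<times> 'b, 'a \<times> 'b) opmap)
     \<Rightarrow> nat \<Rightarrow> nat \<Rightarrow> nat \<Rightarrow> (nat \<Rightarrow> real)
     \<Rightarrow> (nat \<Rightarrow> nat \<Rightarrow> (('a \<times> nat) \<times> ('b \<times> nat), ('a \<times> nat) \<times> ('b \<times> nat)) opmap) \<Rightarrow> bool" where
  "black_box_decomposition S n X Y E p q m a F \<longleftrightarrow>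
     0 < p \<and> 0 < q \<and>
     (\<forall>i\<in>{1..m}. \<forall>j\<in>{1..n}. F i j \<in> S (X j \<times> {..<p}) (Y j \<times> {..<q})) \<and>
     (\<forall>dA dB (rA :: nat \<Rightarrow> nat) (rB :: nat \<Rightarrow> nat)
        (V :: nat \<Rightarrow> 'a \<times> nat \<Rightarrow> nat \<Rightarrow> complex) (V' :: nat \<Rightarrow> 'b \<times> nat \<Rightarrow> nat \<Rightarrow> complex) B.
        let AB = {..<dA} \<times> {..<dB}; PQ = {..<p} \<times> {..<q} in
        (\<forall>j\<in>{1..n}. unitary {..<dA} (X j \<times> {..<rA j}) (V j) \<and>
                    unitary {..<dB} (Y j \<times> {..<rB j}) (V' j)) \<longrightarrow>
        (\<forall>k\<in>{1..<n}. cptp AB AB (B k)) \<longrightarrow>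
        (\<forall>\<rho>\<in>ops AB.
           circuit (\<lambda>j. act_on_subsystem AB (X j \<times> Y j) ({..<rA j} \<times> {..<rB j})
                          (joint_embedding (V j) (V' j)) (E j)) B n \<rho> =
           (\<lambda>x x'. \<Sum>i=1..m. complex_of_real (a i) *
              partial_trace PQ
                (circuit (\<lambda>j. act_on_subsystem (AB \<times> PQ)
                                ((X j \<times> {..<p}) \<times> (Y j \<times> {..<q})) ({..<rA j} \<times> {..<rB j})
                                (joint_embedding_ancilla (V j) (V' j)) (F i j))
                   (\<lambda>k. tensor_map (B k) id) n
                   (attach_state (matrix_unit (0, 0) (0, 0)) \<rho>)) x x')))"

definition black_box_extent ::
  "(('a \<times> nat) set \<Rightarrow> ('b \<times> nat) set
       \<Rightarrow> (('a \<times> nat) \<times> ('b \<times> nat), ('a \<times> nat) \<times> ('b \<times> nat)) opmap set)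
     \<Rightarrow> nat \<Rightarrow> (nat \<Rightarrow> 'a set) \<Rightarrow> (nat \<Rightarrow> 'b set) \<Rightarrow> (nat \<Rightarrow> ('a \<times> 'b, 'a \<times> 'b) opmap)
     \<Rightarrow> ereal" where
  "black_box_extent S n X Y E = Inf {ereal (\<Sum>i=1..m. \<bar>a i\<bar>) | p q m a F.
     black_box_decomposition S n X Y E p q m a F}"

abbreviation qubit :: "bool set" where
  "qubit \<equiv> UNIV"

end

theory Submission
  imports Defs
begin

text \<open>
  In the basis \<open>1, \<i>X, \<i>Y, \<i>Z\<close> of both factors, a two-qubit unitary has a coefficient matrix \<open>T\<close> for
  which unitarity makes \<open>T T\<^sup>*\<close> and \<open>T\<^sup>* T\<close> real. Its real and imaginary parts therefore have a common real
  singular value decomposition, and real unit vectors of coefficients are unit quaternions, so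
  \<open>W\<^sub>j = \<Sum>k. u\<^sub>j\<^sub>k L\<^sub>j\<^sub>k \<otimes> R\<^sub>j\<^sub>k\<close> with \<open>u\<^sub>j\<^sub>k \<ge> 0\<close> and with unitary, Hilbert-Schmidt orthogonal \<open>L\<^sub>j\<^sub>k\<close> and
  \<open>R\<^sub>j\<^sub>k\<close>. All three quantities equal \<open>2 s\<^sup>2 - 1\<close>, where \<open>s\<close> is the product over \<open>j\<close> of \<open>\<Sum>k. u\<^sub>j\<^sub>k\<close>.

  Upper bound: with multi-indices \<open>\<kappa>\<close>, the product channel is the sum of
  \<open>u\<^sub>\<kappa> u\<^sub>\<kappa>\<^sub>' (L\<^sub>\<kappa> \<otimes> R\<^sub>\<kappa>) \<rho> (L\<^sub>\<kappa>\<^sub>' \<otimes> R\<^sub>\<kappa>\<^sub>')\<^sup>*\<close>. By polarisation the terms \<open>(\<kappa>, \<kappa>')\<close> and \<open>(\<kappa>', \<kappa>)\<close> together are a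
  combination of two products of local maps, each a difference of the two branches of a local
  instrument. In the black box setting an ancilla qubit on each side, prepared in \<open>|+\<rangle>\<close>, remembers
  whether \<open>\<kappa>\<close> or \<open>\<kappa>'\<close> is applied, and is measured at the end.

  Lower bound: every map \<open>F\<close> in \<open>LO\<^sup>\<star>\<close> or \<open>LOCC\<^sup>\<star>\<close> admits a trace-preserving \<open>T\<close> such that \<open>T + F\<close> and \<open>T - F\<close>
  are separable. This property survives composition, embedding and discarding of ancillas. It is
  tested against the Choi matrix witness \<open>2 |\<Phi>\<rangle>\<langle>\<Phi>| / D - 1\<close> with \<open>\<Phi> = \<Sum>\<kappa>. L\<^sub>\<kappa> \<otimes> R\<^sub>\<kappa>\<close>.
\<close>

section \<open>Operators and linear maps\<close>

text \<open>The value \<open>2 s^2 - 1\<close> has a separate source on each side. Polarisation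
  spends two product maps on each ordered pair of multi-indices, but a diagonal pair needs only one
  of them; the weights add up to \<open>2 s^2\<close> minus the sum of the squared coefficients,
  which is 1 by unitarity. For the witness, \<open>\<Phi>\<close> overlaps the unitary in
  \<open>D s\<close>; the square of this times \<open>2 / D\<close>, minus the squared norm
  \<open>D\<close>, is \<open>D (2 s^2 - 1)\<close>, while trace preservation allows each admissible
  map at most \<open>D\<close>.

  Two obstacles shape the proof. LOCC instruments may have infinitely many outcomes and arise as
  limits, so separability is defined by duality, as nonnegativity under every linear functional that
  is nonnegative on product Kraus maps; sums and limits then preserve it without an explicit
  decomposition. In the black box setting arbitrary channels intervene, so polarisation has to apply
  to whole sequences of gates rather than to single ones; a memory that stays coherent until the end
  makes all gates use the same pair of multi-indices.\<close>

definition sandwich ::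
  "'a set \<Rightarrow> 'b set \<Rightarrow> ('b \<Rightarrow> 'a \<Rightarrow> complex) \<Rightarrow> ('b \<Rightarrow> 'a \<Rightarrow> complex) \<Rightarrow> ('a, 'b) opmap" where
  "sandwich X Y K K' M = (\<lambda>i j. if i \<in> Y \<and> j \<in> Y
     then (\<Sum>k\<in>X. \<Sum>l\<in>X. K i k * M k l * cnj (K' j l)) else 0)"

definition kron ::
  "('c \<Rightarrow> 'a \<Rightarrow> complex) \<Rightarrow> ('d \<Rightarrow> 'b \<Rightarrow> complex) \<Rightarrow> ('c \<times> 'd \<Rightarrow> 'a \<times> 'b \<Rightarrow> complex)" where
  "kron K J = (\<lambda>(c, d) (a, b). K c a * J d b)"

definition matrix_mult_on ::
  "'b set \<Rightarrow> ('c \<Rightarrow> 'b \<Rightarrow> complex) \<Rightarrow> ('b \<Rightarrow> 'a \<Rightarrow> complex) \<Rightarrow> ('c \<Rightarrow> 'a \<Rightarrow> complex)" where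
  "matrix_mult_on Y K J = (\<lambda>i j. \<Sum>k\<in>Y. K i k * J k j)"

lemma kron_apply [simp]: "kron K J (c, d) (a, b) = K c a * J d b"
  by (simp add: kron_def)

text \<open>Distinct operators on the left and on the right cover the cross terms of a polarised or
  controlled channel, which are not conjugations.\<close>

lemma conj_map_eq_sandwich: "conj_map X Y K = sandwich X Y K K"
  by (intro ext) (simp add: conj_map_def sandwich_def)

lemma opsI: "(\<And>i j. M i j \<noteq> 0 \<Longrightarrow> i \<in> X \<and> j \<in> X) \<Longrightarrow> M \<in> ops X"
  by (simp add: ops_def)

lemma ops_outside: "M \<in> ops X \<Longrightarrow> i \<notin> X \<or> j \<notin> X \<Longrightarrow> M i j = 0"
  by (auto simp: ops_def)

lemma zero_in_ops [simp]: "(\<lambda>i j. 0) \<in> ops X"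
  by (simp add: ops_def)

lemma matrix_unit_in_ops [simp]: "u \<in> X \<Longrightarrow> v \<in> X \<Longrightarrow> matrix_unit u v \<in> ops X"
  by (simp add: ops_def matrix_unit_def)

lemma sum_in_ops: "(\<And>i. i \<in> I \<Longrightarrow> M i \<in> ops X) \<Longrightarrow> (\<lambda>x y. \<Sum>i\<in>I. c i * M i x y) \<in> ops X"
  by (rule opsI) (metis (mono_tags, lifting) mult_zero_right ops_outside sum.neutral)

lemma sandwich_in_ops [simp]: "sandwich X Y K K' M \<in> ops Y"
  by (auto simp: ops_def sandwich_def)

lemma sum_matrix_unit:
  assumes "finite X"
  shows "(\<Sum>u\<in>X. \<Sum>v\<in>X. f u v * matrix_unit u v i j) = (if i \<in> X \<and> j \<in> X then f i j else 0)"
proof -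
  have "(\<Sum>u\<in>X. \<Sum>v\<in>X. f u v * matrix_unit u v i j)
      = (\<Sum>u\<in>X. if i = u then (\<Sum>v\<in>X. if j = v then f u v else 0) else 0)"
    by (intro sum.cong refl) (auto simp: matrix_unit_def if_distrib cong: if_cong)
  then show ?thesis
    using assms by simp
qed

lemma ops_expand:
  assumes "finite X" "M \<in> ops X"
  shows "M = (\<lambda>i j. \<Sum>u\<in>X. \<Sum>v\<in>X. M u v * matrix_unit u v i j)"
  by (intro ext) (use assms in \<open>auto simp: sum_matrix_unit dest: ops_outside\<close>)

lemma linear_mapD:
  assumes "linear_map X Y E"
  shows "M \<in> ops X \<Longrightarrow> E M \<in> ops Y"
    and "M \<in> ops X \<Longrightarrow> N \<in> ops X \<Longrightarrow> E (\<lambda>i j. M i j + N i j) = (\<lambda>i j. E M i j + E N i j)"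
    and "M \<in> ops X \<Longrightarrow> E (\<lambda>i j. c * M i j) = (\<lambda>i j. c * E M i j)"
  using assms by (auto simp: linear_map_def)

lemma linear_map_zero:
  assumes "linear_map X Y E"
  shows "E (\<lambda>i j. 0) = (\<lambda>i j. 0)"
  using linear_mapD(3)[OF assms zero_in_ops, of 0] by simp

lemma linear_map_sum:
  assumes E: "linear_map X Y E" and I: "finite I" and M: "\<And>i. i \<in> I \<Longrightarrow> M i \<in> ops X"
  shows "E (\<lambda>x y. \<Sum>i\<in>I. c i * M i x y) = (\<lambda>x y. \<Sum>i\<in>I. c i * E (M i) x y)"
  using I M
proof (induction I rule: finite_induct)
  case empty
  then show ?case using linear_map_zero[OF E] by simp
next
  case (insert i I)
  have 1: "(\<lambda>x y. c i * M i x y) \<in> ops X"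
    using insert.prems by (auto simp: ops_def)
  have 2: "(\<lambda>x y. \<Sum>i\<in>I. c i * M i x y) \<in> ops X"
    using insert.prems by (intro sum_in_ops) auto
  show ?case
    using insert linear_mapD(2)[OF E 1 2] linear_mapD(3)[OF E, of "M i" "c i"]
    by (simp add: fun_eq_iff)
qed

lemma linear_map_expand:
  assumes E: "linear_map X Y E" and X: "finite X" and M: "M \<in> ops X"
  shows "E M = (\<lambda>y y'. \<Sum>u\<in>X. \<Sum>v\<in>X. M u v * E (matrix_unit u v) y y')"
proof -
  have "M = (\<lambda>i j. \<Sum>w\<in>X \<times> X. M (fst w) (snd w) * matrix_unit (fst w) (snd w) i j)"
    using ops_expand[OF X M] by (simp add: sum.cartesian_product case_prod_beta)
  then have "E M = E (\<lambda>i j. \<Sum>w\<in>X \<times> X. M (fst w) (snd w) * matrix_unit (fst w) (snd w) i j)"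
    by simp
  also have "\<dots> = (\<lambda>y y'. \<Sum>w\<in>X \<times> X. M (fst w) (snd w) * E (matrix_unit (fst w) (snd w)) y y')"
    using X by (intro linear_map_sum[OF E]) auto
  finally show ?thesis
    by (simp add: sum.cartesian_product case_prod_beta)
qed

lemma linear_map_outside:
  assumes E: "linear_map X Y E" and M: "M \<in> ops X" and y: "y \<notin> Y \<or> y' \<notin> Y"
  shows "E M y y' = 0"
  by (rule ops_outside[OF linear_mapD(1)[OF E M] y])

lemma linear_map_eqI:
  assumes "linear_map X Y E" "linear_map X Y F" "finite X" "M \<in> ops X"
    and "\<And>u v y y'. u \<in> X \<Longrightarrow> v \<in> X \<Longrightarrow> y \<in> Y \<Longrightarrow> y' \<in> Y \<Longrightarrow>
      E (matrix_unit u v) y y' = F (matrix_unit u v) y y'"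
  shows "E M = F M"
proof -
  have "E (matrix_unit u v) y y' = F (matrix_unit u v) y y'" if "u \<in> X" "v \<in> X" for u v y y'
    using assms(5)[OF that, of y y'] linear_map_outside[OF assms(1), of "matrix_unit u v" y y']
      linear_map_outside[OF assms(2), of "matrix_unit u v" y y'] that
    by (cases "y \<in> Y \<and> y' \<in> Y") auto
  then have "(\<lambda>y y'. \<Sum>u\<in>X. \<Sum>v\<in>X. M u v * E (matrix_unit u v) y y')
      = (\<lambda>y y'. \<Sum>u\<in>X. \<Sum>v\<in>X. M u v * F (matrix_unit u v) y y')"
    by (intro ext sum.cong refl) simp
  then show ?thesis
    unfolding linear_map_expand[OF assms(1,3,4)] linear_map_expand[OF assms(2,3,4)] .
qed

lemma add_in_ops: "M \<in> ops X \<Longrightarrow> N \<in> ops X \<Longrightarrow> (\<lambda>i j. M i j + N i j) \<in> ops X"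
  by (rule opsI) (metis add_cancel_right_left ops_outside)

lemma scale_in_ops: "M \<in> ops X \<Longrightarrow> (\<lambda>i j. c * M i j) \<in> ops X"
  by (rule opsI) (metis mult_zero_right ops_outside)

lemma linear_mapI:
  assumes "\<And>M. M \<in> ops X \<Longrightarrow> E M \<in> ops Y"
    and "\<And>M N y y'. M \<in> ops X \<Longrightarrow> N \<in> ops X \<Longrightarrow>
      E (\<lambda>i j. M i j + N i j) y y' = E M y y' + E N y y'"
    and "\<And>c M y y'. M \<in> ops X \<Longrightarrow> E (\<lambda>i j. c * M i j) y y' = c * E M y y'"
  shows "linear_map X Y E"
  unfolding linear_map_def using assms(1) by (intro conjI ballI allI ext assms(2,3)) auto

lemma linear_map_add:
  assumes E: "linear_map X Y E" and F: "linear_map X Y F"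
  shows "linear_map X Y (\<lambda>M y y'. E M y y' + F M y y')"
proof (rule linear_mapI)
  fix M assume "M \<in> ops X"
  then show "(\<lambda>y y'. E M y y' + F M y y') \<in> ops Y"
    using linear_mapD(1)[OF E] linear_mapD(1)[OF F] by (intro add_in_ops) auto
next
  fix M N y y' assume M: "M \<in> ops X" "N \<in> ops X"
  show "E (\<lambda>i j. M i j + N i j) y y' + F (\<lambda>i j. M i j + N i j) y y'
      = E M y y' + F M y y' + (E N y y' + F N y y')"
    unfolding linear_mapD(2)[OF E M] linear_mapD(2)[OF F M] by simp
next
  fix c M y y' assume M: "M \<in> ops X"
  show "E (\<lambda>i j. c * M i j) y y' + F (\<lambda>i j. c * M i j) y y' = c * (E M y y' + F M y y')"
    unfolding linear_mapD(3)[OF E M] linear_mapD(3)[OF F M] by (simp add: algebra_simps)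
qed

lemma linear_map_scale:
  assumes E: "linear_map X Y E"
  shows "linear_map X Y (\<lambda>M y y'. c * E M y y')"
proof (rule linear_mapI)
  fix M assume "M \<in> ops X"
  then show "(\<lambda>y y'. c * E M y y') \<in> ops Y"
    using linear_mapD(1)[OF E] by (intro scale_in_ops) auto
next
  fix M N y y' assume M: "M \<in> ops X" "N \<in> ops X"
  show "c * E (\<lambda>i j. M i j + N i j) y y' = c * E M y y' + c * E N y y'"
    unfolding linear_mapD(2)[OF E M] by (simp add: algebra_simps)
next
  fix d M y y' assume M: "M \<in> ops X"
  show "c * E (\<lambda>i j. d * M i j) y y' = d * (c * E M y y')"
    unfolding linear_mapD(3)[OF E M] by simp
qed

lemma linear_map_diff:
  assumes "linear_map X Y E" "linear_map X Y F"
  shows "linear_map X Y (\<lambda>M y y'. E M y y' - F M y y')"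
  using linear_map_add[OF assms(1) linear_map_scale[OF assms(2), of "-1"]] by simp

lemma linear_map_comp:
  assumes E: "linear_map X Y E" and F: "linear_map Y Z F"
  shows "linear_map X Z (F \<circ> E)"
proof (rule linear_mapI)
  fix M assume "M \<in> ops X"
  then show "(F \<circ> E) M \<in> ops Z"
    by (simp add: linear_mapD(1)[OF E] linear_mapD(1)[OF F])
next
  fix M N y y' assume M: "M \<in> ops X" "N \<in> ops X"
  show "(F \<circ> E) (\<lambda>i j. M i j + N i j) y y' = (F \<circ> E) M y y' + (F \<circ> E) N y y'"
    unfolding comp_def linear_mapD(2)[OF E M] linear_mapD(2)[OF F linear_mapD(1)[OF E M(1)] linear_mapD(1)[OF E M(2)]] ..
next
  fix c M y y' assume M: "M \<in> ops X"
  show "(F \<circ> E) (\<lambda>i j. c * M i j) y y' = c * (F \<circ> E) M y y'"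
    unfolding comp_def linear_mapD(3)[OF E M] linear_mapD(3)[OF F linear_mapD(1)[OF E M]] ..
qed

lemma linear_map_id: "linear_map X X id"
  by (simp add: linear_map_def)

lemma linear_map_cong:
  assumes E: "linear_map X Y E" and eq: "\<And>M. M \<in> ops X \<Longrightarrow> F M = E M"
  shows "linear_map X Y F"
proof (rule linear_mapI)
  fix M assume M: "M \<in> ops X"
  show "F M \<in> ops Y"
    unfolding eq[OF M] by (rule linear_mapD(1)[OF E M])
next
  fix M N y y' assume M: "M \<in> ops X" "N \<in> ops X"
  show "F (\<lambda>i j. M i j + N i j) y y' = F M y y' + F N y y'"
    unfolding eq[OF M(1)] eq[OF M(2)] eq[OF add_in_ops[OF M]] linear_mapD(2)[OF E M] ..
next
  fix c M y y' assume M: "M \<in> ops X"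
  show "F (\<lambda>i j. c * M i j) y y' = c * F M y y'"
    unfolding eq[OF M] eq[OF scale_in_ops[OF M]] linear_mapD(3)[OF E M] ..
qed

lemma linear_map_sandwich [simp]: "linear_map X Y (sandwich X Y K K')"
  by (rule linear_mapI) (simp, auto simp: sandwich_def algebra_simps sum.distrib sum_distrib_left)

lemma linear_map_conj_map [simp]: "linear_map X Y (conj_map X Y K)"
  unfolding linear_map_def conj_map_eq_sandwich using linear_map_sandwich by (simp add: linear_map_def)

lemma sandwich_unit:
  assumes "finite X" "u \<in> X" "v \<in> X"
  shows "sandwich X Y K K' (matrix_unit u v) y y' = (if y \<in> Y \<and> y' \<in> Y then K y u * cnj (K' y' v) else 0)"
proof -
  have "(\<Sum>k\<in>X. \<Sum>l\<in>X. K y k * matrix_unit u v k l * cnj (K' y' l))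
      = (\<Sum>k\<in>X. if k = u then (\<Sum>l\<in>X. if l = v then K y k * cnj (K' y' l) else 0) else 0)"
    by (intro sum.cong refl) (auto simp: matrix_unit_def intro!: sum.cong)
  then show ?thesis
    using assms by (simp add: sandwich_def)
qed

lemma sum_swap_pairs:
  "(\<Sum>k\<in>Y. \<Sum>l\<in>Y'. \<Sum>a\<in>X. \<Sum>b\<in>X'. f k l a b) = (\<Sum>a\<in>X. \<Sum>b\<in>X'. \<Sum>k\<in>Y. \<Sum>l\<in>Y'. f k l a b)"
proof -
  have "(\<Sum>k\<in>Y. \<Sum>l\<in>Y'. \<Sum>a\<in>X. \<Sum>b\<in>X'. f k l a b) = (\<Sum>a\<in>X. \<Sum>k\<in>Y. \<Sum>l\<in>Y'. \<Sum>b\<in>X'. f k l a b)"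
    by (subst sum.swap[of _ X]) (intro sum.cong refl sum.swap)
  also have "\<dots> = (\<Sum>a\<in>X. \<Sum>b\<in>X'. \<Sum>k\<in>Y. \<Sum>l\<in>Y'. f k l a b)"
    by (subst sum.swap[of _ X']) (intro sum.cong refl sum.swap)
  finally show ?thesis .
qed

lemma sandwich_comp:
  assumes "finite X" "finite Y"
  shows "sandwich Y Z K K' (sandwich X Y J J' M)
       = sandwich X Z (matrix_mult_on Y K J) (matrix_mult_on Y K' J') M"
proof (intro ext)
  fix i j
  have "(\<Sum>k\<in>Y. \<Sum>l\<in>Y. K i k * (\<Sum>a\<in>X. \<Sum>b\<in>X. J k a * M a b * cnj (J' l b)) * cnj (K' j l))
      = (\<Sum>k\<in>Y. \<Sum>l\<in>Y. \<Sum>a\<in>X. \<Sum>b\<in>X. K i k * J k a * M a b * cnj (J' l b) * cnj (K' j l))"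
    by (simp add: sum_distrib_left sum_distrib_right mult.assoc)
  also have "\<dots> = (\<Sum>a\<in>X. \<Sum>b\<in>X. \<Sum>k\<in>Y. \<Sum>l\<in>Y. K i k * J k a * M a b * cnj (J' l b) * cnj (K' j l))"
    by (rule sum_swap_pairs)
  also have "\<dots> = (\<Sum>a\<in>X. \<Sum>b\<in>X. matrix_mult_on Y K J i a * M a b * cnj (matrix_mult_on Y K' J' j b))"
  proof (intro sum.cong refl)
    fix a b
    have "matrix_mult_on Y K J i a * M a b * cnj (matrix_mult_on Y K' J' j b)
        = M a b * (matrix_mult_on Y K J i a * cnj (matrix_mult_on Y K' J' j b))"
      by simp
    also have "\<dots> = (\<Sum>k\<in>Y. \<Sum>l\<in>Y. M a b * ((K i k * J k a) * (cnj (K' j l) * cnj (J' l b))))"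
      unfolding matrix_mult_on_def cnj_sum sum_product by (simp add: sum_distrib_left)
    finally show "(\<Sum>k\<in>Y. \<Sum>l\<in>Y. K i k * J k a * M a b * cnj (J' l b) * cnj (K' j l))
        = matrix_mult_on Y K J i a * M a b * cnj (matrix_mult_on Y K' J' j b)"
      by (simp add: mult_ac)
  qed
  finally show "sandwich Y Z K K' (sandwich X Y J J' M) i j
      = sandwich X Z (matrix_mult_on Y K J) (matrix_mult_on Y K' J') M i j"
    by (simp add: sandwich_def)
qed

section \<open>Tensor products of maps\<close>

lemma block_in_ops:
  assumes "M \<in> ops (X \<times> R)"
  shows "(\<lambda>a a'. M (a, r) (a', r')) \<in> ops X" "(\<lambda>b b'. M (x, b) (x', b')) \<in> ops R"
  using assms by (auto simp: ops_def)

lemma tensor_map_inner_in_ops: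
  assumes "M \<in> ops (X \<times> X')" "linear_map X' Y' F"
  shows "(\<lambda>a a'. F (\<lambda>b b'. M (a, b) (a', b')) d d') \<in> ops X"
proof (rule opsI, rule ccontr)
  fix a a' assume "F (\<lambda>b b'. M (a, b) (a', b')) d d' \<noteq> 0" "\<not> (a \<in> X \<and> a' \<in> X)"
  moreover from this(2) assms(1) have "(\<lambda>b b'. M (a, b) (a', b')) = (\<lambda>b b'. 0)"
    by (intro ext) (auto dest: ops_outside)
  ultimately show False
    using linear_map_zero[OF assms(2)] by simp
qed

text \<open>Expanding both factors in matrix units removes the asymmetry of
  \<open>tensor_map\<close>, in which the second factor acts inside the first.\<close>

lemma tensor_map_expand:
  assumes E: "linear_map X Y E" and F: "linear_map X' Y' F" and X: "finite X" "finite X'"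
    and M: "M \<in> ops (X \<times> X')"
  shows "tensor_map E F M (c, d) (c', d') =
    (\<Sum>u\<in>X. \<Sum>v\<in>X. \<Sum>s\<in>X'. \<Sum>t\<in>X'. M (u, s) (v, t) *
       (E (matrix_unit u v) c c' * F (matrix_unit s t) d d'))"
proof -
  have "tensor_map E F M (c, d) (c', d') =
    (\<Sum>u\<in>X. \<Sum>v\<in>X. F (\<lambda>b b'. M (u, b) (v, b')) d d' * E (matrix_unit u v) c c')"
    by (simp add: tensor_map_def linear_map_expand[OF E X(1) tensor_map_inner_in_ops[OF M F]])
  also have "\<dots> = (\<Sum>u\<in>X. \<Sum>v\<in>X. (\<Sum>s\<in>X'. \<Sum>t\<in>X'. M (u, s) (v, t) * F (matrix_unit s t) d d') *
      E (matrix_unit u v) c c')"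
    by (simp add: linear_map_expand[OF F X(2) block_in_ops(2)[OF M]])
  finally show ?thesis
    by (simp add: sum_distrib_left sum_distrib_right mult_ac)
qed

lemma linear_map_tensor_map:
  assumes E: "linear_map X Y E" and F: "linear_map X' Y' F"
  shows "linear_map (X \<times> X') (Y \<times> Y') (tensor_map E F)"
  unfolding linear_map_def
proof (intro conjI ballI allI)
  fix M assume M: "M \<in> ops (X \<times> X')"
  show "tensor_map E F M \<in> ops (Y \<times> Y')"
  proof (rule opsI)
    fix i j assume nz: "tensor_map E F M i j \<noteq> 0"
    obtain c d c' d' where ij: "i = (c, d)" "j = (c', d')" by (metis surj_pair)
    have 1: "c \<in> Y \<and> c' \<in> Y"
      using nz linear_map_outside[OF E tensor_map_inner_in_ops[OF M F]]
      by (auto simp: ij tensor_map_def)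
    have "d \<in> Y' \<and> d' \<in> Y'"
    proof (rule ccontr)
      assume "\<not> (d \<in> Y' \<and> d' \<in> Y')"
      then have "(\<lambda>a a'. F (\<lambda>b b'. M (a, b) (a', b')) d d') = (\<lambda>a a'. 0)"
        using linear_map_outside[OF F block_in_ops(2)[OF M]] by auto
      then show False using nz linear_map_zero[OF E] by (simp add: ij tensor_map_def)
    qed
    then show "i \<in> Y \<times> Y' \<and> j \<in> Y \<times> Y'" using 1 ij by simp
  qed
next
  fix M N assume M: "M \<in> ops (X \<times> X')" and N: "N \<in> ops (X \<times> X')"
  show "tensor_map E F (\<lambda>i j. M i j + N i j) = (\<lambda>i j. tensor_map E F M i j + tensor_map E F N i j)"
    using linear_mapD(2)[OF F block_in_ops(2)[OF M] block_in_ops(2)[OF N]]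
      linear_mapD(2)[OF E tensor_map_inner_in_ops[OF M F] tensor_map_inner_in_ops[OF N F]]
    by (auto simp: tensor_map_def fun_eq_iff)
next
  fix c M assume M: "M \<in> ops (X \<times> X')"
  show "tensor_map E F (\<lambda>i j. c * M i j) = (\<lambda>i j. c * tensor_map E F M i j)"
    using linear_mapD(3)[OF F block_in_ops(2)[OF M]]
      linear_mapD(3)[OF E tensor_map_inner_in_ops[OF M F]]
    by (auto simp: tensor_map_def fun_eq_iff)
qed

lemma tensor_map_sandwich_id:
  "tensor_map (sandwich X Y K K') id M (c, d) (c', d') =
    (if c \<in> Y \<and> c' \<in> Y then (\<Sum>k\<in>X. \<Sum>l\<in>X. K c k * M (k, d) (l, d') * cnj (K' c' l)) else 0)"
  by (simp add: tensor_map_def sandwich_def)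

lemma tensor_map_sandwich:
  "tensor_map (sandwich X Y K K') (sandwich X' Y' J J') M
    = sandwich (X \<times> X') (Y \<times> Y') (kron K J) (kron K' J') M"
proof -
  have "tensor_map (sandwich X Y K K') (sandwich X' Y' J J') M (c, d) (c', d')
      = sandwich (X \<times> X') (Y \<times> Y') (kron K J) (kron K' J') M (c, d) (c', d')" for c d c' d'
  proof -
    have "(\<Sum>k\<in>X \<times> X'. \<Sum>l\<in>X \<times> X'. kron K J (c, d) k * M k l * cnj (kron K' J' (c', d') l))
       = (\<Sum>u\<in>X. \<Sum>s\<in>X'. \<Sum>v\<in>X. \<Sum>t\<in>X'. K c u * J d s * M (u, s) (v, t) * (cnj (K' c' v) * cnj (J' d' t)))"
      by (simp add: sum.cartesian_product')
    also have "\<dots> = (\<Sum>u\<in>X. \<Sum>v\<in>X. \<Sum>s\<in>X'. \<Sum>t\<in>X'. K c u * J d s * M (u, s) (v, t) * (cnj (K' c' v) * cnj (J' d' t)))"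
      by (rule sum.cong[OF refl sum.swap])
    also have "\<dots> = (\<Sum>u\<in>X. \<Sum>v\<in>X. K c u * (\<Sum>s\<in>X'. \<Sum>t\<in>X'. J d s * M (u, s) (v, t) * cnj (J' d' t)) * cnj (K' c' v))"
      by (simp add: sum_distrib_left sum_distrib_right mult_ac)
    finally show ?thesis
      by (auto simp: tensor_map_def sandwich_def)
  qed
  then show ?thesis
    by (simp add: fun_eq_iff)
qed

lemma tensor_map_conj_map:
  "tensor_map (conj_map X Y K) (conj_map X' Y' J) M = conj_map (X \<times> X') (Y \<times> Y') (kron K J) M"
  by (simp add: conj_map_eq_sandwich tensor_map_sandwich)

section \<open>Cones of completely positive maps\<close>

definition choi_entry :: "('a, 'b) opmap \<Rightarrow> 'a \<times> 'a \<times> 'b \<times> 'b \<Rightarrow> complex" where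
  "choi_entry P = (\<lambda>(u, v, y, y'). P (matrix_unit u v) y y')"

lemma choi_entry_apply [simp]: "choi_entry P (u, v, y, y') = P (matrix_unit u v) y y'"
  by (simp add: choi_entry_def)

text \<open>Only linear maps are constrained, since an \<open>opmap\<close> may be arbitrary off
  \<open>ops X\<close>. Being a finite combination of Choi entries makes a functional compatible
  with entrywise infinite sums and limits.\<close>

definition lin_form :: "'a set \<Rightarrow> 'b set \<Rightarrow> (('a, 'b) opmap \<Rightarrow> complex) \<Rightarrow> bool" where
  "lin_form X Y g \<longleftrightarrow> (\<exists>c. \<forall>P. linear_map X Y P \<longrightarrow>
     g P = (\<Sum>w\<in>X \<times> X \<times> Y \<times> Y. c w * choi_entry P w))"

lemma lin_form_cong:
  "lin_form X Y h \<Longrightarrow> (\<And>P. linear_map X Y P \<Longrightarrow> g P = h P) \<Longrightarrow> lin_form X Y g"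
  by (simp add: lin_form_def)

lemma lin_form_sum:
  assumes "\<And>i. i \<in> I \<Longrightarrow> lin_form X Y (g i)"
  shows "lin_form X Y (\<lambda>P. \<Sum>i\<in>I. a i * g i P)"
proof -
  from assms have "\<forall>i\<in>I. \<exists>c. \<forall>P. linear_map X Y P \<longrightarrow>
      g i P = (\<Sum>w\<in>X \<times> X \<times> Y \<times> Y. c w * choi_entry P w)"
    by (simp add: lin_form_def)
  then obtain c where c: "\<forall>i\<in>I. \<forall>P. linear_map X Y P \<longrightarrow>
      g i P = (\<Sum>w\<in>X \<times> X \<times> Y \<times> Y. c i w * choi_entry P w)"
    by (rule bchoice[THEN exE])
  have "(\<Sum>i\<in>I. a i * g i P) = (\<Sum>w\<in>X \<times> X \<times> Y \<times> Y. (\<Sum>i\<in>I. a i * c i w) * choi_entry P w)"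
    if "linear_map X Y P" for P
    using c that by (simp add: sum_distrib_left sum_distrib_right mult.assoc sum.swap[of _ _ I])
  then show ?thesis
    unfolding lin_form_def by (intro exI[of _ "\<lambda>w. \<Sum>i\<in>I. a i * c i w"]) simp
qed

lemma lin_form_zero [simp]: "lin_form X Y (\<lambda>P. 0)"
  by (auto simp: lin_form_def intro: exI[of _ "\<lambda>_. 0"])

lemma lin_form_scale: "lin_form X Y g \<Longrightarrow> lin_form X Y (\<lambda>P. c * g P)"
  using lin_form_sum[of "{()}" X Y "\<lambda>_. g" "\<lambda>_. c"] by simp

lemma lin_form_add:
  assumes "lin_form X Y g" "lin_form X Y h"
  shows "lin_form X Y (\<lambda>P. g P + h P)"
  using lin_form_sum[of UNIV X Y "\<lambda>b. if b then g else h" "\<lambda>_. 1"] assms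
  by (simp add: UNIV_bool add.commute)

lemma lin_form_diff:
  assumes "lin_form X Y g" "lin_form X Y h"
  shows "lin_form X Y (\<lambda>P. g P - h P)"
  using lin_form_add[OF assms(1) lin_form_scale[OF assms(2), of "-1"]] by simp

lemma lin_form_unit:
  assumes "finite X" "finite Y" "u \<in> X" "v \<in> X"
  shows "lin_form X Y (\<lambda>P. P (matrix_unit u v) y y')"
proof (cases "y \<in> Y \<and> y' \<in> Y")
  case True
  have "P (matrix_unit u v) y y' =
      (\<Sum>w\<in>X \<times> X \<times> Y \<times> Y. (if w = (u, v, y, y') then 1 else 0) * choi_entry P w)" for P
  proof -
    have "(\<Sum>w\<in>X \<times> X \<times> Y \<times> Y. (if w = (u, v, y, y') then 1 else 0) * choi_entry P w)
        = (\<Sum>w\<in>X \<times> X \<times> Y \<times> Y. if w = (u, v, y, y') then choi_entry P w else 0)"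
      by (intro sum.cong) auto
    then show ?thesis using assms True by simp
  qed
  then show ?thesis
    unfolding lin_form_def by (intro exI allI impI)
next
  case False
  have "P (matrix_unit u v) y y' = 0" if "linear_map X Y P" for P
    by (rule linear_map_outside[OF that]) (use assms False in auto)
  then show ?thesis
    by (intro lin_form_cong[OF lin_form_zero])
qed

lemma lin_form_entry:
  assumes "finite X" "finite Y" "M \<in> ops X"
  shows "lin_form X Y (\<lambda>P. P M y y')"
proof -
  have "lin_form X Y (\<lambda>P. \<Sum>w\<in>X \<times> X. M (fst w) (snd w) * P (matrix_unit (fst w) (snd w)) y y')"
    by (intro lin_form_sum lin_form_unit) (use assms in auto)
  moreover have "P M y y' = (\<Sum>w\<in>X \<times> X. M (fst w) (snd w) * P (matrix_unit (fst w) (snd w)) y y')"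
    if "linear_map X Y P" for P
    unfolding linear_map_expand[OF that assms(1,3)]
    by (simp add: sum.cartesian_product case_prod_beta)
  ultimately show ?thesis
    by (rule lin_form_cong)
qed

text \<open>This is the adjoint of a linear transformation of maps. Checking it entry by entry
  suffices because \<open>g\<close> is a finite combination of entries.\<close>

lemma lin_form_transfer:
  assumes g: "lin_form X' Y' g"
    and lin: "\<And>P. linear_map X Y P \<Longrightarrow> linear_map X' Y' (\<Psi> P)"
    and entry: "\<And>u v y y'. u \<in> X' \<Longrightarrow> v \<in> X' \<Longrightarrow> y \<in> Y' \<Longrightarrow> y' \<in> Y' \<Longrightarrow>
      lin_form X Y (\<lambda>P. \<Psi> P (matrix_unit u v) y y')"
  shows "lin_form X Y (\<lambda>P. g (\<Psi> P))"
proof -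
  obtain c where c: "\<And>P. linear_map X' Y' P \<Longrightarrow>
      g P = (\<Sum>w\<in>X' \<times> X' \<times> Y' \<times> Y'. c w * choi_entry P w)"
    using g by (auto simp: lin_form_def)
  have "lin_form X Y (\<lambda>P. \<Sum>w\<in>X' \<times> X' \<times> Y' \<times> Y'. c w * choi_entry (\<Psi> P) w)"
    by (intro lin_form_sum) (auto intro!: entry)
  then show ?thesis
    by (rule lin_form_cong) (rule c[OF lin])
qed

lemma lin_form_cong_map:
  assumes "lin_form X Y g" "linear_map X Y P" "linear_map X Y Q"
    and "\<And>M. M \<in> ops X \<Longrightarrow> P M = Q M"
  shows "g P = g Q"
proof -
  have "choi_entry P w = choi_entry Q w" if "w \<in> X \<times> X \<times> Y \<times> Y" for w
    using that assms(4) by auto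
  then have eq: "(\<Sum>w\<in>X \<times> X \<times> Y \<times> Y. c w * choi_entry P w) = (\<Sum>w\<in>X \<times> X \<times> Y \<times> Y. c w * choi_entry Q w)" for c
    by (intro sum.cong refl) simp
  obtain c where c: "\<And>P. linear_map X Y P \<Longrightarrow>
      g P = (\<Sum>w\<in>X \<times> X \<times> Y \<times> Y. c w * choi_entry P w)"
    using assms(1) by (auto simp: lin_form_def)
  show ?thesis
    unfolding c[OF assms(2)] c[OF assms(3)] by (rule eq)
qed

lemma lin_form_linear:
  assumes g: "lin_form X Y g" and P: "linear_map X Y P" and Q: "linear_map X Y Q"
  shows "g (\<lambda>M y y'. P M y y' + c * Q M y y') = g P + c * g Q"
proof -
  obtain d where d: "\<And>P. linear_map X Y P \<Longrightarrow>
      g P = (\<Sum>w\<in>X \<times> X \<times> Y \<times> Y. d w * choi_entry P w)"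
    using g by (auto simp: lin_form_def)
  have "choi_entry (\<lambda>M y y'. P M y y' + c * Q M y y') w = choi_entry P w + c * choi_entry Q w" for w
    by (simp add: choi_entry_def case_prod_beta)
  then show ?thesis
    unfolding d[OF P] d[OF Q] d[OF linear_map_add[OF P linear_map_scale[OF Q]]]
    by (simp add: algebra_simps sum.distrib sum_distrib_left)
qed

section \<open>Functionals and infinite sums of maps\<close>

lemma has_sum_finite_sum:
  fixes f :: "'i \<Rightarrow> 'w \<Rightarrow> 'c :: {topological_comm_monoid_add, comm_monoid_add}"
  assumes "finite W" "\<And>w. w \<in> W \<Longrightarrow> ((\<lambda>i. f i w) has_sum s w) I"
  shows "((\<lambda>i. \<Sum>w\<in>W. f i w) has_sum (\<Sum>w\<in>W. s w)) I"
  using assms by (induction W rule: finite_induct) (auto intro: has_sum_add)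

lemma lin_form_has_sum:
  assumes g: "lin_form X Y g" and fin: "finite X" "finite Y"
    and E: "\<And>i. i \<in> I \<Longrightarrow> linear_map X Y (E i)" and G: "linear_map X Y G"
    and sum: "map_has_sum X E I G"
  shows "((\<lambda>i. g (E i)) has_sum g G) I"
proof -
  obtain d where d: "\<And>P. linear_map X Y P \<Longrightarrow>
      g P = (\<Sum>w\<in>X \<times> X \<times> Y \<times> Y. d w * choi_entry P w)"
    using g by (auto simp: lin_form_def)
  have "((\<lambda>i. \<Sum>w\<in>X \<times> X \<times> Y \<times> Y. d w * choi_entry (E i) w) has_sum
      (\<Sum>w\<in>X \<times> X \<times> Y \<times> Y. d w * choi_entry G w)) I"
    by (rule has_sum_finite_sum)
      (use fin sum in \<open>auto simp: map_has_sum_def intro!: has_sum_cmult_right\<close>)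
  then have "((\<lambda>i. g (E i)) has_sum (\<Sum>w\<in>X \<times> X \<times> Y \<times> Y. d w * choi_entry G w)) I"
    by (rule has_sum_cong[THEN iffD1, rotated]) (simp add: d E)
  then show ?thesis
    by (simp add: d G)
qed

lemma linear_map_has_sum:
  assumes E: "\<And>i. i \<in> I \<Longrightarrow> linear_map X Y (E i)" and sum: "map_has_sum X E I G"
  shows "linear_map X Y G"
proof (rule linear_mapI)
  have s: "((\<lambda>i. E i M y y') has_sum G M y y') I" if "M \<in> ops X" for M y y'
    using sum that by (simp add: map_has_sum_def)
  {
    fix M assume M: "M \<in> ops X"
    show "G M \<in> ops Y"
    proof (rule opsI, rule ccontr)
      fix y y' assume nz: "G M y y' \<noteq> 0" and out: "\<not> (y \<in> Y \<and> y' \<in> Y)"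
      have "E i M y y' = 0" if "i \<in> I" for i
        by (rule linear_map_outside[OF E[OF that] M]) (use out in auto)
      then have "((\<lambda>i. E i M y y') has_sum 0) I"
        by (intro has_sum_0)
      then show False
        using nz has_sum_unique[OF s[OF M]] by blast
    qed
  next
    fix M N y y' assume M: "M \<in> ops X" and N: "N \<in> ops X"
    have "((\<lambda>i. E i (\<lambda>i j. M i j + N i j) y y') has_sum (G M y y' + G N y y')) I"
      by (rule has_sum_cong[THEN iffD1, OF _ has_sum_add[OF s[OF M] s[OF N]]])
        (simp add: linear_mapD(2)[OF E M N])
    then show "G (\<lambda>i j. M i j + N i j) y y' = G M y y' + G N y y'"
      using has_sum_unique[OF s[OF add_in_ops[OF M N]]] by blast
  next
    fix c M y y' assume M: "M \<in> ops X"
    have "((\<lambda>i. E i (\<lambda>i j. c * M i j) y y') has_sum (c * G M y y')) I"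
      by (rule has_sum_cong[THEN iffD1, OF _ has_sum_cmult_right[OF s[OF M]]])
        (simp add: linear_mapD(3)[OF E M])
    then show "G (\<lambda>i j. c * M i j) y y' = c * G M y y'"
      using has_sum_unique[OF s[OF scale_in_ops[OF M]]] by blast
  }
qed

text \<open>By the bipolar theorem this is the closed convex cone generated by the maps
  \<open>conj_map X Y K\<close>; real parts of complex functionals give all real ones. The dual form
  makes closure under infinite sums and limits immediate. For product Kraus operators the members
  are the separable maps.\<close>

definition kraus_cone :: "'a set \<Rightarrow> 'b set \<Rightarrow> ('b \<Rightarrow> 'a \<Rightarrow> complex) set \<Rightarrow> ('a, 'b) opmap \<Rightarrow> bool" where
  "kraus_cone X Y \<K> P \<longleftrightarrow> linear_map X Y P \<and>
     (\<forall>g. lin_form X Y g \<longrightarrow> (\<forall>K\<in>\<K>. 0 \<le> Re (g (conj_map X Y K))) \<longrightarrow> 0 \<le> Re (g P))"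

lemma kraus_cone_linear: "kraus_cone X Y \<K> P \<Longrightarrow> linear_map X Y P"
  by (simp add: kraus_cone_def)

lemma kraus_cone_nonneg:
  "kraus_cone X Y \<K> P \<Longrightarrow> lin_form X Y g \<Longrightarrow> (\<And>K. K \<in> \<K> \<Longrightarrow> 0 \<le> Re (g (conj_map X Y K))) \<Longrightarrow> 0 \<le> Re (g P)"
  by (simp add: kraus_cone_def)

lemma kraus_cone_conj_map: "K \<in> \<K> \<Longrightarrow> kraus_cone X Y \<K> (conj_map X Y K)"
  by (simp add: kraus_cone_def)

lemma kraus_cone_cong:
  assumes P: "kraus_cone X Y \<K> P" and eq: "\<And>M. M \<in> ops X \<Longrightarrow> Q M = P M"
  shows "kraus_cone X Y \<K> Q"
proof -
  have Q: "linear_map X Y Q"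
    by (rule linear_map_cong[OF kraus_cone_linear[OF P] eq])
  have eqg: "g Q = g P" if "lin_form X Y g" for g
    by (rule lin_form_cong_map[OF that Q kraus_cone_linear[OF P] eq])
  have "0 \<le> Re (g Q)" if "lin_form X Y g" "\<forall>K\<in>\<K>. 0 \<le> Re (g (conj_map X Y K))" for g
    unfolding eqg[OF that(1)] using kraus_cone_nonneg[OF P that(1)] that(2) by blast
  then show ?thesis
    using Q by (simp add: kraus_cone_def)
qed

text \<open>A test functional on the target pulls back to one on the source, so only the generators
  have to be checked.\<close>

lemma kraus_cone_transfer:
  assumes P: "kraus_cone X Y \<K> P"
    and lin: "\<And>P. linear_map X Y P \<Longrightarrow> linear_map X' Y' (\<Psi> P)"
    and entry: "\<And>u v y y'. u \<in> X' \<Longrightarrow> v \<in> X' \<Longrightarrow> y \<in> Y' \<Longrightarrow> y' \<in> Y' \<Longrightarrow>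
      lin_form X Y (\<lambda>P. \<Psi> P (matrix_unit u v) y y')"
    and K: "\<And>K. K \<in> \<K> \<Longrightarrow> kraus_cone X' Y' \<K>' (\<Psi> (conj_map X Y K))"
  shows "kraus_cone X' Y' \<K>' (\<Psi> P)"
  unfolding kraus_cone_def
proof (intro conjI allI impI)
  show "linear_map X' Y' (\<Psi> P)"
    by (rule lin[OF kraus_cone_linear[OF P]])
  fix g assume g: "lin_form X' Y' g" and pos: "\<forall>K\<in>\<K>'. 0 \<le> Re (g (conj_map X' Y' K))"
  show "0 \<le> Re (g (\<Psi> P))"
  proof (rule kraus_cone_nonneg[OF P lin_form_transfer[OF g lin entry]])
    fix K assume "K \<in> \<K>"
    then show "0 \<le> Re (g (\<Psi> (conj_map X Y K)))"
      using kraus_cone_nonneg[OF K g] pos by blast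
  qed auto
qed

text \<open>A functional commutes with the sum, and a sum of nonnegative reals is
  nonnegative.\<close>

lemma kraus_cone_has_sum:
  assumes fin: "finite X" "finite Y" and E: "\<And>i. i \<in> I \<Longrightarrow> kraus_cone X Y \<K> (E i)"
    and sum: "map_has_sum X E I G"
  shows "kraus_cone X Y \<K> G"
  unfolding kraus_cone_def
proof (intro conjI allI impI)
  show G: "linear_map X Y G"
    by (rule linear_map_has_sum[OF kraus_cone_linear[OF E] sum])
  fix g assume g: "lin_form X Y g" and pos: "\<forall>K\<in>\<K>. 0 \<le> Re (g (conj_map X Y K))"
  have "((\<lambda>i. g (E i)) has_sum g G) I"
    by (rule lin_form_has_sum[OF g fin kraus_cone_linear[OF E] G sum])
  then have "((\<lambda>i. Re (g (E i))) has_sum Re (g G)) I"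
    by (rule has_sum_Re)
  then show "0 \<le> Re (g G)"
    by (rule has_sum_nonneg) (use kraus_cone_nonneg[OF E g] pos in blast)
qed

lemma kraus_cone_lin_comb:
  assumes P: "kraus_cone X Y \<K> P" and Q: "kraus_cone X Y \<K> Q" and c: "0 \<le> c"
  shows "kraus_cone X Y \<K> (\<lambda>M y y'. P M y y' + complex_of_real c * Q M y y')"
  unfolding kraus_cone_def
proof (intro conjI allI impI)
  show "linear_map X Y (\<lambda>M y y'. P M y y' + complex_of_real c * Q M y y')"
    by (intro linear_map_add linear_map_scale kraus_cone_linear[OF P] kraus_cone_linear[OF Q])
  fix g assume g: "lin_form X Y g" and pos: "\<forall>K\<in>\<K>. 0 \<le> Re (g (conj_map X Y K))"
  then have "0 \<le> Re (g P)" "0 \<le> Re (g Q)"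
    using P Q by (simp_all add: kraus_cone_def)
  then show "0 \<le> Re (g (\<lambda>M y y'. P M y y' + complex_of_real c * Q M y y'))"
    using c by (simp add: lin_form_linear[OF g kraus_cone_linear[OF P] kraus_cone_linear[OF Q]])
qed

lemma kraus_cone_zero: "kraus_cone X Y \<K> (\<lambda>M y y'. 0)"
proof -
  have lin: "linear_map X Y (\<lambda>M y y'. 0)"
    by (rule linear_mapI) auto
  have z: "g (\<lambda>M y y'. 0) = 0" if "lin_form X Y g" for g
    using lin_form_linear[OF that lin lin, of 1] by simp
  have "0 \<le> Re (g (\<lambda>M y y'. 0))" if "lin_form X Y g" for g
    unfolding z[OF that] by simp
  then show ?thesis
    using lin unfolding kraus_cone_def by blast
qed

lemma kraus_cone_scale:
  assumes "kraus_cone X Y \<K> P" "0 \<le> c"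
  shows "kraus_cone X Y \<K> (\<lambda>M y y'. complex_of_real c * P M y y')"
  using kraus_cone_lin_comb[OF kraus_cone_zero assms] by simp

text \<open>Composition is bilinear, so the transfer principle is applied once in each factor: with
  a generator after \<open>P\<close>, and then with an arbitrary \<open>Q\<close> after the fixed
  \<open>P\<close>.\<close>

lemma kraus_cone_comp:
  assumes fin: "finite X" "finite Y" "finite Z"
    and P: "kraus_cone X Y \<K> P" and Q: "kraus_cone Y Z \<K>' Q"
    and mult: "\<And>K J. K \<in> \<K> \<Longrightarrow> J \<in> \<K>' \<Longrightarrow> matrix_mult_on Y J K \<in> \<K>''"
  shows "kraus_cone X Z \<K>'' (Q \<circ> P)"
proof -
  have step: "kraus_cone X Z \<K>'' (conj_map Y Z J \<circ> P)" if J: "J \<in> \<K>'" for J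
  proof (rule kraus_cone_transfer[OF P, where \<Psi> = "\<lambda>P. conj_map Y Z J \<circ> P"])
    fix P :: "('a, 'b) opmap" assume "linear_map X Y P"
    then show "linear_map X Z (conj_map Y Z J \<circ> P)"
      by (rule linear_map_comp) simp
  next
    fix u v z z' assume uv: "u \<in> X" "v \<in> X" and z: "z \<in> Z" "z' \<in> Z"
    have "(conj_map Y Z J \<circ> P) (matrix_unit u v) z z' =
        (\<Sum>w\<in>Y \<times> Y. (J z (fst w) * cnj (J z' (snd w))) * P (matrix_unit u v) (fst w) (snd w))" for P
      using z by (simp add: conj_map_def sum.cartesian_product case_prod_beta mult_ac)
    moreover have "lin_form X Y (\<lambda>P. \<Sum>w\<in>Y \<times> Y. (J z (fst w) * cnj (J z' (snd w))) *
        P (matrix_unit u v) (fst w) (snd w))"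
      by (intro lin_form_sum lin_form_unit fin uv)
    ultimately show "lin_form X Y (\<lambda>P. (conj_map Y Z J \<circ> P) (matrix_unit u v) z z')"
      by simp
  next
    fix K assume K: "K \<in> \<K>"
    have "conj_map Y Z J \<circ> conj_map X Y K = conj_map X Z (matrix_mult_on Y J K)"
      by (rule ext) (simp add: conj_map_eq_sandwich sandwich_comp[OF fin(1,2)])
    then show "kraus_cone X Z \<K>'' (conj_map Y Z J \<circ> conj_map X Y K)"
      using mult[OF K J] by (simp add: kraus_cone_conj_map)
  qed
  show ?thesis
  proof (rule kraus_cone_transfer[OF Q, where \<Psi> = "\<lambda>Q. Q \<circ> P"])
    fix Q :: "('b, 'c) opmap" assume "linear_map Y Z Q"
    then show "linear_map X Z (Q \<circ> P)"
      by (rule linear_map_comp[OF kraus_cone_linear[OF P]])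
  next
    fix u v z z' assume uv: "u \<in> X" "v \<in> X"
    show "lin_form Y Z (\<lambda>Q. (Q \<circ> P) (matrix_unit u v) z z')"
      unfolding comp_def
      by (intro lin_form_entry fin linear_mapD(1)[OF kraus_cone_linear[OF P]] matrix_unit_in_ops uv)
  qed (rule step)
qed

text \<open>Equivalently, \<open>F\<close> is the difference of the two members
  \<open>(T + F) / 2\<close> and \<open>(T - F) / 2\<close> of the cone, whose sum is
  trace-preserving: a two-outcome instrument whose outcomes count with opposite signs.\<close>

definition sep_contr :: "'a set \<Rightarrow> ('a \<Rightarrow> 'a \<Rightarrow> complex) set \<Rightarrow> ('a, 'a) opmap \<Rightarrow> bool" where
  "sep_contr X \<K> F \<longleftrightarrow> linear_map X X F \<and>
     (\<exists>T. tp X X T \<and> (\<forall>c\<in>{-1, 1}. kraus_cone X X \<K> (\<lambda>M y y'. T M y y' + complex_of_real c * F M y y')))"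

section \<open>Composition, transfer and testing of separable contractions\<close>

lemma tp_comp:
  assumes E: "tp X Y E" and F: "tp Y Z F"
  shows "tp X Z (F \<circ> E)"
proof -
  have lin: "linear_map X Y E" "linear_map Y Z F"
    using E F by (simp_all add: tp_def)
  have "trace_on Z (F (E M)) = trace_on X M" if "M \<in> ops X" for M
    using E F that linear_mapD(1)[OF lin(1) that] by (simp add: tp_def)
  then show ?thesis
    unfolding tp_def using linear_map_comp[OF lin] by simp
qed

lemma sep_contr_comp:
  assumes X: "finite X" and F: "sep_contr X \<K> F" and G: "sep_contr X \<K> G"
    and mult: "\<And>K J. K \<in> \<K> \<Longrightarrow> J \<in> \<K> \<Longrightarrow> matrix_mult_on X J K \<in> \<K>"
  shows "sep_contr X \<K> (G \<circ> F)"
proof -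
  obtain T where T: "tp X X T" "\<And>c. c \<in> {-1, 1} \<Longrightarrow> kraus_cone X X \<K> (\<lambda>M y y'. T M y y' + complex_of_real c * F M y y')"
    and linF: "linear_map X X F"
    using F unfolding sep_contr_def by blast
  obtain S where S: "tp X X S" "\<And>c. c \<in> {-1, 1} \<Longrightarrow> kraus_cone X X \<K> (\<lambda>M y y'. S M y y' + complex_of_real c * G M y y')"
    and linG: "linear_map X X G"
    using G unfolding sep_contr_def by blast
  have linT: "linear_map X X T" and linS: "linear_map X X S"
    using T(1) S(1) by (simp_all add: tp_def)
  have "kraus_cone X X \<K> (\<lambda>M y y'. (S \<circ> T) M y y' + complex_of_real c * (G \<circ> F) M y y')"
    if c: "c \<in> {-1, 1}" for c
  proof -
    \<comment> \<open>Averaging \<open>(S + c d G) \<circ> (T + d F)\<close> over the signs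
      \<open>d\<close> cancels the mixed terms and leaves
      \<open>S \<circ> T + c G \<circ> F\<close>.\<close>
    define P where "P = (\<lambda>d. (\<lambda>M y y'. S M y y' + complex_of_real (c * d) * G M y y') \<circ>
      (\<lambda>M y y'. T M y y' + complex_of_real d * F M y y'))"
    have "kraus_cone X X \<K> (P d)" if "d \<in> {-1, 1}" for d
      unfolding P_def using that c by (intro kraus_cone_comp[OF X X X T(2) S(2) mult]) auto
    then have "kraus_cone X X \<K> (\<lambda>M y y'. complex_of_real (1/2) *
        (P 1 M y y' + complex_of_real 1 * P (-1) M y y'))"
      by (intro kraus_cone_scale kraus_cone_lin_comb) auto
    then show ?thesis
    proof (rule kraus_cone_cong)
      fix M assume M: "M \<in> ops X"
      have TM: "T M \<in> ops X" and FM: "F M \<in> ops X"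
        using M linear_mapD(1)[OF linT] linear_mapD(1)[OF linF] by auto
      have lin: "H (\<lambda>y y'. T M y y' + d * F M y y') = (\<lambda>y y'. H (T M) y y' + d * H (F M) y y')"
        if H: "linear_map X X H" for H d
        unfolding linear_mapD(2)[OF H TM scale_in_ops[OF FM]] linear_mapD(3)[OF H FM] ..
      show "(\<lambda>y y'. (S \<circ> T) M y y' + complex_of_real c * (G \<circ> F) M y y') =
          (\<lambda>y y'. complex_of_real (1/2) * (P 1 M y y' + complex_of_real 1 * P (-1) M y y'))"
        unfolding P_def comp_def lin[OF linS] lin[OF linG]
        by (intro ext) (simp add: algebra_simps)
    qed
  qed
  then show ?thesis
    unfolding sep_contr_def
    using linear_map_comp[OF linF linG] tp_comp[OF T(1) S(1)] by blast
qed

text \<open>The principle is that for cones; in addition \<open>\<Psi>\<close> has to keep the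
  dominating map \<open>T\<close> trace-preserving and to respect the combinations
  \<open>T + c F\<close>.\<close>

lemma sep_contr_transfer:
  assumes F: "sep_contr X \<K> F"
    and tp: "\<And>T. tp X X T \<Longrightarrow> tp X' X' (\<Psi> T)"
    and lin: "\<And>P. linear_map X X P \<Longrightarrow> linear_map X' X' (\<Psi> P)"
    and add: "\<And>P Q c M. linear_map X X P \<Longrightarrow> linear_map X X Q \<Longrightarrow> M \<in> ops X' \<Longrightarrow>
       \<Psi> (\<lambda>M y y'. P M y y' + c * Q M y y') M = (\<lambda>y y'. \<Psi> P M y y' + c * \<Psi> Q M y y')"
    and entry: "\<And>u v y y'. u \<in> X' \<Longrightarrow> v \<in> X' \<Longrightarrow> y \<in> X' \<Longrightarrow> y' \<in> X' \<Longrightarrow>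
      lin_form X X (\<lambda>P. \<Psi> P (matrix_unit u v) y y')"
    and K: "\<And>K. K \<in> \<K> \<Longrightarrow> kraus_cone X' X' \<K>' (\<Psi> (conj_map X X K))"
  shows "sep_contr X' \<K>' (\<Psi> F)"
proof -
  obtain T where T: "tp X X T" "\<And>c. c \<in> {-1, 1} \<Longrightarrow> kraus_cone X X \<K> (\<lambda>M y y'. T M y y' + complex_of_real c * F M y y')"
    and linF: "linear_map X X F"
    using F unfolding sep_contr_def by blast
  have linT: "linear_map X X T"
    using T(1) by (simp add: tp_def)
  have "kraus_cone X' X' \<K>' (\<lambda>M y y'. \<Psi> T M y y' + complex_of_real c * \<Psi> F M y y')" if "c \<in> {-1, 1}" for c
    by (rule kraus_cone_cong[OF kraus_cone_transfer[OF T(2)[OF that] lin entry K] add[OF linT linF, symmetric]])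
  then show ?thesis
    unfolding sep_contr_def using lin[OF linF] tp[OF T(1)] by blast
qed

text \<open>Weak duality: by hypothesis \<open>t + g\<close> and \<open>t - g\<close> are
  nonnegative on the cone, and \<open>t\<close> is constant on trace-preserving maps.\<close>

lemma sep_contr_bound:
  assumes F: "sep_contr X \<K> F" and g: "lin_form X X g" and t: "lin_form X X t"
    and bound: "\<And>K. K \<in> \<K> \<Longrightarrow> \<bar>Re (g (conj_map X X K))\<bar> \<le> Re (t (conj_map X X K))"
    and tD: "\<And>T. tp X X T \<Longrightarrow> Re (t T) = D"
  shows "\<bar>Re (g F)\<bar> \<le> D"
proof -
  obtain T where T: "tp X X T" "\<And>c. c \<in> {-1, 1} \<Longrightarrow> kraus_cone X X \<K> (\<lambda>M y y'. T M y y' + complex_of_real c * F M y y')"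
    and linF: "linear_map X X F"
    using F unfolding sep_contr_def by blast
  have linT: "linear_map X X T"
    using T(1) by (simp add: tp_def)
  \<comment> \<open>Adding the cases \<open>(c, d)\<close> and \<open>(-c, -d)\<close> cancels
    \<open>t F\<close> and \<open>g T\<close> and leaves a bound on \<open>c d g F\<close> by
    \<open>t T\<close>.\<close>
  have *: "0 \<le> Re (t T) + c * Re (t F) + d * (Re (g T) + c * Re (g F))" if c: "c \<in> {-1, 1}" and d: "d \<in> {-1, 1}" for c d
  proof -
    have tg: "lin_form X X (\<lambda>P. t P + complex_of_real d * g P)"
      by (intro lin_form_add lin_form_scale t g)
    have "0 \<le> Re (t (\<lambda>M y y'. T M y y' + complex_of_real c * F M y y')
        + complex_of_real d * g (\<lambda>M y y'. T M y y' + complex_of_real c * F M y y'))"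
    proof (rule kraus_cone_nonneg[OF T(2)[OF c] tg])
      fix K assume "K \<in> \<K>"
      then show "0 \<le> Re (t (conj_map X X K) + complex_of_real d * g (conj_map X X K))"
        using bound[of K] d by auto
    qed
    then show ?thesis
      by (simp add: lin_form_linear[OF g linT linF] lin_form_linear[OF t linT linF])
  qed
  show ?thesis
    using *[of 1 1] *[of 1 "-1"] *[of "-1" 1] *[of "-1" "-1"] tD[OF T(1)] by simp
qed

text \<open>\<open>T + c G\<close> is the sum of the \<open>E i\<close> with coefficients
  \<open>1 + c * \<beta> i\<close>, which are nonnegative because \<open>\<beta> i\<close> lies
  between \<open>-1\<close> and \<open>1\<close>.\<close>

lemma star_sep_contr:
  assumes X: "finite X" and T: "tp X X T" "map_has_sum X E UNIV T"
    and E: "\<And>i. kraus_cone X X \<K> (E i)"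
    and \<beta>: "\<And>i. \<beta> i \<in> {-1..1}"
    and G: "map_has_sum X (\<lambda>i M y y'. complex_of_real (\<beta> i) * E i M y y') UNIV G"
  shows "sep_contr X \<K> G"
proof -
  have "kraus_cone X X \<K> (\<lambda>M y y'. T M y y' + complex_of_real c * G M y y')" if c: "c \<in> {-1, 1}" for c
  proof (rule kraus_cone_has_sum[OF X X])
    fix i
    have "0 \<le> 1 + c * \<beta> i"
      using c \<beta>[of i] by auto
    then show "kraus_cone X X \<K> (\<lambda>M y y'. complex_of_real (1 + c * \<beta> i) * E i M y y')"
      by (rule kraus_cone_scale[OF E])
  next
    show "map_has_sum X (\<lambda>i M y y'. complex_of_real (1 + c * \<beta> i) * E i M y y') UNIV
        (\<lambda>M y y'. T M y y' + complex_of_real c * G M y y')"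
      unfolding map_has_sum_def
    proof (intro ballI allI)
      fix M y y' assume M: "M \<in> ops X"
      have "((\<lambda>i. E i M y y' + complex_of_real c * (complex_of_real (\<beta> i) * E i M y y')) has_sum
          T M y y' + complex_of_real c * G M y y') UNIV"
        using T(2) G M by (intro has_sum_add has_sum_cmult_right) (auto simp: map_has_sum_def)
      then show "((\<lambda>i. complex_of_real (1 + c * \<beta> i) * E i M y y') has_sum
          T M y y' + complex_of_real c * G M y y') UNIV"
        by (simp add: algebra_simps)
    qed
  qed
  moreover have "linear_map X X G"
    by (rule linear_map_has_sum[OF linear_map_scale[OF kraus_cone_linear[OF E]] G])
  ultimately show ?thesis
    unfolding sep_contr_def using T(1) by blast
qed

section \<open>Kraus decompositions and separability of local instruments\<close>

definition hform :: "'a set \<Rightarrow> 'a oper \<Rightarrow> ('a \<Rightarrow> complex) \<Rightarrow> complex" where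
  "hform X M v = (\<Sum>i\<in>X. \<Sum>j\<in>X. cnj (v i) * M i j * v j)"

lemma psd_hform: "psd X M \<longleftrightarrow> M \<in> ops X \<and> (\<forall>v. hform X M v \<in> \<real>\<^sub>\<ge>\<^sub>0)"
  by (simp add: psd_def hform_def)

lemma hform_insert:
  assumes "finite X" "x \<notin> X"
  shows "hform (insert x X) M v = cnj (v x) * M x x * v x + cnj (v x) * (\<Sum>j\<in>X. M x j * v j)
    + (\<Sum>i\<in>X. cnj (v i) * M i x) * v x + hform X M v"
  using assms by (simp add: hform_def sum.distrib sum_distrib_left sum_distrib_right algebra_simps)

lemma hform_outside: "(\<And>i. i \<in> X \<Longrightarrow> v i = w i) \<Longrightarrow> hform X M v = hform X M w"
  by (simp add: hform_def)

lemma hform_two: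
  assumes "finite X" "i \<in> X" "j \<in> X" "i \<noteq> j"
  shows "hform X M (\<lambda>k. if k = i then s else if k = j then t else 0)
    = cnj s * M i i * s + cnj s * M i j * t + cnj t * M j i * s + cnj t * M j j * t"
proof -
  define v where "v = (\<lambda>k. if k = i then s else if k = j then t else 0)"
  have "hform X M v = (\<Sum>k\<in>{i, j}. \<Sum>l\<in>{i, j}. cnj (v k) * M k l * v l)"
  proof -
    have "(\<Sum>l\<in>X. cnj (v k) * M k l * v l) = (\<Sum>l\<in>{i, j}. cnj (v k) * M k l * v l)" for k
      by (rule sum.mono_neutral_right) (use assms in \<open>auto simp: v_def\<close>)
    then show ?thesis
      unfolding hform_def
      by (simp only:) (rule sum.mono_neutral_right, use assms in \<open>auto simp: v_def\<close>)
  qed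
  then show ?thesis
    using assms by (simp add: v_def algebra_simps)
qed

lemma hform_one:
  assumes "finite X" "i \<in> X"
  shows "hform X M (\<lambda>k. if k = i then s else 0) = cnj s * M i i * s"
  using assms by (simp add: hform_def if_distrib[of cnj] if_distrib[of "\<lambda>x. x * _"]
      if_distrib[of "\<lambda>x. _ * x"] cong: if_cong)

text \<open>Polarisation: reality of the form at \<open>e\<^sub>i + e\<^sub>j\<close> and at
  \<open>e\<^sub>i + \<i> e\<^sub>j\<close> determines \<open>M j i\<close> from
  \<open>M i j\<close>.\<close>

lemma psd_hermitian:
  assumes X: "finite X" and psd: "\<And>v. hform X M v \<in> \<real>\<^sub>\<ge>\<^sub>0" and ij: "i \<in> X" "j \<in> X"
  shows "M j i = cnj (M i j)"
proof (cases "i = j")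
  case True
  have "hform X M (\<lambda>k. if k = i then 1 else 0) \<in> \<real>\<^sub>\<ge>\<^sub>0"
    by (rule psd)
  then have "M i i \<in> \<real>\<^sub>\<ge>\<^sub>0"
    unfolding hform_one[OF X ij(1)] by simp
  then show ?thesis
    using True by (simp add: complex_nonneg_Reals_iff complex_eq_iff)
next
  case False
  have "hform X M (\<lambda>k. if k = i then 1 else 0) \<in> \<real>\<^sub>\<ge>\<^sub>0" "hform X M (\<lambda>k. if k = j then 1 else 0) \<in> \<real>\<^sub>\<ge>\<^sub>0"
    by (rule psd)+
  then have d: "Im (M i i) = 0" "Im (M j j) = 0"
    unfolding hform_one[OF X ij(1)] hform_one[OF X ij(2)] by (auto simp: complex_nonneg_Reals_iff)
  have *: "hform X M (\<lambda>k. if k = i then s else if k = j then t else 0) \<in> \<real>\<^sub>\<ge>\<^sub>0" for s t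
    by (rule psd)
  have "Im (M i j + M j i) = 0" "Re (M j i) = Re (M i j)"
    using *[of 1 1] *[of 1 \<i>] d
    unfolding hform_two[OF X ij False] by (auto simp: complex_nonneg_Reals_iff)
  then show ?thesis
    by (simp add: complex_eq_iff)
qed

text \<open>If the diagonal entry at \<open>i\<close> is zero, the form is affine in the size of the
  component along \<open>e\<^sub>i\<close>, and a nonzero entry \<open>M i j\<close> would drive it
  below zero.\<close>

lemma psd_zero_row:
  assumes X: "finite X" and psd: "\<And>v. hform X M v \<in> \<real>\<^sub>\<ge>\<^sub>0" and ij: "i \<in> X" "j \<in> X" and z: "M i i = 0"
  shows "M i j = 0"
proof (cases "i = j")
  case False
  have *: "0 \<le> Re (M j j) - 2 * r * (cmod (M i j))\<^sup>2" for r :: real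
  proof -
    have "hform X M (\<lambda>k. if k = i then - (complex_of_real r * M i j) else if k = j then 1 else 0) \<in> \<real>\<^sub>\<ge>\<^sub>0"
      by (rule psd)
    then have "0 \<le> Re (cnj (- (complex_of_real r * M i j)) * M i j + cnj (M i j) * (- (complex_of_real r * M i j)) + M j j)"
      unfolding hform_two[OF X ij False] z psd_hermitian[OF X psd ij]
      by (simp add: complex_nonneg_Reals_iff)
    then show ?thesis
      unfolding cmod_power2 by (simp add: power2_eq_square algebra_simps)
  qed
  show ?thesis
  proof (rule ccontr)
    assume "M i j \<noteq> 0"
    then have pos: "0 < (cmod (M i j))\<^sup>2" by simp
    have "0 \<le> Re (M j j) - 2 * ((Re (M j j) + 1) / (cmod (M i j))\<^sup>2) * (cmod (M i j))\<^sup>2"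
      by (rule *)
    also have "\<dots> = - Re (M j j) - 2"
      using pos by simp
    finally show False
      using *[of 0] by simp
  qed
qed (use z in simp)

text \<open>Cholesky decomposition: the Schur complement of a diagonal entry is again positive
  semidefinite, and if the entry is zero then so is its row.\<close>

lemma psd_gram:
  assumes "finite X" "\<And>v. hform X M v \<in> \<real>\<^sub>\<ge>\<^sub>0"
  shows "\<exists>(m::nat) w. \<forall>i\<in>X. \<forall>j\<in>X. M i j = (\<Sum>k<m. w k i * cnj (w k j))"
  using assms
proof (induction X arbitrary: M rule: finite_induct)
  case empty
  then show ?case by simp
next
  case (insert x X)
  define a where "a = M x x"
  have fin: "finite (insert x X)" using insert.hyps by simp
  have herm: "M j i = cnj (M i j)" if "i \<in> insert x X" "j \<in> insert x X" for i j
    by (rule psd_hermitian[OF fin insert.prems that])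
  have "hform (insert x X) M (\<lambda>k. if k = x then 1 else 0) \<in> \<real>\<^sub>\<ge>\<^sub>0"
    by (rule insert.prems)
  then have "a \<in> \<real>\<^sub>\<ge>\<^sub>0"
    by (subst (asm) hform_one[OF fin]) (simp_all add: a_def)
  then obtain r where r: "a = complex_of_real r" "0 \<le> r"
    by (auto simp: nonneg_Reals_def)
  define w0 where "w0 = (\<lambda>i. M i x / complex_of_real (sqrt r))"
  have zero: "M x j = 0" if "r = 0" "j \<in> insert x X" for j
    by (rule psd_zero_row[OF fin insert.prems _ that(2)]) (use that r in \<open>auto simp: a_def\<close>)
  have sq: "complex_of_real (sqrt r) * complex_of_real (sqrt r) = a"
    using r by (simp flip: of_real_mult)
  have ww: "w0 i * cnj (w0 j) = M i x * M x j / a" if "i \<in> insert x X" "j \<in> insert x X" for i j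
    using herm[of j x] that by (simp add: w0_def sq[symmetric])
  define M' where "M' = (\<lambda>i j. M i j - w0 i * cnj (w0 j))"
  have "hform X M' v \<in> \<real>\<^sub>\<ge>\<^sub>0" for v
  proof -
    define b where "b = (\<Sum>j\<in>X. M x j * v j)"
    \<comment> \<open>For \<open>a \<noteq> 0\<close> this value at \<open>x\<close> minimises the
      form and leaves the Schur complement. If \<open>a = 0\<close>, division by zero makes the
      value \<open>0\<close>, and the correction \<open>cnj b * b / a\<close> is \<open>0\<close> as
      well.\<close>
    define v' where "v' = v(x := - b / a)"
    have b': "(\<Sum>i\<in>X. cnj (v i) * M i x) = cnj b"
      unfolding b_def cnj_sum by (intro sum.cong refl) (simp add: herm[of x])
    have v'X: "v' i = v i" if "i \<in> X" for i
      using that insert.hyps by (auto simp: v'_def)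
    have "hform X M' v = hform X M v - (\<Sum>i\<in>X. \<Sum>j\<in>X. cnj (v i) * (M i x * M x j / a) * v j)"
      unfolding hform_def M'_def sum_subtractf[symmetric]
      by (intro sum.cong refl) (simp add: ww algebra_simps)
    also have "(\<Sum>i\<in>X. \<Sum>j\<in>X. cnj (v i) * (M i x * M x j / a) * v j) =
        (\<Sum>i\<in>X. cnj (v i) * M i x) * (\<Sum>j\<in>X. M x j * v j) / a"
      unfolding sum_product sum_divide_distrib by (intro sum.cong refl) simp
    finally have 1: "hform X M' v = hform X M v - cnj b * b / a"
      by (simp add: b' b_def)
    have "hform (insert x X) M v' = hform X M v - cnj b * b / a"
    proof -
      have "hform (insert x X) M v' = cnj (v' x) * a * v' x + cnj (v' x) * b + cnj b * v' x + hform X M v"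
      proof -
        have "(\<Sum>i\<in>X. cnj (v' i) * M i x) = cnj b" "(\<Sum>j\<in>X. M x j * v' j) = b"
          using b' v'X by (simp_all add: b_def)
        moreover have "hform X M v' = hform X M v"
          by (rule hform_outside[OF v'X])
        ultimately show ?thesis
          by (simp add: hform_insert[OF insert.hyps] a_def)
      qed
      also have "\<dots> = hform X M v - cnj b * b / a"
        using r by (cases "r = 0") (simp_all add: v'_def field_simps)
      finally show ?thesis .
    qed
    then show ?thesis
      using insert.prems[of v'] 1 by simp
  qed
  from insert.IH[OF this] obtain m w where
    w: "\<And>i j. i \<in> X \<Longrightarrow> j \<in> X \<Longrightarrow> M' i j = (\<Sum>k<m::nat. w k i * cnj (w k j))"
    by blast
  \<comment> \<open>The new vector \<open>w0\<close> comes first. The old ones are set to zero at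
    \<open>x\<close>, where the induction hypothesis says nothing about them.\<close>
  define w' where "w' = (\<lambda>k i. case k of 0 \<Rightarrow> w0 i | Suc k \<Rightarrow> if i = x then 0 else w k i)"
  have "M i j = (\<Sum>k<Suc m. w' k i * cnj (w' k j))" if ij: "i \<in> insert x X" "j \<in> insert x X" for i j
  proof -
    have "(\<Sum>k<Suc m. w' k i * cnj (w' k j)) = w0 i * cnj (w0 j) + (if i = x \<or> j = x then 0 else M' i j)"
      unfolding sum.lessThan_Suc_shift using ij by (auto simp: w'_def w)
    also have "\<dots> = M i j"
    proof (cases "i = x \<or> j = x")
      case True
      have "M i x * M x j / a = M i j"
      proof (cases "r = 0")
        case True
        then show ?thesis
          using zero[OF True] herm[of x i] ij \<open>i = x \<or> j = x\<close> by auto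
      next
        case False
        then have "a \<noteq> 0" using r by simp
        then show ?thesis
          using \<open>i = x \<or> j = x\<close> by (auto simp: a_def)
      qed
      then show ?thesis
        using True by (simp add: ww[OF ij])
    qed (simp add: M'_def)
    finally show ?thesis by simp
  qed
  then show ?case
    by blast
qed

lemma linear_map_sum_maps:
  "(\<And>k. k \<in> I \<Longrightarrow> linear_map X Y (E k)) \<Longrightarrow> linear_map X Y (\<lambda>M y y'. \<Sum>k\<in>I. E k M y y')"
proof (induction I rule: infinite_finite_induct)
  case (insert k I)
  then show ?case
    using linear_map_add[of X Y "E k" "\<lambda>M y y'. \<Sum>k\<in>I. E k M y y'"] by simp
qed (auto intro: linear_mapI)

lemma cp_linear: "cp X Y E \<Longrightarrow> linear_map X Y E"
  by (simp add: cp_def)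

text \<open>Choi's theorem: the Gram vectors of the Choi matrix, read as matrices, are the Kraus
  operators.\<close>

theorem cp_kraus:
  assumes X: "finite X" and Y: "finite Y" and E: "cp X Y E"
  obtains m :: nat and K where
    "\<And>M. M \<in> ops X \<Longrightarrow> E M = (\<lambda>y y'. \<Sum>k<m. conj_map X Y (K k) M y y')"
proof -
  obtain e where e: "bij_betw e X {0..<card X}"
    using ex_bij_betw_finite_nat[OF X] by blast
  define n where "n = card X"
  have e_less: "e x < n" if "x \<in> X" for x
    using e that by (auto simp: bij_betw_def n_def)
  have e_inj: "e x = e y \<longleftrightarrow> x = y" if "x \<in> X" "y \<in> X" for x y
    using e that by (auto simp: bij_betw_def inj_on_def)
  \<comment> \<open>The unnormalised maximally entangled state. Its ancilla is a copy of
    \<open>X\<close> enumerated by \<open>e\<close>, since \<open>cp\<close> tests ancillas labelled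
    by natural numbers.\<close>
  define \<Omega> :: "('a \<times> nat) oper" where
    "\<Omega> = (\<lambda>(x, i) (x', i'). if x \<in> X \<and> x' \<in> X \<and> i = e x \<and> i' = e x' then 1 else 0)"
  have "hform (X \<times> {..<n}) \<Omega> v \<in> \<real>\<^sub>\<ge>\<^sub>0" for v
  proof -
    have delta: "(\<Sum>x\<in>X. \<Sum>i<n. if i = e x then f x i else 0) = (\<Sum>x\<in>X. f x (e x))" for f :: "'a \<Rightarrow> nat \<Rightarrow> complex"
      by (intro sum.cong refl) (simp add: e_less)
    have d1: "(\<Sum>y<n. c * (if y = m then 1 else 0) * f y) = c * f m" if "m < n" for c m and f :: "nat \<Rightarrow> complex"
    proof -
      have "(\<Sum>y<n. c * (if y = m then 1 else 0) * f y) = (\<Sum>y<n. if y = m then c * f y else 0)"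
        by (intro sum.cong) auto
      then show ?thesis using that by simp
    qed
    have "hform (X \<times> {..<n}) \<Omega> v = (\<Sum>x\<in>X. \<Sum>i<n. if i = e x then cnj (v (x, i)) *
        (\<Sum>x'\<in>X. \<Sum>i'<n. if i' = e x' then v (x', i') else 0) else 0)"
      unfolding hform_def sum.cartesian_product'
      by (intro sum.cong refl) (auto simp: \<Omega>_def sum_distrib_left d1 e_less intro!: sum.cong)
    also have "\<dots> = cnj (\<Sum>x\<in>X. v (x, e x)) * (\<Sum>x\<in>X. v (x, e x))"
      unfolding delta by (simp add: sum_distrib_right)
    also have "\<dots> = complex_of_real ((cmod (\<Sum>x\<in>X. v (x, e x)))\<^sup>2)"
      by (rule trans[OF mult.commute complex_norm_square[symmetric]])
    finally show ?thesis
      by simp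
  qed
  moreover have "\<Omega> \<in> ops (X \<times> {..<n})"
    by (auto simp: ops_def \<Omega>_def e_less split: if_splits)
  ultimately have "psd (Y \<times> {..<n}) (tensor_map E id \<Omega>)"
    using E by (simp add: cp_def psd_hform)
  then have "\<And>v. hform (Y \<times> {..<n}) (tensor_map E id \<Omega>) v \<in> \<real>\<^sub>\<ge>\<^sub>0"
    by (simp add: psd_hform)
  then obtain m w where w: "\<forall>p\<in>Y \<times> {..<n}. \<forall>p'\<in>Y \<times> {..<n}.
      tensor_map E id \<Omega> p p' = (\<Sum>k<m::nat. w k p * cnj (w k p'))"
    using psd_gram[of "Y \<times> {..<n}" "tensor_map E id \<Omega>"] Y by auto
  have choi: "tensor_map E id \<Omega> (y, e u) (y', e v) = E (matrix_unit u v) y y'" if "u \<in> X" "v \<in> X" for u v y y'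
  proof -
    have "(\<lambda>a a'. \<Omega> (a, e u) (a', e v)) = matrix_unit u v"
      using that by (auto simp: \<Omega>_def matrix_unit_def e_inj fun_eq_iff)
    then show ?thesis
      by (simp add: tensor_map_def)
  qed
  define K where "K = (\<lambda>k y u. w k (y, e u))"
  have "E M = (\<lambda>y y'. \<Sum>k<m. conj_map X Y (K k) M y y')" if M: "M \<in> ops X" for M
  proof (rule linear_map_eqI[OF cp_linear[OF E] linear_map_sum_maps X M])
    fix u v y y' assume uv: "u \<in> X" "v \<in> X" and y: "y \<in> Y" "y' \<in> Y"
    have "E (matrix_unit u v) y y' = (\<Sum>k<m. w k (y, e u) * cnj (w k (y', e v)))"
      using w uv y by (simp add: choi[symmetric] e_less)
    also have "\<dots> = (\<Sum>k<m. conj_map X Y (K k) (matrix_unit u v) y y')"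
      by (simp add: conj_map_eq_sandwich sandwich_unit[OF X uv] y K_def)
    finally show "E (matrix_unit u v) y y' = (\<Sum>k<m. conj_map X Y (K k) (matrix_unit u v) y y')" .
  qed simp
  then show thesis
    by (rule that)
qed

text \<open>The quadratic form of the image at \<open>v\<close> is that of \<open>M\<close> at the
  vector which the adjoint of \<open>K\<close> makes of \<open>v\<close> on the first
  factor.\<close>

lemma cp_conj_map: "cp X Y (conj_map X Y K)"
  unfolding cp_def
proof (intro conjI allI impI)
  fix k :: nat and M :: "('a \<times> nat) oper" assume M: "psd (X \<times> {..<k}) M"
  then have MX: "M \<in> ops (X \<times> {..<k})"
    by (simp add: psd_def)
  have "hform (Y \<times> {..<k}) (tensor_map (conj_map X Y K) id M) v
      = hform (X \<times> {..<k}) M (\<lambda>(x, i). \<Sum>y\<in>Y. cnj (K y x) * v (y, i))" for v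
  proof -
    have "hform (Y \<times> {..<k}) (tensor_map (conj_map X Y K) id M) v
      = (\<Sum>y\<in>Y. \<Sum>i<k. \<Sum>y'\<in>Y. \<Sum>i'<k. \<Sum>x\<in>X. \<Sum>x'\<in>X.
          cnj (v (y, i)) * (K y x * M (x, i) (x', i') * cnj (K y' x')) * v (y', i'))"
      by (simp add: hform_def sum.cartesian_product' conj_map_eq_sandwich tensor_map_sandwich_id
          sum_distrib_left sum_distrib_right)
    also have "\<dots> = (\<Sum>i<k. \<Sum>y\<in>Y. \<Sum>i'<k. \<Sum>y'\<in>Y. \<Sum>x\<in>X. \<Sum>x'\<in>X.
          cnj (v (y, i)) * (K y x * M (x, i) (x', i') * cnj (K y' x')) * v (y', i'))"
      by (subst sum.swap, intro sum.cong refl, rule sum.swap)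
    also have "\<dots> = (\<Sum>i<k. \<Sum>i'<k. \<Sum>y\<in>Y. \<Sum>y'\<in>Y. \<Sum>x\<in>X. \<Sum>x'\<in>X.
          cnj (v (y, i)) * (K y x * M (x, i) (x', i') * cnj (K y' x')) * v (y', i'))"
      by (intro sum.cong refl, rule sum.swap)
    also have "\<dots> = (\<Sum>i<k. \<Sum>i'<k. \<Sum>x\<in>X. \<Sum>x'\<in>X. \<Sum>y\<in>Y. \<Sum>y'\<in>Y.
          cnj (v (y, i)) * (K y x * M (x, i) (x', i') * cnj (K y' x')) * v (y', i'))"
      by (intro sum.cong refl, rule sum_swap_pairs)
    also have "\<dots> = (\<Sum>i<k. \<Sum>i'<k. \<Sum>x\<in>X. \<Sum>x'\<in>X.
          cnj (\<Sum>y\<in>Y. cnj (K y x) * v (y, i)) * M (x, i) (x', i') * (\<Sum>y'\<in>Y. cnj (K y' x') * v (y', i')))"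
    proof (intro sum.cong refl)
      fix i i' x x'
      have "cnj (\<Sum>y\<in>Y. cnj (K y x) * v (y, i)) * M (x, i) (x', i') * (\<Sum>y'\<in>Y. cnj (K y' x') * v (y', i'))
        = M (x, i) (x', i') * (\<Sum>y\<in>Y. \<Sum>y'\<in>Y. (K y x * cnj (v (y, i))) * (cnj (K y' x') * v (y', i')))"
        unfolding sum_product[symmetric] by simp
      then show "(\<Sum>y\<in>Y. \<Sum>y'\<in>Y. cnj (v (y, i)) * (K y x * M (x, i) (x', i') * cnj (K y' x')) * v (y', i'))
        = cnj (\<Sum>y\<in>Y. cnj (K y x) * v (y, i)) * M (x, i) (x', i') * (\<Sum>y'\<in>Y. cnj (K y' x') * v (y', i'))"
        by (simp add: sum_distrib_left mult_ac)
    qed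
    also have "\<dots> = (\<Sum>i<k. \<Sum>x\<in>X. \<Sum>i'<k. \<Sum>x'\<in>X.
          cnj (\<Sum>y\<in>Y. cnj (K y x) * v (y, i)) * M (x, i) (x', i') * (\<Sum>y'\<in>Y. cnj (K y' x') * v (y', i')))"
      by (intro sum.cong refl, rule sum.swap)
    also have "\<dots> = (\<Sum>x\<in>X. \<Sum>i<k. \<Sum>x'\<in>X. \<Sum>i'<k.
          cnj (\<Sum>y\<in>Y. cnj (K y x) * v (y, i)) * M (x, i) (x', i') * (\<Sum>y'\<in>Y. cnj (K y' x') * v (y', i')))"
      by (subst sum.swap, intro sum.cong refl, rule sum.swap)
    also have "\<dots> = hform (X \<times> {..<k}) M (\<lambda>(x, i). \<Sum>y\<in>Y. cnj (K y x) * v (y, i))"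
      by (simp add: hform_def sum.cartesian_product')
    finally show ?thesis .
  qed
  then show "psd (Y \<times> {..<k}) (tensor_map (conj_map X Y K) id M)"
    using M linear_mapD(1)[OF linear_map_tensor_map[OF linear_map_conj_map linear_map_id] MX]
    by (simp add: psd_hform)
qed simp

lemma cp_id: "cp X X id"
proof -
  have "tensor_map id id M = M" for M :: "('a \<times> nat) oper"
    by (auto simp: tensor_map_def fun_eq_iff)
  then show ?thesis
    unfolding cp_def by (auto simp: linear_map_id)
qed

lemma cptp_id: "cptp X X id"
  by (simp add: cptp_def tp_def cp_id linear_map_id)

lemma kraus_cone_sum:
  assumes "finite I" "\<And>i. i \<in> I \<Longrightarrow> kraus_cone X Y \<K> (P i)"
  shows "kraus_cone X Y \<K> (\<lambda>M y y'. \<Sum>i\<in>I. P i M y y')"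
  using assms
proof (induction I rule: finite_induct)
  case empty
  then show ?case by (simp add: kraus_cone_zero)
next
  case (insert i I)
  then show ?case
    using kraus_cone_lin_comb[of X Y \<K> "P i" "\<lambda>M y y'. \<Sum>i\<in>I. P i M y y'" 1] by simp
qed

section \<open>Separability of LO and LOCC maps\<close>

definition product_kraus :: "('a \<times> 'b \<Rightarrow> 'c \<times> 'd \<Rightarrow> complex) set" where
  "product_kraus = {kron K J | K J. True}"

lemma kron_in_product_kraus: "kron K J \<in> product_kraus"
  by (auto simp: product_kraus_def)

lemma matrix_mult_on_kron:
  "matrix_mult_on (A \<times> B) (kron K J) (kron K' J') = kron (matrix_mult_on A K K') (matrix_mult_on B J J')"
  by (auto simp: fun_eq_iff matrix_mult_on_def sum.cartesian_product' sum_product mult_ac)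

lemma product_kraus_mult:
  "K \<in> product_kraus \<Longrightarrow> J \<in> product_kraus \<Longrightarrow> matrix_mult_on (A \<times> B) J K \<in> product_kraus"
  unfolding product_kraus_def
  by (elim CollectE exE conjE) (simp add: matrix_mult_on_kron, blast)

text \<open>The products of the Kraus operators of the two factors are Kraus operators of the tensor
  product.\<close>

lemma tensor_map_kraus_cone:
  assumes A: "finite A" "finite A'" and B: "finite B" "finite B'" and E: "cp A A' E" and F: "cp B B' F"
  shows "kraus_cone (A \<times> B) (A' \<times> B') product_kraus (tensor_map E F)"
proof -
  obtain m K where K: "\<And>M. M \<in> ops A \<Longrightarrow> E M = (\<lambda>y y'. \<Sum>k<m::nat. conj_map A A' (K k) M y y')"
    by (rule cp_kraus[OF A E]) blast
  obtain l J where J: "\<And>M. M \<in> ops B \<Longrightarrow> F M = (\<lambda>y y'. \<Sum>k<l::nat. conj_map B B' (J k) M y y')"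
    by (rule cp_kraus[OF B F]) blast
  have "kraus_cone (A \<times> B) (A' \<times> B') product_kraus (\<lambda>M y y'. \<Sum>k<m. \<Sum>i<l. conj_map (A \<times> B) (A' \<times> B') (kron (K k) (J i)) M y y')"
    by (intro kraus_cone_sum kraus_cone_conj_map kron_in_product_kraus) auto
  then show ?thesis
  proof (rule kraus_cone_cong)
    fix M assume M: "M \<in> ops (A \<times> B)"
    have "tensor_map E F M (c, d) (c', d') = (\<Sum>k<m. \<Sum>i<l. conj_map (A \<times> B) (A' \<times> B') (kron (K k) (J i)) M (c, d) (c', d'))" for c d c' d'
    proof -
      have *: "(\<lambda>a a'. conj_map B B' (J i) (\<lambda>b b'. M (a, b) (a', b')) d d') \<in> ops A" for i
        by (rule tensor_map_inner_in_ops[OF M linear_map_conj_map])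
      have "tensor_map E F M (c, d) (c', d') = (\<Sum>k<m. conj_map A A' (K k)
          (\<lambda>a a'. F (\<lambda>b b'. M (a, b) (a', b')) d d') c c')"
        using tensor_map_inner_in_ops[OF M cp_linear[OF F]] by (simp add: tensor_map_def K)
      also have "\<dots> = (\<Sum>k<m. conj_map A A' (K k)
          (\<lambda>a a'. \<Sum>i<l. 1 * conj_map B B' (J i) (\<lambda>b b'. M (a, b) (a', b')) d d') c c')"
        by (simp add: J[OF block_in_ops(2)[OF M]])
      also have "\<dots> = (\<Sum>k<m. \<Sum>i<l. 1 * conj_map A A' (K k)
          (\<lambda>a a'. conj_map B B' (J i) (\<lambda>b b'. M (a, b) (a', b')) d d') c c')"
        by (subst linear_map_sum[OF linear_map_conj_map _ *]) auto
      also have "\<dots> = (\<Sum>k<m. \<Sum>i<l. tensor_map (conj_map A A' (K k)) (conj_map B B' (J i)) M (c, d) (c', d'))"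
        by (simp add: tensor_map_def)
      finally show ?thesis
        by (simp add: tensor_map_conj_map)
    qed
    then show "tensor_map E F M = (\<lambda>y y'. \<Sum>k<m. \<Sum>i<l. conj_map (A \<times> B) (A' \<times> B') (kron (K k) (J i)) M y y')"
      by (simp add: fun_eq_iff)
  qed
qed

text \<open>Summable families of complex numbers are absolutely summable, so the product family is
  summable and may be summed in iterated order.\<close>

lemma has_sum_product_complex:
  fixes f :: "'i \<Rightarrow> complex" and g :: "'j \<Rightarrow> complex"
  assumes f: "(f has_sum a) I" and g: "(g has_sum b) J"
  shows "((\<lambda>(i, j). f i * g j) has_sum a * b) (I \<times> J)"
proof -
  have fa: "(\<lambda>i. norm (f i)) summable_on I" and ga: "(\<lambda>i. norm (g i)) summable_on J"
    using f g by (auto simp: summable_on_iff_abs_summable_on_complex[symmetric] summable_on_def)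
  have "(\<lambda>p. norm ((\<lambda>(i, j). f i * g j) p)) summable_on I \<times> J"
    unfolding Infinite_Sum.abs_summable_on_Sigma_iff
  proof (intro conjI ballI)
    fix i
    show "(\<lambda>j. norm (case (i, j) of (i, j) \<Rightarrow> f i * g j)) summable_on J"
      using ga by (simp add: norm_mult summable_on_cmult_right)
  next
    have "(\<lambda>i. norm (f i) * (\<Sum>\<^sub>\<infinity>j\<in>J. norm (g j))) summable_on I"
      using fa by (rule summable_on_cmult_left)
    then show "(\<lambda>i. norm (\<Sum>\<^sub>\<infinity>j\<in>J. norm (case (i, j) of (i, j) \<Rightarrow> f i * g j))) summable_on I"
      by (simp add: norm_mult infsum_cmult_right' abs_mult infsum_nonneg)
  qed
  then have "(\<lambda>(i, j). f i * g j) summable_on I \<times> J"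
    by (simp add: summable_on_iff_abs_summable_on_complex)
  then show ?thesis
    by (intro has_sum_SigmaI[where g = "\<lambda>i. f i * b"])
      (auto intro: has_sum_cmult_right[OF g] has_sum_cmult_left[OF f])
qed

lemma tp_tensor_map:
  assumes T: "tp A A T" and S: "tp B B S"
  shows "tp (A \<times> B) (A \<times> B) (tensor_map T S)"
proof -
  have lin: "linear_map A A T" "linear_map B B S"
    using T S by (simp_all add: tp_def)
  have "trace_on (A \<times> B) (tensor_map T S M) = trace_on (A \<times> B) M" if M: "M \<in> ops (A \<times> B)" for M
  proof -
    have "trace_on (A \<times> B) (tensor_map T S M)
      = (\<Sum>d\<in>B. trace_on A (T (\<lambda>a a'. S (\<lambda>b b'. M (a, b) (a', b')) d d)))"
      unfolding trace_on_def by (simp add: sum.cartesian_product' tensor_map_def) (rule sum.swap)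
    also have "\<dots> = (\<Sum>d\<in>B. trace_on A (\<lambda>a a'. S (\<lambda>b b'. M (a, b) (a', b')) d d))"
      using T tensor_map_inner_in_ops[OF M lin(2)] by (intro sum.cong refl) (auto simp: tp_def)
    also have "\<dots> = (\<Sum>a\<in>A. trace_on B (S (\<lambda>b b'. M (a, b) (a, b'))))"
      unfolding trace_on_def by (rule sum.swap)
    also have "\<dots> = (\<Sum>a\<in>A. trace_on B (\<lambda>b b'. M (a, b) (a, b')))"
      using S block_in_ops(2)[OF M] by (intro sum.cong refl) (auto simp: tp_def)
    finally show ?thesis
      by (simp add: trace_on_def sum.cartesian_product')
  qed
  then show ?thesis
    unfolding tp_def using linear_map_tensor_map[OF lin] by blast
qed

text \<open>After expansion in matrix units each entry is a finite combination of products of one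
  summand from either side.\<close>

lemma map_has_sum_tensor_map:
  fixes E :: "'i \<Rightarrow> ('a, 'a) opmap" and F :: "'j \<Rightarrow> ('b, 'b) opmap"
  assumes fin: "finite A" "finite B"
    and linE: "\<And>i. linear_map A A (E i)" and linF: "\<And>j. linear_map B B (F j)"
    and linT: "linear_map A A T" and linS: "linear_map B B S"
    and T: "map_has_sum A E UNIV T" and S: "map_has_sum B F UNIV S"
  shows "map_has_sum (A \<times> B) (\<lambda>(i, j). tensor_map (E i) (F j)) UNIV (tensor_map T S)"
  unfolding map_has_sum_def
proof (intro ballI allI)
  fix M and y y' :: "'a \<times> 'b" assume M: "M \<in> ops (A \<times> B)"
  obtain c d c' d' where y: "y = (c, d)" "y' = (c', d')" by (metis surj_pair)
  have prod: "((\<lambda>p. E (fst p) (matrix_unit u v) c c' * F (snd p) (matrix_unit s t) d d') has_sum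
      T (matrix_unit u v) c c' * S (matrix_unit s t) d d') UNIV"
    if "u \<in> A" "v \<in> A" "s \<in> B" "t \<in> B" for u v s t
    using has_sum_product_complex[of "\<lambda>i. E i (matrix_unit u v) c c'" UNIV "T (matrix_unit u v) c c'"
        "\<lambda>i. F i (matrix_unit s t) d d'" UNIV "S (matrix_unit s t) d d'"] T S that
    by (simp add: map_has_sum_def case_prod_unfold)
  have "((\<lambda>p. \<Sum>u\<in>A. \<Sum>v\<in>A. \<Sum>s\<in>B. \<Sum>t\<in>B. M (u, s) (v, t) *
      (E (fst p) (matrix_unit u v) c c' * F (snd p) (matrix_unit s t) d d')) has_sum
      (\<Sum>u\<in>A. \<Sum>v\<in>A. \<Sum>s\<in>B. \<Sum>t\<in>B. M (u, s) (v, t) *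
      (T (matrix_unit u v) c c' * S (matrix_unit s t) d d'))) UNIV"
    by (intro has_sum_finite_sum fin has_sum_cmult_right prod)
  then show "((\<lambda>i. (case i of (i, j) \<Rightarrow> tensor_map (E i) (F j)) M y y') has_sum tensor_map T S M y y') UNIV"
    unfolding y tensor_map_expand[OF linT linS fin M]
    by (simp add: case_prod_beta tensor_map_expand[OF linE linF fin M])
qed

lemma lo_star_sep_contr:
  assumes fin: "finite A" "finite B" and G: "G \<in> lo_star A B"
  shows "sep_contr (A \<times> B) product_kraus G"
proof -
  obtain EF \<beta> where EF: "EF \<in> lo_instruments A B" and \<beta>: "\<And>i. \<beta> i \<in> {-1..1}"
    and sum': "map_has_sum (A \<times> B) (\<lambda>i M y y'. complex_of_real (\<beta> i) * EF i M y y') UNIV G"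
    using G unfolding lo_star_def star_def by blast
  obtain E F where E: "instrument A A E" and F: "instrument B B F"
    and EF_eq: "EF = (\<lambda>(i, j). tensor_map (E i) (F j))"
    using EF unfolding lo_instruments_def by blast
  have sum: "map_has_sum (A \<times> B) (\<lambda>i M y y'. complex_of_real (\<beta> i) * (case i of (i, j) \<Rightarrow> tensor_map (E i) (F j)) M y y') UNIV G"
    using sum' unfolding EF_eq .
  obtain T where T: "tp A A T" "map_has_sum A E UNIV T" using E by (auto simp: instrument_def)
  obtain S where S: "tp B B S" "map_has_sum B F UNIV S" using F by (auto simp: instrument_def)
  have cpE: "cp A A (E i)" and cpF: "cp B B (F i)" for i
    using E F by (auto simp: instrument_def)
  have linT: "linear_map A A T" and linS: "linear_map B B S"
    using T(1) S(1) by (simp_all add: tp_def)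
  show ?thesis
  proof (rule star_sep_contr[OF _ tp_tensor_map[OF T(1) S(1)] _ _ \<beta> sum])
    show "finite (A \<times> B)" using fin by simp
    show "kraus_cone (A \<times> B) (A \<times> B) product_kraus (case i of (i, j) \<Rightarrow> tensor_map (E i) (F j))" for i
      using tensor_map_kraus_cone[OF fin(1) fin(1) fin(2) fin(2) cpE cpF] by (cases i) simp
    show "map_has_sum (A \<times> B) (\<lambda>(i, j). tensor_map (E i) (F j)) UNIV (tensor_map T S)"
      by (rule map_has_sum_tensor_map[OF fin cp_linear[OF cpE] cp_linear[OF cpF] linT linS T(2) S(2)])
  qed
qed

lemma one_way_local_kraus_cone:
  assumes "finite A" "finite B" "one_way_local A B J"
  shows "kraus_cone (A \<times> B) (A \<times> B) product_kraus (J k)"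
  using assms by (auto simp: one_way_local_def instrument_def cptp_def intro!: tensor_map_kraus_cone)

text \<open>A round composes separable maps, and a coarse-graining sums them, possibly infinitely
  many at once. The cone is closed under both.\<close>

lemma locc_round_kraus_cone:
  assumes "locc_round A B r I" "finite A" "finite B"
  shows "kraus_cone (A \<times> B) (A \<times> B) product_kraus (I k)"
  using assms
proof (induction arbitrary: k rule: locc_round.induct)
  case (one_round J I)
  then obtain f where f: "\<And>k. map_has_sum (A \<times> B) J {i. f i = k} (I k)"
    unfolding coarse_graining_def by blast
  show ?case
    by (rule kraus_cone_has_sum[OF _ _ _ f])
      (use one_round in \<open>auto intro: one_way_local_kraus_cone\<close>)
next
  case (next_round r I I')
  then obtain J f where J: "\<And>j. one_way_local A B (J j)"
    and f: "\<And>k. map_has_sum (A \<times> B) (\<lambda>(j, j'). J j j' \<circ> I j) {i. f i = k} (I' k)"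
    unfolding locc_linked_def coarse_graining_def by blast
  have "kraus_cone (A \<times> B) (A \<times> B) product_kraus (J j j' \<circ> I j)" for j j'
    by (rule kraus_cone_comp[OF _ _ _ next_round.IH one_way_local_kraus_cone[OF _ _ J] product_kraus_mult])
      (use next_round.prems in auto)
  then show ?case
    by (intro kraus_cone_has_sum[OF _ _ _ f]) (use next_round.prems in auto)
qed

lemma coarse_graining_kraus_cone:
  assumes "finite X" "finite Y" "coarse_graining X E F" "\<And>i. kraus_cone X Y \<K> (E i)"
  shows "kraus_cone X Y \<K> (F k)"
  using assms(3) unfolding coarse_graining_def by (auto intro: kraus_cone_has_sum[OF assms(1,2,4)])

text \<open>The cone is closed because every functional is continuous in the finitely many Choi
  entries.\<close>

lemma kraus_cone_limit:
  assumes fin: "finite X" "finite Y"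
    and C: "\<And>n. n \<ge> 1 \<Longrightarrow> kraus_cone X Y \<K> (C n)" and P: "linear_map X Y P"
    and lim: "\<And>u v y y'. u \<in> X \<Longrightarrow> v \<in> X \<Longrightarrow> y \<in> Y \<Longrightarrow> y' \<in> Y \<Longrightarrow>
      (\<lambda>n. C n (matrix_unit u v) y y') \<longlonglongrightarrow> P (matrix_unit u v) y y'"
  shows "kraus_cone X Y \<K> P"
  unfolding kraus_cone_def
proof (intro conjI allI impI P)
  fix g assume g: "lin_form X Y g" and pos: "\<forall>K\<in>\<K>. 0 \<le> Re (g (conj_map X Y K))"
  obtain c where c: "\<And>P. linear_map X Y P \<Longrightarrow>
      g P = (\<Sum>w\<in>X \<times> X \<times> Y \<times> Y. c w * choi_entry P w)"
    using g by (auto simp: lin_form_def)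
  have "(\<lambda>n. \<Sum>w\<in>X \<times> X \<times> Y \<times> Y. c w * choi_entry (C n) w) \<longlonglongrightarrow> (\<Sum>w\<in>X \<times> X \<times> Y \<times> Y. c w * choi_entry P w)"
    by (intro tendsto_sum tendsto_mult tendsto_const) (use lim in auto)
  then have lim_Re: "(\<lambda>n. Re (\<Sum>w\<in>X \<times> X \<times> Y \<times> Y. c w * choi_entry (C n) w)) \<longlonglongrightarrow> Re (g P)"
    unfolding c[OF P] by (rule tendsto_Re)
  have "0 \<le> Re (\<Sum>w\<in>X \<times> X \<times> Y \<times> Y. c w * choi_entry (C n) w)" if "n \<ge> 1" for n
    using kraus_cone_nonneg[OF C[OF that] g] pos c[OF kraus_cone_linear[OF C[OF that]]] by simp
  then show "0 \<le> Re (g P)"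
    by (intro LIMSEQ_le_const[OF lim_Re]) blast
qed

text \<open>Each Choi entry of each member contributes one of the nonnegative terms that make up the
  distance.\<close>

lemma family_dist_tendsto:
  assumes fin: "finite X" "finite Y" and lim: "(\<lambda>n. family_dist X Y (C n) I) \<longlonglongrightarrow> 0"
    and uv: "u \<in> X" "v \<in> X" "y \<in> Y" "y' \<in> Y"
  shows "(\<lambda>n. C n k (matrix_unit u v) y y') \<longlonglongrightarrow> I k (matrix_unit u v) y y'"
proof -
  have le: "ennreal (cmod (C n k (matrix_unit u v) y y' - I k (matrix_unit u v) y y')) \<le> family_dist X Y (C n) I" for n
  proof -
    define d where "d = (\<lambda>k u v y y'. cmod (C n k (matrix_unit u v) y y' - I k (matrix_unit u v) y y'))"
    have "d k u v y y' \<le> (\<Sum>y'\<in>Y. d k u v y y')"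
      by (rule member_le_sum) (use uv fin in \<open>auto simp: d_def\<close>)
    also have "\<dots> \<le> (\<Sum>y\<in>Y. \<Sum>y'\<in>Y. d k u v y y')"
      by (rule member_le_sum) (use uv fin in \<open>auto simp: d_def intro!: sum_nonneg\<close>)
    also have "\<dots> \<le> (\<Sum>v\<in>X. \<Sum>y\<in>Y. \<Sum>y'\<in>Y. d k u v y y')"
      by (rule member_le_sum) (use uv fin in \<open>auto simp: d_def intro!: sum_nonneg\<close>)
    also have "\<dots> \<le> (\<Sum>u\<in>X. \<Sum>v\<in>X. \<Sum>y\<in>Y. \<Sum>y'\<in>Y. d k u v y y')"
      by (rule member_le_sum) (use uv fin in \<open>auto simp: d_def intro!: sum_nonneg\<close>)
    finally have "ennreal (d k u v y y') \<le> ennreal (\<Sum>u\<in>X. \<Sum>v\<in>X. \<Sum>y\<in>Y. \<Sum>y'\<in>Y. d k u v y y')"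
      by (rule ennreal_leI)
    also have "\<dots> \<le> (\<Sum>k. ennreal (\<Sum>u\<in>X. \<Sum>v\<in>X. \<Sum>y\<in>Y. \<Sum>y'\<in>Y. d k u v y y'))"
      using sum_le_suminf[of "\<lambda>k. ennreal (\<Sum>u\<in>X. \<Sum>v\<in>X. \<Sum>y\<in>Y. \<Sum>y'\<in>Y. d k u v y y')" "{k}"] by simp
    finally show ?thesis
      by (simp add: d_def family_dist_def)
  qed
  have "(\<lambda>n. ennreal (cmod (C n k (matrix_unit u v) y y' - I k (matrix_unit u v) y y'))) \<longlonglongrightarrow> ennreal 0"
    using tendsto_sandwich[OF _ _ tendsto_const lim] le by (simp add: always_eventually)
  then have "(\<lambda>n. cmod (C n k (matrix_unit u v) y y' - I k (matrix_unit u v) y y')) \<longlonglongrightarrow> 0"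
    by (subst (asm) tendsto_ennreal_iff) auto
  then show ?thesis
    by (simp add: LIM_zero_iff tendsto_norm_zero_iff)
qed

text \<open>Separability passes from the protocols to their limit outcome by outcome. Trace
  preservation comes from the limit instrument itself and does not have to survive the
  limit.\<close>

lemma locc_star_sep_contr:
  assumes fin: "finite A" "finite B" and G: "G \<in> locc_star A B"
  shows "sep_contr (A \<times> B) product_kraus G"
proof -
  obtain I \<beta> where I: "I \<in> locc_instruments A B" and \<beta>: "\<And>i. \<beta> i \<in> {-1..1}"
    and sum: "map_has_sum (A \<times> B) (\<lambda>i M y y'. complex_of_real (\<beta> i) * I i M y y') UNIV G"
    using G unfolding locc_star_def star_def by blast
  obtain S C where inst: "instrument (A \<times> B) (A \<times> B) I"
    and S: "\<And>n. n \<ge> 1 \<Longrightarrow> locc_round A B n (S n)"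
    and C: "\<And>n. n \<ge> 1 \<Longrightarrow> coarse_graining (A \<times> B) (S n) (C n)"
    and lim: "(\<lambda>n. family_dist (A \<times> B) (A \<times> B) (C n) I) \<longlonglongrightarrow> 0"
    using I unfolding locc_instruments_def by blast
  obtain T where T: "tp (A \<times> B) (A \<times> B) T" "map_has_sum (A \<times> B) I UNIV T"
    using inst by (auto simp: instrument_def)
  have finAB: "finite (A \<times> B)" using fin by simp
  have "kraus_cone (A \<times> B) (A \<times> B) product_kraus (I k)" for k
  proof (rule kraus_cone_limit[OF finAB finAB, where C = "\<lambda>n. C n k"])
    show "kraus_cone (A \<times> B) (A \<times> B) product_kraus (C n k)" if "n \<ge> 1" for n
      by (rule coarse_graining_kraus_cone[OF finAB finAB C[OF that] locc_round_kraus_cone[OF S[OF that] fin]])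
    show "linear_map (A \<times> B) (A \<times> B) (I k)"
      using inst by (auto simp: instrument_def cp_linear)
  qed (rule family_dist_tendsto[OF finAB finAB lim])
  then show ?thesis
    by (rule star_sep_contr[OF finAB T _ \<beta> sum])
qed

section \<open>Simultaneous singular value decomposition\<close>

text \<open>The assumptions on inner products say that \<open>A\<^sup>T B\<close> and
  \<open>A B\<^sup>T\<close> are symmetric. For \<open>T = A + \<i> B\<close> this is the reality of
  the two Gram matrices of \<open>T\<close>.\<close>

locale svd_pair =
  fixes A B :: "'a::euclidean_space \<Rightarrow> 'a"
  assumes linA: "linear A" and linB: "linear B"
    and comm1: "\<And>x y. A x \<bullet> B y = B x \<bullet> A y"
    and comm2: "\<And>x y. adjoint A x \<bullet> adjoint B y = adjoint B x \<bullet> adjoint A y"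
begin

text \<open>A pair of unit vectors \<open>l\<close>, \<open>r\<close> maximising \<open>(l \<bullet> A r)\<^sup>2 + (l \<bullet> B r)\<^sup>2\<close> is a common singular pair.
  After rotating \<open>(A, B)\<close> to \<open>(M, N)\<close> with \<open>l \<bullet> N r = 0\<close>, maximality makes it a singular pair of \<open>M\<close>, and
  comparing with the vectors \<open>l \<plusminus> N r\<close>, \<open>r \<plusminus> N\<^sup>T l\<close> forces \<open>N r = 0\<close> and \<open>N\<^sup>T l = 0\<close>.\<close>

lemma maximal_pair:
  assumes L: "subspace L" and R: "subspace R"
    and inv: "\<And>y. y \<in> R \<Longrightarrow> A y \<in> L \<and> B y \<in> L" "\<And>x. x \<in> L \<Longrightarrow> adjoint A x \<in> R \<and> adjoint B x \<in> R"
    and lr: "l \<in> L" "r \<in> R" "norm l = 1" "norm r = 1"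
    and max: "\<And>x y. x \<in> L \<Longrightarrow> y \<in> R \<Longrightarrow> norm x = 1 \<Longrightarrow> norm y = 1 \<Longrightarrow>
      (x \<bullet> A y)\<^sup>2 + (x \<bullet> B y)\<^sup>2 \<le> (l \<bullet> A r)\<^sup>2 + (l \<bullet> B r)\<^sup>2"
  shows "A r = (l \<bullet> A r) *\<^sub>R l" "B r = (l \<bullet> B r) *\<^sub>R l"
    "adjoint A l = (l \<bullet> A r) *\<^sub>R r" "adjoint B l = (l \<bullet> B r) *\<^sub>R r"
proof -
  define a where "a = l \<bullet> A r"
  define b where "b = l \<bullet> B r"
  define \<sigma> where "\<sigma> = sqrt (a\<^sup>2 + b\<^sup>2)"
  have \<sigma>2: "\<sigma>\<^sup>2 = a\<^sup>2 + b\<^sup>2" and \<sigma>0: "0 \<le> \<sigma>" by (simp_all add: \<sigma>_def)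
  have ll: "l \<bullet> l = 1" "r \<bullet> r = 1" using lr by (simp_all add: norm_eq_1)
  \<comment> \<open>Maximality in homogeneous form, so that the test vectors below need not be
    normalised.\<close>
  have hom: "(x \<bullet> A y)\<^sup>2 + (x \<bullet> B y)\<^sup>2 \<le> \<sigma>\<^sup>2 * (x \<bullet> x) * (y \<bullet> y)" if xy: "x \<in> L" "y \<in> R" for x y
  proof (cases "x = 0 \<or> y = 0")
    case True
    then show ?thesis by (auto simp: linear_0[OF linA] linear_0[OF linB])
  next
    case False
    define x' where "x' = (1 / norm x) *\<^sub>R x"
    define y' where "y' = (1 / norm y) *\<^sub>R y"
    have nx: "norm x \<noteq> 0" "norm y \<noteq> 0" using False by auto
    have xx: "x = norm x *\<^sub>R x'" "y = norm y *\<^sub>R y'" using False by (simp_all add: x'_def y'_def)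
    have "x' \<in> L" "y' \<in> R" "norm x' = 1" "norm y' = 1"
      using xy False L R by (auto simp: x'_def y'_def subspace_scale)
    from max[OF this] have "(x' \<bullet> A y')\<^sup>2 + (x' \<bullet> B y')\<^sup>2 \<le> \<sigma>\<^sup>2" by (simp add: \<sigma>2 a_def b_def)
    then have "((x' \<bullet> A y')\<^sup>2 + (x' \<bullet> B y')\<^sup>2) * ((norm x)\<^sup>2 * (norm y)\<^sup>2) \<le> \<sigma>\<^sup>2 * ((norm x)\<^sup>2 * (norm y)\<^sup>2)"
      by (intro mult_right_mono) auto
    moreover have "x \<bullet> A y = norm x * norm y * (x' \<bullet> A y')"
      by (subst xx(1), subst xx(2)) (simp add: linear_scale[OF linA])
    moreover have "x \<bullet> B y = norm x * norm y * (x' \<bullet> B y')"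
      by (subst xx(1), subst xx(2)) (simp add: linear_scale[OF linB])
    ultimately show ?thesis
      by (simp add: power_mult_distrib power2_norm_eq_inner[symmetric] algebra_simps)
  qed
  have adjA: "x \<bullet> A y = adjoint A x \<bullet> y" and adjB: "x \<bullet> B y = adjoint B x \<bullet> y" for x y
    using adjoint_works[OF linA, of y x] adjoint_works[OF linB, of y x] by (simp_all add: inner_commute)
  have "A r = a *\<^sub>R l \<and> B r = b *\<^sub>R l \<and> adjoint A l = a *\<^sub>R r \<and> adjoint B l = b *\<^sub>R r"
  proof (cases "\<sigma> = 0")
    case True
    then have ab: "a = 0" "b = 0" using \<sigma>2 by auto
    have z: "x \<bullet> A y = 0 \<and> x \<bullet> B y = 0" if "x \<in> L" "y \<in> R" for x y
      using hom[OF that] True by (simp add: sum_power2_le_zero_iff)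
    have "A r \<bullet> A r = 0" "B r \<bullet> B r = 0" using z inv(1)[OF lr(2)] lr by blast+
    moreover have "adjoint A l \<bullet> adjoint A l = 0" "adjoint B l \<bullet> adjoint B l = 0"
      using z[OF lr(1)] inv(2)[OF lr(1)] by (simp_all flip: adjA adjB)
    ultimately show ?thesis using ab by simp
  next
    case False
    then have pos: "0 < \<sigma>" using \<sigma>0 by simp
    define c where "c = a / \<sigma>"
    define s where "s = b / \<sigma>"
    have "c * c + s * s = (a\<^sup>2 + b\<^sup>2) / \<sigma>\<^sup>2"
      by (simp add: c_def s_def power2_eq_square add_divide_distrib)
    then have cs: "c * c + s * s = 1" "c * \<sigma> = a" "s * \<sigma> = b"
      using False by (simp_all add: \<sigma>2[symmetric] c_def s_def)
    define M where "M = (\<lambda>x. c *\<^sub>R A x + s *\<^sub>R B x)"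
    define N where "N = (\<lambda>x. c *\<^sub>R B x - s *\<^sub>R A x)"
    define M' where "M' = (\<lambda>x. c *\<^sub>R adjoint A x + s *\<^sub>R adjoint B x)"
    define N' where "N' = (\<lambda>x. c *\<^sub>R adjoint B x - s *\<^sub>R adjoint A x)"
    have linM: "linear M" and linN: "linear N"
      unfolding M_def N_def by (intro linear_compose_add linear_compose_sub linear_compose_scale_right linA linB)+
    have adjM: "x \<bullet> M y = M' x \<bullet> y" and adjN: "x \<bullet> N y = N' x \<bullet> y" for x y
      by (simp_all add: M_def N_def M'_def N'_def algebra_simps adjA adjB)
    have MN: "M x \<bullet> N y = N x \<bullet> M y" for x y
      using comm1[of x y] by (simp add: M_def N_def algebra_simps)
    have MN': "M' x \<bullet> N' y = N' x \<bullet> M' y" for x y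
      using comm2[of x y] by (simp add: M'_def N'_def algebra_simps)
    have sq: "(x \<bullet> M y)\<^sup>2 + (x \<bullet> N y)\<^sup>2 = (x \<bullet> A y)\<^sup>2 + (x \<bullet> B y)\<^sup>2" for x y
    proof -
      have "(x \<bullet> M y)\<^sup>2 + (x \<bullet> N y)\<^sup>2 = (c * c + s * s) * ((x \<bullet> A y)\<^sup>2 + (x \<bullet> B y)\<^sup>2)"
        by (simp add: M_def N_def algebra_simps power2_eq_square)
      then show ?thesis by (simp add: cs)
    qed
    have homM: "(x \<bullet> M y)\<^sup>2 + (x \<bullet> N y)\<^sup>2 \<le> \<sigma>\<^sup>2 * (x \<bullet> x) * (y \<bullet> y)" if "x \<in> L" "y \<in> R" for x y
      unfolding sq by (rule hom[OF that])
    have lMr: "l \<bullet> M r = \<sigma>" and lNr: "l \<bullet> N r = 0"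
    proof -
      have "l \<bullet> M r = c * a + s * b" by (simp add: M_def a_def b_def algebra_simps)
      also have "\<dots> = (c * c + s * s) * \<sigma>" unfolding cs(2,3)[symmetric] by (simp add: algebra_simps)
      finally show "l \<bullet> M r = \<sigma>" by (simp add: cs)
      have "l \<bullet> N r = c * b - s * a" by (simp add: N_def a_def b_def algebra_simps)
      then show "l \<bullet> N r = 0" unfolding cs(2,3)[symmetric] by simp
    qed
    have invM: "M r \<in> L" "N r \<in> L" "M' l \<in> R" "N' l \<in> R"
      unfolding M_def N_def M'_def N'_def using inv(1)[OF lr(2)] inv(2)[OF lr(1)] L R
      by (auto intro!: subspace_add subspace_diff subspace_scale)
    \<comment> \<open>The equality case of Cauchy-Schwarz: \<open>v\<close> has norm at most
      \<open>\<sigma>\<close> and component \<open>\<sigma>\<close> along the unit vector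
      \<open>w\<close>.\<close>
    have small: "v = \<sigma> *\<^sub>R w" if "w \<bullet> w = 1" "v \<bullet> w = \<sigma>" "(v \<bullet> v)\<^sup>2 \<le> \<sigma>\<^sup>2 * (v \<bullet> v)" for v w :: 'a
    proof -
      have "v \<bullet> v \<le> \<sigma>\<^sup>2"
        using that(3) by (cases "v \<bullet> v = 0") (auto simp: power2_eq_square mult_le_cancel_right)
      then have "(v - \<sigma> *\<^sub>R w) \<bullet> (v - \<sigma> *\<^sub>R w) \<le> 0"
        using that(1,2) by (simp add: inner_diff_left inner_diff_right inner_commute[of w v] power2_eq_square)
      then show ?thesis by (metis eq_iff_diff_eq_0 inner_eq_zero_iff inner_ge_zero order_antisym)
    qed
    have Mr: "M r = \<sigma> *\<^sub>R l"
    proof (rule small)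
      have "(M r \<bullet> M r)\<^sup>2 + (M r \<bullet> N r)\<^sup>2 \<le> \<sigma>\<^sup>2 * (M r \<bullet> M r)"
        using homM[OF invM(1) lr(2)] ll by simp
      then show "(M r \<bullet> M r)\<^sup>2 \<le> \<sigma>\<^sup>2 * (M r \<bullet> M r)"
        by (smt (verit) zero_le_power2)
    qed (use ll lMr in \<open>auto simp: inner_commute\<close>)
    have M'l: "M' l = \<sigma> *\<^sub>R r"
    proof (rule small)
      have "(M' l \<bullet> M' l)\<^sup>2 + (l \<bullet> N (M' l))\<^sup>2 \<le> \<sigma>\<^sup>2 * (M' l \<bullet> M' l)"
        using homM[OF lr(1) invM(3)] ll by (simp add: adjM)
      then show "(M' l \<bullet> M' l)\<^sup>2 \<le> \<sigma>\<^sup>2 * (M' l \<bullet> M' l)"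
        by (smt (verit) zero_le_power2)
    qed (use ll lMr in \<open>auto simp: adjM\<close>)
    define w where "w = N r"
    define z where "z = N' l"
    \<comment> \<open>The symmetry relations make \<open>w\<close> and \<open>z\<close> a singular
      pair of \<open>M\<close> for the same value \<open>\<sigma>\<close>, up to normalisation. This
      is why adding them to \<open>l\<close> and \<open>r\<close> keeps the \<open>M\<close> term
      maximal.\<close>
    have Mz: "M z = \<sigma> *\<^sub>R w"
    proof (rule vector_eq_rdot[THEN iffD1], intro allI)
      fix y
      have "M z \<bullet> y = z \<bullet> M' y" using adjM[of y z] by (simp add: inner_commute)
      also have "\<dots> = M' l \<bullet> N' y" unfolding z_def using MN'[of l y] by simp
      also have "\<dots> = \<sigma> * (w \<bullet> y)" using adjN[of y r] by (simp add: M'l w_def inner_commute)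
      finally show "M z \<bullet> y = (\<sigma> *\<^sub>R w) \<bullet> y" by simp
    qed
    have M'w: "M' w = \<sigma> *\<^sub>R z"
    proof (rule vector_eq_rdot[THEN iffD1], intro allI)
      fix y
      have "M' w \<bullet> y = N r \<bullet> M y" by (simp add: w_def adjM)
      also have "\<dots> = M r \<bullet> N y" by (simp add: MN)
      also have "\<dots> = \<sigma> * (z \<bullet> y)" using adjN[of l y] by (simp add: Mr z_def)
      finally show "M' w \<bullet> y = (\<sigma> *\<^sub>R z) \<bullet> y" by simp
    qed
    have wz: "w \<bullet> w = z \<bullet> z"
    proof -
      have "\<sigma> * (w \<bullet> w) = w \<bullet> M z" by (simp add: Mz)
      also have "\<dots> = \<sigma> * (z \<bullet> z)" by (simp add: adjM M'w)
      finally show ?thesis using pos by simp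
    qed
    have wl: "w \<bullet> l = 0" "l \<bullet> w = 0" using lNr by (simp_all add: w_def inner_commute)
    have zr: "z \<bullet> r = 0" "r \<bullet> z = 0" using lNr adjN[of l r] by (simp_all add: z_def inner_commute)
    \<comment> \<open>At \<open>l + t w\<close> and \<open>r + t z\<close> the \<open>M\<close> term
      alone attains the bound, so the \<open>N\<close> term vanishes for every \<open>t\<close>.
      Opposite values of \<open>t\<close> then isolate the part linear in \<open>t\<close>.\<close>
    have zero: "2 * t * (w \<bullet> w) + t\<^sup>2 * (w \<bullet> N z) = 0" for t
    proof -
      have x: "l + t *\<^sub>R w \<in> L" and y: "r + t *\<^sub>R z \<in> R"
        using invM lr L R by (auto simp: w_def z_def intro!: subspace_add subspace_scale)
      have 1: "(l + t *\<^sub>R w) \<bullet> (l + t *\<^sub>R w) = 1 + t\<^sup>2 * (w \<bullet> w)"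
        by (simp add: inner_add_left inner_add_right ll wl power2_eq_square)
      have 2: "(r + t *\<^sub>R z) \<bullet> (r + t *\<^sub>R z) = 1 + t\<^sup>2 * (w \<bullet> w)"
        by (simp add: inner_add_left inner_add_right ll zr power2_eq_square wz)
      have 3: "(l + t *\<^sub>R w) \<bullet> M (r + t *\<^sub>R z) = \<sigma> * (1 + t\<^sup>2 * (w \<bullet> w))"
        by (simp add: linear_add[OF linM] linear_scale[OF linM] inner_add_left inner_add_right
            Mr Mz ll wl power2_eq_square algebra_simps)
      have "l \<bullet> N z = z \<bullet> z" by (simp add: adjN z_def)
      then have 4: "(l + t *\<^sub>R w) \<bullet> N (r + t *\<^sub>R z) = 2 * t * (w \<bullet> w) + t\<^sup>2 * (w \<bullet> N z)"
        by (simp add: linear_add[OF linN] linear_scale[OF linN] inner_add_left inner_add_right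
            lNr w_def[symmetric] wl wz[symmetric] power2_eq_square algebra_simps)
      have "(\<sigma> * (1 + t\<^sup>2 * (w \<bullet> w)))\<^sup>2 + (2 * t * (w \<bullet> w) + t\<^sup>2 * (w \<bullet> N z))\<^sup>2
          \<le> \<sigma>\<^sup>2 * (1 + t\<^sup>2 * (w \<bullet> w)) * (1 + t\<^sup>2 * (w \<bullet> w))"
        using homM[OF x y] unfolding 1 2 3 4 .
      also have "\<dots> = (\<sigma> * (1 + t\<^sup>2 * (w \<bullet> w)))\<^sup>2"
        by (simp add: power2_eq_square)
      finally show ?thesis by simp
    qed
    have "w \<bullet> w = 0" using zero[of 1] zero[of "-1"] by simp
    then have w0: "w = 0" and z0: "z = 0" using wz by auto
    have A: "A x = c *\<^sub>R M x - s *\<^sub>R N x" and B: "B x = s *\<^sub>R M x + c *\<^sub>R N x" for x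
    proof -
      have "c *\<^sub>R M x - s *\<^sub>R N x = (c * c + s * s) *\<^sub>R A x" by (simp add: M_def N_def algebra_simps)
      then show "A x = c *\<^sub>R M x - s *\<^sub>R N x" by (simp add: cs)
      have "s *\<^sub>R M x + c *\<^sub>R N x = (c * c + s * s) *\<^sub>R B x" by (simp add: M_def N_def algebra_simps)
      then show "B x = s *\<^sub>R M x + c *\<^sub>R N x" by (simp add: cs)
    qed
    have A': "adjoint A x = c *\<^sub>R M' x - s *\<^sub>R N' x" and B': "adjoint B x = s *\<^sub>R M' x + c *\<^sub>R N' x" for x
    proof -
      have "c *\<^sub>R M' x - s *\<^sub>R N' x = (c * c + s * s) *\<^sub>R adjoint A x" by (simp add: M'_def N'_def algebra_simps)
      then show "adjoint A x = c *\<^sub>R M' x - s *\<^sub>R N' x" by (simp add: cs)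
      have "s *\<^sub>R M' x + c *\<^sub>R N' x = (c * c + s * s) *\<^sub>R adjoint B x" by (simp add: M'_def N'_def algebra_simps)
      then show "adjoint B x = s *\<^sub>R M' x + c *\<^sub>R N' x" by (simp add: cs)
    qed
    show ?thesis
      using w0 z0 cs by (simp add: A B A' B' Mr M'l w_def z_def)
  qed
  then show "A r = (l \<bullet> A r) *\<^sub>R l" "B r = (l \<bullet> B r) *\<^sub>R l"
    "adjoint A l = (l \<bullet> A r) *\<^sub>R r" "adjoint B l = (l \<bullet> B r) *\<^sub>R r"
    unfolding a_def b_def by auto
qed

text \<open>The equations for \<open>A\<close>, \<open>B\<close> and those for their adjoints
  together make the orthogonal complements of the \<open>l i\<close> and of the \<open>r i\<close>
  invariant, so that the next pair can be sought there.\<close>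

definition singular_system :: "nat \<Rightarrow> (nat \<Rightarrow> 'a) \<Rightarrow> (nat \<Rightarrow> 'a) \<Rightarrow> (nat \<Rightarrow> real) \<Rightarrow> (nat \<Rightarrow> real) \<Rightarrow> bool" where
  "singular_system k l r d e \<longleftrightarrow>
     (\<forall>i<k. \<forall>j<k. l i \<bullet> l j = (if i = j then 1 else 0) \<and> r i \<bullet> r j = (if i = j then 1 else 0)) \<and>
     (\<forall>i<k. A (r i) = d i *\<^sub>R l i \<and> B (r i) = e i *\<^sub>R l i \<and>
        adjoint A (l i) = d i *\<^sub>R r i \<and> adjoint B (l i) = e i *\<^sub>R r i)"

lemma exists_unit_orthogonal:
  assumes "k < DIM('a)"
  obtains x :: 'a where "norm x = 1" "\<And>i. i < k \<Longrightarrow> x \<bullet> l i = 0"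
proof -
  have "dim (l ` {..<k}) \<le> card (l ` {..<k})" by (rule dim_le_card') simp
  also have "\<dots> \<le> k" using card_image_le[of "{..<k}" l] by simp
  finally have "dim (l ` {..<k}) < DIM('a)" using assms by simp
  then obtain x where x: "x \<noteq> 0" "\<And>y. y \<in> span (l ` {..<k}) \<Longrightarrow> orthogonal x y"
    by (rule orthogonal_to_subspace_exists) blast
  have "x \<bullet> l i = 0" if "i < k" for i
    using x(2)[of "l i"] that by (auto simp: orthogonal_def span_base)
  then show thesis
    using x(1) by (intro that[of "(1 / norm x) *\<^sub>R x"]) auto
qed

text \<open>Compactness provides a maximising pair of unit vectors in the orthogonal complements of
  those already found, and maximality makes it singular.\<close>

lemma singular_system_exists: "k \<le> DIM('a) \<Longrightarrow> \<exists>l r d e. singular_system k l r d e"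
proof (induction k)
  case 0
  then show ?case by (simp add: singular_system_def)
next
  case (Suc k)
  then obtain l r d e where sys: "singular_system k l r d e" by auto
  define L where "L = {x. \<forall>i<k. x \<bullet> l i = 0}"
  define R where "R = {x. \<forall>i<k. x \<bullet> r i = 0}"
  have subL: "subspace L" and subR: "subspace R"
    by (auto simp: L_def R_def subspace_def inner_add_left)
  have clL: "closed L" and clR: "closed R"
    using subL subR by (simp_all add: closed_subspace)
  define S where "S = {p. fst p \<in> L \<and> snd p \<in> R \<and> norm (fst p) = 1 \<and> norm (snd p) = 1}"
  have S_eq: "S = (L \<inter> sphere 0 1) \<times> (R \<inter> sphere 0 1)"
    by (auto simp: S_def)
  have "compact S"
    unfolding S_eq by (intro compact_Times closed_Int_compact clL clR compact_sphere)
  moreover have "S \<noteq> {}"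
  proof -
    obtain x where "norm x = 1" "\<And>i. i < k \<Longrightarrow> x \<bullet> l i = 0"
      by (rule exists_unit_orthogonal[of k l]) (use Suc.prems in auto)
    moreover obtain y where "norm y = 1" "\<And>i. i < k \<Longrightarrow> y \<bullet> r i = 0"
      by (rule exists_unit_orthogonal[of k r]) (use Suc.prems in auto)
    ultimately have "(x, y) \<in> S" by (simp add: S_def L_def R_def)
    then show ?thesis by blast
  qed
  moreover have "continuous_on S (\<lambda>p. (fst p \<bullet> A (snd p))\<^sup>2 + (fst p \<bullet> B (snd p))\<^sup>2)"
    by (intro continuous_on_add continuous_on_power continuous_on_inner continuous_on_fst continuous_on_id
        bounded_linear.continuous_on[OF linear_conv_bounded_linear[THEN iffD1, OF linA]]
        bounded_linear.continuous_on[OF linear_conv_bounded_linear[THEN iffD1, OF linB]]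
        continuous_on_snd)
  ultimately obtain p where p: "p \<in> S"
    and max: "\<And>q. q \<in> S \<Longrightarrow> (fst q \<bullet> A (snd q))\<^sup>2 + (fst q \<bullet> B (snd q))\<^sup>2
      \<le> (fst p \<bullet> A (snd p))\<^sup>2 + (fst p \<bullet> B (snd p))\<^sup>2"
    using continuous_attains_sup[of S] by blast
  define x where "x = fst p"
  define y where "y = snd p"
  have xy: "x \<in> L" "y \<in> R" "norm x = 1" "norm y = 1"
    using p by (simp_all add: S_def x_def y_def)
  have adj: "A y \<bullet> x = y \<bullet> adjoint A x" "B y \<bullet> x = y \<bullet> adjoint B x" for x y
    using adjoint_works[OF linA] adjoint_works[OF linB] by simp_all
  have sysD: "A (r i) = d i *\<^sub>R l i" "B (r i) = e i *\<^sub>R l i"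
    "adjoint A (l i) = d i *\<^sub>R r i" "adjoint B (l i) = e i *\<^sub>R r i" if "i < k" for i
    using sys that by (auto simp: singular_system_def)
  have inv1: "A y \<in> L \<and> B y \<in> L" if "y \<in> R" for y
    using that by (simp add: L_def R_def adj sysD)
  have inv2: "adjoint A x \<in> R \<and> adjoint B x \<in> R" if "x \<in> L" for x
  proof -
    have "adjoint A x \<bullet> r i = x \<bullet> A (r i)" "adjoint B x \<bullet> r i = x \<bullet> B (r i)" for i
      using adj[of "r i" x] by (simp_all add: inner_commute)
    then show ?thesis
      using that by (simp add: L_def R_def sysD)
  qed
  have max': "(x' \<bullet> A y')\<^sup>2 + (x' \<bullet> B y')\<^sup>2 \<le> (x \<bullet> A y)\<^sup>2 + (x \<bullet> B y)\<^sup>2"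
    if "x' \<in> L" "y' \<in> R" "norm x' = 1" "norm y' = 1" for x' y'
    using max[of "(x', y')"] that by (simp add: S_def x_def y_def)
  define dk where "dk = x \<bullet> A y"
  define ek where "ek = x \<bullet> B y"
  have pair: "A y = dk *\<^sub>R x" "B y = ek *\<^sub>R x" "adjoint A x = dk *\<^sub>R y" "adjoint B x = ek *\<^sub>R y"
    unfolding dk_def ek_def by (rule maximal_pair[OF subL subR inv1 inv2 xy max']; assumption)+
  have orth: "x \<bullet> l i = 0" "l i \<bullet> x = 0" "y \<bullet> r i = 0" "r i \<bullet> y = 0" if "i < k" for i
    using xy(1,2) that by (auto simp: L_def R_def inner_commute)
  have "x \<bullet> x = 1" "y \<bullet> y = 1" using xy by (simp_all add: norm_eq_1)
  then have "singular_system (Suc k) (l(k := x)) (r(k := y)) (d(k := dk)) (e(k := ek))"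
    using sys orth pair unfolding singular_system_def by (auto simp: less_Suc_eq)
  then show ?case by blast
qed

lemma orthonormal_expand:
  fixes r :: "nat \<Rightarrow> 'a"
  assumes "\<And>i j. i < DIM('a) \<Longrightarrow> j < DIM('a) \<Longrightarrow> r i \<bullet> r j = (if i = j then 1 else 0)"
  shows "x = (\<Sum>k<DIM('a). (x \<bullet> r k) *\<^sub>R r k)"
proof -
  let ?B = "r ` {..<DIM('a)}"
  have inj: "inj_on r {..<DIM('a)}"
    by (rule inj_onI) (metis assms lessThan_iff zero_neq_one)
  have orth: "pairwise orthogonal ?B"
    using assms by (auto simp: pairwise_def orthogonal_def)
  have norm: "norm b = 1" if "b \<in> ?B" for b
    using assms that by (auto simp: norm_eq_1)
  have "independent ?B"
    using orth norm by (intro pairwise_orthogonal_independent) (metis norm_zero zero_neq_one)+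
  then have "span ?B = UNIV"
    using card_eq_dim[of ?B UNIV] card_image[OF inj] by auto
  then have "(\<Sum>b\<in>?B. (x \<bullet> b) *\<^sub>R b) = x"
    using orth norm by (intro orthonormal_basis_expand) auto
  then show ?thesis
    by (simp add: sum.reindex[OF inj] o_def)
qed

theorem simultaneous_svd:
  obtains l r :: "nat \<Rightarrow> 'a" and d e where
    "\<And>i j. i < DIM('a) \<Longrightarrow> j < DIM('a) \<Longrightarrow> l i \<bullet> l j = (if i = j then 1 else 0)"
    "\<And>i j. i < DIM('a) \<Longrightarrow> j < DIM('a) \<Longrightarrow> r i \<bullet> r j = (if i = j then 1 else 0)"
    "\<And>x. A x = (\<Sum>k<DIM('a). (d k * (x \<bullet> r k)) *\<^sub>R l k)"
    "\<And>x. B x = (\<Sum>k<DIM('a). (e k * (x \<bullet> r k)) *\<^sub>R l k)"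
proof -
  obtain l r d e where sys: "singular_system (DIM('a)) l r d e"
    using singular_system_exists by blast
  have r: "r i \<bullet> r j = (if i = j then 1 else 0)" if "i < DIM('a)" "j < DIM('a)" for i j
    using sys that by (simp add: singular_system_def)
  have l: "l i \<bullet> l j = (if i = j then 1 else 0)" if "i < DIM('a)" "j < DIM('a)" for i j
    using sys that by (simp add: singular_system_def)
  have expand: "f x = (\<Sum>k<DIM('a). (c k * (x \<bullet> r k)) *\<^sub>R l k)"
    if f: "linear f" and c: "\<And>k. k < DIM('a) \<Longrightarrow> f (r k) = c k *\<^sub>R l k" for f c x
  proof -
    have "f x = f (\<Sum>k<DIM('a). (x \<bullet> r k) *\<^sub>R r k)"
      using orthonormal_expand[OF r, of x] by simp
    also have "\<dots> = (\<Sum>k<DIM('a). (c k * (x \<bullet> r k)) *\<^sub>R l k)"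
      unfolding linear_sum[OF f] by (intro sum.cong refl) (simp add: linear_scale[OF f] c mult.commute)
    finally show ?thesis .
  qed
  show thesis
    by (rule that[OF l r expand[OF linA] expand[OF linB]]) (use sys in \<open>auto simp: singular_system_def\<close>)
qed

end

section \<open>Operator Schmidt decomposition of two-qubit unitaries\<close>

definition isometric :: "'a set \<Rightarrow> 'b set \<Rightarrow> ('b \<Rightarrow> 'a \<Rightarrow> complex) \<Rightarrow> bool" where
  "isometric X Y K \<longleftrightarrow>
     (\<forall>i\<in>X. \<forall>j\<in>X. (\<Sum>k\<in>Y. cnj (K k i) * K k j) = (if i = j then 1 else 0))"

lemma isometric_scale:
  assumes "cnj c * c = 1" "isometric X Y K"
  shows "isometric X Y (\<lambda>x y. c * K x y)"
proof -
  have "(\<Sum>k\<in>Y. cnj (c * K k i) * (c * K k j)) = cnj c * c * (\<Sum>k\<in>Y. cnj (K k i) * K k j)" for i j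
    by (simp add: sum_distrib_left mult_ac)
  then show ?thesis
    using assms by (simp add: isometric_def)
qed

text \<open>The matrices \<open>1\<close>, \<open>\<i>X\<close>, \<open>\<i>Y\<close>, \<open>\<i>Z\<close>, with \<open>X\<close>, \<open>Y\<close>, \<open>Z\<close> the Pauli matrices. Their real span is the
  algebra of quaternions, so real unit vectors of coefficients give unitary matrices.\<close>

definition quat_basis :: "bool \<times> bool \<Rightarrow> bool \<Rightarrow> bool \<Rightarrow> complex" where
  "quat_basis a x y =
     (if a = (False, False) then (if x = y then 1 else 0)
      else if a = (True, False) then (if x \<noteq> y then \<i> else 0)
      else if a = (False, True) then (if x = y then 0 else if y then 1 else -1)
      else (if x \<noteq> y then 0 else if x then -\<i> else \<i>))"

text \<open>The basis matrices are orthogonal with squared Hilbert-Schmidt norm 2, hence the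
  division.\<close>

definition quat_coeff :: "(bool \<Rightarrow> bool \<Rightarrow> complex) \<Rightarrow> bool \<times> bool \<Rightarrow> complex" where
  "quat_coeff f a = (\<Sum>x\<in>UNIV. \<Sum>y\<in>UNIV. cnj (quat_basis a x y) * f x y) / 2"

definition quat_mat :: "real ^ (bool \<times> bool) \<Rightarrow> bool \<Rightarrow> bool \<Rightarrow> complex" where
  "quat_mat v x y = (\<Sum>a\<in>UNIV. complex_of_real (v $ a) * quat_basis a x y)"

lemma UNIV_bool_prod: "(UNIV :: (bool \<times> bool) set) = {(False, False), (True, False), (False, True), (True, True)}"
  by auto

lemma sum_bool_prod: "(\<Sum>a\<in>(UNIV :: (bool \<times> bool) set). f a)
    = f (False, False) + f (True, False) + f (False, True) + f (True, True)"
  by (simp add: UNIV_bool_prod add.assoc)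

lemma sum_bool: "(\<Sum>a\<in>(UNIV :: bool set). f a) = f False + f True"
  by (simp add: UNIV_bool)

lemma quat_expand: "f x y = (\<Sum>a\<in>UNIV. quat_coeff f a * quat_basis a x y)"
  by (cases x; cases y)
    (simp_all add: sum_bool_prod sum_bool quat_coeff_def quat_basis_def field_simps)

lemma quat_parseval:
  "(\<Sum>a\<in>UNIV. quat_coeff f a * cnj (quat_coeff g a)) = (\<Sum>x\<in>UNIV. \<Sum>y\<in>UNIV. f x y * cnj (g x y)) / 2"
  by (simp add: sum_bool_prod sum_bool quat_coeff_def quat_basis_def field_simps)

lemma quat_mat_inner:
  "(\<Sum>x\<in>UNIV. \<Sum>y\<in>UNIV. cnj (quat_mat v x y) * quat_mat w x y) = complex_of_real (2 * (v \<bullet> w))"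
  by (simp add: sum_bool_prod sum_bool quat_mat_def quat_basis_def inner_vec_def complex_eq_iff algebra_simps)

lemma quat_mat_isometric:
  assumes "v \<bullet> v = 1"
  shows "isometric UNIV UNIV (quat_mat v)"
proof -
  have "(v $ (False, False))\<^sup>2 + (v $ (True, False))\<^sup>2 + (v $ (False, True))\<^sup>2 + (v $ (True, True))\<^sup>2 = 1"
    using assms by (simp add: inner_vec_def sum_bool_prod power2_eq_square)
  then have "(\<Sum>k\<in>UNIV. cnj (quat_mat v k i) * quat_mat v k j) = (if i = j then 1 else 0)" for i j
    by (cases i; cases j)
      (simp_all add: sum_bool_prod sum_bool quat_mat_def quat_basis_def complex_eq_iff algebra_simps power2_eq_square)
  then show ?thesis
    by (simp add: isometric_def)
qed

definition quat_coeff2 :: "(bool \<times> bool \<Rightarrow> bool \<times> bool \<Rightarrow> complex) \<Rightarrow> bool \<times> bool \<Rightarrow> bool \<times> bool \<Rightarrow> complex" where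
  "quat_coeff2 W a b = quat_coeff (\<lambda>y y'. quat_coeff (\<lambda>x x'. W (x, y) (x', y')) a) b"

lemma quat_expand2:
  "W (x, y) (x', y') = (\<Sum>a\<in>UNIV. \<Sum>b\<in>UNIV. quat_coeff2 W a b * quat_basis a x x' * quat_basis b y y')"
proof -
  have "W (x, y) (x', y') = (\<Sum>a\<in>UNIV. quat_coeff (\<lambda>x x'. W (x, y) (x', y')) a * quat_basis a x x')"
    by (rule quat_expand)
  also have "\<dots> = (\<Sum>a\<in>UNIV. (\<Sum>b\<in>UNIV. quat_coeff2 W a b * quat_basis b y y') * quat_basis a x x')"
    unfolding quat_coeff2_def quat_expand[of "\<lambda>y y'. quat_coeff (\<lambda>x x'. W (x, y) (x', y')) _" y y', symmetric] ..
  finally show ?thesis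
    by (simp add: sum_distrib_left sum_distrib_right mult_ac)
qed

lemma quat_coeff_swap:
  "quat_coeff (\<lambda>y y'. quat_coeff (\<lambda>x x'. f x x' y y') a) b = quat_coeff (\<lambda>x x'. quat_coeff (\<lambda>y y'. f x x' y y') b) a"
  by (simp add: quat_coeff_def sum_bool field_simps)

lemma coeff_product:
  "quat_coeff f a * cnj (quat_coeff g c) = (\<Sum>x\<in>UNIV. \<Sum>x'\<in>UNIV. \<Sum>z\<in>UNIV. \<Sum>z'\<in>UNIV.
      cnj (quat_basis a x x') * quat_basis c z z' * (f x x' * cnj (g z z'))) / 4"
  by (simp add: quat_coeff_def sum_bool field_simps)

text \<open>For the reduced operator \<open>T T\<^sup>*\<close> of the coefficient matrix \<open>T\<close>, row unitarity kills the imaginary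
  part of one chirality and column unitarity that of the other.\<close>

lemma quat_coeff2_gram_symmetric:
  assumes W: "unitary UNIV UNIV W"
  shows "(\<Sum>b\<in>UNIV. quat_coeff2 W a b * cnj (quat_coeff2 W c b)) = (\<Sum>b\<in>UNIV. quat_coeff2 W c b * cnj (quat_coeff2 W a b))"
proof -
  \<comment> \<open>Up to normalisation, the Choi state of \<open>W\<close> reduced to the first
    qubit, with output labels \<open>x\<close>, \<open>z\<close> and input labels \<open>x'\<close>,
    \<open>z'\<close>.\<close>
  define \<Omega> where "\<Omega> = (\<lambda>x x' z z'. \<Sum>y\<in>UNIV. \<Sum>y'\<in>UNIV. W (x, y) (x', y') * cnj (W (z, y) (z', y')))"
  have gram: "(\<Sum>b\<in>UNIV. quat_coeff2 W a b * cnj (quat_coeff2 W c b))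
      = (\<Sum>x\<in>UNIV. \<Sum>x'\<in>UNIV. \<Sum>z\<in>UNIV. \<Sum>z'\<in>UNIV. cnj (quat_basis a x x') * quat_basis c z z' * \<Omega> x x' z z') / 8" for a c
  proof -
    have "(\<Sum>b\<in>UNIV. quat_coeff2 W a b * cnj (quat_coeff2 W c b))
      = (\<Sum>y\<in>UNIV. \<Sum>y'\<in>UNIV. quat_coeff (\<lambda>x x'. W (x, y) (x', y')) a * cnj (quat_coeff (\<lambda>x x'. W (x, y) (x', y')) c)) / 2"
      unfolding quat_coeff2_def by (rule quat_parseval)
    also have "\<dots> = (\<Sum>y\<in>UNIV. \<Sum>y'\<in>UNIV. \<Sum>x\<in>UNIV. \<Sum>x'\<in>UNIV. \<Sum>z\<in>UNIV. \<Sum>z'\<in>UNIV.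
        cnj (quat_basis a x x') * quat_basis c z z' * (W (x, y) (x', y') * cnj (W (z, y) (z', y')))) / 8"
      unfolding coeff_product by (simp add: sum_divide_distrib)
    also have "\<dots> = (\<Sum>x\<in>UNIV. \<Sum>x'\<in>UNIV. \<Sum>y\<in>UNIV. \<Sum>y'\<in>UNIV. \<Sum>z\<in>UNIV. \<Sum>z'\<in>UNIV.
        cnj (quat_basis a x x') * quat_basis c z z' * (W (x, y) (x', y') * cnj (W (z, y) (z', y')))) / 8"
      by (subst sum_swap_pairs) (rule refl)
    also have "\<dots> = (\<Sum>x\<in>UNIV. \<Sum>x'\<in>UNIV. \<Sum>z\<in>UNIV. \<Sum>z'\<in>UNIV. \<Sum>y\<in>UNIV. \<Sum>y'\<in>UNIV.
        cnj (quat_basis a x x') * quat_basis c z z' * (W (x, y) (x', y') * cnj (W (z, y) (z', y')))) / 8"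
      by (rule arg_cong[where f = "\<lambda>s. s / 8"], rule sum.cong[OF refl], rule sum.cong[OF refl])
        (rule sum_swap_pairs)
    finally show ?thesis
      by (simp add: \<Omega>_def sum_distrib_left)
  qed
  \<comment> \<open>By this and \<open>cols\<close> both marginals of \<open>\<Omega>\<close> are
    multiples of the identity, so its Pauli expansion contains only the identity and products of two
    Pauli matrices. In the quaternion basis, which is the magic basis, these are real symmetric; the
    excluded one-sided Pauli matrices are imaginary antisymmetric.\<close>
  have rows: "(\<Sum>x'\<in>UNIV. \<Omega> x x' z x') = (if x = z then 2 else 0)" for x z
  proof -
    have "(\<Sum>x'\<in>UNIV. \<Omega> x x' z x') = (\<Sum>y\<in>UNIV. \<Sum>k\<in>UNIV. W (x, y) k * cnj (W (z, y) k))"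
      by (simp add: \<Omega>_def sum_bool sum_bool_prod algebra_simps)
    also have "\<dots> = (\<Sum>y\<in>(UNIV::bool set). if (x, y) = (z, y) then 1 else 0)"
      using W unfolding unitary_def by (intro sum.cong refl) blast
    finally show ?thesis by (simp add: sum_bool)
  qed
  have cols: "(\<Sum>x\<in>UNIV. \<Omega> x x' x z') = (if x' = z' then 2 else 0)" for x' z'
  proof -
    have "(\<Sum>x\<in>UNIV. \<Omega> x x' x z') = (\<Sum>y'\<in>UNIV. \<Sum>k\<in>UNIV. cnj (W k (z', y')) * W k (x', y'))"
      by (simp add: \<Omega>_def sum_bool sum_bool_prod algebra_simps)
    also have "\<dots> = (\<Sum>y\<in>(UNIV::bool set). if (z', y) = (x', y) then 1 else 0)"
      using W unfolding unitary_def by (intro sum.cong refl) blast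
    finally show ?thesis by (auto simp: sum_bool)
  qed
  note r = rows[of False False] rows[of False True] rows[of True False] rows[of True True]
    cols[of False False] cols[of False True] cols[of True False] cols[of True True]
  obtain a1 a2 c1 c2 where ac: "a = (a1, a2)" "c = (c1, c2)" by (metis surj_pair)
  show ?thesis
    using r unfolding gram ac
    by (cases a1; cases a2; cases c1; cases c2)
      (auto simp: sum_bool quat_basis_def complex_eq_iff)
qed

theorem two_qubit_decomposition:
  assumes W: "unitary UNIV UNIV W"
  obtains u :: "nat \<Rightarrow> real" and L R :: "nat \<Rightarrow> bool \<Rightarrow> bool \<Rightarrow> complex" where
    "\<And>k. 0 \<le> u k"
    "\<And>k. k < 4 \<Longrightarrow> isometric UNIV UNIV (L k)" "\<And>k. k < 4 \<Longrightarrow> isometric UNIV UNIV (R k)"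
    "\<And>k l. k < 4 \<Longrightarrow> l < 4 \<Longrightarrow> (\<Sum>x\<in>UNIV. \<Sum>y\<in>UNIV. cnj (L k x y) * L l x y) = (if k = l then 2 else 0)"
    "\<And>k l. k < 4 \<Longrightarrow> l < 4 \<Longrightarrow> (\<Sum>x\<in>UNIV. \<Sum>y\<in>UNIV. cnj (R k x y) * R l x y) = (if k = l then 2 else 0)"
    "\<And>x y x' y'. W (x, y) (x', y') = (\<Sum>k<4. complex_of_real (u k) * L k x x' * R k y y')"
proof -
  define T where "T = quat_coeff2 W"
  define MA :: "real ^ (bool \<times> bool) ^ (bool \<times> bool)" where "MA = (\<chi> a b. Re (T a b))"
  define MB :: "real ^ (bool \<times> bool) ^ (bool \<times> bool)" where "MB = (\<chi> a b. Im (T a b))"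
  have sym: "(\<Sum>b\<in>UNIV. Re (S a b) * Im (S c b)) = (\<Sum>b\<in>UNIV. Im (S a b) * Re (S c b))"
    if "(\<Sum>b\<in>UNIV. S a b * cnj (S c b)) = (\<Sum>b\<in>UNIV. S c b * cnj (S a b))"
    for S :: "bool \<times> bool \<Rightarrow> bool \<times> bool \<Rightarrow> complex" and a c
    using arg_cong[where f = Im, OF that] by (simp add: sum_bool_prod algebra_simps)
  \<comment> \<open>Exchanging the two qubits transposes \<open>T\<close>, so the statement about
    rows also yields the one about columns.\<close>
  define W' where "W' = (\<lambda>(y, x) (y', x'). W (x, y) (x', y'))"
  have "unitary UNIV UNIV W'"
    using W by (auto simp: unitary_def W'_def sum_bool_prod add_ac)
  moreover have swap: "quat_coeff2 W' b a = T a b" for a b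
    unfolding T_def quat_coeff2_def W'_def prod.case by (rule quat_coeff_swap)
  ultimately have T2: "(\<Sum>a\<in>UNIV. Re (T a b) * Im (T a c)) = (\<Sum>a\<in>UNIV. Im (T a b) * Re (T a c))" for b c
    using sym[of "quat_coeff2 W'" b c] quat_coeff2_gram_symmetric[of W' b c]
    unfolding swap by blast
  have T1: "(\<Sum>b\<in>UNIV. Re (T a b) * Im (T c b)) = (\<Sum>b\<in>UNIV. Im (T a b) * Re (T c b))" for a c
    unfolding T_def by (rule sym[OF quat_coeff2_gram_symmetric[OF W]])
  have m1: "transpose MA ** MB = transpose MB ** MA"
    by (simp add: vec_eq_iff matrix_matrix_mult_def transpose_def MA_def MB_def T2)
  have m2: "MA ** transpose MB = MB ** transpose MA"
    by (simp add: vec_eq_iff matrix_matrix_mult_def transpose_def MA_def MB_def T1)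
  have tr: "(M *v x) \<bullet> y = x \<bullet> (transpose M *v y)" for M :: "real ^ (bool \<times> bool) ^ (bool \<times> bool)" and x y
    using adjoint_works[OF matrix_vector_mul_linear, of x M y] by (simp add: adjoint_matrix)
  interpret svd_pair "(*v) MA" "(*v) MB"
  proof
    show "(MA *v x) \<bullet> (MB *v y) = (MB *v x) \<bullet> (MA *v y)" for x y
      by (simp add: tr matrix_vector_mul_assoc m1)
    show "adjoint ((*v) MA) x \<bullet> adjoint ((*v) MB) y = adjoint ((*v) MB) x \<bullet> adjoint ((*v) MA) y" for x y
      unfolding adjoint_matrix tr transpose_transpose matrix_vector_mul_assoc m2 ..
  qed (simp_all add: matrix_vector_right_distrib matrix_vector_mult_scaleR)
  have dim: "DIM(real ^ (bool \<times> bool)) = 4" by simp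
  obtain l r :: "nat \<Rightarrow> real ^ (bool \<times> bool)" and d e where l: "\<And>i j. i < 4 \<Longrightarrow> j < 4 \<Longrightarrow> l i \<bullet> l j = (if i = j then 1 else 0)"
    and r: "\<And>i j. i < 4 \<Longrightarrow> j < 4 \<Longrightarrow> r i \<bullet> r j = (if i = j then 1 else 0)"
    and A: "\<And>x. MA *v x = (\<Sum>k<4. (d k * (x \<bullet> r k)) *\<^sub>R l k)"
    and B: "\<And>x. MB *v x = (\<Sum>k<4. (e k * (x \<bullet> r k)) *\<^sub>R l k)"
    by (rule simultaneous_svd[unfolded dim]) (rule that; assumption)
  define D where "D = (\<lambda>k. Complex (d k) (e k))"
  have comp: "M $ a $ b = (\<Sum>k<4. c k * r k $ b * l k $ a)"
    if "\<And>x. M *v x = (\<Sum>k<4. (c k * (x \<bullet> r k)) *\<^sub>R l k)"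
    for M :: "real ^ (bool \<times> bool) ^ (bool \<times> bool)" and c a b
  proof -
    have "M $ a $ b = (M *v axis b 1) $ a"
      by (simp add: matrix_vector_mult_basis column_def)
    also have "\<dots> = (\<Sum>k<4. c k * r k $ b * l k $ a)"
      unfolding that by (simp add: inner_axis')
    finally show ?thesis .
  qed
  have T: "T a b = (\<Sum>k<4. D k * complex_of_real (r k $ b) * complex_of_real (l k $ a))" for a b
    using comp[OF A, of a b] comp[OF B, of a b]
    by (simp add: complex_eq_iff MA_def MB_def D_def)
  \<comment> \<open>The common singular values of real and imaginary part combine to complex numbers
    \<open>D k\<close>, whose phases go into the left factor. At \<open>D k = 0\<close>, where
    \<open>sgn\<close> would give \<open>0\<close>, the phase is set to 1 to keep that factor
    unitary.\<close>
  define ph where "ph = (\<lambda>k. if D k = 0 then 1 else sgn (D k))"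
  have ph: "cnj (ph k) * ph k = 1" "D k = complex_of_real (cmod (D k)) * ph k" for k
  proof -
    have n: "cmod (ph k) = 1"
      by (simp add: ph_def norm_sgn)
    have "cnj (ph k) * ph k = complex_of_real ((cmod (ph k))\<^sup>2)"
      by (rule trans[OF mult.commute complex_norm_square[symmetric]])
    then show "cnj (ph k) * ph k = 1"
      by (simp add: n)
    show "D k = complex_of_real (cmod (D k)) * ph k"
      by (simp add: ph_def sgn_div_norm scaleR_conv_of_real)
  qed
  show thesis
  proof (rule that[of "\<lambda>k. cmod (D k)" "\<lambda>k x y. ph k * quat_mat (l k) x y" "\<lambda>k. quat_mat (r k)"])
    fix k :: nat assume k: "k < 4"
    show "isometric UNIV UNIV (\<lambda>x y. ph k * quat_mat (l k) x y)"
      using quat_mat_isometric[of "l k"] l[OF k k] by (intro isometric_scale ph(1)) simp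
    show "isometric UNIV UNIV (quat_mat (r k))"
      using r[OF k k] by (simp add: quat_mat_isometric)
    fix j :: nat assume j: "j < 4"
    show "(\<Sum>x\<in>UNIV. \<Sum>y\<in>UNIV. cnj (quat_mat (r k) x y) * quat_mat (r j) x y) = (if k = j then 2 else 0)"
      unfolding quat_mat_inner r[OF k j] by simp
    have "(\<Sum>x\<in>UNIV. \<Sum>y\<in>UNIV. cnj (ph k * quat_mat (l k) x y) * (ph j * quat_mat (l j) x y))
        = cnj (ph k) * ph j * (\<Sum>x\<in>UNIV. \<Sum>y\<in>UNIV. cnj (quat_mat (l k) x y) * quat_mat (l j) x y)"
      by (simp add: sum_distrib_left mult_ac)
    also have "\<dots> = (if k = j then 2 else 0)"
      unfolding quat_mat_inner l[OF k j] using ph(1)[of k] by (cases "k = j") simp_all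
    finally show "(\<Sum>x\<in>UNIV. \<Sum>y\<in>UNIV. cnj (ph k * quat_mat (l k) x y) * (ph j * quat_mat (l j) x y))
        = (if k = j then 2 else 0)" .
  next
    fix x y x' y'
    have "W (x, y) (x', y') = (\<Sum>a\<in>UNIV. \<Sum>b\<in>UNIV. T a b * quat_basis a x x' * quat_basis b y y')"
      unfolding T_def by (rule quat_expand2)
    also have "\<dots> = (\<Sum>a\<in>UNIV. \<Sum>b\<in>UNIV. \<Sum>k<4. D k * (complex_of_real (l k $ a) * quat_basis a x x')
        * (complex_of_real (r k $ b) * quat_basis b y y'))"
      unfolding T sum_distrib_right by (simp add: mult_ac)
    also have "\<dots> = (\<Sum>k<4. \<Sum>a\<in>UNIV. \<Sum>b\<in>UNIV. D k * (complex_of_real (l k $ a) * quat_basis a x x')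
        * (complex_of_real (r k $ b) * quat_basis b y y'))"
      by (simp only: sum.swap[of _ "{..<4::nat}"])
    also have "\<dots> = (\<Sum>k<4. D k * quat_mat (l k) x x' * quat_mat (r k) y y')"
      unfolding quat_mat_def by (simp add: sum_distrib_left sum_distrib_right mult_ac)
    finally show "W (x, y) (x', y') = (\<Sum>k<4. complex_of_real (cmod (D k)) * (ph k * quat_mat (l k) x x') * quat_mat (r k) y y')"
      by (simp add: ph(2)[symmetric] mult.assoc[symmetric])
  qed auto
qed

section \<open>Differences of Kraus maps as local instruments\<close>

text \<open>A measurement with Kraus operators \<open>K 0\<close> and \<open>K 1\<close> whose
  outcomes count with the signs \<open>+1\<close> and \<open>-1\<close>.\<close>

definition signed_map :: "'a set \<Rightarrow> (nat \<Rightarrow> 'a \<Rightarrow> 'a \<Rightarrow> complex) \<Rightarrow> ('a, 'a) opmap" where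
  "signed_map X K M = (\<lambda>i j. conj_map X X (K 0) M i j - conj_map X X (K 1) M i j)"

definition kraus_pair :: "'a set \<Rightarrow> (nat \<Rightarrow> 'a \<Rightarrow> 'a \<Rightarrow> complex) \<Rightarrow> bool" where
  "kraus_pair X K \<longleftrightarrow> (\<forall>i\<in>X. \<forall>j\<in>X.
     (\<Sum>k\<in>X. cnj (K 0 k i) * K 0 k j) + (\<Sum>k\<in>X. cnj (K 1 k i) * K 1 k j) = (if i = j then 1 else 0))"

text \<open>Outcomes range over all of \<open>nat\<close>; the zero map marks those from 2 on as
  absent.\<close>

definition pair_instrument :: "'a set \<Rightarrow> (nat \<Rightarrow> 'a \<Rightarrow> 'a \<Rightarrow> complex) \<Rightarrow> nat \<Rightarrow> ('a, 'a) opmap" where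
  "pair_instrument X K i = conj_map X X (if i < 2 then K i else (\<lambda>_ _. 0))"

definition pair_sign :: "nat \<Rightarrow> real" where
  "pair_sign i = (if i = 0 then 1 else if i = 1 then -1 else 0)"

lemma conj_map_zero: "conj_map X Y (\<lambda>_ _. 0) = (\<lambda>M i j. 0)"
  by (simp add: conj_map_def fun_eq_iff)

lemma cp_zero: "cp X Y (\<lambda>M i j. 0)"
  using cp_conj_map[of X Y "\<lambda>_ _. 0"] by (simp add: conj_map_zero)

lemma trace_conj_map:
  "trace_on Y (conj_map X Y K M) = (\<Sum>k\<in>X. \<Sum>l\<in>X. M k l * (\<Sum>i\<in>Y. cnj (K i l) * K i k))"
proof -
  have "trace_on Y (conj_map X Y K M) = (\<Sum>i\<in>Y. \<Sum>k\<in>X. \<Sum>l\<in>X. K i k * M k l * cnj (K i l))"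
    by (simp add: trace_on_def conj_map_def)
  also have "\<dots> = (\<Sum>k\<in>X. \<Sum>i\<in>Y. \<Sum>l\<in>X. K i k * M k l * cnj (K i l))"
    by (rule sum.swap)
  also have "\<dots> = (\<Sum>k\<in>X. \<Sum>l\<in>X. \<Sum>i\<in>Y. K i k * M k l * cnj (K i l))"
    by (intro sum.cong refl) (rule sum.swap)
  finally show ?thesis
    by (simp add: sum_distrib_left mult_ac)
qed

lemma sum_delta_pair:
  assumes "finite X"
  shows "(\<Sum>k\<in>X. \<Sum>l\<in>X. f k l * (if l = k then 1 else 0)) = (\<Sum>k\<in>X. f k k :: complex)"
proof -
  have "(\<Sum>l\<in>X. f k l * (if l = k then 1 else 0)) = (\<Sum>l\<in>X. if l = k then f k l else 0)" for k
    by (intro sum.cong) auto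
  then show ?thesis
    using assms by simp
qed

lemma tp_kraus_pair:
  assumes X: "finite X" and K: "kraus_pair X K"
  shows "tp X X (\<lambda>M i j. conj_map X X (K 0) M i j + conj_map X X (K 1) M i j)"
proof -
  have "trace_on X (\<lambda>i j. conj_map X X (K 0) M i j + conj_map X X (K 1) M i j) = trace_on X M" for M
  proof -
    have "trace_on X (\<lambda>i j. conj_map X X (K 0) M i j + conj_map X X (K 1) M i j)
        = trace_on X (conj_map X X (K 0) M) + trace_on X (conj_map X X (K 1) M)"
      by (simp add: trace_on_def sum.distrib)
    also have "\<dots> = (\<Sum>k\<in>X. \<Sum>l\<in>X. M k l *
        ((\<Sum>i\<in>X. cnj (K 0 i l) * K 0 i k) + (\<Sum>i\<in>X. cnj (K 1 i l) * K 1 i k)))"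
      by (simp add: trace_conj_map sum.distrib algebra_simps)
    also have "\<dots> = (\<Sum>k\<in>X. \<Sum>l\<in>X. M k l * (if l = k then 1 else 0))"
      using K unfolding kraus_pair_def by (intro sum.cong refl arg_cong2[where f = "(*)"]) blast
    finally show ?thesis
      by (simp add: sum_delta_pair[OF X] trace_on_def)
  qed
  then show ?thesis
    by (simp add: tp_def linear_map_add)
qed

lemma map_has_sum_two:
  assumes "\<And>i. i \<ge> 2 \<Longrightarrow> E i = (\<lambda>M y y'. 0)"
  shows "map_has_sum X E (UNIV :: nat set) (\<lambda>M y y'. E 0 M y y' + E 1 M y y')"
  unfolding map_has_sum_def
proof (intro ballI allI)
  fix M y y'
  show "((\<lambda>i. E i M y y') has_sum (E 0 M y y' + E 1 M y y')) UNIV"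
    by (rule has_sum_finite_neutralI[of "{0, 1}"]) (use assms in \<open>auto simp: not_less_eq numeral_2_eq_2\<close>)
qed

lemma pair_instrument_zero: "i \<ge> 2 \<Longrightarrow> pair_instrument X K i = (\<lambda>M y y'. 0)"
  by (simp add: pair_instrument_def conj_map_zero)

lemma map_has_sum_pair_instrument:
  "map_has_sum X (pair_instrument X K) UNIV (\<lambda>M i j. conj_map X X (K 0) M i j + conj_map X X (K 1) M i j)"
  using map_has_sum_two[of "pair_instrument X K" X] pair_instrument_zero[of _ X K]
  by (simp add: pair_instrument_def)

lemma map_has_sum_signed_map:
  "map_has_sum X (\<lambda>i M y y'. complex_of_real (pair_sign i) * pair_instrument X K i M y y') UNIV (signed_map X K)"
proof -
  have "signed_map X K = (\<lambda>M y y'. complex_of_real (pair_sign 0) * pair_instrument X K 0 M y y'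
      + complex_of_real (pair_sign 1) * pair_instrument X K 1 M y y')"
    by (simp add: signed_map_def pair_instrument_def pair_sign_def fun_eq_iff)
  moreover have "map_has_sum X (\<lambda>i M y y'. complex_of_real (pair_sign i) * pair_instrument X K i M y y') UNIV
     (\<lambda>M y y'. complex_of_real (pair_sign 0) * pair_instrument X K 0 M y y'
      + complex_of_real (pair_sign 1) * pair_instrument X K 1 M y y')"
    by (rule map_has_sum_two) (simp add: pair_instrument_zero)
  ultimately show ?thesis
    by simp
qed

lemma cp_pair_instrument: "cp X X (pair_instrument X K i)"
  by (simp add: pair_instrument_def cp_conj_map)

lemma linear_map_pair_instrument [simp]: "linear_map X X (pair_instrument X K i)"
  by (simp add: pair_instrument_def)

lemma linear_map_signed_map [simp]: "linear_map X X (signed_map X K)"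
  using linear_map_diff[OF linear_map_conj_map[of X X "K 0"] linear_map_conj_map[of X X "K 1"]]
  unfolding signed_map_def[abs_def] .

lemma instrument_pair:
  assumes "finite X" "kraus_pair X K"
  shows "instrument X X (pair_instrument X K)"
  unfolding instrument_def
  using cp_pair_instrument tp_kraus_pair[OF assms] map_has_sum_pair_instrument by blast

lemma tensor_map_scale:
  assumes E: "linear_map A A' E" and F: "linear_map B B' F" and M: "M \<in> ops (A \<times> B)"
  shows "tensor_map (\<lambda>M y y'. c * E M y y') (\<lambda>M y y'. d * F M y y') M
    = (\<lambda>y y'. c * d * tensor_map E F M y y')"
  using linear_mapD(3)[OF E tensor_map_inner_in_ops[OF M F], of d]
  by (auto simp: tensor_map_def fun_eq_iff)

lemma pair_sign_bounds: "pair_sign i * pair_sign j \<in> {-1..1}"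
  by (simp add: pair_sign_def)

lemma map_has_sum_signed_product:
  assumes fin: "finite A" "finite B"
  shows "map_has_sum (A \<times> B) (\<lambda>p M y y'. complex_of_real (pair_sign (fst p) * pair_sign (snd p)) *
      tensor_map (pair_instrument A K (fst p)) (pair_instrument B J (snd p)) M y y') UNIV
      (tensor_map (signed_map A K) (signed_map B J))"
proof -
  have "map_has_sum (A \<times> B) (\<lambda>(i, j). tensor_map
      (\<lambda>M y y'. complex_of_real (pair_sign i) * pair_instrument A K i M y y')
      (\<lambda>M y y'. complex_of_real (pair_sign j) * pair_instrument B J j M y y')) UNIV
      (tensor_map (signed_map A K) (signed_map B J))"
    by (rule map_has_sum_tensor_map[OF fin])
      (simp_all add: linear_map_scale map_has_sum_signed_map)
  then show ?thesis
    by (simp add: map_has_sum_def case_prod_beta tensor_map_scale[OF linear_map_pair_instrument linear_map_pair_instrument])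
qed

text \<open>The product of the two local signs is an admissible coefficient for a pair of outcomes,
  so the product of the signed maps is classical post-processing of a product instrument.\<close>

lemma signed_product_lo_star:
  assumes fin: "finite A" "finite B" and K: "kraus_pair A K" and J: "kraus_pair B J"
  shows "tensor_map (signed_map A K) (signed_map B J) \<in> lo_star A B"
  unfolding lo_star_def star_def
proof (intro CollectI bexI exI conjI)
  show "\<forall>p. pair_sign (fst p) * pair_sign (snd p) \<in> {-1..1}"
    using pair_sign_bounds by blast
  show "map_has_sum (A \<times> B) (\<lambda>p M y y'. complex_of_real (pair_sign (fst p) * pair_sign (snd p)) *
      (\<lambda>(i, j). tensor_map (pair_instrument A K i) (pair_instrument B J j)) p M y y') UNIV
      (tensor_map (signed_map A K) (signed_map B J))"
    using map_has_sum_signed_product[OF fin] by (simp add: case_prod_beta)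
  show "(\<lambda>(i, j). tensor_map (pair_instrument A K i) (pair_instrument B J j)) \<in> lo_instruments A B"
    unfolding lo_instruments_def using instrument_pair[OF fin(1) K] instrument_pair[OF fin(2) J] by blast
qed

section \<open>Local instruments as LOCC protocols\<close>

lemma map_has_sum_single:
  assumes "i \<in> I" "\<And>M. M \<in> ops X \<Longrightarrow> E i M = G M"
    "\<And>j M. j \<in> I \<Longrightarrow> j \<noteq> i \<Longrightarrow> M \<in> ops X \<Longrightarrow> E j M = (\<lambda>y y'. 0)"
  shows "map_has_sum X E I G"
  unfolding map_has_sum_def
proof (intro ballI allI)
  fix M y y' assume M: "M \<in> ops X"
  show "((\<lambda>i. E i M y y') has_sum G M y y') I"
    by (rule has_sum_finite_neutralI[of "{i}"]) (use assms M in auto)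
qed

lemma coarse_graining_refl: "coarse_graining X E E"
  unfolding coarse_graining_def
  by (intro exI[of _ id] allI map_has_sum_single) auto

lemma tensor_map_id_id: "tensor_map id id M = M"
  by (auto simp: tensor_map_def fun_eq_iff)

lemma tensor_map_comp_sides:
  assumes E: "linear_map A A E" and F: "linear_map B B F" and fin: "finite A" "finite B"
    and M: "M \<in> ops (A \<times> B)"
  shows "tensor_map id F (tensor_map E id M) = tensor_map E F M"
proof -
  have "tensor_map id F (tensor_map E id M) (c, d) (c', d') = tensor_map E F M (c, d) (c', d')" for c d c' d'
  proof -
    have N: "tensor_map E id M \<in> ops (A \<times> B)"
      by (rule linear_mapD(1)[OF linear_map_tensor_map[OF E linear_map_id] M])
    have "tensor_map id F (tensor_map E id M) (c, d) (c', d') = F (\<lambda>b b'. tensor_map E id M (c, b) (c', b')) d d'"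
      by (simp add: tensor_map_def)
    also have "\<dots> = (\<Sum>s\<in>B. \<Sum>t\<in>B. tensor_map E id M (c, s) (c', t) * F (matrix_unit s t) d d')"
      by (simp add: linear_map_expand[OF F fin(2) block_in_ops(2)[OF N]])
    also have "\<dots> = (\<Sum>s\<in>B. \<Sum>t\<in>B. \<Sum>u\<in>A. \<Sum>v\<in>A. M (u, s) (v, t) * (E (matrix_unit u v) c c' * F (matrix_unit s t) d d'))"
    proof (intro sum.cong refl)
      fix s t
      have "tensor_map E id M (c, s) (c', t) = E (\<lambda>a a'. M (a, s) (a', t)) c c'"
        by (simp add: tensor_map_def)
      then show "tensor_map E id M (c, s) (c', t) * F (matrix_unit s t) d d' =
          (\<Sum>u\<in>A. \<Sum>v\<in>A. M (u, s) (v, t) * (E (matrix_unit u v) c c' * F (matrix_unit s t) d d'))"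
        by (simp add: linear_map_expand[OF E fin(1) block_in_ops(1)[OF M]] sum_distrib_right mult.assoc)
    qed
    also have "\<dots> = tensor_map E F M (c, d) (c', d')"
      unfolding tensor_map_expand[OF E F fin M] by (rule sum_swap_pairs)
    finally show ?thesis .
  qed
  then show ?thesis
    by (simp add: fun_eq_iff)
qed

lemma instrument_trivial: "instrument X X (\<lambda>k::nat. if k = 0 then id else (\<lambda>M i j. 0))"
  unfolding instrument_def
proof (intro conjI allI exI)
  show "cp X X (if k = 0 then id else (\<lambda>M i j. 0))" for k :: nat
    by (simp add: cp_id cp_zero)
  show "tp X X id"
    using cptp_id[of X] by (simp add: cptp_def)
  show "map_has_sum X (\<lambda>k::nat. if k = 0 then id else (\<lambda>M i j. 0)) UNIV id"
    by (rule map_has_sum_single[of 0]) auto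
qed

text \<open>A round in which one party applies the identity, as the only nonzero outcome, changes
  nothing. It pads a finite protocol to the infinite sequence that \<open>locc_instruments\<close>
  demands.\<close>

lemma locc_linked_refl: "locc_linked A B I I"
proof -
  define J where "J = (\<lambda>(j::nat) k::nat. tensor_map (if k = 0 then id else (\<lambda>M i j. 0)) id :: ('a \<times> 'b, 'a \<times> 'b) opmap)"
  have "one_way_local A B (J j)" for j
    unfolding one_way_local_def J_def
    by (intro disjI1 exI[of _ "\<lambda>k::nat. if k = 0 then id else (\<lambda>M i j. 0)"] exI[of _ "\<lambda>_. id"] conjI
        instrument_trivial allI cptp_id refl)
  moreover have "coarse_graining (A \<times> B) (\<lambda>(j, j'). J j j' \<circ> I j) I"
    unfolding coarse_graining_def
  proof (intro exI[of _ fst] allI)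
    fix k
    show "map_has_sum (A \<times> B) (\<lambda>(j, j'). J j j' \<circ> I j) {p. fst p = k} (I k)"
    proof (rule map_has_sum_single[of "(k, 0)"])
      fix p :: "nat \<times> nat" and M assume "p \<in> {p. fst p = k}" "p \<noteq> (k, 0)"
      then have "snd p \<noteq> 0"
        by (cases p) auto
      then show "(case p of (j, j') \<Rightarrow> J j j' \<circ> I j) M = (\<lambda>y y'. 0)"
        by (simp add: J_def case_prod_beta tensor_map_def fun_eq_iff)
    qed (auto simp: J_def tensor_map_id_id)
  qed
  ultimately show ?thesis
    unfolding locc_linked_def by blast
qed

text \<open>The second party measures regardless of the first outcome. Outcomes of a protocol are
  natural numbers, so the pair of outcomes is relabelled by \<open>prod_encode\<close>; being
  injective, this merges nothing.\<close>

lemma locc_linked_local: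
  assumes fin: "finite A" "finite B" and E: "instrument A A E" and F: "instrument B B F"
  shows "locc_linked A B (\<lambda>k. tensor_map (E k) id)
    (\<lambda>m. tensor_map (E (fst (prod_decode m))) (F (snd (prod_decode m))))"
proof -
  have "one_way_local A B (\<lambda>k. tensor_map id (F k))"
    unfolding one_way_local_def
    by (intro disjI2 exI[of _ "\<lambda>_. id"] exI[of _ F] conjI allI cptp_id F refl)
  moreover have "coarse_graining (A \<times> B) (\<lambda>(j, j'). tensor_map id (F j') \<circ> tensor_map (E j) id)
      (\<lambda>m. tensor_map (E (fst (prod_decode m))) (F (snd (prod_decode m))))"
    unfolding coarse_graining_def
  proof (intro exI[of _ prod_encode] allI)
    fix k
    have lin: "linear_map A A (E i)" "linear_map B B (F i)" for i
      using E F by (auto simp: instrument_def cp_linear)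
    have "p = prod_decode k" if "prod_encode p = k" for p
      using that by auto
    then show "map_has_sum (A \<times> B) (\<lambda>(j, j'). tensor_map id (F j') \<circ> tensor_map (E j) id) {p. prod_encode p = k}
        (tensor_map (E (fst (prod_decode k))) (F (snd (prod_decode k))))"
      by (intro map_has_sum_single[of "prod_decode k"])
        (auto simp: case_prod_beta tensor_map_comp_sides[OF lin fin])
  qed
  ultimately show ?thesis
    unfolding locc_linked_def by (intro exI[of _ "\<lambda>_ k. tensor_map id (F k)"]) simp
qed

lemma map_has_sum_prod_decode:
  assumes "map_has_sum X E UNIV G"
  shows "map_has_sum X (\<lambda>m. E (prod_decode m)) UNIV G"
  using assms unfolding map_has_sum_def
  by (intro ballI allI has_sum_reindex_bij_betw[OF bij_prod_decode, THEN iffD2]) blast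

lemma family_dist_same: "family_dist X Y E E = 0"
  by (simp add: family_dist_def)

lemma signed_product_locc_star:
  assumes fin: "finite A" "finite B" and K: "kraus_pair A K" and J: "kraus_pair B J"
  shows "tensor_map (signed_map A K) (signed_map B J) \<in> locc_star A B"
proof -
  define E where "E = pair_instrument A K"
  define F where "F = pair_instrument B J"
  define I where "I = (\<lambda>m. tensor_map (E (fst (prod_decode m))) (F (snd (prod_decode m))))"
  have E: "instrument A A E" and F: "instrument B B F"
    unfolding E_def F_def using fin K J by (auto intro: instrument_pair)
  \<comment> \<open>The first party measures in round 1, the second in round 2, and all later rounds
    are trivial, so the distance to \<open>I\<close> is eventually \<open>0\<close>.\<close>
  define S where "S = (\<lambda>n::nat. if n = 1 then (\<lambda>k. tensor_map (E k) id) else I)"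
  have link: "locc_linked A B (S n) (S (Suc n))" if "n \<ge> 1" for n
    using that locc_linked_local[OF fin E F] locc_linked_refl[of A B I] by (auto simp: S_def I_def)
  have "one_way_local A B (\<lambda>k. tensor_map (E k) id)"
    unfolding one_way_local_def
    by (intro disjI1 exI[of _ "\<lambda>_. id"] exI[of _ E] conjI allI cptp_id E refl)
  then have first: "locc_round A B 1 (S 1)"
    using locc_round.one_round[OF _ coarse_graining_refl] by (simp add: S_def)
  have round: "locc_round A B n (S n)" if "n \<ge> 1" for n
    using that
  proof (induction n rule: dec_induct)
    case base
    show ?case by (rule first)
  next
    case (step n)
    show ?case by (rule locc_round.next_round[OF step.IH link[OF step.hyps(1)]])
  qed
  have cpI: "cp (A \<times> B) (A \<times> B) (I m)" for m
  proof -
    have "I m = conj_map (A \<times> B) (A \<times> B) (kron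
        (if fst (prod_decode m) < 2 then K (fst (prod_decode m)) else (\<lambda>_ _. 0))
        (if snd (prod_decode m) < 2 then J (snd (prod_decode m)) else (\<lambda>_ _. 0)))"
      unfolding I_def E_def F_def pair_instrument_def by (rule ext) (rule tensor_map_conj_map)
    then show ?thesis
      by (simp add: cp_conj_map)
  qed
  obtain T where T: "tp A A T" "map_has_sum A E UNIV T" using E by (auto simp: instrument_def)
  obtain T' where T': "tp B B T'" "map_has_sum B F UNIV T'" using F by (auto simp: instrument_def)
  have "map_has_sum (A \<times> B) (\<lambda>(i, j). tensor_map (E i) (F j)) UNIV (tensor_map T T')"
    by (rule map_has_sum_tensor_map[OF fin]) (use T T' in \<open>auto simp: E_def F_def tp_def\<close>)
  from map_has_sum_prod_decode[OF this]
  have "map_has_sum (A \<times> B) I UNIV (tensor_map T T')"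
    by (simp add: I_def case_prod_beta)
  then have "instrument (A \<times> B) (A \<times> B) I"
    unfolding instrument_def using cpI tp_tensor_map[OF T(1) T'(1)] by blast
  moreover have "(\<lambda>n. family_dist (A \<times> B) (A \<times> B) (S n) I) \<longlonglongrightarrow> 0"
    by (rule tendsto_eventually, rule eventually_sequentiallyI[of 2]) (simp add: S_def family_dist_same)
  ultimately have I: "I \<in> locc_instruments A B"
    unfolding locc_instruments_def using round link coarse_graining_refl by blast
  show ?thesis
    unfolding locc_star_def star_def
  proof (intro CollectI bexI[OF _ I] exI conjI)
    show "\<forall>m. pair_sign (fst (prod_decode m)) * pair_sign (snd (prod_decode m)) \<in> {-1..1}"
      using pair_sign_bounds by blast
    show "map_has_sum (A \<times> B) (\<lambda>m M y y'. complex_of_real (pair_sign (fst (prod_decode m)) * pair_sign (snd (prod_decode m))) *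
        I m M y y') UNIV (tensor_map (signed_map A K) (signed_map B J))"
      using map_has_sum_prod_decode[OF map_has_sum_signed_product[OF fin]] by (simp add: I_def E_def F_def)
  qed
qed

section \<open>The witness\<close>

text \<open>The vectors keep a common squared norm \<open>N\<close> instead of being normalised, so
  that unitary matrices can be used as they are.\<close>

definition orth_family :: "'k set \<Rightarrow> 'z set \<Rightarrow> real \<Rightarrow> ('k \<Rightarrow> 'z \<Rightarrow> complex) \<Rightarrow> bool" where
  "orth_family I Z N v \<longleftrightarrow> (\<forall>k\<in>I. \<forall>l\<in>I.
     (\<Sum>z\<in>Z. cnj (v k z) * v l z) = (if k = l then complex_of_real N else 0))"

lemma cnj_mult_self: "cnj z * z = complex_of_real ((cmod z)\<^sup>2)"
  by (rule trans[OF mult.commute complex_norm_square[symmetric]])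

lemma orth_family_expand:
  assumes I: "finite I" and v: "orth_family I Z N v" and w: "orth_family I Z' N' w"
  shows "(\<Sum>z\<in>Z. \<Sum>z'\<in>Z'. cnj (\<Sum>k\<in>I. c k * v k z * w k z') * (\<Sum>k\<in>I. d k * v k z * w k z'))
    = complex_of_real (N * N') * (\<Sum>k\<in>I. cnj (c k) * d k)"
proof -
  have "(\<Sum>z\<in>Z. \<Sum>z'\<in>Z'. cnj (\<Sum>k\<in>I. c k * v k z * w k z') * (\<Sum>k\<in>I. d k * v k z * w k z'))
    = (\<Sum>z\<in>Z. \<Sum>z'\<in>Z'. \<Sum>k\<in>I. \<Sum>l\<in>I. cnj (c k) * d l * ((cnj (v k z) * v l z) * (cnj (w k z') * w l z')))"
    unfolding cnj_sum sum_product by (simp add: mult_ac)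
  also have "\<dots> = (\<Sum>k\<in>I. \<Sum>l\<in>I. \<Sum>z\<in>Z. \<Sum>z'\<in>Z'. cnj (c k) * d l * ((cnj (v k z) * v l z) * (cnj (w k z') * w l z')))"
    by (rule sum_swap_pairs)
  also have "\<dots> = (\<Sum>k\<in>I. \<Sum>l\<in>I. cnj (c k) * d l * ((\<Sum>z\<in>Z. cnj (v k z) * v l z) * (\<Sum>z'\<in>Z'. cnj (w k z') * w l z')))"
    unfolding sum_product by (simp only: sum_distrib_left)
  also have "\<dots> = (\<Sum>k\<in>I. \<Sum>l\<in>I. if l = k then cnj (c k) * d l * complex_of_real (N * N') else 0)"
    using v w by (intro sum.cong refl) (auto simp: orth_family_def)
  finally show ?thesis
    using I by (simp add: sum_distrib_left mult_ac)
qed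

text \<open>The squared norm of \<open>f - p / N\<close> is nonnegative, where \<open>p / N\<close>
  is the orthogonal projection of \<open>f\<close> onto the span of the family.\<close>

lemma orth_family_bessel:
  assumes I: "finite I" and N: "0 < N" and v: "orth_family I Z N v"
  shows "(\<Sum>k\<in>I. (cmod (\<Sum>z\<in>Z. cnj (v k z) * f z))\<^sup>2) \<le> N * (\<Sum>z\<in>Z. (cmod (f z))\<^sup>2)"
proof -
  define c where "c = (\<lambda>k. \<Sum>z\<in>Z. cnj (v k z) * f z)"
  define p where "p = (\<lambda>z. \<Sum>k\<in>I. c k * v k z)"
  define S where "S = (\<Sum>k\<in>I. cnj (c k) * c k)"
  have pf: "(\<Sum>z\<in>Z. cnj (p z) * f z) = S"
  proof -
    have "(\<Sum>z\<in>Z. cnj (p z) * f z) = (\<Sum>z\<in>Z. \<Sum>k\<in>I. cnj (c k) * (cnj (v k z) * f z))"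
      unfolding p_def cnj_sum sum_distrib_right by (simp add: mult_ac)
    also have "\<dots> = (\<Sum>k\<in>I. \<Sum>z\<in>Z. cnj (c k) * (cnj (v k z) * f z))"
      by (rule sum.swap)
    also have "\<dots> = S"
      unfolding S_def by (simp add: c_def sum_distrib_left)
    finally show ?thesis .
  qed
  have fp: "(\<Sum>z\<in>Z. cnj (f z) * p z) = S"
  proof -
    have "(\<Sum>z\<in>Z. cnj (f z) * p z) = cnj (\<Sum>z\<in>Z. cnj (p z) * f z)"
      unfolding cnj_sum by (simp add: mult_ac)
    then show ?thesis
      unfolding pf by (simp add: S_def mult_ac)
  qed
  have pp: "(\<Sum>z\<in>Z. cnj (p z) * p z) = complex_of_real N * S"
  proof -
    have "(\<Sum>z\<in>Z. cnj (p z) * p z) = (\<Sum>z\<in>Z. \<Sum>k\<in>I. \<Sum>l\<in>I. cnj (c k) * c l * (cnj (v k z) * v l z))"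
      unfolding p_def cnj_sum sum_product by (simp add: mult_ac)
    also have "\<dots> = (\<Sum>k\<in>I. \<Sum>l\<in>I. \<Sum>z\<in>Z. cnj (c k) * c l * (cnj (v k z) * v l z))"
      by (simp only: sum.swap[of _ Z])
    also have "\<dots> = (\<Sum>k\<in>I. \<Sum>l\<in>I. if l = k then complex_of_real N * (cnj (c k) * c l) else 0)"
      using v unfolding sum_distrib_left[symmetric] by (intro sum.cong refl) (auto simp: orth_family_def)
    finally show ?thesis
      using I by (simp add: S_def sum_distrib_left)
  qed
  have nn: "0 \<le> (\<Sum>z\<in>Z. (cmod (f z - p z / complex_of_real N))\<^sup>2)"
    by (intro sum_nonneg) simp
  have "complex_of_real (\<Sum>z\<in>Z. (cmod (f z - p z / complex_of_real N))\<^sup>2) = (\<Sum>z\<in>Z. cnj (f z - p z / complex_of_real N) * (f z - p z / complex_of_real N))"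
    unfolding of_real_sum by (intro sum.cong refl cnj_mult_self[symmetric])
  also have "\<dots> = (\<Sum>z\<in>Z. cnj (f z) * f z) - (\<Sum>z\<in>Z. cnj (p z) * f z) / N - (\<Sum>z\<in>Z. cnj (f z) * p z) / N
      + (\<Sum>z\<in>Z. cnj (p z) * p z) / (N * N)"
    by (simp add: sum_subtractf sum.distrib sum_divide_distrib algebra_simps add_divide_distrib diff_divide_distrib)
  also have "\<dots> = (\<Sum>z\<in>Z. cnj (f z) * f z) - S / N"
    unfolding pf fp pp using N by (simp add: field_simps)
  also have "\<dots> = complex_of_real ((\<Sum>z\<in>Z. (cmod (f z))\<^sup>2) - (\<Sum>k\<in>I. (cmod (c k))\<^sup>2) / N)"
    unfolding S_def cnj_mult_self by simp
  finally have "0 \<le> (\<Sum>z\<in>Z. (cmod (f z))\<^sup>2) - (\<Sum>k\<in>I. (cmod (c k))\<^sup>2) / N"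
    using nn by (simp only: of_real_eq_iff)
  then show ?thesis
    using N by (simp add: c_def field_simps)
qed

text \<open>\<open>X k k' False\<close> and \<open>X k k' True\<close> stand for the products of the
  two real and of the two imaginary parts of a polarised term; their difference is the
  symmetrisation of \<open>G\<close>. As the weights are symmetric, the sum over ordered pairs
  restores \<open>G\<close>. On the diagonal the second product vanishes and gets weight
  zero.\<close>

lemma weighted_pair_sum:
  fixes u :: "'k \<Rightarrow> real" and X :: "'k \<Rightarrow> 'k \<Rightarrow> bool \<Rightarrow> complex"
  assumes "finite I"
    and XG: "\<And>k k'. k \<in> I \<Longrightarrow> k' \<in> I \<Longrightarrow> X k k' False - X k k' True = (G k k' + G k' k) / 2"
    and X0: "\<And>k. k \<in> I \<Longrightarrow> X k k True = 0"
  shows "(\<Sum>(k, k', b)\<in>I \<times> I \<times> UNIV. complex_of_real (if b then (if k = k' then 0 else - (u k * u k')) else u k * u k') * X k k' b)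
    = (\<Sum>k\<in>I. \<Sum>k'\<in>I. complex_of_real (u k * u k') * G k k')"
proof -
  have "(\<Sum>(k, k', b)\<in>I \<times> I \<times> UNIV. complex_of_real (if b then (if k = k' then 0 else - (u k * u k')) else u k * u k') * X k k' b)
    = (\<Sum>k\<in>I. \<Sum>k'\<in>I. \<Sum>b\<in>UNIV. complex_of_real (if b then (if k = k' then 0 else - (u k * u k')) else u k * u k') * X k k' b)"
    by (simp add: sum.cartesian_product')
  also have "\<dots> = (\<Sum>k\<in>I. \<Sum>k'\<in>I. complex_of_real (u k * u k') * ((G k k' + G k' k) / 2))"
    by (intro sum.cong refl) (auto simp: sum_bool XG[symmetric] X0 algebra_simps)
  also have "\<dots> = ((\<Sum>k\<in>I. \<Sum>k'\<in>I. complex_of_real (u k * u k') * G k k')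
      + (\<Sum>k\<in>I. \<Sum>k'\<in>I. complex_of_real (u k * u k') * G k' k)) / 2"
    by (simp add: sum.distrib sum_divide_distrib add_divide_distrib algebra_simps)
  also have "(\<Sum>k\<in>I. \<Sum>k'\<in>I. complex_of_real (u k * u k') * G k' k) = (\<Sum>k\<in>I. \<Sum>k'\<in>I. complex_of_real (u k * u k') * G k k')"
    by (subst sum.swap) (simp add: mult.commute)
  finally show ?thesis
    by simp
qed

text \<open>Each ordered pair carries the weight \<open>u k * u k'\<close> twice, except that a
  diagonal pair carries it once; this saves the sum of the squares, which is 1.\<close>

lemma weighted_pair_norm:
  fixes u :: "'k \<Rightarrow> real"
  assumes I: "finite I" and u: "\<And>k. k \<in> I \<Longrightarrow> 0 \<le> u k" and norm: "(\<Sum>k\<in>I. (u k)\<^sup>2) = 1"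
  shows "(\<Sum>(k, k', b)\<in>I \<times> I \<times> UNIV. \<bar>if b then (if k = k' then 0 else - (u k * u k')) else u k * u k'\<bar>)
    = 2 * (\<Sum>k\<in>I. u k)\<^sup>2 - 1"
proof -
  have "(\<Sum>(k, k', b)\<in>I \<times> I \<times> UNIV. \<bar>if b then (if k = k' then 0 else - (u k * u k')) else u k * u k'\<bar>)
    = (\<Sum>k\<in>I. \<Sum>k'\<in>I. \<Sum>b\<in>UNIV. \<bar>if b then (if k = k' then 0 else - (u k * u k')) else u k * u k'\<bar>)"
    by (simp add: sum.cartesian_product')
  also have "\<dots> = (\<Sum>k\<in>I. \<Sum>k'\<in>I. 2 * (u k * u k') - (if k' = k then (u k)\<^sup>2 else 0))"
    by (intro sum.cong refl) (auto simp: sum_bool u power2_eq_square)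
  also have "\<dots> = 2 * ((\<Sum>k\<in>I. u k) * (\<Sum>k\<in>I. u k)) - (\<Sum>k\<in>I. (u k)\<^sup>2)"
    using I unfolding sum_product by (simp add: sum_subtractf sum_distrib_left)
  finally show ?thesis
    unfolding norm by (simp add: power2_eq_square)
qed

lemma lin_form_lin_comb:
  assumes g: "lin_form X Y g" and F: "\<And>i. i \<in> S \<Longrightarrow> linear_map X Y (F i)"
  shows "g (\<lambda>M y y'. \<Sum>i\<in>S. c i * F i M y y') = (\<Sum>i\<in>S. c i * g (F i))"
proof -
  obtain d where d: "\<And>P. linear_map X Y P \<Longrightarrow>
      g P = (\<Sum>w\<in>X \<times> X \<times> Y \<times> Y. d w * choi_entry P w)"
    using g by (auto simp: lin_form_def)
  have lin: "linear_map X Y (\<lambda>M y y'. \<Sum>i\<in>S. c i * F i M y y')"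
    by (intro linear_map_sum_maps linear_map_scale F)
  have "g (\<lambda>M y y'. \<Sum>i\<in>S. c i * F i M y y') = (\<Sum>w\<in>X \<times> X \<times> Y \<times> Y. \<Sum>i\<in>S. d w * (c i * choi_entry (F i) w))"
    unfolding d[OF lin] by (simp add: choi_entry_def case_prod_beta sum_distrib_left)
  also have "\<dots> = (\<Sum>i\<in>S. \<Sum>w\<in>X \<times> X \<times> Y \<times> Y. d w * (c i * choi_entry (F i) w))"
    by (rule sum.swap)
  also have "\<dots> = (\<Sum>i\<in>S. c i * g (F i))"
    by (intro sum.cong refl) (simp add: d[OF F] sum_distrib_left mult_ac)
  finally show ?thesis .
qed

text \<open>The witness \<open>2 |\<Phi>\<rangle>\<langle>\<Phi>| / D - 1\<close> on Choi matrices, for the maximally entangled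
  \<open>\<Phi> = \<Sum>k. l\<^sub>k \<otimes> r\<^sub>k\<close>: by Cauchy-Schwarz and Bessel its modulus on a product Kraus operator is at most
  the squared norm of that operator.\<close>

theorem sep_contr_lower_bound:
  fixes l :: "'k \<Rightarrow> 'a \<times> 'a \<Rightarrow> complex" and r :: "'k \<Rightarrow> 'b \<times> 'b \<Rightarrow> complex" and u :: "'k \<Rightarrow> real"
  assumes fin: "finite A" "finite B" "finite I"
    and l: "orth_family I (A \<times> A) N l" and r: "orth_family I (B \<times> B) N' r"
    and N: "0 < N" "0 < N'" "N * N' = real (card A) * real (card B)"
    and norm: "(\<Sum>k\<in>I. (u k)\<^sup>2) = 1"
    and W: "\<And>a b a' b'. a \<in> A \<Longrightarrow> b \<in> B \<Longrightarrow> a' \<in> A \<Longrightarrow> b' \<in> B \<Longrightarrow>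
      W (a, b) (a', b') = (\<Sum>k\<in>I. complex_of_real (u k) * l k (a, a') * r k (b, b'))"
    and F: "\<And>i. i \<in> {1..m::nat} \<Longrightarrow> sep_contr (A \<times> B) product_kraus (F i)"
    and dec: "\<And>M. M \<in> ops (A \<times> B) \<Longrightarrow>
      conj_map (A \<times> B) (A \<times> B) W M = (\<lambda>y y'. \<Sum>i=1..m. complex_of_real (a i) * F i M y y')"
  shows "2 * (\<Sum>k\<in>I. u k)\<^sup>2 - 1 \<le> (\<Sum>i=1..m. \<bar>a i\<bar>)"
proof -
  define X where "X = A \<times> B"
  define D where "D = N * N'"
  have D: "0 < D" unfolding D_def by (rule mult_pos_pos[OF N(1,2)])
  have X: "finite X" using fin by (simp add: X_def)
  define \<Phi> where "\<Phi> = (\<lambda>(a, b) (a', b'). \<Sum>k\<in>I. l k (a, a') * r k (b, b'))"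
  define ip where "ip = (\<lambda>K. \<Sum>p\<in>X. \<Sum>q\<in>X. cnj (\<Phi> p q) * K p q)"
  define nrm where "nrm = (\<lambda>K :: 'a \<times> 'b \<Rightarrow> 'a \<times> 'b \<Rightarrow> complex. \<Sum>p\<in>X. \<Sum>q\<in>X. (cmod (K p q))\<^sup>2)"
  \<comment> \<open>\<open>t\<close> is the trace of the Choi matrix, \<open>h\<close> its
    expectation in \<open>\<Phi>\<close>, and \<open>g\<close> the witness built from both.\<close>
  define t :: "('a \<times> 'b, 'a \<times> 'b) opmap \<Rightarrow> complex" where
    "t = (\<lambda>P. \<Sum>w\<in>X \<times> X. 1 * P (matrix_unit (fst w) (fst w)) (snd w) (snd w))"
  define h :: "('a \<times> 'b, 'a \<times> 'b) opmap \<Rightarrow> complex" where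
    "h = (\<lambda>P. \<Sum>w\<in>(X \<times> X) \<times> (X \<times> X). (cnj (\<Phi> (fst (fst w)) (snd (fst w))) * \<Phi> (fst (snd w)) (snd (snd w))) *
       P (matrix_unit (snd (fst w)) (snd (snd w))) (fst (fst w)) (fst (snd w)))"
  define g where "g = (\<lambda>P. complex_of_real (2 / D) * h P - t P)"
  have tf: "lin_form X X t"
    unfolding t_def by (intro lin_form_sum lin_form_unit X) auto
  have hf: "lin_form X X h"
    unfolding h_def by (intro lin_form_sum lin_form_unit X) auto
  have gf: "lin_form X X g"
    unfolding g_def by (intro lin_form_diff lin_form_scale hf tf)
  have sq: "z * cnj z = complex_of_real ((cmod z)\<^sup>2)" for z
    by (rule complex_norm_square[symmetric])
  have tK: "t (conj_map X X K) = complex_of_real (nrm K)" for K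
  proof -
    have "t (conj_map X X K) = (\<Sum>w\<in>X \<times> X. complex_of_real ((cmod (K (snd w) (fst w)))\<^sup>2))"
      unfolding t_def by (intro sum.cong refl) (auto simp: conj_map_eq_sandwich sandwich_unit[OF X] sq)
    also have "\<dots> = (\<Sum>q\<in>X. \<Sum>p\<in>X. complex_of_real ((cmod (K p q))\<^sup>2))"
      by (simp add: sum.cartesian_product case_prod_beta)
    also have "\<dots> = complex_of_real (nrm K)"
      unfolding nrm_def of_real_sum by (rule sum.swap)
    finally show ?thesis .
  qed
  have hK: "h (conj_map X X K) = complex_of_real ((cmod (ip K))\<^sup>2)" for K
  proof -
    have "h (conj_map X X K) = (\<Sum>w\<in>(X \<times> X) \<times> (X \<times> X). (cnj (\<Phi> (fst (fst w)) (snd (fst w))) * K (fst (fst w)) (snd (fst w))) *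
       cnj (cnj (\<Phi> (fst (snd w)) (snd (snd w))) * K (fst (snd w)) (snd (snd w))))"
      unfolding h_def by (intro sum.cong refl) (auto simp: conj_map_eq_sandwich sandwich_unit[OF X])
    also have "\<dots> = (\<Sum>w\<in>X \<times> X. cnj (\<Phi> (fst w) (snd w)) * K (fst w) (snd w)) *
        cnj (\<Sum>w\<in>X \<times> X. cnj (\<Phi> (fst w) (snd w)) * K (fst w) (snd w))"
      unfolding cnj_sum sum_product by (simp add: sum.cartesian_product case_prod_beta)
    also have "(\<Sum>w\<in>X \<times> X. cnj (\<Phi> (fst w) (snd w)) * K (fst w) (snd w)) = ip K"
      by (simp add: ip_def sum.cartesian_product case_prod_beta)
    finally show ?thesis
      by (simp add: sq)
  qed
  \<comment> \<open>Output and input labels are regrouped by party, since both the Schmidt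
    decomposition and product Kraus operators factorise across that cut.\<close>
  have pairs: "(\<Sum>p\<in>X. \<Sum>q\<in>X. f p q) = (\<Sum>z\<in>A \<times> A. \<Sum>z'\<in>B \<times> B. f (fst z, fst z') (snd z, snd z'))"
    for f :: "'a \<times> 'b \<Rightarrow> 'a \<times> 'b \<Rightarrow> 'c::comm_monoid_add"
  proof -
    have "(\<Sum>p\<in>X. \<Sum>q\<in>X. f p q) = (\<Sum>a\<in>A. \<Sum>b\<in>B. \<Sum>a'\<in>A. \<Sum>b'\<in>B. f (a, b) (a', b'))"
      by (simp add: X_def sum.cartesian_product')
    also have "\<dots> = (\<Sum>a\<in>A. \<Sum>a'\<in>A. \<Sum>b\<in>B. \<Sum>b'\<in>B. f (a, b) (a', b'))"
      by (intro sum.cong refl) (rule sum.swap)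
    finally show ?thesis
      by (simp add: sum.cartesian_product')
  qed
  have bound: "\<bar>Re (g (conj_map X X K))\<bar> \<le> Re (t (conj_map X X K))" if KP: "K \<in> product_kraus" for K
  proof -
    obtain k j where K: "K = kron k j"
      using KP unfolding product_kraus_def by blast
    define al where "al = (\<lambda>i. \<Sum>z\<in>A \<times> A. cnj (l i z) * k (fst z) (snd z))"
    define be where "be = (\<lambda>i. \<Sum>z\<in>B \<times> B. cnj (r i z) * j (fst z) (snd z))"
    have "ip K = (\<Sum>z\<in>A \<times> A. \<Sum>z'\<in>B \<times> B. \<Sum>i\<in>I. (cnj (l i z) * k (fst z) (snd z)) * (cnj (r i z') * j (fst z') (snd z')))"
      unfolding ip_def pairs K by (simp add: \<Phi>_def sum_distrib_left sum_distrib_right mult_ac)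
    also have "\<dots> = (\<Sum>i\<in>I. al i * be i)"
      unfolding al_def be_def sum_product by (simp only: sum.swap[of _ I])
    finally have "cmod (ip K) \<le> (\<Sum>i\<in>I. cmod (al i) * cmod (be i))"
      by (simp add: sum_norm_le norm_mult)
    then have "(cmod (ip K))\<^sup>2 \<le> (\<Sum>i\<in>I. cmod (al i) * cmod (be i))\<^sup>2"
      by (intro power_mono) auto
    also have "\<dots> \<le> (\<Sum>i\<in>I. (cmod (al i))\<^sup>2) * (\<Sum>i\<in>I. (cmod (be i))\<^sup>2)"
      by (rule Cauchy_Schwarz_ineq_sum)
    also have "\<dots> \<le> (N * (\<Sum>z\<in>A \<times> A. (cmod (k (fst z) (snd z)))\<^sup>2)) * (N' * (\<Sum>z\<in>B \<times> B. (cmod (j (fst z) (snd z)))\<^sup>2))"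
      unfolding al_def be_def using N
      by (intro mult_mono orth_family_bessel fin l r) (auto intro!: sum_nonneg mult_nonneg_nonneg)
    also have "\<dots> = D * nrm K"
    proof -
      have "(\<Sum>z\<in>A \<times> A. (cmod (k (fst z) (snd z)))\<^sup>2) * (\<Sum>z\<in>B \<times> B. (cmod (j (fst z) (snd z)))\<^sup>2) = nrm K"
        unfolding nrm_def pairs K sum_product by (simp add: norm_mult power_mult_distrib)
      then show ?thesis
        by (simp add: D_def mult_ac)
    qed
    \<comment> \<open>Since \<open>(cmod (ip K))^2 / D\<close> lies between \<open>0\<close> and
      \<open>nrm K\<close>, twice it minus \<open>nrm K\<close> lies between \<open>- nrm K\<close>
      and \<open>nrm K\<close>. The factor 2 of the witness is the largest for which this
      holds.\<close>
    finally have le: "(cmod (ip K))\<^sup>2 / D \<le> nrm K"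
      using D by (simp add: field_simps)
    have "0 \<le> (cmod (ip K))\<^sup>2 / D"
      using D by simp
    then show ?thesis
      using le unfolding g_def tK hK by simp
  qed
  have tT: "Re (t T) = real (card X)" if T: "tp X X T" for T
  proof -
    have tr: "(\<Sum>p\<in>X. T (matrix_unit q q) p p) = 1" if "q \<in> X" for q
    proof -
      have "trace_on X (T (matrix_unit q q)) = trace_on X (matrix_unit q q)"
        using T that by (simp add: tp_def)
      also have "\<dots> = 1"
        using that X by (simp add: trace_on_def matrix_unit_def)
      finally show ?thesis by (simp add: trace_on_def)
    qed
    have "t T = (\<Sum>q\<in>X. \<Sum>p\<in>X. T (matrix_unit q q) p p)"
      by (simp add: t_def sum.cartesian_product case_prod_beta)
    then show ?thesis
      by (simp add: tr)
  qed
  have cardX: "real (card X) = D"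
    using N by (simp add: X_def D_def card_cartesian_product)
  have gF: "\<bar>Re (g (F i))\<bar> \<le> D" if "i \<in> {1..m}" for i
    using sep_contr_bound[OF F[OF that, folded X_def] gf tf bound tT] by (simp add: cardX)
  have "g (conj_map X X W) = (\<Sum>i=1..m. complex_of_real (a i) * g (F i))"
  proof -
    have lin: "linear_map X X (F i)" if "i \<in> {1..m}" for i
      using F[OF that] by (simp add: sep_contr_def X_def)
    have lins: "linear_map X X (\<lambda>M y y'. \<Sum>i=1..m. complex_of_real (a i) * F i M y y')"
      by (intro linear_map_sum_maps linear_map_scale lin)
    have gs: "g (\<lambda>M y y'. \<Sum>i=1..m. complex_of_real (a i) * F i M y y') = (\<Sum>i=1..m. complex_of_real (a i) * g (F i))"
      by (rule lin_form_lin_comb[OF gf lin])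
    show ?thesis
      unfolding gs[symmetric]
      by (rule lin_form_cong_map[OF gf linear_map_conj_map lins]) (use dec in \<open>simp add: X_def\<close>)
  qed
  then have "Re (g (conj_map X X W)) = (\<Sum>i=1..m. a i * Re (g (F i)))"
    by simp
  also have "\<dots> \<le> (\<Sum>i=1..m. \<bar>a i\<bar> * D)"
  proof (rule sum_mono)
    fix i assume "i \<in> {1..m}"
    have "a i * Re (g (F i)) \<le> \<bar>a i\<bar> * \<bar>Re (g (F i))\<bar>"
      by (simp flip: abs_mult)
    also have "\<dots> \<le> \<bar>a i\<bar> * D"
      by (rule mult_left_mono[OF gF[OF \<open>i \<in> {1..m}\<close>]]) simp
    finally show "a i * Re (g (F i)) \<le> \<bar>a i\<bar> * D" .
  qed
  finally have up: "Re (g (conj_map X X W)) \<le> D * (\<Sum>i=1..m. \<bar>a i\<bar>)"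
    by (simp add: sum_distrib_left mult.commute)
  have Wz: "W (fst z, fst z') (snd z, snd z') = (\<Sum>k\<in>I. complex_of_real (u k) * l k z * r k z')"
    if "z \<in> A \<times> A" "z' \<in> B \<times> B" for z z'
    using that W by (cases z; cases z') auto
  have "ip W = (\<Sum>z\<in>A \<times> A. \<Sum>z'\<in>B \<times> B. cnj (\<Sum>k\<in>I. 1 * l k z * r k z') * (\<Sum>k\<in>I. complex_of_real (u k) * l k z * r k z'))"
    unfolding ip_def pairs by (intro sum.cong refl) (simp add: Wz \<Phi>_def)
  also have "\<dots> = complex_of_real (D * (\<Sum>k\<in>I. u k))"
    unfolding orth_family_expand[OF fin(3) l r] by (simp add: D_def)
  finally have ipW: "ip W = complex_of_real (D * (\<Sum>k\<in>I. u k))" .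
  have "complex_of_real (nrm W) = (\<Sum>z\<in>A \<times> A. \<Sum>z'\<in>B \<times> B. cnj (\<Sum>k\<in>I. complex_of_real (u k) * l k z * r k z') *
      (\<Sum>k\<in>I. complex_of_real (u k) * l k z * r k z'))"
    unfolding nrm_def pairs of_real_sum by (intro sum.cong refl) (simp only: Wz sq[symmetric] mult.commute)
  also have "\<dots> = complex_of_real (D * (\<Sum>k\<in>I. (u k)\<^sup>2))"
    unfolding orth_family_expand[OF fin(3) l r] by (simp add: D_def power2_eq_square)
  finally have nW: "nrm W = D"
    by (simp only: norm of_real_eq_iff mult_1_right)
  have "Re (g (conj_map X X W)) = 2 / D * (D * (\<Sum>k\<in>I. u k))\<^sup>2 - D"
    unfolding g_def tK hK ipW nW norm_of_real by simp
  also have "\<dots> = D * (2 * (\<Sum>k\<in>I. u k)\<^sup>2 - 1)"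
    using D by (simp add: power2_eq_square field_simps)
  finally show ?thesis
    using up D by simp
qed

section \<open>Tensor products of two-qubit unitaries\<close>

definition phase :: "bool \<Rightarrow> complex" where
  "phase b = (if b then \<i> else 1)"

text \<open>The Kraus operators of the polarisation identity, half the sum and half the difference
  of \<open>phase b * l\<close> and \<open>l'\<close>. The phase \<open>\<i>\<close> yields the
  imaginary part of the cross term, up to sign, in place of the real part.\<close>

definition polar_pair :: "bool \<Rightarrow> ('a \<Rightarrow> 'a \<Rightarrow> complex) \<Rightarrow> ('a \<Rightarrow> 'a \<Rightarrow> complex) \<Rightarrow> nat \<Rightarrow> 'a \<Rightarrow> 'a \<Rightarrow> complex" where
  "polar_pair b l l' = (\<lambda>s a a'. (phase b * l a a' + (if s = 0 then 1 else -1) * l' a a') / 2)"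

lemma cnj_phase_mult: "cnj (phase b) * phase b = 1"
  by (simp add: phase_def)

text \<open>Parallelogram law: the cross terms of the two outcomes cancel.\<close>

lemma kraus_pair_polar:
  assumes l: "isometric A A l" and l': "isometric A A l'"
  shows "kraus_pair A (polar_pair b l l')"
  unfolding kraus_pair_def
proof (intro ballI)
  fix i j assume ij: "i \<in> A" "j \<in> A"
  have pt: "cnj (polar_pair b l l' 0 k i) * polar_pair b l l' 0 k j + cnj (polar_pair b l l' 1 k i) * polar_pair b l l' 1 k j
      = (cnj (l k i) * l k j + cnj (l' k i) * l' k j) / 2" for k
  proof -
    have "cnj (polar_pair b l l' 0 k i) * polar_pair b l l' 0 k j + cnj (polar_pair b l l' 1 k i) * polar_pair b l l' 1 k j
      = ((cnj (phase b) * phase b) * (cnj (l k i) * l k j) + cnj (l' k i) * l' k j) / 2"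
      by (simp add: polar_pair_def field_simps)
    then show ?thesis by (simp add: cnj_phase_mult)
  qed
  have "(\<Sum>k\<in>A. cnj (polar_pair b l l' 0 k i) * polar_pair b l l' 0 k j) +
      (\<Sum>k\<in>A. cnj (polar_pair b l l' 1 k i) * polar_pair b l l' 1 k j)
    = ((\<Sum>k\<in>A. cnj (l k i) * l k j) + (\<Sum>k\<in>A. cnj (l' k i) * l' k j)) / 2"
    unfolding sum.distrib[symmetric] by (simp only: pt sum_divide_distrib)
  also have "\<dots> = (if i = j then 1 else 0)"
    using l l' ij by (simp add: isometric_def)
  finally show "(\<Sum>k\<in>A. cnj (polar_pair b l l' 0 k i) * polar_pair b l l' 0 k j) +
      (\<Sum>k\<in>A. cnj (polar_pair b l l' 1 k i) * polar_pair b l l' 1 k j) = (if i = j then 1 else 0)" .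
qed

lemma signed_map_polar_unit:
  assumes "finite A" "a \<in> A" "a' \<in> A" "c \<in> A" "c' \<in> A"
  shows "signed_map A (polar_pair b l l') (matrix_unit a a') c c'
    = (phase b * (l c a * cnj (l' c' a')) + cnj (phase b) * (l' c a * cnj (l c' a'))) / 2"
  using assms by (simp add: signed_map_def conj_map_eq_sandwich sandwich_unit polar_pair_def field_simps)

lemma matrix_unit_Pair: "matrix_unit (a, b) (a', b') (c, d) (c', d') = matrix_unit a a' c c' * matrix_unit b b' d d'"
  by (simp add: matrix_unit_def)

lemma tensor_map_unit:
  assumes E: "linear_map A A' E" and F: "linear_map B B' F" and fin: "finite A" "finite B"
    and u: "a \<in> A" "b \<in> B" "a' \<in> A" "b' \<in> B"
  shows "tensor_map E F (matrix_unit (a, b) (a', b')) (c, d) (c', d') = E (matrix_unit a a') c c' * F (matrix_unit b b') d d'"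
proof -
  have 1: "F (\<lambda>t t'. matrix_unit (a, b) (a', b') (s, t) (s', t')) d d' = F (matrix_unit b b') d d' * matrix_unit a a' s s'" for s s'
  proof -
    have "(\<lambda>t t'. matrix_unit (a, b) (a', b') (s, t) (s', t')) = (\<lambda>t t'. matrix_unit a a' s s' * matrix_unit b b' t t')"
      by (simp add: matrix_unit_Pair)
    then show ?thesis
      using linear_mapD(3)[OF F matrix_unit_in_ops[OF u(2,4)]] by (simp add: mult.commute)
  qed
  show ?thesis
    unfolding tensor_map_def prod.case 1 linear_mapD(3)[OF E matrix_unit_in_ops[OF u(1,3)]]
    by (simp add: mult.commute)
qed

text \<open>If \<open>q = cnj p\<close>, then \<open>x False p q\<close> and
  \<open>- x True p q\<close> are the real and the imaginary part of \<open>p\<close>, and the first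
  identity computes the real part of a product. By the second one a diagonal term has no imaginary
  part.\<close>

lemma polar_product_identities:
  defines "x b p q \<equiv> (phase b * p + cnj (phase b) * q) / 2"
  shows "x False p q * x False p' q' - x True p q * x True p' q' = (p * p' + q * q') / 2"
    and "x True p p = 0"
  by (simp_all add: x_def phase_def field_simps)

definition qubit_schmidt :: "(bool \<times> bool \<Rightarrow> bool \<times> bool \<Rightarrow> complex) \<Rightarrow> (nat \<Rightarrow> real) \<Rightarrow>
    (nat \<Rightarrow> bool \<Rightarrow> bool \<Rightarrow> complex) \<Rightarrow> (nat \<Rightarrow> bool \<Rightarrow> bool \<Rightarrow> complex) \<Rightarrow> bool" where
  "qubit_schmidt W u L R \<longleftrightarrow>
     (\<forall>k. 0 \<le> u k) \<and> (\<Sum>k<4. (u k)\<^sup>2) = 1 \<and>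
     (\<forall>k<4. isometric UNIV UNIV (L k) \<and> isometric UNIV UNIV (R k)) \<and>
     (\<forall>k<4. \<forall>l<4. (\<Sum>x\<in>UNIV. \<Sum>y\<in>UNIV. cnj (L k x y) * L l x y) = (if k = l then 2 else 0)) \<and>
     (\<forall>k<4. \<forall>l<4. (\<Sum>x\<in>UNIV. \<Sum>y\<in>UNIV. cnj (R k x y) * R l x y) = (if k = l then 2 else 0)) \<and>
     (\<forall>x y x' y'. W (x, y) (x', y') = (\<Sum>k<4. complex_of_real (u k) * L k x x' * R k y y'))"

lemma qubit_schmidt_exists:
  assumes W: "unitary UNIV UNIV W"
  shows "\<exists>u L R. qubit_schmidt W u L R"
proof -
  obtain u :: "nat \<Rightarrow> real" and L R :: "nat \<Rightarrow> bool \<Rightarrow> bool \<Rightarrow> complex" where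
    u: "\<And>k. 0 \<le> u k"
    and iso: "\<And>k. k < 4 \<Longrightarrow> isometric UNIV UNIV (L k)" "\<And>k. k < 4 \<Longrightarrow> isometric UNIV UNIV (R k)"
    and L: "\<And>k l. k < 4 \<Longrightarrow> l < 4 \<Longrightarrow> (\<Sum>x\<in>UNIV. \<Sum>y\<in>UNIV. cnj (L k x y) * L l x y) = (if k = l then 2 else 0)"
    and R: "\<And>k l. k < 4 \<Longrightarrow> l < 4 \<Longrightarrow> (\<Sum>x\<in>UNIV. \<Sum>y\<in>UNIV. cnj (R k x y) * R l x y) = (if k = l then 2 else 0)"
    and dec: "\<And>x y x' y'. W (x, y) (x', y') = (\<Sum>k<4. complex_of_real (u k) * L k x x' * R k y y')"
    by (rule two_qubit_decomposition[OF W]) (rule that; assumption)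
  have oL: "orth_family {..<4} (UNIV \<times> UNIV) 2 (\<lambda>k z. L k (fst z) (snd z))"
    and oR: "orth_family {..<4} (UNIV \<times> UNIV) 2 (\<lambda>k z. R k (fst z) (snd z))"
    unfolding orth_family_def using L R by (simp_all only: sum.cartesian_product' fst_conv snd_conv) auto
  \<comment> \<open>The squared Hilbert-Schmidt norm of \<open>W\<close> is 4, the dimension. Each
    product of an \<open>L k\<close> with an \<open>R k\<close> also has squared norm
    \<open>2 * 2\<close>, so the squares of the \<open>u k\<close> sum to 1.\<close>
  have "(\<Sum>q\<in>UNIV. \<Sum>p\<in>UNIV. cnj (W p q) * W p q) = (\<Sum>q\<in>(UNIV :: (bool \<times> bool) set). 1)"
    using W unfolding unitary_def by (intro sum.cong refl) auto
  then have "4 = (\<Sum>q\<in>UNIV. \<Sum>p\<in>UNIV. cnj (W p q) * W p q)"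
    by (simp add: sum_bool_prod)
  also have "\<dots> = (\<Sum>z\<in>UNIV \<times> UNIV. \<Sum>z'\<in>UNIV \<times> UNIV.
      cnj (W (fst z, fst z') (snd z, snd z')) * W (fst z, fst z') (snd z, snd z'))"
    by (simp add: sum_bool_prod add_ac)
  also have "\<dots> = (\<Sum>z\<in>UNIV \<times> UNIV. \<Sum>z'\<in>UNIV \<times> UNIV.
      cnj (\<Sum>k<4. complex_of_real (u k) * L k (fst z) (snd z) * R k (fst z') (snd z')) *
      (\<Sum>k<4. complex_of_real (u k) * L k (fst z) (snd z) * R k (fst z') (snd z')))"
    unfolding dec ..
  also have "\<dots> = 4 * (\<Sum>k<4. complex_of_real ((u k)\<^sup>2))"
    unfolding orth_family_expand[OF finite_lessThan oL oR] by (simp add: power2_eq_square)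
  finally have "complex_of_real (\<Sum>k<4. (u k)\<^sup>2) = 1"
    by simp
  then have "(\<Sum>k<4. (u k)\<^sup>2) = 1"
    by (simp only: of_real_eq_1_iff)
  then show ?thesis
    unfolding qubit_schmidt_def using u iso L R dec by blast
qed

text \<open>Basis labels of \<open>n\<close> qubits as bit strings. Two label sets are needed: the
  extensional functions of \<open>tensor_maps\<close>, with the identity, and the numbers below
  \<open>2 ^ n\<close>, since surrounding systems of a black box are labelled by numbers.\<close>

definition coords :: "nat \<Rightarrow> 'a set \<Rightarrow> ('a \<Rightarrow> nat \<Rightarrow> bool) \<Rightarrow> bool" where
  "coords n A e \<longleftrightarrow> bij_betw e A (\<Pi>\<^sub>E j\<in>{1..n}. UNIV)"

lemma sum_coords:
  fixes f :: "nat \<Rightarrow> bool \<Rightarrow> 'c::comm_semiring_1"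
  assumes "coords n A e"
  shows "(\<Sum>a\<in>A. \<Prod>j=1..n. f j (e a j)) = (\<Prod>j=1..n. \<Sum>x\<in>UNIV. f j x)"
proof -
  have "(\<Sum>a\<in>A. \<Prod>j=1..n. f j (e a j)) = (\<Sum>g\<in>(\<Pi>\<^sub>E j\<in>{1..n}. UNIV). \<Prod>j=1..n. f j (g j))"
    using sum.reindex_bij_betw[of e A _ "\<lambda>g. \<Prod>j=1..n. f j (g j)"] assms by (simp add: coords_def)
  then show ?thesis
    by (simp add: prod_sum_PiE)
qed

lemma coords_finite: "coords n A e \<Longrightarrow> finite A"
  by (auto simp: coords_def bij_betw_finite finite_PiE)

lemma coords_card: "coords n A e \<Longrightarrow> card A = 2 ^ n"
  by (simp add: coords_def bij_betw_same_card card_PiE)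

lemma coords_eq_iff:
  assumes e: "coords n A e" and a: "a \<in> A" "a' \<in> A"
  shows "a = a' \<longleftrightarrow> (\<forall>j\<in>{1..n}. e a j = e a' j)"
proof
  assume *: "\<forall>j\<in>{1..n}. e a j = e a' j"
  have "e a \<in> (\<Pi>\<^sub>E j\<in>{1..n}. UNIV)" "e a' \<in> (\<Pi>\<^sub>E j\<in>{1..n}. UNIV)"
    using e a by (auto simp: coords_def bij_betw_def)
  then have "e a = e a'"
    by (rule PiE_ext) (use * in auto)
  then show "a = a'"
    using e a by (auto simp: coords_def bij_betw_def inj_on_def)
qed simp

lemma prod_delta:
  "finite J \<Longrightarrow> (\<Prod>j\<in>J. if P j then c else 0 :: 'c::comm_semiring_1) = (if \<forall>j\<in>J. P j then c ^ card J else 0)"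
  by (induction J rule: finite_induct) auto

definition prod_op :: "nat \<Rightarrow> ('a \<Rightarrow> nat \<Rightarrow> bool) \<Rightarrow> (nat \<Rightarrow> nat \<Rightarrow> bool \<Rightarrow> bool \<Rightarrow> complex) \<Rightarrow> (nat \<Rightarrow> nat) \<Rightarrow> 'a \<Rightarrow> 'a \<Rightarrow> complex" where
  "prod_op n e L \<kappa> a a' = (\<Prod>j=1..n. L j (\<kappa> j) (e a j) (e a' j))"

definition multi_index :: "nat \<Rightarrow> (nat \<Rightarrow> nat) set" where
  "multi_index n = (\<Pi>\<^sub>E j\<in>{1..n}. {..<4})"

lemma finite_multi_index [simp]: "finite (multi_index n)"
  by (simp add: multi_index_def finite_PiE)

lemma multi_index_less: "\<kappa> \<in> multi_index n \<Longrightarrow> j \<in> {1..n} \<Longrightarrow> \<kappa> j < 4"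
  by (auto simp: multi_index_def)

lemma prod_op_isometric:
  assumes e: "coords n A e" and \<kappa>: "\<kappa> \<in> multi_index n"
    and L: "\<And>j k. j \<in> {1..n} \<Longrightarrow> k < 4 \<Longrightarrow> isometric UNIV UNIV (L j k)"
  shows "isometric A A (prod_op n e L \<kappa>)"
  unfolding isometric_def
proof (intro ballI)
  fix a a' assume a: "a \<in> A" "a' \<in> A"
  have "(\<Sum>k\<in>A. cnj (prod_op n e L \<kappa> k a) * prod_op n e L \<kappa> k a')
      = (\<Sum>k\<in>A. \<Prod>j=1..n. cnj (L j (\<kappa> j) (e k j) (e a j)) * L j (\<kappa> j) (e k j) (e a' j))"
    by (simp add: prod_op_def prod.distrib)
  also have "\<dots> = (\<Prod>j=1..n. \<Sum>x\<in>UNIV. cnj (L j (\<kappa> j) x (e a j)) * L j (\<kappa> j) x (e a' j))"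
    by (rule sum_coords[OF e, where f = "\<lambda>j x. cnj (L j (\<kappa> j) x (e a j)) * L j (\<kappa> j) x (e a' j)"])
  also have "\<dots> = (\<Prod>j=1..n. if e a j = e a' j then 1 else 0)"
    using L multi_index_less[OF \<kappa>] by (intro prod.cong refl) (auto simp: isometric_def)
  also have "\<dots> = (if a = a' then 1 else 0)"
    by (simp add: prod_delta coords_eq_iff[OF e a])
  finally show "(\<Sum>k\<in>A. cnj (prod_op n e L \<kappa> k a) * prod_op n e L \<kappa> k a') = (if a = a' then 1 else 0)" .
qed

lemma prod_op_orth_family:
  assumes e: "coords n A e"
    and L: "\<And>j k l. j \<in> {1..n} \<Longrightarrow> k < 4 \<Longrightarrow> l < 4 \<Longrightarrow>
      (\<Sum>x\<in>UNIV. \<Sum>y\<in>UNIV. cnj (L j k x y) * L j l x y) = (if k = l then 2 else 0)"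
  shows "orth_family (multi_index n) (A \<times> A) (2 ^ n) (\<lambda>\<kappa> z. prod_op n e L \<kappa> (fst z) (snd z))"
  unfolding orth_family_def
proof (intro ballI)
  fix \<kappa> \<kappa>' assume \<kappa>: "\<kappa> \<in> multi_index n" "\<kappa>' \<in> multi_index n"
  have "(\<Sum>z\<in>A \<times> A. cnj (prod_op n e L \<kappa> (fst z) (snd z)) * prod_op n e L \<kappa>' (fst z) (snd z))
      = (\<Sum>a\<in>A. \<Sum>a'\<in>A. \<Prod>j=1..n. cnj (L j (\<kappa> j) (e a j) (e a' j)) * L j (\<kappa>' j) (e a j) (e a' j))"
    by (simp add: prod_op_def prod.distrib sum.cartesian_product')
  also have "\<dots> = (\<Sum>a\<in>A. \<Prod>j=1..n. \<Sum>y\<in>UNIV. cnj (L j (\<kappa> j) (e a j) y) * L j (\<kappa>' j) (e a j) y)"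
    by (intro sum.cong refl sum_coords[OF e, where f = "\<lambda>j y. cnj (L j (\<kappa> j) (e _ j) y) * L j (\<kappa>' j) (e _ j) y"])
  also have "\<dots> = (\<Prod>j=1..n. \<Sum>x\<in>UNIV. \<Sum>y\<in>UNIV. cnj (L j (\<kappa> j) x y) * L j (\<kappa>' j) x y)"
    by (rule sum_coords[OF e, where f = "\<lambda>j x. \<Sum>y\<in>UNIV. cnj (L j (\<kappa> j) x y) * L j (\<kappa>' j) x y"])
  also have "\<dots> = (\<Prod>j=1..n. if \<kappa> j = \<kappa>' j then 2 else 0)"
    using L multi_index_less[OF \<kappa>(1)] multi_index_less[OF \<kappa>(2)] by (intro prod.cong refl) auto
  also have "\<dots> = (if \<kappa> = \<kappa>' then 2 ^ n else 0)"
  proof -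
    have "\<kappa> = \<kappa>' \<longleftrightarrow> (\<forall>j\<in>{1..n}. \<kappa> j = \<kappa>' j)"
      using \<kappa> unfolding multi_index_def by (auto intro: PiE_ext)
    then show ?thesis
      by (simp add: prod_delta)
  qed
  finally show "(\<Sum>z\<in>A \<times> A. cnj (prod_op n e L \<kappa> (fst z) (snd z)) * prod_op n e L \<kappa>' (fst z) (snd z))
      = (if \<kappa> = \<kappa>' then complex_of_real (2 ^ n) else 0)"
    by simp
qed

locale qubit_unitaries =
  fixes n :: nat and W :: "nat \<Rightarrow> bool \<times> bool \<Rightarrow> bool \<times> bool \<Rightarrow> complex"
    and u :: "nat \<Rightarrow> nat \<Rightarrow> real" and L R :: "nat \<Rightarrow> nat \<Rightarrow> bool \<Rightarrow> bool \<Rightarrow> complex"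
  assumes schmidt: "\<And>j. j \<in> {1..n} \<Longrightarrow> qubit_schmidt (W j) (u j) (L j) (R j)"
begin

definition weight :: "(nat \<Rightarrow> nat) \<Rightarrow> real" where
  "weight \<kappa> = (\<Prod>j=1..n. u j (\<kappa> j))"

definition extent :: real where
  "extent = 2 * (\<Sum>\<kappa>\<in>multi_index n. weight \<kappa>)\<^sup>2 - 1"

definition prod_unitary :: "('a \<Rightarrow> nat \<Rightarrow> bool) \<Rightarrow> ('b \<Rightarrow> nat \<Rightarrow> bool) \<Rightarrow> 'a \<times> 'b \<Rightarrow> 'a \<times> 'b \<Rightarrow> complex" where
  "prod_unitary e e' = (\<lambda>(a, b) (a', b'). \<Prod>j=1..n. W j (e a j, e' b j) (e a' j, e' b' j))"

lemma u_nonneg: "j \<in> {1..n} \<Longrightarrow> 0 \<le> u j k"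
  using schmidt by (simp add: qubit_schmidt_def)

lemma weight_nonneg: "0 \<le> weight \<kappa>"
  unfolding weight_def by (rule prod_nonneg) (use u_nonneg in auto)

lemma weight_norm: "(\<Sum>\<kappa>\<in>multi_index n. (weight \<kappa>)\<^sup>2) = 1"
proof -
  have "(\<Sum>\<kappa>\<in>multi_index n. (weight \<kappa>)\<^sup>2) = (\<Sum>\<kappa>\<in>multi_index n. \<Prod>j=1..n. (u j (\<kappa> j))\<^sup>2)"
    by (simp add: weight_def prod_power_distrib)
  also have "\<dots> = (\<Prod>j=1..n. \<Sum>k<4. (u j k)\<^sup>2)"
    unfolding multi_index_def by (subst prod_sum_PiE) auto
  also have "\<dots> = 1"
    using schmidt by (intro prod.neutral) (simp add: qubit_schmidt_def)
  finally show ?thesis .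
qed

lemma isoL: "j \<in> {1..n} \<Longrightarrow> k < 4 \<Longrightarrow> isometric UNIV UNIV (L j k)"
  and isoR: "j \<in> {1..n} \<Longrightarrow> k < 4 \<Longrightarrow> isometric UNIV UNIV (R j k)"
  using schmidt by (simp_all add: qubit_schmidt_def)

lemma orthL: "j \<in> {1..n} \<Longrightarrow> k < 4 \<Longrightarrow> l < 4 \<Longrightarrow>
      (\<Sum>x\<in>UNIV. \<Sum>y\<in>UNIV. cnj (L j k x y) * L j l x y) = (if k = l then 2 else 0)"
  and orthR: "j \<in> {1..n} \<Longrightarrow> k < 4 \<Longrightarrow> l < 4 \<Longrightarrow>
      (\<Sum>x\<in>UNIV. \<Sum>y\<in>UNIV. cnj (R j k x y) * R j l x y) = (if k = l then 2 else 0)"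
  using schmidt by (simp_all add: qubit_schmidt_def)

lemma W_expand: "j \<in> {1..n} \<Longrightarrow>
    W j (x, y) (x', y') = (\<Sum>k<4. complex_of_real (u j k) * L j k x x' * R j k y y')"
  using schmidt by (simp add: qubit_schmidt_def)

text \<open>Multiplying out the decompositions of the factors gives the Schmidt decomposition across
  the cut between the two parties.\<close>

lemma prod_unitary_expand:
  "prod_unitary e e' (a, b) (a', b') =
    (\<Sum>\<kappa>\<in>multi_index n. complex_of_real (weight \<kappa>) * prod_op n e L \<kappa> a a' * prod_op n e' R \<kappa> b b')"
proof -
  have "prod_unitary e e' (a, b) (a', b') = (\<Prod>j=1..n. \<Sum>k<4. complex_of_real (u j k) * L j k (e a j) (e a' j) * R j k (e' b j) (e' b' j))"
    unfolding prod_unitary_def prod.case by (intro prod.cong refl W_expand)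
  also have "\<dots> = (\<Sum>\<kappa>\<in>multi_index n. \<Prod>j=1..n. complex_of_real (u j (\<kappa> j)) * L j (\<kappa> j) (e a j) (e a' j) * R j (\<kappa> j) (e' b j) (e' b' j))"
    unfolding multi_index_def by (subst prod_sum_PiE) auto
  finally show ?thesis
    by (simp add: weight_def prod_op_def prod.distrib)
qed

lemma lower_bound:
  assumes e: "coords n A e" and e': "coords n B e'"
    and F: "\<And>i. i \<in> {1..m::nat} \<Longrightarrow> sep_contr (A \<times> B) product_kraus (F i)"
    and dec: "\<And>M. M \<in> ops (A \<times> B) \<Longrightarrow>
      conj_map (A \<times> B) (A \<times> B) (prod_unitary e e') M = (\<lambda>y y'. \<Sum>i=1..m. complex_of_real (a i) * F i M y y')"
  shows "extent \<le> (\<Sum>i=1..m. \<bar>a i\<bar>)"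
  unfolding extent_def
proof (rule sep_contr_lower_bound[OF coords_finite[OF e] coords_finite[OF e'] finite_multi_index
      prod_op_orth_family[OF e orthL] prod_op_orth_family[OF e' orthR] _ _ _ weight_norm _ F dec])
  show "2 ^ n * 2 ^ n = real (card A) * real (card B)"
    by (simp add: coords_card[OF e] coords_card[OF e'])
qed (auto simp: prod_unitary_expand)

abbreviation labels :: "(nat \<Rightarrow> bool) set" where
  "labels \<equiv> (\<Pi>\<^sub>E j\<in>{1..n}. qubit)"

lemma coords_labels: "coords n labels id"
  by (simp add: coords_def)

lemma finite_labels: "finite labels"
  by (simp add: finite_PiE)

lemma tensor_maps_conj_map:
  assumes U: "\<And>j. j \<in> {1..n} \<Longrightarrow> U j = conj_map (qubit \<times> qubit) (qubit \<times> qubit) (W j)"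
  shows "tensor_maps n (\<lambda>_. qubit) (\<lambda>_. qubit) U M = conj_map (labels \<times> labels) (labels \<times> labels) (prod_unitary id id) M"
proof -
  have U_unit: "U j (matrix_unit q q') p p' = W j p q * cnj (W j p' q')" if "j \<in> {1..n}" for j q q' p p'
    unfolding U[OF that] conj_map_eq_sandwich by (subst sandwich_unit) auto
  have pr: "(\<Prod>j=1..n. U j (matrix_unit (fst q j, snd q j) (fst q' j, snd q' j)) (fst p j, snd p j) (fst p' j, snd p' j))
      = prod_unitary id id p q * cnj (prod_unitary id id p' q')" for p p' q q'
    by (simp add: U_unit prod_unitary_def case_prod_beta prod.distrib)
  show ?thesis
    unfolding tensor_maps_def conj_map_def Let_def pr by (simp add: fun_eq_iff mult_ac)
qed

text \<open>An ordered pair of multi-indices and the choice between the two polarised products. The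
  same index set and coefficients serve the tensor product and the black box decomposition.\<close>

definition terms :: "((nat \<Rightarrow> nat) \<times> (nat \<Rightarrow> nat) \<times> bool) set" where
  "terms = multi_index n \<times> multi_index n \<times> UNIV"

definition term_coeff :: "(nat \<Rightarrow> nat) \<times> (nat \<Rightarrow> nat) \<times> bool \<Rightarrow> real" where
  "term_coeff = (\<lambda>(\<kappa>, \<kappa>', b). if b then (if \<kappa> = \<kappa>' then 0 else - (weight \<kappa> * weight \<kappa>')) else weight \<kappa> * weight \<kappa>')"

lemma finite_terms: "finite terms"
  by (simp add: terms_def)

lemma sum_term_coeff: "(\<Sum>t\<in>terms. \<bar>term_coeff t\<bar>) = extent"
  using weighted_pair_norm[OF finite_multi_index weight_nonneg weight_norm]
  by (simp add: terms_def term_coeff_def extent_def case_prod_unfold)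

lemma card_terms: "1 \<le> card terms"
proof -
  have "multi_index n \<noteq> {}"
    by (simp add: multi_index_def PiE_eq_empty_iff lessThan_empty_iff)
  then have "terms \<noteq> {}"
    by (auto simp: terms_def)
  then show ?thesis
    using finite_terms by (simp add: Suc_le_eq card_gt_0_iff)
qed

lemma quasi_extent_eq:
  assumes U: "\<And>j. j \<in> {1..n} \<Longrightarrow> U j = conj_map (qubit \<times> qubit) (qubit \<times> qubit) (W j)"
  shows "quasi_extent (labels \<times> labels) (lo_star labels labels) (tensor_maps n (\<lambda>_. qubit) (\<lambda>_. qubit) U) = ereal extent"
proof -
  define K where "K = (\<lambda>(M :: nat \<Rightarrow> nat \<Rightarrow> bool \<Rightarrow> bool \<Rightarrow> complex) (\<kappa>, \<kappa>', b). polar_pair b (prod_op n id M \<kappa>) (prod_op n id M \<kappa>'))"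
  define G where "G = (\<lambda>t. tensor_map (signed_map labels (K L t)) (signed_map labels (K R t)))"
  have G: "G t \<in> lo_star labels labels" if mem: "t \<in> terms" for t
  proof -
    obtain \<kappa> \<kappa>' b where t: "t = (\<kappa>, \<kappa>', b)" "\<kappa> \<in> multi_index n" "\<kappa>' \<in> multi_index n"
      using mem by (auto simp: terms_def)
    show ?thesis
      unfolding G_def t(1) K_def prod.case
      by (intro signed_product_lo_star finite_labels kraus_pair_polar prod_op_isometric coords_labels t isoL isoR)
  qed
  \<comment> \<open>\<open>quasi_extent\<close> wants the terms numbered from 1.\<close>
  obtain h where h: "bij_betw h {1..card terms} terms"
    using ex_bij_betw_nat_finite_1[OF finite_terms] by blast
  have h_sum: "(\<Sum>i=1..card terms. f (h i)) = (\<Sum>t\<in>terms. f t)" for f :: "_ \<Rightarrow> 'z::comm_monoid_add"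
    by (rule sum.reindex_bij_betw[OF h])
  let ?X = "labels \<times> labels"
  have linG: "linear_map ?X ?X (G t)" for t
    unfolding G_def by (intro linear_map_tensor_map linear_map_signed_map)
  have dec: "conj_map ?X ?X (prod_unitary id id) M = (\<lambda>y y'. \<Sum>i=1..card terms. complex_of_real (term_coeff (h i)) * G (h i) M y y')"
    if M: "M \<in> ops ?X" for M
  proof (rule linear_map_eqI[OF linear_map_conj_map linear_map_sum_maps _ M])
    show "linear_map ?X ?X (\<lambda>M y y'. complex_of_real (term_coeff (h i)) * G (h i) M y y')" for i
      by (intro linear_map_scale linG)
    show finX: "finite ?X"
      using finite_labels by simp
    fix p p' y y' assume mem: "p \<in> ?X" "p' \<in> ?X" "y \<in> ?X" "y' \<in> ?X"
    obtain a0 b0 a1 b1 c d c' d' where eq: "p = (a0, b0)" "p' = (a1, b1)" "y = (c, d)" "y' = (c', d')"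
      by (metis surj_pair)
    have lab: "a0 \<in> labels" "b0 \<in> labels" "a1 \<in> labels" "b1 \<in> labels" "c \<in> labels" "d \<in> labels" "c' \<in> labels" "d' \<in> labels"
      using mem unfolding eq by auto
    define l where "l = (\<lambda>\<kappa>. prod_op n id L \<kappa> c a0)"
    define l' where "l' = (\<lambda>\<kappa>. cnj (prod_op n id L \<kappa> c' a1))"
    define r where "r = (\<lambda>\<kappa>. prod_op n id R \<kappa> d b0)"
    define r' where "r' = (\<lambda>\<kappa>. cnj (prod_op n id R \<kappa> d' b1))"
    define x where "x = (\<lambda>b p q :: complex. (phase b * p + cnj (phase b) * q) / 2)"
    define H where "H = (\<lambda>\<kappa> \<kappa>'. (l \<kappa> * l' \<kappa>') * (r \<kappa> * r' \<kappa>'))"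
    \<comment> \<open>On matrix units both local maps become polarised expressions in scalar
      amplitudes, to which the identities for polarised products apply.\<close>
    have G_unit: "G (\<kappa>, \<kappa>', b) (matrix_unit p p') y y' = x b (l \<kappa> * l' \<kappa>') (l \<kappa>' * l' \<kappa>) * x b (r \<kappa> * r' \<kappa>') (r \<kappa>' * r' \<kappa>)" for \<kappa> \<kappa>' b
      unfolding eq G_def K_def prod.case
        tensor_map_unit[OF linear_map_signed_map linear_map_signed_map finite_labels finite_labels lab(1,2,3,4)]
        signed_map_polar_unit[OF finite_labels lab(1,3,5,7)] signed_map_polar_unit[OF finite_labels lab(2,4,6,8)]
      by (simp add: x_def l_def l'_def r_def r'_def)
    have "(\<Sum>i=1..card terms. complex_of_real (term_coeff (h i)) * G (h i) (matrix_unit p p') y y')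
        = (\<Sum>t\<in>terms. complex_of_real (term_coeff t) * G t (matrix_unit p p') y y')"
      by (rule h_sum)
    also have "\<dots> = (\<Sum>(\<kappa>, \<kappa>', b)\<in>multi_index n \<times> multi_index n \<times> UNIV.
        complex_of_real (if b then (if \<kappa> = \<kappa>' then 0 else - (weight \<kappa> * weight \<kappa>')) else weight \<kappa> * weight \<kappa>') *
        (x b (l \<kappa> * l' \<kappa>') (l \<kappa>' * l' \<kappa>) * x b (r \<kappa> * r' \<kappa>') (r \<kappa>' * r' \<kappa>)))"
      unfolding terms_def by (intro sum.cong refl) (auto simp: term_coeff_def G_unit)
    also have "\<dots> = (\<Sum>\<kappa>\<in>multi_index n. \<Sum>\<kappa>'\<in>multi_index n. complex_of_real (weight \<kappa> * weight \<kappa>') * H \<kappa> \<kappa>')"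
      by (rule weighted_pair_sum[OF finite_multi_index])
        (simp_all only: x_def polar_product_identities H_def mult_zero_left)
    \<comment> \<open>\<open>H\<close> splits into a factor in \<open>\<kappa>\<close>, from the
      left operators of the channel, and one in \<open>\<kappa>'\<close>, from the right
      ones.\<close>
    also have "\<dots> = (\<Sum>\<kappa>\<in>multi_index n. complex_of_real (weight \<kappa>) * l \<kappa> * r \<kappa>) *
        (\<Sum>\<kappa>\<in>multi_index n. complex_of_real (weight \<kappa>) * l' \<kappa> * r' \<kappa>)"
      unfolding sum_product by (simp add: H_def mult_ac)
    also have "\<dots> = conj_map ?X ?X (prod_unitary id id) (matrix_unit p p') y y'"
      using mem unfolding conj_map_eq_sandwich sandwich_unit[OF finX mem(1,2)]
      unfolding eq prod_unitary_expand by (simp add: l_def l'_def r_def r'_def)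
    finally show "conj_map ?X ?X (prod_unitary id id) (matrix_unit p p') y y'
        = (\<Sum>i=1..card terms. complex_of_real (term_coeff (h i)) * G (h i) (matrix_unit p p') y y')" ..
  qed
  have U': "tensor_maps n (\<lambda>_. qubit) (\<lambda>_. qubit) U M = conj_map ?X ?X (prod_unitary id id) M" for M
    by (rule tensor_maps_conj_map) (rule U)
  show ?thesis
    unfolding quasi_extent_def U'
  proof (rule antisym, goal_cases)
    case 1
    show ?case
    proof (rule Inf_lower, intro CollectI exI conjI)
      show "ereal extent = ereal (\<Sum>i=1..card terms. \<bar>term_coeff (h i)\<bar>)"
        using h_sum[of "\<lambda>t. \<bar>term_coeff t\<bar>"] by (simp add: sum_term_coeff)
      show "\<forall>i\<in>{1..card terms}. G (h i) \<in> lo_star labels labels"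
        using G bij_betwE[OF h] by blast
      show "\<forall>M\<in>ops ?X. conj_map ?X ?X (prod_unitary id id) M = (\<lambda>y y'. \<Sum>i=1..card terms. complex_of_real (term_coeff (h i)) * G (h i) M y y')"
        using dec by blast
    qed (rule card_terms)
  next
    case 2
    show ?case
    proof (rule Inf_greatest, elim CollectE exE conjE)
      fix z m and a :: "nat \<Rightarrow> real" and F
      assume z: "z = ereal (\<Sum>i=1..m. \<bar>a i\<bar>)" and F: "\<forall>i\<in>{1..m}. F i \<in> lo_star labels labels"
        and M: "\<forall>M\<in>ops ?X. conj_map ?X ?X (prod_unitary id id) M = (\<lambda>y y'. \<Sum>i=1..m. complex_of_real (a i) * F i M y y')"
      have "extent \<le> (\<Sum>i=1..m. \<bar>a i\<bar>)"
      proof (rule lower_bound[OF coords_labels coords_labels])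
        show "sep_contr ?X product_kraus (F i)" if "i \<in> {1..m}" for i
          by (rule lo_star_sep_contr[OF finite_labels finite_labels]) (use F that in blast)
      qed (use M in blast)
      then show "ereal extent \<le> z"
        by (simp add: z)
    qed
  qed
qed

end

section \<open>Embeddings and ancillas\<close>

text \<open>This is \<open>W\<^sup>* (K \<otimes> 1) W\<close>, with the identity on the complement
  already summed out.\<close>

definition lift_op :: "'x set \<Rightarrow> 'r set \<Rightarrow> ('x \<times> 'r \<Rightarrow> 'a \<Rightarrow> complex) \<Rightarrow> ('x \<Rightarrow> 'x \<Rightarrow> complex) \<Rightarrow> 'a \<Rightarrow> 'a \<Rightarrow> complex" where
  "lift_op X R W K a a' = (\<Sum>x\<in>X. \<Sum>r\<in>R. \<Sum>x'\<in>X. cnj (W (x, r) a) * K x x' * W (x', r) a')"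

definition delta :: "'a \<Rightarrow> 'a \<Rightarrow> complex" where
  "delta i j = (if i = j then 1 else 0)"

lemma cnj_delta: "cnj (delta i j) = delta i j"
  by (simp add: delta_def)

lemma sum_delta_left: "finite X \<Longrightarrow> (\<Sum>k\<in>X. delta i k * f k) = (if i \<in> X then f i else 0)"
proof -
  assume X: "finite X"
  have "(\<Sum>k\<in>X. delta i k * f k) = (\<Sum>k\<in>X. if k = i then f k else 0)"
    by (intro sum.cong) (auto simp: delta_def)
  then show ?thesis using X by simp
qed

lemma sandwich_delta:
  assumes "finite R" "M \<in> ops R"
  shows "sandwich R R delta delta M = M"
proof (intro ext)
  fix i j
  have "(\<Sum>k\<in>R. \<Sum>l\<in>R. delta i k * M k l * cnj (delta j l)) = (\<Sum>k\<in>R. delta i k * (\<Sum>l\<in>R. delta j l * M k l))"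
    by (simp add: sum_distrib_left cnj_delta mult_ac)
  also have "\<dots> = M i j"
    using assms by (auto simp: sum_delta_left dest: ops_outside)
  finally show "sandwich R R delta delta M i j = M i j"
    using assms by (auto simp: sandwich_def dest: ops_outside)
qed

lemma tensor_map_sandwich_id_eq:
  assumes R: "finite R" and N: "N \<in> ops (X \<times> R)"
  shows "tensor_map (sandwich X X K K') id N = sandwich (X \<times> R) (X \<times> R) (kron K delta) (kron K' delta) N"
proof -
  have "tensor_map (sandwich X X K K') id N = tensor_map (sandwich X X K K') (sandwich R R delta delta) N"
    unfolding tensor_map_def sandwich_delta[OF R block_in_ops(2)[OF N]] by simp
  then show ?thesis
    by (simp add: tensor_map_sandwich)
qed

lemma lift_op_matrix_mult:
  assumes "finite R"
  shows "matrix_mult_on (X \<times> R) (adjoint_matrix W) (matrix_mult_on (X \<times> R) (kron K delta) W) = lift_op X R W K"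
proof (intro ext)
  fix a a'
  have "matrix_mult_on (X \<times> R) (kron K delta) W (x, r) a' = (\<Sum>x'\<in>X. K x x' * W (x', r) a')" if "r \<in> R" for x r
  proof -
    have "matrix_mult_on (X \<times> R) (kron K delta) W (x, r) a' = (\<Sum>x'\<in>X. \<Sum>s\<in>R. delta r s * (K x x' * W (x', s) a'))"
      by (simp add: matrix_mult_on_def sum.cartesian_product' mult_ac)
    then show ?thesis
      using assms that by (simp add: sum_delta_left)
  qed
  then show "matrix_mult_on (X \<times> R) (adjoint_matrix W) (matrix_mult_on (X \<times> R) (kron K delta) W) a a' = lift_op X R W K a a'"
    unfolding matrix_mult_on_def[of _ "adjoint_matrix W"] lift_op_def
    by (simp add: sum.cartesian_product' adjoint_matrix_def sum_distrib_left mult.assoc)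
qed

section \<open>Maps acting on embedded subsystems\<close>

lemma act_on_subsystem_sandwich:
  assumes fin: "finite A" "finite X" "finite R"
  shows "act_on_subsystem A X R W (sandwich X X K K') M = sandwich A A (lift_op X R W K) (lift_op X R W K') M"
proof -
  have XR: "finite (X \<times> R)" using fin by simp
  show ?thesis
    unfolding act_on_subsystem_def comp_def conj_map_eq_sandwich
      tensor_map_sandwich_id_eq[OF fin(3) sandwich_in_ops]
      sandwich_comp[OF fin(1) XR] sandwich_comp[OF XR XR] lift_op_matrix_mult[OF fin(3)] ..
qed

lemma act_on_subsystem_conj_map:
  assumes "finite A" "finite X" "finite R"
  shows "act_on_subsystem A X R W (conj_map X X K) = conj_map A A (lift_op X R W K)"
  by (rule ext) (simp add: conj_map_eq_sandwich act_on_subsystem_sandwich[OF assms])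

lemma linear_map_act_on_subsystem:
  assumes "linear_map X X E"
  shows "linear_map A A (act_on_subsystem A X R W E)"
  unfolding act_on_subsystem_def
  by (rule linear_map_comp[OF linear_map_conj_map
      linear_map_comp[OF linear_map_tensor_map[OF assms linear_map_id] linear_map_conj_map]])

lemma act_on_subsystem_lin_comb:
  assumes P: "\<And>i. i \<in> I \<Longrightarrow> linear_map X X (P i)" and I: "finite I"
  shows "act_on_subsystem A X R W (\<lambda>M y y'. \<Sum>i\<in>I. c i * P i M y y') M
    = (\<lambda>y y'. \<Sum>i\<in>I. c i * act_on_subsystem A X R W (P i) M y y')"
proof -
  define N where "N = conj_map A (X \<times> R) W M"
  have N: "N \<in> ops (X \<times> R)"
    by (simp add: N_def conj_map_eq_sandwich)
  have "tensor_map (\<lambda>M y y'. \<Sum>i\<in>I. c i * P i M y y') id N = (\<lambda>y y'. \<Sum>i\<in>I. c i * tensor_map (P i) id N y y')"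
    by (auto simp: tensor_map_def fun_eq_iff)
  then show ?thesis
    unfolding act_on_subsystem_def comp_def N_def[symmetric]
    using linear_map_sum[OF linear_map_conj_map I linear_mapD(1)[OF linear_map_tensor_map[OF P linear_map_id] N]]
    by simp
qed

lemma trace_conj_map_isometry:
  assumes X: "finite X" and W: "\<And>i j. i \<in> X \<Longrightarrow> j \<in> X \<Longrightarrow> (\<Sum>k\<in>Y. cnj (W k i) * W k j) = (if i = j then 1 else 0)"
  shows "trace_on Y (conj_map X Y W M) = trace_on X M"
proof -
  have "trace_on Y (conj_map X Y W M) = (\<Sum>k\<in>X. \<Sum>l\<in>X. M k l * (if l = k then 1 else 0))"
    unfolding trace_conj_map using W by (intro sum.cong refl) auto
  then show ?thesis
    by (simp add: sum_delta_pair[OF X] trace_on_def)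
qed

lemma tp_act_on_subsystem:
  assumes fin: "finite A" "finite X" "finite R" and W: "unitary A (X \<times> R) W" and T: "tp X X T"
  shows "tp A A (act_on_subsystem A X R W T)"
proof -
  have lin: "linear_map X X T"
    using T by (simp add: tp_def)
  have "trace_on A (act_on_subsystem A X R W T M) = trace_on A M" if M: "M \<in> ops A" for M
  proof -
    define N where "N = conj_map A (X \<times> R) W M"
    have N: "N \<in> ops (X \<times> R)"
      by (simp add: N_def conj_map_eq_sandwich)
    have "trace_on A (act_on_subsystem A X R W T M) = trace_on (X \<times> R) (tensor_map T id N)"
      unfolding act_on_subsystem_def comp_def N_def[symmetric]
    proof (rule trace_conj_map_isometry)
      show "finite (X \<times> R)" using fin by simp
      fix i j assume "i \<in> X \<times> R" "j \<in> X \<times> R"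
      then have "(\<Sum>k\<in>A. W i k * cnj (W j k)) = (if i = j then 1 else 0)"
        using W unfolding unitary_def by blast
      then show "(\<Sum>k\<in>A. cnj (adjoint_matrix W k i) * adjoint_matrix W k j) = (if i = j then 1 else 0)"
        by (simp add: adjoint_matrix_def)
    qed
    also have "\<dots> = (\<Sum>r\<in>R. trace_on X (T (\<lambda>a a'. N (a, r) (a', r))))"
      unfolding trace_on_def by (simp add: sum.cartesian_product' tensor_map_def) (rule sum.swap)
    also have "\<dots> = (\<Sum>r\<in>R. trace_on X (\<lambda>a a'. N (a, r) (a', r)))"
      using T block_in_ops(1)[OF N] by (intro sum.cong refl) (simp add: tp_def)
    also have "\<dots> = trace_on (X \<times> R) N"
      unfolding trace_on_def by (simp add: sum.cartesian_product') (rule sum.swap)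
    also have "\<dots> = trace_on A M"
      unfolding N_def by (rule trace_conj_map_isometry[OF fin(1)]) (use W in \<open>simp add: unitary_def\<close>)
    finally show ?thesis .
  qed
  then show ?thesis
    by (simp add: tp_def linear_map_act_on_subsystem[OF lin])
qed

text \<open>The embedded map depends linearly on the given one, and conjugation by \<open>K\<close>
  becomes conjugation by \<open>lift_op X R W K\<close>, so the transfer principle applies.\<close>

lemma sep_contr_act_on_subsystem:
  assumes fin: "finite A" "finite X" "finite R" and W: "unitary A (X \<times> R) W"
    and F: "sep_contr X \<K> F" and K: "\<And>K. K \<in> \<K> \<Longrightarrow> lift_op X R W K \<in> \<K>'"
  shows "sep_contr A \<K>' (act_on_subsystem A X R W F)"
proof (rule sep_contr_transfer[OF F])
  fix T assume "tp X X T"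
  then show "tp A A (act_on_subsystem A X R W T)"
    by (rule tp_act_on_subsystem[OF fin W])
next
  fix P assume "linear_map X X P"
  then show "linear_map A A (act_on_subsystem A X R W P)"
    by (rule linear_map_act_on_subsystem)
next
  fix P Q c M assume "linear_map X X P" "linear_map X X Q"
  then show "act_on_subsystem A X R W (\<lambda>M y y'. P M y y' + c * Q M y y') M =
      (\<lambda>y y'. act_on_subsystem A X R W P M y y' + c * act_on_subsystem A X R W Q M y y')"
    using act_on_subsystem_lin_comb[of UNIV X "\<lambda>b. if b then Q else P" A R W "\<lambda>b. if b then c else 1" M]
    by (simp add: sum_bool)
next
  fix v w y y' assume "v \<in> A" "w \<in> A" and y: "y \<in> A" "y' \<in> A"
  define N where "N = conj_map A (X \<times> R) W (matrix_unit v w)"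
  have N: "N \<in> ops (X \<times> R)"
    by (simp add: N_def conj_map_eq_sandwich)
  have "act_on_subsystem A X R W P (matrix_unit v w) y y' = (\<Sum>z\<in>(X \<times> R) \<times> (X \<times> R).
      (adjoint_matrix W y (fst z) * cnj (adjoint_matrix W y' (snd z))) *
      P (\<lambda>a a'. N (a, snd (fst z)) (a', snd (snd z))) (fst (fst z)) (fst (snd z)))" for P
  proof -
    have "act_on_subsystem A X R W P (matrix_unit v w) y y' = (\<Sum>k\<in>X \<times> R. \<Sum>l\<in>X \<times> R.
      adjoint_matrix W y k * tensor_map P id N k l * cnj (adjoint_matrix W y' l))"
      unfolding act_on_subsystem_def comp_def N_def[symmetric] using y by (simp add: conj_map_def)
    also have "\<dots> = (\<Sum>z\<in>(X \<times> R) \<times> (X \<times> R).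
      adjoint_matrix W y (fst z) * tensor_map P id N (fst z) (snd z) * cnj (adjoint_matrix W y' (snd z)))"
      by (simp add: sum.cartesian_product case_prod_beta)
    finally show ?thesis
      by (simp add: tensor_map_def case_prod_beta mult_ac)
  qed
  moreover have "lin_form X X (\<lambda>P. \<Sum>z\<in>(X \<times> R) \<times> (X \<times> R).
      (adjoint_matrix W y (fst z) * cnj (adjoint_matrix W y' (snd z))) *
      P (\<lambda>a a'. N (a, snd (fst z)) (a', snd (snd z))) (fst (fst z)) (fst (snd z)))"
    by (intro lin_form_sum lin_form_entry fin block_in_ops(1)[OF N])
  ultimately show "lin_form X X (\<lambda>P. act_on_subsystem A X R W P (matrix_unit v w) y y')"
    by simp
next
  fix K assume "K \<in> \<K>"
  then show "kraus_cone A A \<K>' (act_on_subsystem A X R W (conj_map X X K))"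
    unfolding act_on_subsystem_conj_map[OF fin] by (intro kraus_cone_conj_map assms)
qed

text \<open>Regrouping the summation labels by party factorises the sum; hence product operators
  stay product operators under local embeddings.\<close>

lemma lift_op_joint_embedding:
  "lift_op (X \<times> Y) (R \<times> S) (joint_embedding V V') (kron K J) (a, b) (a', b')
    = lift_op X R V K a a' * lift_op Y S V' J b b'"
proof -
  define f where "f = (\<lambda>(x, r, x'). cnj (V (x, r) a) * K x x' * V (x', r) a')"
  define g where "g = (\<lambda>(y, s, y'). cnj (V' (y, s) b) * J y y' * V' (y', s) b')"
  have "lift_op X R V K a a' * lift_op Y S V' J b b' = (\<Sum>t\<in>X \<times> R \<times> X. f t) * (\<Sum>t\<in>Y \<times> S \<times> Y. g t)"
    by (simp add: lift_op_def f_def g_def sum.cartesian_product')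
  also have "\<dots> = (\<Sum>t\<in>(X \<times> R \<times> X) \<times> (Y \<times> S \<times> Y). f (fst t) * g (snd t))"
    by (simp add: sum_product sum.cartesian_product case_prod_beta)
  also have "\<dots> = (\<Sum>t\<in>(X \<times> Y) \<times> (R \<times> S) \<times> (X \<times> Y).
      cnj (joint_embedding V V' (fst t, fst (snd t)) (a, b)) * kron K J (fst t) (snd (snd t)) *
      joint_embedding V V' (snd (snd t), fst (snd t)) (a', b'))"
    by (rule sum.reindex_bij_witness[where
        j = "\<lambda>((x, r, x'), (y, s, y')). ((x, y), (r, s), (x', y'))" and
        i = "\<lambda>((x, y), (r, s), (x', y')). ((x, r, x'), (y, s, y'))"])
      (auto simp: f_def g_def joint_embedding_def)
  also have "\<dots> = lift_op (X \<times> Y) (R \<times> S) (joint_embedding V V') (kron K J) (a, b) (a', b')"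
    unfolding lift_op_def by (simp only: sum.cartesian_product case_prod_unfold fst_conv snd_conv)
  finally show ?thesis ..
qed

text \<open>The embedding of one party's subsystem when its ancilla, carried along unchanged, counts
  as part of both the subsystem and the surrounding system.\<close>

definition ancilla_embedding :: "('x \<times> 'r \<Rightarrow> 'a \<Rightarrow> complex) \<Rightarrow> (('x \<times> 'p) \<times> 'r \<Rightarrow> 'a \<times> 'p \<Rightarrow> complex)" where
  "ancilla_embedding V = (\<lambda>((x, p), r) (a, p'). V (x, r) a * delta p p')"

text \<open>A product operator between two parties that each hold a main system and an ancilla. In
  the black box definition the labels list both main systems before both ancillas, so the factors
  interleave and \<open>kron\<close> does not fit.\<close>

definition shuffle_kron :: "('a \<times> 'p \<Rightarrow> 'a \<times> 'p \<Rightarrow> complex) \<Rightarrow> ('b \<times> 'q \<Rightarrow> 'b \<times> 'q \<Rightarrow> complex)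
    \<Rightarrow> ('a \<times> 'b) \<times> ('p \<times> 'q) \<Rightarrow> ('a \<times> 'b) \<times> ('p \<times> 'q) \<Rightarrow> complex" where
  "shuffle_kron K J = (\<lambda>((a, b), (p, q)) ((a', b'), (p', q')). K (a, p) (a', p') * J (b, q) (b', q'))"

definition shuffled_kraus :: "(('a \<times> 'b) \<times> ('p \<times> 'q) \<Rightarrow> ('a \<times> 'b) \<times> ('p \<times> 'q) \<Rightarrow> complex) set" where
  "shuffled_kraus = {shuffle_kron K J | K J. True}"

lemma joint_embedding_ancilla_eq:
  "joint_embedding_ancilla V V' z ((a, b), (p, q))
    = joint_embedding (ancilla_embedding V) (ancilla_embedding V') z ((a, p), (b, q))"
  by (auto simp: joint_embedding_ancilla_def joint_embedding_def ancilla_embedding_def delta_def case_prod_unfold)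

lemma lift_op_joint_embedding_ancilla:
  "lift_op ((X \<times> P) \<times> (Y \<times> Q)) (R \<times> S) (joint_embedding_ancilla V V') (kron K J)
    = shuffle_kron (lift_op (X \<times> P) R (ancilla_embedding V) K) (lift_op (Y \<times> Q) S (ancilla_embedding V') J)"
proof -
  have "lift_op ((X \<times> P) \<times> (Y \<times> Q)) (R \<times> S) (joint_embedding_ancilla V V') (kron K J) ((a, b), (p, q)) ((a', b'), (p', q'))
    = lift_op ((X \<times> P) \<times> (Y \<times> Q)) (R \<times> S) (joint_embedding (ancilla_embedding V) (ancilla_embedding V')) (kron K J) ((a, p), (b, q)) ((a', p'), (b', q'))"
    for a b p q a' b' p' q'
    by (simp add: lift_op_def joint_embedding_ancilla_eq)
  then show ?thesis
    by (simp add: fun_eq_iff shuffle_kron_def lift_op_joint_embedding)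
qed

section \<open>Unitarity of joint embeddings\<close>

lemma unitary_joint_embedding:
  assumes V: "unitary A (X \<times> R) V" and V': "unitary B (Y \<times> S) V'"
  shows "unitary (A \<times> B) ((X \<times> Y) \<times> (R \<times> S)) (joint_embedding V V')"
  unfolding unitary_def
proof (intro conjI ballI)
  fix i j assume "i \<in> A \<times> B" "j \<in> A \<times> B"
  then obtain a b a' b' where ij: "i = (a, b)" "j = (a', b')" "a \<in> A" "b \<in> B" "a' \<in> A" "b' \<in> B" by auto
  have "(\<Sum>k\<in>(X \<times> Y) \<times> (R \<times> S). cnj (joint_embedding V V' k i) * joint_embedding V V' k j)
      = (\<Sum>t\<in>(X \<times> R) \<times> (Y \<times> S). (cnj (V (fst t) a) * V (fst t) a') * (cnj (V' (snd t) b) * V' (snd t) b'))"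
    by (rule sum.reindex_bij_witness[where
        i = "\<lambda>((x, r), (y, s)). ((x, y), (r, s))" and j = "\<lambda>((x, y), (r, s)). ((x, r), (y, s))"])
      (auto simp: ij joint_embedding_def)
  also have "\<dots> = (\<Sum>k\<in>X \<times> R. cnj (V k a) * V k a') * (\<Sum>k\<in>Y \<times> S. cnj (V' k b) * V' k b')"
    unfolding sum_product by (simp add: sum.cartesian_product case_prod_beta)
  also have "\<dots> = (if i = j then 1 else 0)"
    using V V' ij by (simp add: unitary_def)
  finally show "(\<Sum>k\<in>(X \<times> Y) \<times> (R \<times> S). cnj (joint_embedding V V' k i) * joint_embedding V V' k j) = (if i = j then 1 else 0)" .
next
  fix i j assume "i \<in> (X \<times> Y) \<times> (R \<times> S)" "j \<in> (X \<times> Y) \<times> (R \<times> S)"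
  then obtain x y r s x' y' r' s' where ij: "i = ((x, y), (r, s))" "j = ((x', y'), (r', s'))"
    and mem: "(x, r) \<in> X \<times> R" "(y, s) \<in> Y \<times> S" "(x', r') \<in> X \<times> R" "(y', s') \<in> Y \<times> S" by auto
  have "(\<Sum>k\<in>A \<times> B. joint_embedding V V' i k * cnj (joint_embedding V V' j k))
      = (\<Sum>k\<in>A. V (x, r) k * cnj (V (x', r') k)) * (\<Sum>k\<in>B. V' (y, s) k * cnj (V' (y', s') k))"
    unfolding sum_product by (simp add: ij joint_embedding_def sum.cartesian_product' mult_ac)
  also have "\<dots> = (if (x, r) = (x', r') then 1 else 0) * (if (y, s) = (y', s') then 1 else 0)"
    using V V' mem unfolding unitary_def by simp
  finally show "(\<Sum>k\<in>A \<times> B. joint_embedding V V' i k * cnj (joint_embedding V V' j k)) = (if i = j then 1 else 0)"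
    by (auto simp: ij)
qed

lemma unitary_ancilla_embedding:
  assumes P: "finite P" and V: "unitary A (X \<times> R) V"
  shows "unitary (A \<times> P) ((X \<times> P) \<times> R) (ancilla_embedding V)"
  unfolding unitary_def
proof (intro conjI ballI)
  fix i j assume "i \<in> A \<times> P" "j \<in> A \<times> P"
  then obtain a p a' p' where ij: "i = (a, p)" "j = (a', p')" "a \<in> A" "p \<in> P" "a' \<in> A" "p' \<in> P" by auto
  have "(\<Sum>k\<in>(X \<times> P) \<times> R. cnj (ancilla_embedding V k i) * ancilla_embedding V k j)
      = (\<Sum>t\<in>(X \<times> R) \<times> P. (cnj (V (fst t) a) * V (fst t) a') * (delta p (snd t) * delta p' (snd t)))"
    by (rule sum.reindex_bij_witness[where
        i = "\<lambda>((x, r), p). ((x, p), r)" and j = "\<lambda>((x, p), r). ((x, r), p)"])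
      (auto simp: ij ancilla_embedding_def delta_def)
  also have "\<dots> = (\<Sum>k\<in>X \<times> R. cnj (V k a) * V k a') * (\<Sum>k\<in>P. delta p k * delta p' k)"
    unfolding sum_product by (simp add: sum.cartesian_product case_prod_beta)
  also have "\<dots> = (if i = j then 1 else 0)"
    using V ij P by (simp add: unitary_def sum_delta_left) (auto simp: delta_def)
  finally show "(\<Sum>k\<in>(X \<times> P) \<times> R. cnj (ancilla_embedding V k i) * ancilla_embedding V k j) = (if i = j then 1 else 0)" .
next
  fix i j assume "i \<in> (X \<times> P) \<times> R" "j \<in> (X \<times> P) \<times> R"
  then obtain x p r x' p' r' where ij: "i = ((x, p), r)" "j = ((x', p'), r')"
    and mem: "(x, r) \<in> X \<times> R" "p \<in> P" "(x', r') \<in> X \<times> R" "p' \<in> P" by auto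
  have "(\<Sum>k\<in>A \<times> P. ancilla_embedding V i k * cnj (ancilla_embedding V j k))
      = (\<Sum>k\<in>A. V (x, r) k * cnj (V (x', r') k)) * (\<Sum>k\<in>P. delta p k * delta p' k)"
    unfolding sum_product by (simp add: ij ancilla_embedding_def sum.cartesian_product' cnj_delta mult_ac)
  also have "\<dots> = (if (x, r) = (x', r') then 1 else 0) * delta p' p"
    using V mem P unfolding unitary_def by (simp add: sum_delta_left)
  finally show "(\<Sum>k\<in>A \<times> P. ancilla_embedding V i k * cnj (ancilla_embedding V j k)) = (if i = j then 1 else 0)"
    by (auto simp: ij delta_def)
qed

lemma unitary_joint_embedding_ancilla:
  fixes V :: "'x \<times> 'r \<Rightarrow> 'a \<Rightarrow> complex" and V' :: "'y \<times> 's \<Rightarrow> 'b \<Rightarrow> complex"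
    and P :: "'p set" and Q :: "'q set"
  assumes "finite P" "finite Q" and V: "unitary A (X \<times> R) V" and V': "unitary B (Y \<times> S) V'"
  shows "unitary ((A \<times> B) \<times> (P \<times> Q)) (((X \<times> P) \<times> (Y \<times> Q)) \<times> (R \<times> S)) (joint_embedding_ancilla V V')"
proof -
  let ?J = "joint_embedding (ancilla_embedding V) (ancilla_embedding V')"
  have U: "unitary ((A \<times> P) \<times> (B \<times> Q)) (((X \<times> P) \<times> (Y \<times> Q)) \<times> (R \<times> S)) ?J"
    by (intro unitary_joint_embedding unitary_ancilla_embedding assms)
  define \<pi> where "\<pi> = (\<lambda>((a, b), (p, q)). ((a, p), (b, q)) :: ('a \<times> 'p) \<times> ('b \<times> 'q))"
  have J: "joint_embedding_ancilla V V' z i = ?J z (\<pi> i)" for z and i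
    by (cases i) (auto simp: \<pi>_def joint_embedding_ancilla_eq)
  have \<pi>: "bij_betw \<pi> ((A \<times> B) \<times> (P \<times> Q)) ((A \<times> P) \<times> (B \<times> Q))"
    by (rule bij_betw_byWitness[where f' = "\<lambda>((a, p), (b, q)). ((a, b), (p, q))"]) (auto simp: \<pi>_def)
  have \<pi>_eq: "\<pi> i = \<pi> j \<longleftrightarrow> i = j" for i j
    by (cases i; cases j) (auto simp: \<pi>_def)
  have mem: "\<pi> i \<in> (A \<times> P) \<times> (B \<times> Q)" if "i \<in> (A \<times> B) \<times> (P \<times> Q)" for i
    using that by (auto simp: \<pi>_def)
  show ?thesis
    unfolding unitary_def J
  proof (intro conjI ballI)
    fix i j assume "i \<in> (A \<times> B) \<times> (P \<times> Q)" "j \<in> (A \<times> B) \<times> (P \<times> Q)"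
    then have "(\<Sum>k\<in>((X \<times> P) \<times> (Y \<times> Q)) \<times> (R \<times> S). cnj (?J k (\<pi> i)) * ?J k (\<pi> j)) = (if \<pi> i = \<pi> j then 1 else 0)"
      using U mem unfolding unitary_def by blast
    then show "(\<Sum>k\<in>((X \<times> P) \<times> (Y \<times> Q)) \<times> (R \<times> S). cnj (?J k (\<pi> i)) * ?J k (\<pi> j)) = (if i = j then 1 else 0)"
      unfolding \<pi>_eq .
  next
    fix i j assume "i \<in> ((X \<times> P) \<times> (Y \<times> Q)) \<times> (R \<times> S)" "j \<in> ((X \<times> P) \<times> (Y \<times> Q)) \<times> (R \<times> S)"
    then have "(\<Sum>k\<in>(A \<times> P) \<times> (B \<times> Q). ?J i k * cnj (?J j k)) = (if i = j then 1 else 0)"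
      using U unfolding unitary_def by blast
    then show "(\<Sum>k\<in>(A \<times> B) \<times> (P \<times> Q). ?J i (\<pi> k) * cnj (?J j (\<pi> k))) = (if i = j then 1 else 0)"
      using sum.reindex_bij_betw[OF \<pi>, of "\<lambda>k. ?J i k * cnj (?J j k)"] by simp
  qed
qed

lemma matrix_mult_on_shuffle_kron:
  "matrix_mult_on ((A \<times> B) \<times> (P \<times> Q)) (shuffle_kron K J) (shuffle_kron K' J')
    = shuffle_kron (matrix_mult_on (A \<times> P) K K') (matrix_mult_on (B \<times> Q) J J')"
proof -
  have "(\<Sum>k\<in>(A \<times> B) \<times> (P \<times> Q). shuffle_kron K J ((a, b), (p, q)) k * shuffle_kron K' J' k ((a', b'), (p', q')))
    = (\<Sum>k\<in>A \<times> P. K (a, p) k * K' k (a', p')) * (\<Sum>k\<in>B \<times> Q. J (b, q) k * J' k (b', q'))"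
    (is "?l = ?r") for a b p q a' b' p' q'
  proof -
    have "?l = (\<Sum>t\<in>(A \<times> P) \<times> (B \<times> Q). (K (a, p) (fst t) * K' (fst t) (a', p')) * (J (b, q) (snd t) * J' (snd t) (b', q')))"
      by (rule sum.reindex_bij_witness[where
          i = "\<lambda>((a, p), (b, q)). ((a, b), (p, q))" and j = "\<lambda>((a, b), (p, q)). ((a, p), (b, q))"])
        (auto simp: shuffle_kron_def)
    also have "\<dots> = ?r"
      unfolding sum_product by (simp add: sum.cartesian_product case_prod_beta)
    finally show ?thesis .
  qed
  then show ?thesis
    by (simp add: fun_eq_iff matrix_mult_on_def) (simp add: shuffle_kron_def)
qed

lemma shuffled_kraus_mult:
  assumes "K \<in> shuffled_kraus" "J \<in> shuffled_kraus"
  shows "matrix_mult_on ((A \<times> B) \<times> (P \<times> Q)) J K \<in> shuffled_kraus"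
  using assms unfolding shuffled_kraus_def
  by (elim CollectE exE conjE) (simp add: matrix_mult_on_shuffle_kron, blast)

section \<open>Circuits and discarded ancillas\<close>

lemma circuit_Suc: "circuit E B (Suc k) = (if k = 0 then E 1 else E (Suc k) \<circ> B k \<circ> circuit E B k)"
  by (cases k) auto

lemma sep_contr_circuit:
  assumes X: "finite X" and E: "\<And>j. j \<in> {1..k} \<Longrightarrow> sep_contr X \<K> (E j)" and k: "1 \<le> k"
    and B: "\<And>j M. B j M = M"
    and mult: "\<And>K J. K \<in> \<K> \<Longrightarrow> J \<in> \<K> \<Longrightarrow> matrix_mult_on X J K \<in> \<K>"
  shows "sep_contr X \<K> (circuit E B k)"
  using k E
proof (induction k rule: dec_induct)
  case base
  then show ?case by (simp add: circuit_Suc)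
next
  case (step k)
  have "circuit E B (Suc k) = E (Suc k) \<circ> circuit E B k"
    using step.hyps by (simp add: circuit_Suc fun_eq_iff B)
  moreover have "sep_contr X \<K> (E (Suc k) \<circ> circuit E B k)"
    by (rule sep_contr_comp[OF X step.IH _ mult]) (use step.prems in auto)
  ultimately show ?case
    by (simp only:)
qed

definition close_ancilla :: "'p set \<Rightarrow> 'p \<Rightarrow> ('a \<times> 'p, 'a \<times> 'p) opmap \<Rightarrow> ('a, 'a) opmap" where
  "close_ancilla P o' F \<rho> = partial_trace P (F (attach_state (matrix_unit o' o') \<rho>))"

lemma attach_state_in_ops:
  "o' \<in> P \<Longrightarrow> \<rho> \<in> ops A \<Longrightarrow> attach_state (matrix_unit o' o') \<rho> \<in> ops (A \<times> P)"
  by (rule opsI) (auto simp: attach_state_def matrix_unit_def split: if_splits dest: ops_outside)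

lemma linear_map_close_ancilla:
  assumes o': "o' \<in> P" and F: "linear_map (A \<times> P) (A \<times> P) F"
  shows "linear_map A A (close_ancilla P o' F)"
proof (rule linear_mapI)
  fix M assume M: "M \<in> ops A"
  have "F (attach_state (matrix_unit o' o') M) \<in> ops (A \<times> P)"
    by (rule linear_mapD(1)[OF F attach_state_in_ops[OF o' M]])
  then show "close_ancilla P o' F M \<in> ops A"
    unfolding close_ancilla_def partial_trace_def
    by (intro opsI) (metis (mono_tags, lifting) mem_Sigma_iff ops_outside sum.neutral)
next
  fix M N y y' assume M: "M \<in> ops A" "N \<in> ops A"
  have "attach_state (matrix_unit o' o') (\<lambda>i j. M i j + N i j) =
      (\<lambda>i j. attach_state (matrix_unit o' o') M i j + attach_state (matrix_unit o' o') N i j)"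
    by (auto simp: attach_state_def fun_eq_iff algebra_simps)
  then show "close_ancilla P o' F (\<lambda>i j. M i j + N i j) y y' = close_ancilla P o' F M y y' + close_ancilla P o' F N y y'"
    using linear_mapD(2)[OF F attach_state_in_ops[OF o' M(1)] attach_state_in_ops[OF o' M(2)]]
    by (simp add: close_ancilla_def partial_trace_def sum.distrib)
next
  fix c M y y' assume M: "M \<in> ops A"
  have "attach_state (matrix_unit o' o') (\<lambda>i j. c * M i j) =
      (\<lambda>i j. c * attach_state (matrix_unit o' o') M i j)"
    by (auto simp: attach_state_def fun_eq_iff algebra_simps)
  then show "close_ancilla P o' F (\<lambda>i j. c * M i j) y y' = c * close_ancilla P o' F M y y'"
    using linear_mapD(3)[OF F attach_state_in_ops[OF o' M]]
    by (simp add: close_ancilla_def partial_trace_def sum_distrib_left)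
qed

lemma sandwich_attach_state:
  assumes o': "o' \<in> P" and fin: "finite A" "finite P" and y: "(y, p) \<in> A \<times> P" "(y', p') \<in> A \<times> P"
  shows "sandwich (A \<times> P) (A \<times> P) K K' (attach_state (matrix_unit o' o') \<rho>) (y, p) (y', p')
    = (\<Sum>k\<in>A. \<Sum>l\<in>A. K (y, p) (k, o') * \<rho> k l * cnj (K' (y', p') (l, o')))"
proof -
  have "sandwich (A \<times> P) (A \<times> P) K K' (attach_state (matrix_unit o' o') \<rho>) (y, p) (y', p')
    = (\<Sum>k\<in>A. \<Sum>s\<in>P. delta o' s * (\<Sum>l\<in>A. \<Sum>t\<in>P. delta o' t * (K (y, p) (k, s) * \<rho> k l * cnj (K' (y', p') (l, t)))))"
    using y by (simp add: sandwich_def sum.cartesian_product' attach_state_def matrix_unit_def delta_def sum_distrib_left)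
      (intro sum.cong refl, auto)
  then show ?thesis
    using fin o' by (simp add: sum_delta_left)
qed

text \<open>Attaching and tracing out the ancilla preserves the trace and replaces a Kraus operator
  by its blocks in the ancilla basis.\<close>

lemma sep_contr_close_ancilla:
  fixes F :: "(('a \<times> 'b) \<times> ('p \<times> 'q), ('a \<times> 'b) \<times> ('p \<times> 'q)) opmap"
  assumes fin: "finite A" "finite B" "finite P" "finite Q" and o': "o' \<in> P \<times> Q"
    and F: "sep_contr ((A \<times> B) \<times> (P \<times> Q)) shuffled_kraus F"
  shows "sep_contr (A \<times> B) product_kraus (close_ancilla (P \<times> Q) o' F)"
proof (rule sep_contr_transfer[OF F])
  let ?AB = "A \<times> B" and ?PQ = "P \<times> Q"
  have finAB: "finite ?AB" "finite ?PQ" "finite (?AB \<times> ?PQ)" using fin by auto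
  {
    fix T :: "(('a \<times> 'b) \<times> ('p \<times> 'q), ('a \<times> 'b) \<times> ('p \<times> 'q)) opmap"
    assume T: "tp (?AB \<times> ?PQ) (?AB \<times> ?PQ) T"
    have "trace_on ?AB (close_ancilla ?PQ o' T M) = trace_on ?AB M" if M: "M \<in> ops ?AB" for M
    proof -
      have "trace_on ?AB (close_ancilla ?PQ o' T M) = trace_on (?AB \<times> ?PQ) (T (attach_state (matrix_unit o' o') M))"
        unfolding trace_on_def close_ancilla_def partial_trace_def by (simp add: sum.cartesian_product case_prod_beta)
      also have "\<dots> = trace_on (?AB \<times> ?PQ) (attach_state (matrix_unit o' o') M)"
        using T attach_state_in_ops[OF o' M] by (simp add: tp_def)
      also have "\<dots> = (\<Sum>i\<in>?AB. \<Sum>p\<in>?PQ. delta o' p * M i i)"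
        unfolding trace_on_def sum.cartesian_product
        by (intro sum.cong refl) (auto simp: attach_state_def matrix_unit_def delta_def)
      also have "\<dots> = trace_on ?AB M"
        using o' finAB by (simp add: sum_delta_left trace_on_def)
      finally show ?thesis .
    qed
    moreover have "linear_map (?AB \<times> ?PQ) (?AB \<times> ?PQ) T"
      using T by (simp add: tp_def)
    ultimately show "tp ?AB ?AB (close_ancilla ?PQ o' T)"
      unfolding tp_def using linear_map_close_ancilla[OF o'] by blast
  next
    fix P' :: "(('a \<times> 'b) \<times> ('p \<times> 'q), ('a \<times> 'b) \<times> ('p \<times> 'q)) opmap"
    assume "linear_map (?AB \<times> ?PQ) (?AB \<times> ?PQ) P'"
    then show "linear_map ?AB ?AB (close_ancilla ?PQ o' P')"
      by (rule linear_map_close_ancilla[OF o'])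
  next
    fix P' Q' :: "(('a \<times> 'b) \<times> ('p \<times> 'q), ('a \<times> 'b) \<times> ('p \<times> 'q)) opmap" and c M
    show "close_ancilla ?PQ o' (\<lambda>M y y'. P' M y y' + c * Q' M y y') M =
        (\<lambda>y y'. close_ancilla ?PQ o' P' M y y' + c * close_ancilla ?PQ o' Q' M y y')"
      by (simp add: close_ancilla_def partial_trace_def sum.distrib sum_distrib_left)
  next
    fix v w y y' assume "v \<in> ?AB" "w \<in> ?AB"
    then have "lin_form (?AB \<times> ?PQ) (?AB \<times> ?PQ) (\<lambda>P. \<Sum>p\<in>?PQ. 1 * P (attach_state (matrix_unit o' o') (matrix_unit v w)) (y, p) (y', p))"
      by (intro lin_form_sum lin_form_entry finAB attach_state_in_ops o' matrix_unit_in_ops)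
    then show "lin_form (?AB \<times> ?PQ) (?AB \<times> ?PQ) (\<lambda>P. close_ancilla ?PQ o' P (matrix_unit v w) y y')"
      by (simp add: close_ancilla_def partial_trace_def)
  next
    fix K :: "('a \<times> 'b) \<times> ('p \<times> 'q) \<Rightarrow> ('a \<times> 'b) \<times> ('p \<times> 'q) \<Rightarrow> complex" assume "K \<in> shuffled_kraus"
    then obtain k j where K: "K = shuffle_kron k j"
      unfolding shuffled_kraus_def by blast
    \<comment> \<open>The block for an ancilla that enters in \<open>o'\<close> and leaves in
      \<open>p\<close>. It is a product operator because both labels are pairs, one entry for each
      party.\<close>
    define Kp where "Kp = (\<lambda>p. kron (\<lambda>a a'. k (a, fst p) (a', fst o')) (\<lambda>b b'. j (b, snd p) (b', snd o')))"
    have "kraus_cone ?AB ?AB product_kraus (\<lambda>M y y'. \<Sum>p\<in>?PQ. conj_map ?AB ?AB (Kp p) M y y')"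
      unfolding Kp_def by (intro kraus_cone_sum finAB kraus_cone_conj_map kron_in_product_kraus)
    then show "kraus_cone ?AB ?AB product_kraus (close_ancilla ?PQ o' (conj_map (?AB \<times> ?PQ) (?AB \<times> ?PQ) K))"
    proof (rule kraus_cone_cong)
      fix M assume "M \<in> ops ?AB"
      have KK: "K (y, p) (k, o') = Kp p y k" for y p k
        by (cases y; cases p; cases k; cases o') (simp add: K Kp_def shuffle_kron_def)
      have "(\<Sum>p\<in>?PQ. conj_map (?AB \<times> ?PQ) (?AB \<times> ?PQ) K (attach_state (matrix_unit o' o') M) (y, p) (y', p))
          = (\<Sum>p\<in>?PQ. conj_map ?AB ?AB (Kp p) M y y')" for y y'
      proof (intro sum.cong refl)
        fix p assume p: "p \<in> ?PQ"
        show "conj_map (?AB \<times> ?PQ) (?AB \<times> ?PQ) K (attach_state (matrix_unit o' o') M) (y, p) (y', p) = conj_map ?AB ?AB (Kp p) M y y'"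
        proof (cases "y \<in> ?AB \<and> y' \<in> ?AB")
          case True
          then have m: "(y, p) \<in> ?AB \<times> ?PQ" "(y', p) \<in> ?AB \<times> ?PQ" using p by auto
          show ?thesis
            unfolding conj_map_eq_sandwich sandwich_attach_state[OF o' finAB(1,2) m]
            using True by (simp add: sandwich_def KK)
        next
          case False
          then have "(y, p) \<notin> ?AB \<times> ?PQ \<or> (y', p) \<notin> ?AB \<times> ?PQ" by auto
          then show ?thesis
            unfolding conj_map_eq_sandwich sandwich_def using False by auto
        qed
      qed
      then show "close_ancilla ?PQ o' (conj_map (?AB \<times> ?PQ) (?AB \<times> ?PQ) K) M =
          (\<lambda>y y'. \<Sum>p\<in>?PQ. conj_map ?AB ?AB (Kp p) M y y')"
        by (simp add: close_ancilla_def partial_trace_def)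
    qed
  }
qed

section \<open>The black box lower bound\<close>

text \<open>The tensor product of \<open>G 1\<close> to \<open>G n\<close> over the qubit pairs,
  with the first qubit of every pair held by one party and the second by the other.\<close>

definition multi_op :: "nat \<Rightarrow> ('a \<Rightarrow> nat \<Rightarrow> bool) \<Rightarrow> ('b \<Rightarrow> nat \<Rightarrow> bool) \<Rightarrow>
    (nat \<Rightarrow> bool \<times> bool \<Rightarrow> bool \<times> bool \<Rightarrow> complex) \<Rightarrow> 'a \<times> 'b \<Rightarrow> 'a \<times> 'b \<Rightarrow> complex" where
  "multi_op n e e' G = (\<lambda>p q. \<Prod>j=1..n. G j (e (fst p) j, e' (snd p) j) (e (fst q) j, e' (snd q) j))"

lemma multi_op_mult:
  assumes e: "coords n A e" and e': "coords n B e'"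
  shows "matrix_mult_on (A \<times> B) (multi_op n e e' G) (multi_op n e e' H) = multi_op n e e' (\<lambda>j. matrix_mult_on UNIV (G j) (H j))"
proof (intro ext)
  fix p q
  define f where "f = (\<lambda>j x y. G j (e (fst p) j, e' (snd p) j) (x, y) * H j (x, y) (e (fst q) j, e' (snd q) j))"
  have "matrix_mult_on (A \<times> B) (multi_op n e e' G) (multi_op n e e' H) p q
      = (\<Sum>c\<in>A. \<Sum>d\<in>B. \<Prod>j=1..n. f j (e c j) (e' d j))"
    by (simp add: matrix_mult_on_def multi_op_def sum.cartesian_product' f_def prod.distrib)
  also have "\<dots> = (\<Sum>c\<in>A. \<Prod>j=1..n. \<Sum>y\<in>UNIV. f j (e c j) y)"
    by (intro sum.cong refl sum_coords[OF e', where f = "\<lambda>j. f j (e _ j)"])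
  also have "\<dots> = (\<Prod>j=1..n. \<Sum>x\<in>UNIV. \<Sum>y\<in>UNIV. f j x y)"
    by (rule sum_coords[OF e, where f = "\<lambda>j x. \<Sum>y\<in>UNIV. f j x y"])
  also have "\<dots> = multi_op n e e' (\<lambda>j. matrix_mult_on UNIV (G j) (H j)) p q"
    by (simp add: multi_op_def matrix_mult_on_def f_def UNIV_Times_UNIV[symmetric] sum.cartesian_product' del: UNIV_Times_UNIV)
  finally show "matrix_mult_on (A \<times> B) (multi_op n e e' G) (multi_op n e e' H) p q
      = multi_op n e e' (\<lambda>j. matrix_mult_on UNIV (G j) (H j)) p q" .
qed

lemma sandwich_cong:
  assumes "\<And>y x. y \<in> Y \<Longrightarrow> x \<in> X \<Longrightarrow> K y x = J y x" "\<And>y x. y \<in> Y \<Longrightarrow> x \<in> X \<Longrightarrow> K' y x = J' y x"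
  shows "sandwich X Y K K' M = sandwich X Y J J' M"
  using assms by (auto simp: sandwich_def fun_eq_iff intro!: sum.cong)

lemma conj_map_cong:
  assumes "\<And>y x. y \<in> Y \<Longrightarrow> x \<in> X \<Longrightarrow> K y x = J y x"
  shows "conj_map X Y K M = conj_map X Y J M"
  unfolding conj_map_eq_sandwich by (intro sandwich_cong assms)

text \<open>The permutation matrix of \<open>\<phi>\<close>: an embedding that only relabels basis
  states.\<close>

definition perm_embedding :: "('a \<Rightarrow> 'y) \<Rightarrow> 'y \<Rightarrow> 'a \<Rightarrow> complex" where
  "perm_embedding \<phi> y a = delta (\<phi> a) y"

lemma unitary_perm_embedding:
  assumes \<phi>: "bij_betw \<phi> A Y" and Y: "finite Y"
  shows "unitary A Y (perm_embedding \<phi>)"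
  unfolding unitary_def
proof (intro conjI ballI)
  fix i j assume ij: "i \<in> A" "j \<in> A"
  have "\<phi> i \<in> Y" "\<phi> j = \<phi> i \<longleftrightarrow> i = j"
    using \<phi> ij by (auto simp: bij_betw_def inj_on_def)
  then show "(\<Sum>k\<in>Y. cnj (perm_embedding \<phi> k i) * perm_embedding \<phi> k j) = (if i = j then 1 else 0)"
    using Y by (simp add: perm_embedding_def cnj_delta sum_delta_left) (simp add: delta_def)
next
  fix i j assume ij: "i \<in> Y" "j \<in> Y"
  have "(\<Sum>k\<in>A. perm_embedding \<phi> i k * cnj (perm_embedding \<phi> j k)) = (\<Sum>y\<in>Y. delta y i * delta y j)"
    unfolding perm_embedding_def cnj_delta by (rule sum.reindex_bij_betw[OF \<phi>, where g = "\<lambda>y. delta y i * delta y j"])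
  also have "\<dots> = (\<Sum>y\<in>Y. delta i y * delta y j)"
    by (intro sum.cong refl) (auto simp: delta_def)
  finally show "(\<Sum>k\<in>A. perm_embedding \<phi> i k * cnj (perm_embedding \<phi> j k)) = (if i = j then 1 else 0)"
    using Y ij by (simp add: sum_delta_left) (simp add: delta_def)
qed

lemma lift_op_perm_embedding:
  assumes \<phi>: "bij_betw \<phi> A (X \<times> R)" and fin: "finite X" "finite R" and a: "a \<in> A" "a' \<in> A"
  shows "lift_op X R (perm_embedding \<phi>) K a a' = K (fst (\<phi> a)) (fst (\<phi> a')) * delta (snd (\<phi> a)) (snd (\<phi> a'))"
proof -
  have mem: "\<phi> a \<in> X \<times> R" "\<phi> a' \<in> X \<times> R"
    using \<phi> a by (auto simp: bij_betw_def)
  have split: "delta (\<phi> a) (x, r) = delta (fst (\<phi> a)) x * delta (snd (\<phi> a)) r" for x r a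
    by (cases "\<phi> a") (simp add: delta_def)
  have "lift_op X R (perm_embedding \<phi>) K a a' = (\<Sum>x\<in>X. delta (fst (\<phi> a)) x * (\<Sum>r\<in>R. delta (snd (\<phi> a)) r *
      (\<Sum>x'\<in>X. delta (fst (\<phi> a')) x' * (delta (snd (\<phi> a')) r * K x x'))))"
    unfolding lift_op_def perm_embedding_def split by (simp add: cnj_delta sum_distrib_left mult_ac)
  then show ?thesis
    using mem fin by (simp add: sum_delta_left mem_Times_iff) (simp add: delta_def)
qed

text \<open>Bit \<open>j\<close> becomes the subsystem, and the string of the other bits, numbered
  arbitrarily, becomes the complement.\<close>

lemma qubit_embedding_exists:
  assumes e: "coords n A e" and j: "j \<in> {1..n}"
  obtains \<phi> where "bij_betw \<phi> A (UNIV \<times> {..<(2::nat) ^ (n - 1)})" "\<And>a. fst (\<phi> a) = e a j"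
    "\<And>a a'. a \<in> A \<Longrightarrow> a' \<in> A \<Longrightarrow> snd (\<phi> a) = snd (\<phi> a') \<longleftrightarrow> (\<forall>i\<in>{1..n} - {j}. e a i = e a' i)"
proof -
  define D :: "(nat \<Rightarrow> bool) set" where "D = (\<Pi>\<^sub>E i\<in>{1..n} - {j}. UNIV)"
  have "finite D" "card D = 2 ^ (n - 1)"
    using j by (simp_all add: D_def finite_PiE card_PiE)
  then obtain g where g: "bij_betw g D {..<(2::nat) ^ (n - 1)}"
    using ex_bij_betw_finite_nat[of D] by (auto simp: atLeast0LessThan)
  define \<phi> where "\<phi> = (\<lambda>a. (e a j, g (restrict (e a) ({1..n} - {j}))))"
  have D: "restrict (e a) ({1..n} - {j}) \<in> D" for a
    by (simp add: D_def)
  have snd_eq: "snd (\<phi> a) = snd (\<phi> a') \<longleftrightarrow> (\<forall>i\<in>{1..n} - {j}. e a i = e a' i)" for a a'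
  proof -
    have "snd (\<phi> a) = snd (\<phi> a') \<longleftrightarrow> restrict (e a) ({1..n} - {j}) = restrict (e a') ({1..n} - {j})"
      using g D[of a] D[of a'] by (auto simp: \<phi>_def bij_betw_def inj_on_def)
    also have "\<dots> \<longleftrightarrow> (\<forall>i\<in>{1..n} - {j}. e a i = e a' i)"
      by (auto simp: restrict_def fun_eq_iff split: if_splits)
    finally show ?thesis .
  qed
  have inj: "inj_on \<phi> A"
  proof (rule inj_onI)
    fix a a' assume a: "a \<in> A" "a' \<in> A" "\<phi> a = \<phi> a'"
    then have "e a j = e a' j" "\<forall>i\<in>{1..n} - {j}. e a i = e a' i"
      using snd_eq[of a a'] by (auto simp: \<phi>_def)
    then show "a = a'"
      using coords_eq_iff[OF e a(1,2)] by blast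
  qed
  have sub: "\<phi> ` A \<subseteq> UNIV \<times> {..<2 ^ (n - 1)}"
    using g D by (auto simp: \<phi>_def bij_betw_def)
  have "2 * 2 ^ (n - 1) = (2 :: nat) ^ n"
    using j by (cases n) auto
  then have "card (\<phi> ` A) = card (UNIV \<times> {..<(2::nat) ^ (n - 1)} :: (bool \<times> nat) set)"
    by (simp add: card_image[OF inj] coords_card[OF e] card_cartesian_product)
  then have "\<phi> ` A = UNIV \<times> {..<2 ^ (n - 1)}"
    by (intro card_subset_eq sub) auto
  then show thesis
    using inj snd_eq by (intro that[of \<phi>]) (auto simp: bij_betw_def \<phi>_def)
qed

lemma lift_op_lin_comb:
  "lift_op X R V (\<lambda>x y. \<Sum>k\<in>I. c k * K k x y) a a' = (\<Sum>k\<in>I. c k * lift_op X R V (K k) a a')"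
proof -
  have "lift_op X R V (\<lambda>x y. \<Sum>k\<in>I. c k * K k x y) a a'
    = (\<Sum>x\<in>X. \<Sum>r\<in>R. \<Sum>x'\<in>X. \<Sum>k\<in>I. c k * (cnj (V (x, r) a) * K k x x' * V (x', r) a'))"
    by (simp add: lift_op_def sum_distrib_left sum_distrib_right mult_ac)
  also have "\<dots> = (\<Sum>k\<in>I. \<Sum>x\<in>X. \<Sum>r\<in>R. \<Sum>x'\<in>X. c k * (cnj (V (x, r) a) * K k x x' * V (x', r) a'))"
    by (simp only: sum.swap[of _ I])
  finally show ?thesis
    by (simp add: lift_op_def sum_distrib_left)
qed

lemma matrix_mult_on_delta:
  "matrix_mult_on (UNIV :: 'b::finite set) delta K = K" "matrix_mult_on (UNIV :: 'b::finite set) J delta = J"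
proof -
  have "(\<Sum>k\<in>UNIV. J i k * delta k j) = (\<Sum>k\<in>(UNIV :: 'b set). delta j k * J i k)" for i j
    by (intro sum.cong) (auto simp: delta_def)
  then show "matrix_mult_on (UNIV :: 'b set) delta K = K" "matrix_mult_on (UNIV :: 'b set) J delta = J"
    by (simp_all add: matrix_mult_on_def sum_delta_left)
qed

lemma black_box_decompositionD:
  fixes dA dB :: nat and rA rB :: "nat \<Rightarrow> nat"
  assumes "black_box_decomposition S n X Y E p q m a F"
    and "\<forall>j\<in>{1..n}. unitary {..<dA} (X j \<times> {..<rA j}) (V j) \<and> unitary {..<dB} (Y j \<times> {..<rB j}) (V' j)"
    and "\<forall>k\<in>{1..<n}. cptp ({..<dA} \<times> {..<dB}) ({..<dA} \<times> {..<dB}) (B k)"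
    and "\<rho> \<in> ops ({..<dA} \<times> {..<dB})"
  shows "circuit (\<lambda>j. act_on_subsystem ({..<dA} \<times> {..<dB}) (X j \<times> Y j) ({..<rA j} \<times> {..<rB j})
                          (joint_embedding (V j) (V' j)) (E j)) B n \<rho> =
           (\<lambda>x x'. \<Sum>i=1..m. complex_of_real (a i) *
              partial_trace ({..<p} \<times> {..<q})
                (circuit (\<lambda>j. act_on_subsystem (({..<dA} \<times> {..<dB}) \<times> ({..<p} \<times> {..<q}))
                                ((X j \<times> {..<p}) \<times> (Y j \<times> {..<q})) ({..<rA j} \<times> {..<rB j})
                                (joint_embedding_ancilla (V j) (V' j)) (F i j))
                   (\<lambda>k. tensor_map (B k) id) n
                   (attach_state (matrix_unit (0, 0) (0, 0)) \<rho>)) x x')"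
  by (rule bspec[OF assms(1)[unfolded black_box_decomposition_def Let_def, THEN conjunct2, THEN conjunct2,
      THEN conjunct2, THEN spec[of _ dA], THEN spec[of _ dB], THEN spec[of _ rA], THEN spec[of _ rB],
      THEN spec[of _ V], THEN spec[of _ V'], THEN spec[of _ B], THEN mp, THEN mp, OF assms(2,3)] assms(4)])

context qubit_unitaries
begin

lemma W_kron: "j \<in> {1..n} \<Longrightarrow> W j = (\<lambda>p q. \<Sum>k<4. complex_of_real (u j k) * kron (L j k) (R j k) p q)"
  by (auto simp: fun_eq_iff W_expand mult.assoc)

lemma lift_op_W:
  assumes j: "j \<in> {1..n}"
  shows "lift_op (qubit \<times> qubit) (RA \<times> RB) (joint_embedding V V') (W j) (a, b) (a', b')
    = (\<Sum>k<4. complex_of_real (u j k) * (lift_op qubit RA V (L j k) a a' * lift_op qubit RB V' (R j k) b b'))"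
  unfolding W_kron[OF j] lift_op_lin_comb lift_op_joint_embedding ..

text \<open>Complement labels agree exactly if all bits other than bit \<open>j\<close> agree, so
  the embedded gate is \<open>W j\<close> on pair \<open>j\<close> and the identity on every other
  pair.\<close>

lemma lift_op_W_perm:
  assumes e: "coords n A e" and j: "j \<in> {1..n}"
    and \<phi>: "bij_betw \<phi> A (UNIV \<times> {..<(2::nat) ^ (n - 1)})" "\<And>a. fst (\<phi> a) = e a j"
    "\<And>a a'. a \<in> A \<Longrightarrow> a' \<in> A \<Longrightarrow> snd (\<phi> a) = snd (\<phi> a') \<longleftrightarrow> (\<forall>i\<in>{1..n} - {j}. e a i = e a' i)"
    and p: "p \<in> A \<times> A" "q \<in> A \<times> A"
  shows "lift_op (qubit \<times> qubit) ({..<2 ^ (n - 1)} \<times> {..<2 ^ (n - 1)}) (joint_embedding (perm_embedding \<phi>) (perm_embedding \<phi>)) (W j) p q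
    = multi_op n e e (\<lambda>i. if i = j then W j else delta) p q"
proof -
  obtain a b a' b' where pq: "p = (a, b)" "q = (a', b')" and mem: "a \<in> A" "b \<in> A" "a' \<in> A" "b' \<in> A"
    using p by auto
  have fin: "finite (UNIV :: bool set)" "finite {..<(2::nat) ^ (n - 1)}" by auto
  have "lift_op (qubit \<times> qubit) ({..<2 ^ (n - 1)} \<times> {..<2 ^ (n - 1)}) (joint_embedding (perm_embedding \<phi>) (perm_embedding \<phi>)) (W j) p q
    = W j (e a j, e b j) (e a' j, e b' j) * (delta (snd (\<phi> a)) (snd (\<phi> a')) * delta (snd (\<phi> b)) (snd (\<phi> b')))"
    unfolding pq lift_op_W[OF j] lift_op_perm_embedding[OF \<phi>(1) fin mem(1,3)] lift_op_perm_embedding[OF \<phi>(1) fin mem(2,4)]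
    by (simp add: \<phi>(2) W_expand[OF j] sum_distrib_left sum_distrib_right mult_ac)
  also have "delta (snd (\<phi> a)) (snd (\<phi> a')) * delta (snd (\<phi> b)) (snd (\<phi> b'))
      = (\<Prod>i\<in>{1..n} - {j}. if (e a i, e b i) = (e a' i, e b' i) then 1 else 0)"
    unfolding prod_delta[OF finite_Diff[OF finite_atLeastAtMost]] by (auto simp: delta_def \<phi>(3) mem)
  also have "W j (e a j, e b j) (e a' j, e b' j) * \<dots> = multi_op n e e (\<lambda>i. if i = j then W j else delta) p q"
    unfolding multi_op_def pq fst_conv snd_conv by (subst prod.remove[OF _ j]) (auto simp: delta_def intro!: arg_cong2[where f = "(*)"] prod.cong)
  finally show ?thesis .
qed

text \<open>Gates on different pairs multiply factor by factor: step \<open>Suc k\<close> replaces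
  the identity in factor \<open>Suc k\<close> by the gate.\<close>

lemma circuit_multi_op:
  assumes e: "coords n A e" and k: "1 \<le> k" "k \<le> n"
    and B: "\<And>j M. B j M = M"
    and E: "\<And>j. j \<in> {1..n} \<Longrightarrow> E j = conj_map (A \<times> A) (A \<times> A) (multi_op n e e (\<lambda>i. if i = j then W j else delta))"
  shows "circuit E B k = conj_map (A \<times> A) (A \<times> A) (multi_op n e e (\<lambda>i. if i \<in> {1..k} then W i else delta))"
  using k
proof (induction k rule: dec_induct)
  case base
  have "(\<lambda>i. if i = 1 then W 1 else delta) = (\<lambda>i. if i \<in> {1..1} then W i else delta)"
    by auto
  then show ?case
    using base E[of 1] by (simp add: circuit_Suc)
next
  case (step k)
  have fin: "finite (A \<times> A)"
    using coords_finite[OF e] by simp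
  have mm: "matrix_mult_on UNIV (if i = Suc k then W (Suc k) else delta) (if i \<in> {1..k} then W i else delta)
      = (if i \<in> {1..Suc k} then W i else delta)" for i
    by (auto simp: matrix_mult_on_delta)
  have "circuit E B (Suc k) M = conj_map (A \<times> A) (A \<times> A) (multi_op n e e (\<lambda>i. if i \<in> {1..Suc k} then W i else delta)) M" for M
  proof -
    have IH: "circuit E B k = conj_map (A \<times> A) (A \<times> A) (multi_op n e e (\<lambda>i. if i \<in> {1..k} then W i else delta))"
      using step by auto
    have j: "Suc k \<in> {1..n}"
      using step by auto
    have "circuit E B (Suc k) M = E (Suc k) (B k (circuit E B k M))"
      using step.hyps by (simp add: circuit_Suc)
    also have "\<dots> = E (Suc k) (circuit E B k M)"
      by (rule arg_cong[where f = "E (Suc k)", OF B])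
    finally show ?thesis
      unfolding IH E[OF j] conj_map_eq_sandwich sandwich_comp[OF fin fin] multi_op_mult[OF e e] mm .
  qed
  then show ?case
    by (simp add: fun_eq_iff)
qed

text \<open>A black box decomposition is valid in every surrounding, in particular for disjoint
  embeddings with identity channels in between. There the circuit is the product channel, and the
  right-hand side decomposes it into separable contractions.\<close>

theorem black_box_lower_bound:
  assumes n: "1 \<le> n"
    and S: "\<And>A B F. finite A \<Longrightarrow> finite B \<Longrightarrow> F \<in> S A B \<Longrightarrow> sep_contr (A \<times> B) product_kraus F"
    and U: "\<And>j. j \<in> {1..n} \<Longrightarrow> U j = conj_map (qubit \<times> qubit) (qubit \<times> qubit) (W j)"
    and bb: "black_box_decomposition S n (\<lambda>_. qubit) (\<lambda>_. qubit) U p q m a F"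
  shows "extent \<le> (\<Sum>i=1..m. \<bar>a i\<bar>)"
proof -
  \<comment> \<open>Exactly enough room for \<open>n\<close> disjoint qubits on either side.\<close>
  define A where "A = {..<(2::nat) ^ n}"
  define R where "R = {..<(2::nat) ^ (n - 1)}"
  have finA: "finite A" and finR: "finite R" by (simp_all add: A_def R_def)
  obtain e :: "nat \<Rightarrow> nat \<Rightarrow> bool" where e: "coords n A e"
    using finite_same_card_bij[of A labels] by (auto simp: coords_def A_def finite_PiE card_PiE)
  define good where "good = (\<lambda>j (\<phi> :: nat \<Rightarrow> bool \<times> nat). bij_betw \<phi> A (UNIV \<times> R) \<and> (\<forall>a. fst (\<phi> a) = e a j) \<and>
      (\<forall>a\<in>A. \<forall>a'\<in>A. snd (\<phi> a) = snd (\<phi> a') \<longleftrightarrow> (\<forall>i\<in>{1..n} - {j}. e a i = e a' i)))"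
  have "\<forall>j\<in>{1..n}. \<exists>\<phi>. good j \<phi>"
  proof
    fix j assume j: "j \<in> {1..n}"
    obtain \<phi> where \<phi>: "bij_betw \<phi> A (UNIV \<times> {..<(2::nat) ^ (n - 1)})" "\<And>a. fst (\<phi> a) = e a j"
      "\<And>a a'. a \<in> A \<Longrightarrow> a' \<in> A \<Longrightarrow> snd (\<phi> a) = snd (\<phi> a') \<longleftrightarrow> (\<forall>i\<in>{1..n} - {j}. e a i = e a' i)"
      by (rule qubit_embedding_exists[OF e j]) (rule that; assumption)
    have "good j \<phi>"
      unfolding good_def R_def by (intro conjI allI ballI \<phi>)
    then show "\<exists>\<phi>. good j \<phi>" by blast
  qed
  then obtain \<phi> where "\<forall>j\<in>{1..n}. good j (\<phi> j)"
    by (rule bchoice[THEN exE])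
  then have good: "good j (\<phi> j)" if "j \<in> {1..n}" for j
    using that by blast
  have \<phi>1: "bij_betw (\<phi> j) A (UNIV \<times> R)" if "j \<in> {1..n}" for j
    using good[OF that] by (simp add: good_def)
  have \<phi>2: "fst (\<phi> j a) = e a j" if "j \<in> {1..n}" for j a
    using good[OF that] by (simp add: good_def)
  have \<phi>3: "snd (\<phi> j a) = snd (\<phi> j a') \<longleftrightarrow> (\<forall>i\<in>{1..n} - {j}. e a i = e a' i)"
    if "j \<in> {1..n}" "a \<in> A" "a' \<in> A" for j a a'
    using good[OF that(1)] that(2,3) by (simp add: good_def)
  define V where "V = (\<lambda>j. perm_embedding (\<phi> j))"
  have V: "unitary A (qubit \<times> R) (V j)" if "j \<in> {1..n}" for j
    unfolding V_def by (rule unitary_perm_embedding[OF \<phi>1[OF that]]) (simp add: finR)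
  define AB where "AB = A \<times> A"
  define PQ where "PQ = {..<p} \<times> {..<q}"
  define E1 where "E1 = (\<lambda>j. act_on_subsystem AB (qubit \<times> qubit) (R \<times> R) (joint_embedding (V j) (V j)) (U j))"
  define E2 where "E2 = (\<lambda>i j. act_on_subsystem (AB \<times> PQ) ((qubit \<times> {..<p}) \<times> (qubit \<times> {..<q})) (R \<times> R)
      (joint_embedding_ancilla (V j) (V j)) (F i j))"
  define I2 :: "nat \<Rightarrow> ((nat \<times> nat) \<times> (nat \<times> nat), (nat \<times> nat) \<times> (nat \<times> nat)) opmap" where "I2 = (\<lambda>k. tensor_map id id)"
  have pq: "0 < p" "0 < q"
    and FS: "\<And>i j. i \<in> {1..m} \<Longrightarrow> j \<in> {1..n} \<Longrightarrow> F i j \<in> S (qubit \<times> {..<p}) (qubit \<times> {..<q})"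
    using bb unfolding black_box_decomposition_def by blast+
  have main: "circuit E1 (\<lambda>_. id) n \<rho> = (\<lambda>x x'. \<Sum>i=1..m. complex_of_real (a i) *
      partial_trace PQ (circuit (E2 i) I2 n (attach_state (matrix_unit (0, 0) (0, 0)) \<rho>)) x x')"
    if "\<rho> \<in> ops AB" for \<rho>
  proof -
    have uni: "\<forall>j\<in>{1..n}. unitary {..<2 ^ n} (qubit \<times> {..<2 ^ (n - 1)}) (V j) \<and> unitary {..<2 ^ n} (qubit \<times> {..<2 ^ (n - 1)}) (V j)"
      using V by (simp add: A_def R_def)
    have cps: "\<forall>k\<in>{1..<n}. cptp ({..<2 ^ n} \<times> {..<2 ^ n}) ({..<2 ^ n} \<times> {..<2 ^ n}) id"
      by (simp add: cptp_id)
    show ?thesis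
      unfolding E1_def E2_def I2_def AB_def PQ_def A_def R_def
      by (rule black_box_decompositionD[OF bb uni cps]) (use that in \<open>simp add: AB_def A_def\<close>)
  qed
  have "sep_contr AB product_kraus (close_ancilla PQ (0, 0) (circuit (E2 i) I2 n))" if i: "i \<in> {1..m}" for i
    unfolding AB_def PQ_def
  proof (rule sep_contr_close_ancilla)
    show "sep_contr ((A \<times> A) \<times> ({..<p} \<times> {..<q})) shuffled_kraus (circuit (E2 i) I2 n)"
    proof (rule sep_contr_circuit[OF _ _ n])
      fix j assume j: "j \<in> {1..n}"
      show "sep_contr ((A \<times> A) \<times> ({..<p} \<times> {..<q})) shuffled_kraus (E2 i j)"
        unfolding E2_def AB_def PQ_def
      proof (rule sep_contr_act_on_subsystem)
        show "unitary ((A \<times> A) \<times> ({..<p} \<times> {..<q})) (((qubit \<times> {..<p}) \<times> (qubit \<times> {..<q})) \<times> (R \<times> R)) (joint_embedding_ancilla (V j) (V j))"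
          by (intro unitary_joint_embedding_ancilla V j) auto
        show "sep_contr ((qubit \<times> {..<p}) \<times> (qubit \<times> {..<q})) product_kraus (F i j)"
          by (rule S[OF _ _ FS[OF i j]]) auto
        fix K :: "(bool \<times> nat) \<times> (bool \<times> nat) \<Rightarrow> (bool \<times> nat) \<times> (bool \<times> nat) \<Rightarrow> complex"
        assume "K \<in> product_kraus"
        then obtain k l where "K = kron k l"
          unfolding product_kraus_def by blast
        then show "lift_op ((qubit \<times> {..<p}) \<times> (qubit \<times> {..<q})) (R \<times> R) (joint_embedding_ancilla (V j) (V j)) K \<in> shuffled_kraus"
          unfolding shuffled_kraus_def by (auto simp: lift_op_joint_embedding_ancilla)
      qed (use finA finR in auto)
    qed (use finA in \<open>auto simp: I2_def tensor_map_id_id shuffled_kraus_mult\<close>)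
  qed (use pq finA in auto)
  moreover have "conj_map AB AB (prod_unitary e e) M = (\<lambda>y y'. \<Sum>i=1..m. complex_of_real (a i) * close_ancilla PQ (0, 0) (circuit (E2 i) I2 n) M y y')"
    if M: "M \<in> ops AB" for M
  proof -
    have E1: "E1 j = conj_map (A \<times> A) (A \<times> A) (multi_op n e e (\<lambda>i. if i = j then W j else delta))" if j: "j \<in> {1..n}" for j
    proof (rule ext)
      fix M
      have fin: "finite (A \<times> A)" "finite (qubit \<times> qubit)" "finite (R \<times> R)"
        using finA finR by auto
      show "E1 j M = conj_map (A \<times> A) (A \<times> A) (multi_op n e e (\<lambda>i. if i = j then W j else delta)) M"
        unfolding E1_def U[OF j] AB_def act_on_subsystem_conj_map[OF fin[unfolded R_def]] V_def R_def
        by (intro conj_map_cong lift_op_W_perm[OF e j \<phi>1[OF j, unfolded R_def] \<phi>2[OF j] \<phi>3[OF j]])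
    qed
    have "circuit E1 (\<lambda>_. id) n = conj_map (A \<times> A) (A \<times> A) (multi_op n e e (\<lambda>i. if i \<in> {1..n} then W i else delta))"
      by (rule circuit_multi_op[OF e n order_refl _ E1]) auto
    also have "multi_op n e e (\<lambda>i. if i \<in> {1..n} then W i else delta) = prod_unitary e e"
      by (auto simp: multi_op_def prod_unitary_def fun_eq_iff intro!: prod.cong)
    finally have c: "circuit E1 (\<lambda>_. id) n = conj_map (A \<times> A) (A \<times> A) (prod_unitary e e)" .
    show ?thesis
      using main[OF M] unfolding c close_ancilla_def AB_def .
  qed
  ultimately show ?thesis
    unfolding AB_def by (rule lower_bound[OF e e])
qed

end

section \<open>Controlled circuits\<close>

text \<open>The operator that applies \<open>M \<gamma>\<close> if the ancilla is in the state
  \<open>\<gamma>\<close>, preceded by \<open>g\<close> and followed by \<open>h\<close> on the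
  ancilla.\<close>

definition controlled :: "'g set \<Rightarrow> ('g \<Rightarrow> 'g \<Rightarrow> complex) \<Rightarrow> ('g \<Rightarrow> 'g \<Rightarrow> complex) \<Rightarrow> ('g \<Rightarrow> 'x \<Rightarrow> 'x \<Rightarrow> complex)
    \<Rightarrow> 'x \<times> 'g \<Rightarrow> 'x \<times> 'g \<Rightarrow> complex" where
  "controlled \<Gamma> h g M = (\<lambda>(x, \<pi>) (x', \<pi>'). \<Sum>\<gamma>\<in>\<Gamma>. h \<pi> \<gamma> * g \<gamma> \<pi>' * M \<gamma> x x')"

text \<open>The ancilla block \<open>(\<gamma>, \<gamma>')\<close> meets \<open>M \<gamma>\<close>
  on the left and the adjoint of \<open>M \<gamma>'\<close> on the right. Here distinct operators on
  the two sides arise.\<close>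

lemma sandwich_controlled:
  assumes "x \<in> X" "x' \<in> X" "\<pi> \<in> \<Gamma>" "\<pi>' \<in> \<Gamma>"
  shows "sandwich (X \<times> \<Gamma>) (X \<times> \<Gamma>) (controlled \<Gamma> h g M) (controlled \<Gamma> h g M) N (x, \<pi>) (x', \<pi>')
    = (\<Sum>\<gamma>\<in>\<Gamma>. \<Sum>\<gamma>'\<in>\<Gamma>. h \<pi> \<gamma> * cnj (h \<pi>' \<gamma>') *
        sandwich X X (M \<gamma>) (M \<gamma>') (\<lambda>k l. \<Sum>\<tau>\<in>\<Gamma>. \<Sum>\<tau>'\<in>\<Gamma>. g \<gamma> \<tau> * cnj (g \<gamma>' \<tau>') * N (k, \<tau>) (l, \<tau>')) x x')"
proof -
  define T where "T = (\<lambda>k l \<tau> \<tau>' \<gamma> \<gamma>'. h \<pi> \<gamma> * cnj (h \<pi>' \<gamma>') * (M \<gamma> x k * (g \<gamma> \<tau> * cnj (g \<gamma>' \<tau>') * N (k, \<tau>) (l, \<tau>')) * cnj (M \<gamma>' x' l)))"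
  have "(\<Sum>\<gamma>\<in>\<Gamma>. h \<pi> \<gamma> * g \<gamma> \<tau> * M \<gamma> x k) * N (k, \<tau>) (l, \<tau>') * cnj (\<Sum>\<gamma>\<in>\<Gamma>. h \<pi>' \<gamma> * g \<gamma> \<tau>' * M \<gamma> x' l)
      = (\<Sum>\<gamma>\<in>\<Gamma>. \<Sum>\<gamma>'\<in>\<Gamma>. T k l \<tau> \<tau>' \<gamma> \<gamma>')" for k l \<tau> \<tau>'
  proof -
    have "(\<Sum>\<gamma>\<in>\<Gamma>. h \<pi> \<gamma> * g \<gamma> \<tau> * M \<gamma> x k) * N (k, \<tau>) (l, \<tau>') * cnj (\<Sum>\<gamma>\<in>\<Gamma>. h \<pi>' \<gamma> * g \<gamma> \<tau>' * M \<gamma> x' l)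
      = N (k, \<tau>) (l, \<tau>') * ((\<Sum>\<gamma>\<in>\<Gamma>. h \<pi> \<gamma> * g \<gamma> \<tau> * M \<gamma> x k) * cnj (\<Sum>\<gamma>\<in>\<Gamma>. h \<pi>' \<gamma> * g \<gamma> \<tau>' * M \<gamma> x' l))"
      by (simp add: mult_ac)
    also have "\<dots> = (\<Sum>\<gamma>\<in>\<Gamma>. \<Sum>\<gamma>'\<in>\<Gamma>. N (k, \<tau>) (l, \<tau>') * ((h \<pi> \<gamma> * g \<gamma> \<tau> * M \<gamma> x k) * cnj (h \<pi>' \<gamma>' * g \<gamma>' \<tau>' * M \<gamma>' x' l)))"
      unfolding cnj_sum sum_product by (simp only: sum_distrib_left)
    finally show ?thesis
      by (simp add: T_def mult_ac)
  qed
  then have "sandwich (X \<times> \<Gamma>) (X \<times> \<Gamma>) (controlled \<Gamma> h g M) (controlled \<Gamma> h g M) N (x, \<pi>) (x', \<pi>')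
      = (\<Sum>k\<in>X. \<Sum>\<tau>\<in>\<Gamma>. \<Sum>l\<in>X. \<Sum>\<tau>'\<in>\<Gamma>. \<Sum>\<gamma>\<in>\<Gamma>. \<Sum>\<gamma>'\<in>\<Gamma>. T k l \<tau> \<tau>' \<gamma> \<gamma>')"
    using assms by (simp add: sandwich_def controlled_def sum.cartesian_product')
  also have "\<dots> = (\<Sum>k\<in>X. \<Sum>l\<in>X. \<Sum>\<tau>\<in>\<Gamma>. \<Sum>\<tau>'\<in>\<Gamma>. \<Sum>\<gamma>\<in>\<Gamma>. \<Sum>\<gamma>'\<in>\<Gamma>. T k l \<tau> \<tau>' \<gamma> \<gamma>')"
    by (rule sum.cong[OF refl]) (rule sum.swap)
  also have "\<dots> = (\<Sum>k\<in>X. \<Sum>l\<in>X. \<Sum>\<gamma>\<in>\<Gamma>. \<Sum>\<gamma>'\<in>\<Gamma>. \<Sum>\<tau>\<in>\<Gamma>. \<Sum>\<tau>'\<in>\<Gamma>. T k l \<tau> \<tau>' \<gamma> \<gamma>')"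
    by (rule sum.cong[OF refl], rule sum.cong[OF refl]) (rule sum_swap_pairs)
  also have "\<dots> = (\<Sum>\<gamma>\<in>\<Gamma>. \<Sum>\<gamma>'\<in>\<Gamma>. \<Sum>k\<in>X. \<Sum>l\<in>X. \<Sum>\<tau>\<in>\<Gamma>. \<Sum>\<tau>'\<in>\<Gamma>. T k l \<tau> \<tau>' \<gamma> \<gamma>')"
    by (rule sum_swap_pairs)
  finally show ?thesis
    using assms by (simp add: sandwich_def T_def sum_distrib_left sum_distrib_right mult.assoc)
qed

lemma sandwich_scale: "sandwich X Y K K' (\<lambda>k l. c * N k l) y y' = c * sandwich X Y K K' N y y'"
  by (simp add: sandwich_def sum_distrib_left mult_ac)

lemma sandwich_cong_arg:
  assumes "\<And>k l. k \<in> X \<Longrightarrow> l \<in> X \<Longrightarrow> N k l = N' k l"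
  shows "sandwich X Y K K' N = sandwich X Y K K' N'"
  using assms by (simp add: sandwich_def fun_eq_iff)

text \<open>One signed step, when \<open>g\<close> brings every ancilla block of the input to a
  scalar times a known operator. This form covers the first step, where \<open>g\<close> prepares
  the ancilla, as well as the later ones.\<close>

lemma controlled_step:
  fixes X :: "'x set" and \<Gamma> :: "'g set"
  assumes inner: "\<And>\<gamma> \<gamma>' k l. \<gamma> \<in> \<Gamma> \<Longrightarrow> \<gamma>' \<in> \<Gamma> \<Longrightarrow> k \<in> X \<Longrightarrow> l \<in> X \<Longrightarrow>
      (\<Sum>\<tau>\<in>\<Gamma>. \<Sum>\<tau>'\<in>\<Gamma>. g \<gamma> \<tau> * cnj (g \<gamma>' \<tau>') * N (k, \<tau>) (l, \<tau>')) = c \<gamma> \<gamma>' * P \<gamma> \<gamma>' k l"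
  shows "(\<Sum>\<sigma>\<in>\<Gamma>. sg \<sigma> * conj_map (X \<times> \<Gamma>) (X \<times> \<Gamma>) (controlled \<Gamma> (h \<sigma>) g M) N (x, \<pi>) (x', \<pi>'))
    = (if \<pi> \<in> \<Gamma> \<and> \<pi>' \<in> \<Gamma> then (\<Sum>\<gamma>\<in>\<Gamma>. \<Sum>\<gamma>'\<in>\<Gamma>.
      (\<Sum>\<sigma>\<in>\<Gamma>. sg \<sigma> * h \<sigma> \<pi> \<gamma> * cnj (h \<sigma> \<pi>' \<gamma>')) * c \<gamma> \<gamma>' * sandwich X X (M \<gamma>) (M \<gamma>') (P \<gamma> \<gamma>') x x') else 0)"
proof (cases "\<pi> \<in> \<Gamma> \<and> \<pi>' \<in> \<Gamma> \<and> x \<in> X \<and> x' \<in> X")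
  case True
  have "(\<Sum>\<sigma>\<in>\<Gamma>. sg \<sigma> * conj_map (X \<times> \<Gamma>) (X \<times> \<Gamma>) (controlled \<Gamma> (h \<sigma>) g M) N (x, \<pi>) (x', \<pi>'))
    = (\<Sum>\<sigma>\<in>\<Gamma>. sg \<sigma> * (\<Sum>\<gamma>\<in>\<Gamma>. \<Sum>\<gamma>'\<in>\<Gamma>. h \<sigma> \<pi> \<gamma> * cnj (h \<sigma> \<pi>' \<gamma>') * (c \<gamma> \<gamma>' * sandwich X X (M \<gamma>) (M \<gamma>') (P \<gamma> \<gamma>') x x')))"
  proof (intro sum.cong refl arg_cong2[where f = "(*)"])
    fix \<sigma>
    have "conj_map (X \<times> \<Gamma>) (X \<times> \<Gamma>) (controlled \<Gamma> (h \<sigma>) g M) N (x, \<pi>) (x', \<pi>')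
      = (\<Sum>\<gamma>\<in>\<Gamma>. \<Sum>\<gamma>'\<in>\<Gamma>. h \<sigma> \<pi> \<gamma> * cnj (h \<sigma> \<pi>' \<gamma>') *
        sandwich X X (M \<gamma>) (M \<gamma>') (\<lambda>k l. \<Sum>\<tau>\<in>\<Gamma>. \<Sum>\<tau>'\<in>\<Gamma>. g \<gamma> \<tau> * cnj (g \<gamma>' \<tau>') * N (k, \<tau>) (l, \<tau>')) x x')"
      unfolding conj_map_eq_sandwich using True by (intro sandwich_controlled) auto
    also have "\<dots> = (\<Sum>\<gamma>\<in>\<Gamma>. \<Sum>\<gamma>'\<in>\<Gamma>. h \<sigma> \<pi> \<gamma> * cnj (h \<sigma> \<pi>' \<gamma>') *
        (c \<gamma> \<gamma>' * sandwich X X (M \<gamma>) (M \<gamma>') (P \<gamma> \<gamma>') x x'))"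
    proof (intro sum.cong refl arg_cong2[where f = "(*)"])
      fix \<gamma> \<gamma>' assume "\<gamma> \<in> \<Gamma>" "\<gamma>' \<in> \<Gamma>"
      then have "sandwich X X (M \<gamma>) (M \<gamma>') (\<lambda>k l. \<Sum>\<tau>\<in>\<Gamma>. \<Sum>\<tau>'\<in>\<Gamma>. g \<gamma> \<tau> * cnj (g \<gamma>' \<tau>') * N (k, \<tau>) (l, \<tau>'))
        = sandwich X X (M \<gamma>) (M \<gamma>') (\<lambda>k l. c \<gamma> \<gamma>' * P \<gamma> \<gamma>' k l)"
        by (intro sandwich_cong_arg inner)
      then show "sandwich X X (M \<gamma>) (M \<gamma>') (\<lambda>k l. \<Sum>\<tau>\<in>\<Gamma>. \<Sum>\<tau>'\<in>\<Gamma>. g \<gamma> \<tau> * cnj (g \<gamma>' \<tau>') * N (k, \<tau>) (l, \<tau>')) x x'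
        = c \<gamma> \<gamma>' * sandwich X X (M \<gamma>) (M \<gamma>') (P \<gamma> \<gamma>') x x'"
        by (simp add: sandwich_scale)
    qed
    finally show "conj_map (X \<times> \<Gamma>) (X \<times> \<Gamma>) (controlled \<Gamma> (h \<sigma>) g M) N (x, \<pi>) (x', \<pi>') = \<dots>" .
  qed
  also have "\<dots> = (\<Sum>\<sigma>\<in>\<Gamma>. \<Sum>\<gamma>\<in>\<Gamma>. \<Sum>\<gamma>'\<in>\<Gamma>. (sg \<sigma> * h \<sigma> \<pi> \<gamma> * cnj (h \<sigma> \<pi>' \<gamma>')) * (c \<gamma> \<gamma>' * sandwich X X (M \<gamma>) (M \<gamma>') (P \<gamma> \<gamma>') x x'))"
    by (simp add: sum_distrib_left mult.assoc)
  also have "\<dots> = (\<Sum>\<gamma>\<in>\<Gamma>. \<Sum>\<sigma>\<in>\<Gamma>. \<Sum>\<gamma>'\<in>\<Gamma>. (sg \<sigma> * h \<sigma> \<pi> \<gamma> * cnj (h \<sigma> \<pi>' \<gamma>')) * (c \<gamma> \<gamma>' * sandwich X X (M \<gamma>) (M \<gamma>') (P \<gamma> \<gamma>') x x'))"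
    by (rule sum.swap)
  also have "\<dots> = (\<Sum>\<gamma>\<in>\<Gamma>. \<Sum>\<gamma>'\<in>\<Gamma>. \<Sum>\<sigma>\<in>\<Gamma>. (sg \<sigma> * h \<sigma> \<pi> \<gamma> * cnj (h \<sigma> \<pi>' \<gamma>')) * (c \<gamma> \<gamma>' * sandwich X X (M \<gamma>) (M \<gamma>') (P \<gamma> \<gamma>') x x'))"
    by (rule sum.cong[OF refl]) (rule sum.swap)
  finally show ?thesis
    using True by (simp add: sum_distrib_right mult.assoc)
next
  case False
  then show ?thesis
    by (auto simp: conj_map_eq_sandwich sandwich_def)
qed

lemma linear_map_circuit:
  assumes "1 \<le> k" "\<And>i. i \<in> {1..k} \<Longrightarrow> linear_map X X (E i)" "\<And>i. i \<in> {1..<k} \<Longrightarrow> linear_map X X (B i)"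
  shows "linear_map X X (circuit E B k)"
  using assms
proof (induction k rule: dec_induct)
  case base
  then show ?case by (simp add: circuit_Suc)
next
  case (step k)
  have "linear_map X X (E (Suc k) \<circ> (B k \<circ> circuit E B k))"
    by (intro linear_map_comp[OF linear_map_comp]) (use step in auto)
  moreover have "circuit E B (Suc k) = E (Suc k) \<circ> (B k \<circ> circuit E B k)"
    using step.hyps by (simp add: circuit_Suc comp_assoc)
  ultimately show ?case
    by (simp only:)
qed

text \<open>Between preparation and final readout nothing mixes the control labels, so the ancilla
  blocks evolve independently. Block \<open>(\<gamma>, \<gamma>')\<close> starts with its amplitude
  from the preparation, meets \<open>M i \<gamma>\<close> and \<open>M i \<gamma>'\<close> in every
  step, and passes through the channels \<open>B k\<close> in between like any operator on the main
  system.\<close>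

lemma controlled_circuit:
  fixes X :: "'x set" and \<Gamma> :: "'g set"
  assumes fin: "finite X" "finite \<Gamma>" and o': "o' \<in> \<Gamma>"
    and step: "\<And>j N. j \<in> {1..n} \<Longrightarrow> step j N = (\<lambda>y y'. \<Sum>\<sigma>\<in>\<Gamma>. sg \<sigma> *
      conj_map (X \<times> \<Gamma>) (X \<times> \<Gamma>) (controlled \<Gamma> (h j \<sigma>) (g j) (M j)) N y y')"
    and h: "\<And>j \<sigma> \<pi> \<gamma>. j \<in> {1..<n} \<Longrightarrow> \<pi> \<in> \<Gamma> \<Longrightarrow> \<gamma> \<in> \<Gamma> \<Longrightarrow> \<sigma> \<in> \<Gamma> \<Longrightarrow>
      h j \<sigma> \<pi> \<gamma> = delta o' \<sigma> * delta \<pi> \<gamma>" and sg: "sg o' = 1"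
    and g: "\<And>j \<gamma> \<tau>. j \<in> {2..n} \<Longrightarrow> \<gamma> \<in> \<Gamma> \<Longrightarrow> \<tau> \<in> \<Gamma> \<Longrightarrow> g j \<gamma> \<tau> = delta \<gamma> \<tau>"
    and B: "\<And>k. k \<in> {1..<n} \<Longrightarrow> linear_map X X (B k)" and \<rho>: "\<rho> \<in> ops X"
    and j: "1 \<le> j" "j \<le> n"
  shows "circuit step (\<lambda>k. tensor_map (B k) id) j (attach_state (matrix_unit o' o') \<rho>) =
    (\<lambda>(x, \<pi>) (x', \<pi>'). if \<pi> \<in> \<Gamma> \<and> \<pi>' \<in> \<Gamma> then (\<Sum>\<gamma>\<in>\<Gamma>. \<Sum>\<gamma>'\<in>\<Gamma>.
      (\<Sum>\<sigma>\<in>\<Gamma>. sg \<sigma> * h j \<sigma> \<pi> \<gamma> * cnj (h j \<sigma> \<pi>' \<gamma>')) * (g 1 \<gamma> o' * cnj (g 1 \<gamma>' o')) *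
      circuit (\<lambda>i. sandwich X X (M i \<gamma>) (M i \<gamma>')) B j \<rho> x x') else 0)"
  using j
proof (induction j rule: dec_induct)
  case base
  have one: "1 \<in> {1..n}" using base by auto
  have inner: "(\<Sum>\<tau>\<in>\<Gamma>. \<Sum>\<tau>'\<in>\<Gamma>. g 1 \<gamma> \<tau> * cnj (g 1 \<gamma>' \<tau>') * attach_state (matrix_unit o' o') \<rho> (k, \<tau>) (l, \<tau>'))
      = (g 1 \<gamma> o' * cnj (g 1 \<gamma>' o')) * \<rho> k l" for \<gamma> \<gamma>' k l
  proof -
    have "(\<Sum>\<tau>\<in>\<Gamma>. \<Sum>\<tau>'\<in>\<Gamma>. g 1 \<gamma> \<tau> * cnj (g 1 \<gamma>' \<tau>') * attach_state (matrix_unit o' o') \<rho> (k, \<tau>) (l, \<tau>'))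
      = (\<Sum>\<tau>\<in>\<Gamma>. delta o' \<tau> * (\<Sum>\<tau>'\<in>\<Gamma>. delta o' \<tau>' * (g 1 \<gamma> \<tau> * cnj (g 1 \<gamma>' \<tau>') * \<rho> k l)))"
      unfolding sum_distrib_left by (intro sum.cong refl) (auto simp: attach_state_def matrix_unit_def delta_def)
    then show ?thesis
      using fin o' by (simp add: sum_delta_left)
  qed
  show ?case
    using controlled_step[where X = X and \<Gamma> = \<Gamma> and g = "g 1" and N = "attach_state (matrix_unit o' o') \<rho>"
        and P = "\<lambda>_ _. \<rho>", OF inner, where sg = sg and h = "h 1" and M = "M 1"] step[OF one]
    by (simp add: circuit_Suc fun_eq_iff)
next
  case (step j)
  let ?C = "\<lambda>\<gamma> \<gamma>'. circuit (\<lambda>i. sandwich X X (M i \<gamma>) (M i \<gamma>')) B j \<rho>"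
  let ?\<alpha> = "\<lambda>\<gamma> \<gamma>'. g 1 \<gamma> o' * cnj (g 1 \<gamma>' o')"
  define S where "S = circuit step (\<lambda>k. tensor_map (B k) id) j (attach_state (matrix_unit o' o') \<rho>)"
  have jn: "j \<in> {1..<n}" "Suc j \<in> {1..n}" "Suc j \<in> {2..n}" "j \<noteq> 0" using step by auto
  have IH: "S = (\<lambda>(x, \<pi>) (x', \<pi>'). if \<pi> \<in> \<Gamma> \<and> \<pi>' \<in> \<Gamma> then (\<Sum>\<gamma>\<in>\<Gamma>. \<Sum>\<gamma>'\<in>\<Gamma>.
      (\<Sum>\<sigma>\<in>\<Gamma>. sg \<sigma> * h j \<sigma> \<pi> \<gamma> * cnj (h j \<sigma> \<pi>' \<gamma>')) * ?\<alpha> \<gamma> \<gamma>' * ?C \<gamma> \<gamma>' x x') else 0)"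
    unfolding S_def by (rule step.IH) (use jn in auto)
  have C_ops: "?C \<gamma> \<gamma>' \<in> ops X" for \<gamma> \<gamma>'
    by (rule linear_mapD(1)[OF linear_map_circuit \<rho>]) (use step B in auto)
  have S: "S (a, \<gamma>) (a', \<gamma>') = ?\<alpha> \<gamma> \<gamma>' * ?C \<gamma> \<gamma>' a a'" if "\<gamma> \<in> \<Gamma>" "\<gamma>' \<in> \<Gamma>" for a a' \<gamma> \<gamma>'
  proof -
    \<comment> \<open>A readout before the last step has the single outcome \<open>o'\<close> and
      leaves the ancilla alone.\<close>
    have w: "(\<Sum>\<sigma>\<in>\<Gamma>. sg \<sigma> * h j \<sigma> \<gamma> \<gamma>1 * cnj (h j \<sigma> \<gamma>' \<gamma>2)) = delta \<gamma> \<gamma>1 * delta \<gamma>' \<gamma>2" if "\<gamma>1 \<in> \<Gamma>" "\<gamma>2 \<in> \<Gamma>" for \<gamma>1 \<gamma>2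
    proof -
      have "(\<Sum>\<sigma>\<in>\<Gamma>. sg \<sigma> * h j \<sigma> \<gamma> \<gamma>1 * cnj (h j \<sigma> \<gamma>' \<gamma>2)) = (\<Sum>\<sigma>\<in>\<Gamma>. delta o' \<sigma> * (sg \<sigma> * (delta \<gamma> \<gamma>1 * delta \<gamma>' \<gamma>2)))"
        using \<open>\<gamma> \<in> \<Gamma>\<close> \<open>\<gamma>' \<in> \<Gamma>\<close> that by (intro sum.cong refl) (auto simp: h[OF jn(1)] delta_def)
      then show ?thesis
        using fin o' sg by (simp add: sum_delta_left)
    qed
    have "S (a, \<gamma>) (a', \<gamma>') = (\<Sum>\<gamma>1\<in>\<Gamma>. \<Sum>\<gamma>2\<in>\<Gamma>.
        (\<Sum>\<sigma>\<in>\<Gamma>. sg \<sigma> * h j \<sigma> \<gamma> \<gamma>1 * cnj (h j \<sigma> \<gamma>' \<gamma>2)) * ?\<alpha> \<gamma>1 \<gamma>2 * ?C \<gamma>1 \<gamma>2 a a')"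
      unfolding IH using that by simp
    also have "\<dots> = (\<Sum>\<gamma>1\<in>\<Gamma>. delta \<gamma> \<gamma>1 * (\<Sum>\<gamma>2\<in>\<Gamma>. delta \<gamma>' \<gamma>2 * (?\<alpha> \<gamma>1 \<gamma>2 * ?C \<gamma>1 \<gamma>2 a a')))"
      unfolding sum_distrib_left by (intro sum.cong refl) (simp add: w)
    finally show ?thesis
      using fin that by (simp add: sum_delta_left)
  qed
  have inner: "(\<Sum>\<tau>\<in>\<Gamma>. \<Sum>\<tau>'\<in>\<Gamma>. g (Suc j) \<gamma> \<tau> * cnj (g (Suc j) \<gamma>' \<tau>') * tensor_map (B j) id S (k, \<tau>) (l, \<tau>'))
      = ?\<alpha> \<gamma> \<gamma>' * B j (?C \<gamma> \<gamma>') k l" if \<gamma>: "\<gamma> \<in> \<Gamma>" "\<gamma>' \<in> \<Gamma>" for \<gamma> \<gamma>' k l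
  proof -
    have "(\<Sum>\<tau>\<in>\<Gamma>. \<Sum>\<tau>'\<in>\<Gamma>. g (Suc j) \<gamma> \<tau> * cnj (g (Suc j) \<gamma>' \<tau>') * tensor_map (B j) id S (k, \<tau>) (l, \<tau>'))
      = (\<Sum>\<tau>\<in>\<Gamma>. delta \<gamma> \<tau> * (\<Sum>\<tau>'\<in>\<Gamma>. delta \<gamma>' \<tau>' * tensor_map (B j) id S (k, \<tau>) (l, \<tau>')))"
      unfolding sum_distrib_left by (intro sum.cong refl) (simp add: g[OF jn(3)] \<gamma> cnj_delta)
    also have "\<dots> = B j (\<lambda>a a'. S (a, \<gamma>) (a', \<gamma>')) k l"
      using fin \<gamma> by (simp add: sum_delta_left tensor_map_def)
    also have "\<dots> = B j (\<lambda>a a'. ?\<alpha> \<gamma> \<gamma>' * ?C \<gamma> \<gamma>' a a') k l"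
      unfolding S[OF \<gamma>] ..
    also have "\<dots> = ?\<alpha> \<gamma> \<gamma>' * B j (?C \<gamma> \<gamma>') k l"
      unfolding linear_mapD(3)[OF B[OF jn(1)] C_ops] ..
    finally show ?thesis .
  qed
  have c: "circuit step (\<lambda>k. tensor_map (B k) id) (Suc j) (attach_state (matrix_unit o' o') \<rho>) = step (Suc j) (tensor_map (B j) id S)"
    using jn(4) by (simp add: circuit_Suc S_def)
  have c': "circuit (\<lambda>i. sandwich X X (M i \<gamma>) (M i \<gamma>')) B (Suc j) \<rho> = sandwich X X (M (Suc j) \<gamma>) (M (Suc j) \<gamma>') (B j (?C \<gamma> \<gamma>'))" for \<gamma> \<gamma>'
    using jn(4) by (simp add: circuit_Suc)
  show ?case
    unfolding c c' assms(4)[OF jn(2)]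
    using controlled_step[where X = X and \<Gamma> = \<Gamma> and g = "g (Suc j)" and N = "tensor_map (B j) id S"
        and P = "\<lambda>\<gamma> \<gamma>'. B j (?C \<gamma> \<gamma>')" and c = ?\<alpha>, OF inner, where sg = sg and h = "h (Suc j)" and M = "M (Suc j)"]
    by (simp add: fun_eq_iff)
qed

lemma circuit_cong:
  assumes "\<And>i. i \<in> {1..k} \<Longrightarrow> E i = E' i"
  shows "circuit E B k = circuit E' B k"
  using assms
proof (induction k)
  case (Suc k)
  have eq: "circuit E B k = circuit E' B k" "E 1 = E' 1" "E (Suc k) = E' (Suc k)"
    by (rule Suc.IH) (use Suc.prems in auto)
  show ?case
    unfolding circuit_Suc eq ..
qed simp

lemma multi_index_0: "multi_index 0 = {\<lambda>_. undefined}"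
  by (simp add: multi_index_def)

lemma sum_multi_index_Suc:
  "(\<Sum>\<kappa>\<in>multi_index (Suc k). f \<kappa>) = (\<Sum>\<kappa>\<in>multi_index k. \<Sum>c<4. f (\<kappa>(Suc k := c)))"
proof -
  have ins: "{1..Suc k} = insert (Suc k) {1..k}"
    by auto
  have inj: "inj_on (\<lambda>(c, \<kappa>). \<kappa>(Suc k := c)) ({..<4::nat} \<times> (\<Pi>\<^sub>E j\<in>{1..k}. {..<4}))"
    using inj_combinator[of "Suc k" "{1..k}" "\<lambda>_. {..<4}"] by simp
  have "(\<Sum>\<kappa>\<in>multi_index (Suc k). f \<kappa>) = (\<Sum>(c, \<kappa>)\<in>{..<4} \<times> multi_index k. f (\<kappa>(Suc k := c)))"
    unfolding multi_index_def ins PiE_insert_eq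
    by (subst sum.reindex[OF inj]) (simp only: o_def case_prod_unfold)
  also have "\<dots> = (\<Sum>\<kappa>\<in>multi_index k. \<Sum>c<4. f (\<kappa>(Suc k := c)))"
    by (subst sum.cartesian_product[symmetric]) (rule sum.swap)
  finally show ?thesis .
qed

text \<open>A circuit is linear in the left operator of every step and conjugate linear in the right
  one. Each step of the induction appends one component to both multi-indices.\<close>

lemma circuit_expand:
  assumes fin: "finite X" and B: "\<And>i. i \<in> {1..<k} \<Longrightarrow> linear_map X X (B i)" and \<rho>: "\<rho> \<in> ops X"
  shows "circuit (\<lambda>j. sandwich X X (\<lambda>x y. \<Sum>c<4. complex_of_real (u j c) * Q j c x y) (\<lambda>x y. \<Sum>c<4. complex_of_real (u j c) * Q j c x y)) B k \<rho>
    = (\<lambda>x x'. \<Sum>\<kappa>\<in>multi_index k. \<Sum>\<kappa>'\<in>multi_index k. complex_of_real ((\<Prod>j=1..k. u j (\<kappa> j)) * (\<Prod>j=1..k. u j (\<kappa>' j))) *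
        circuit (\<lambda>j. sandwich X X (Q j (\<kappa> j)) (Q j (\<kappa>' j))) B k \<rho> x x')"
  using B
proof (induction k)
  case 0
  then show ?case by (simp add: multi_index_0)
next
  case (Suc k)
  let ?w = "\<lambda>k \<kappa>. \<Prod>j=1..k. u j (\<kappa> j)"
  let ?C = "\<lambda>k \<kappa> \<kappa>'. circuit (\<lambda>j. sandwich X X (Q j (\<kappa> j)) (Q j (\<kappa>' j))) B k"
  let ?E = "\<lambda>j. sandwich X X (\<lambda>x y. \<Sum>c<4. complex_of_real (u j c) * Q j c x y) (\<lambda>x y. \<Sum>c<4. complex_of_real (u j c) * Q j c x y)"
  \<comment> \<open>The channel in front of step \<open>Suc k\<close>, absent in front of the first
    step; this treats both cases of \<open>circuit_Suc\<close> at once.\<close>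
  define pre where "pre = (\<lambda>N. if k = 0 then N else B k N)"
  have lin: "linear_map X X pre"
  proof (cases "k = 0")
    case True
    then show ?thesis using linear_map_id[of X] by (simp add: pre_def id_def)
  next
    case False
    then show ?thesis using Suc.prems[of k] by (simp add: pre_def)
  qed
  have circ: "circuit E B (Suc k) \<rho> = E (Suc k) (pre (circuit E B k \<rho>))" for E
    by (simp add: circuit_Suc pre_def)
  have C_ops: "?C k \<kappa> \<kappa>' \<rho> \<in> ops X" for \<kappa> \<kappa>'
  proof (cases "k = 0")
    case False
    then show ?thesis
      by (intro linear_mapD(1)[OF linear_map_circuit \<rho>]) (use Suc.prems in auto)
  qed (use \<rho> in simp)
  let ?I = "multi_index k \<times> multi_index k"
  have IH: "circuit ?E B k \<rho> = (\<lambda>x x'. \<Sum>t\<in>?I. complex_of_real (?w k (fst t) * ?w k (snd t)) * ?C k (fst t) (snd t) \<rho> x x')"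
    using Suc by (simp add: sum.cartesian_product case_prod_beta)
  have "pre (circuit ?E B k \<rho>) = (\<lambda>x x'. \<Sum>t\<in>?I. complex_of_real (?w k (fst t) * ?w k (snd t)) * pre (?C k (fst t) (snd t) \<rho>) x x')"
    unfolding IH by (rule linear_map_sum[OF lin]) (use C_ops in auto)
  then have 1: "circuit ?E B (Suc k) \<rho> = (\<lambda>x x'. \<Sum>t\<in>?I. complex_of_real (?w k (fst t) * ?w k (snd t)) * ?E (Suc k) (pre (?C k (fst t) (snd t) \<rho>)) x x')"
    unfolding circ by (simp only:) (rule linear_map_sum[OF linear_map_sandwich], use linear_mapD(1)[OF lin C_ops] in auto)
  have 2: "?E (Suc k) N x x' = (\<Sum>c<4. \<Sum>c'<4. complex_of_real (u (Suc k) c * u (Suc k) c') * sandwich X X (Q (Suc k) c) (Q (Suc k) c') N x x')" for N x x'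
  proof (cases "x \<in> X \<and> x' \<in> X")
    case True
    have "?E (Suc k) N x x' = (\<Sum>a\<in>X. \<Sum>b\<in>X. \<Sum>c<4. \<Sum>c'<4. complex_of_real (u (Suc k) c * u (Suc k) c') * (Q (Suc k) c x a * N a b * cnj (Q (Suc k) c' x' b)))"
    proof -
      have "(\<Sum>c<4. complex_of_real (u (Suc k) c) * Q (Suc k) c x a) * N a b * cnj (\<Sum>c<4. complex_of_real (u (Suc k) c) * Q (Suc k) c x' b)
        = N a b * ((\<Sum>c<4. complex_of_real (u (Suc k) c) * Q (Suc k) c x a) * cnj (\<Sum>c<4. complex_of_real (u (Suc k) c) * Q (Suc k) c x' b))" for a b
        by (simp add: mult_ac)
      also have "\<dots> a b = (\<Sum>c<4. \<Sum>c'<4. N a b * ((complex_of_real (u (Suc k) c) * Q (Suc k) c x a) * cnj (complex_of_real (u (Suc k) c') * Q (Suc k) c' x' b)))" for a b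
        unfolding cnj_sum sum_product by (simp only: sum_distrib_left)
      finally show ?thesis
        using True by (simp add: sandwich_def mult_ac)
    qed
    also have "\<dots> = (\<Sum>c<4. \<Sum>c'<4. \<Sum>a\<in>X. \<Sum>b\<in>X. complex_of_real (u (Suc k) c * u (Suc k) c') * (Q (Suc k) c x a * N a b * cnj (Q (Suc k) c' x' b)))"
      by (rule sum_swap_pairs)
    finally show ?thesis
      using True by (simp add: sandwich_def sum_distrib_left)
  qed (auto simp: sandwich_def)
  have w_upd: "?w (Suc k) (\<kappa>(Suc k := c)) = ?w k \<kappa> * u (Suc k) c" for \<kappa> c
  proof -
    have "(\<Prod>j=1..k. u j ((\<kappa>(Suc k := c)) j)) = ?w k \<kappa>"
      by (intro prod.cong refl) auto
    then show ?thesis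
      by (simp add: prod.cl_ivl_Suc)
  qed
  have C_upd: "?C (Suc k) (\<kappa>(Suc k := c)) (\<kappa>'(Suc k := c')) \<rho> = sandwich X X (Q (Suc k) c) (Q (Suc k) c') (pre (?C k \<kappa> \<kappa>' \<rho>))" for \<kappa> \<kappa>' c c'
  proof -
    have "?C k (\<kappa>(Suc k := c)) (\<kappa>'(Suc k := c')) = ?C k \<kappa> \<kappa>'"
      by (rule circuit_cong) auto
    then show ?thesis
      unfolding circ by simp
  qed
  have "(\<Sum>\<kappa>\<in>multi_index (Suc k). \<Sum>\<kappa>'\<in>multi_index (Suc k). complex_of_real (?w (Suc k) \<kappa> * ?w (Suc k) \<kappa>') * ?C (Suc k) \<kappa> \<kappa>' \<rho> x x')
    = (\<Sum>\<kappa>\<in>multi_index k. \<Sum>c<4. \<Sum>\<kappa>'\<in>multi_index k. \<Sum>c'<4. complex_of_real ((?w k \<kappa> * u (Suc k) c) * (?w k \<kappa>' * u (Suc k) c')) *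
        sandwich X X (Q (Suc k) c) (Q (Suc k) c') (pre (?C k \<kappa> \<kappa>' \<rho>)) x x')" for x x'
    unfolding sum_multi_index_Suc w_upd C_upd ..
  also have "\<dots> x x' = (\<Sum>\<kappa>\<in>multi_index k. \<Sum>\<kappa>'\<in>multi_index k. \<Sum>c<4. \<Sum>c'<4. complex_of_real ((?w k \<kappa> * u (Suc k) c) * (?w k \<kappa>' * u (Suc k) c')) *
        sandwich X X (Q (Suc k) c) (Q (Suc k) c') (pre (?C k \<kappa> \<kappa>' \<rho>)) x x')" for x x'
    by (intro sum.cong refl) (rule sum.swap)
  finally have 3: "(\<Sum>\<kappa>\<in>multi_index (Suc k). \<Sum>\<kappa>'\<in>multi_index (Suc k). complex_of_real (?w (Suc k) \<kappa> * ?w (Suc k) \<kappa>') * ?C (Suc k) \<kappa> \<kappa>' \<rho> x x')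
    = (\<Sum>\<kappa>\<in>multi_index k. \<Sum>\<kappa>'\<in>multi_index k. complex_of_real (?w k \<kappa> * ?w k \<kappa>') * ?E (Suc k) (pre (?C k \<kappa> \<kappa>' \<rho>)) x x')" for x x'
    unfolding 2 by (simp add: sum_distrib_left mult_ac)
  show ?case
    unfolding 1 3 by (simp add: sum.cartesian_product case_prod_beta)
qed

section \<open>The black box upper bound\<close>

definition hadamard :: "nat \<Rightarrow> nat \<Rightarrow> complex" where
  "hadamard p c = (if p = 1 \<and> c = 1 then -1 else 1) / complex_of_real (sqrt 2)"

text \<open>The ancilla qubit is rotated to \<open>|+\<rangle>\<close> in the first step, controls the gates in all steps, and in
  the last step is measured in the basis \<open>X\<close> after a phase \<open>phase b\<close> on \<open>|0\<rangle>\<close>.\<close>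

definition prep :: "nat \<Rightarrow> nat \<Rightarrow> nat \<Rightarrow> complex" where
  "prep j = (if j = 1 then hadamard else delta)"

text \<open>Up to step \<open>n - 1\<close> the outcome is always \<open>0\<close>. In step
  \<open>n\<close> the factor \<open>delta s p\<close> leaves the ancilla in the state named by the
  outcome.\<close>

definition readout :: "nat \<Rightarrow> bool \<Rightarrow> nat \<Rightarrow> nat \<Rightarrow> nat \<Rightarrow> nat \<Rightarrow> complex" where
  "readout n b j s p c = (if j = n
     then delta s p * (if c = 0 then phase b else if s = 0 then 1 else -1) / complex_of_real (sqrt 2)
     else delta 0 s * delta p c)"

lemma lessThan_2: "{..<2::nat} = {0, 1}"
  by auto

lemma sqrt2_mult: "complex_of_real (sqrt 2) * complex_of_real (sqrt 2) = 2"
  by (simp flip: of_real_mult)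

lemma prep_orth:
  assumes "p < 2" "p' < 2"
  shows "(\<Sum>c<2. cnj (prep j c p) * prep j c p') = delta p p'"
proof -
  have "p = 0 \<or> p = 1" "p' = 0 \<or> p' = 1" using assms by auto
  then show ?thesis
    by (auto simp: lessThan_2 prep_def hadamard_def delta_def sqrt2_mult)
qed

lemma readout_orth:
  assumes "c < 2" "c' < 2"
  shows "(\<Sum>s<2. \<Sum>p<2. cnj (readout n b j s p c) * readout n b j s p c') = delta c c'"
proof -
  have "c = 0 \<or> c = 1" "c' = 0 \<or> c' = 1" using assms by auto
  then show ?thesis
    by (auto simp: lessThan_2 readout_def delta_def sqrt2_mult cnj_phase_mult)
qed

text \<open>The observable measured by the signed readout. It is off-diagonal in the control basis,
  so only the coherences between the two branches survive, with the phase \<open>phase b\<close> or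
  its conjugate.\<close>

lemma readout_weight:
  assumes "c < 2" "c' < 2"
  shows "(\<Sum>p<2. \<Sum>s<2. complex_of_real (pair_sign s) * readout n b n s p c * cnj (readout n b n s p c'))
    = (if c = c' then 0 else if c = 0 then phase b else cnj (phase b))"
proof -
  have "c = 0 \<or> c = 1" "c' = 0 \<or> c' = 1" using assms by auto
  then show ?thesis
    by (auto simp: lessThan_2 readout_def delta_def pair_sign_def sqrt2_mult field_simps)
qed

lemma prep_weight: "c < 2 \<Longrightarrow> prep 1 c 0 = 1 / complex_of_real (sqrt 2)"
  by (simp add: prep_def hadamard_def)

text \<open>Completeness of the readout collapses the double sum over control labels to its
  diagonal. There each \<open>l c\<close> is isometric, and the preparation is unitary on the
  ancilla.\<close>

lemma kraus_pair_controlled: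
  fixes X :: "'x set"
  assumes l: "\<And>c. c < 2 \<Longrightarrow> isometric X X (l c)"
  shows "kraus_pair (X \<times> {..<2}) (\<lambda>s. controlled {..<2} (readout n b j s) (prep j) l)"
  unfolding kraus_pair_def
proof (intro ballI)
  fix z z' assume "z \<in> X \<times> {..<2::nat}" "z' \<in> X \<times> {..<2::nat}"
  then obtain y p y' p' where z: "z = (y, p)" "z' = (y', p')" and mem: "y \<in> X" "y' \<in> X" "p < 2" "p' < 2"
    by auto
  let ?K = "\<lambda>s. controlled {..<2} (readout n b j s) (prep j) l"
  define T where "T = (\<lambda>s q x c c'. (cnj (readout n b j s q c) * readout n b j s q c') * ((cnj (prep j c p) * prep j c' p') * (cnj (l c x y) * l c' x y')))"
  have "(\<Sum>k\<in>X \<times> {..<2}. cnj (?K 0 k z) * ?K 0 k z') + (\<Sum>k\<in>X \<times> {..<2}. cnj (?K 1 k z) * ?K 1 k z')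
      = (\<Sum>s<2. \<Sum>k\<in>X \<times> {..<2}. cnj (?K s k z) * ?K s k z')"
    by (simp add: lessThan_2)
  also have "\<dots> = (\<Sum>s<2. \<Sum>x\<in>X. \<Sum>q<2. \<Sum>c<2. \<Sum>c'<2. T s q x c c')"
    unfolding sum.cartesian_product' z controlled_def prod.case cnj_sum sum_product by (simp add: T_def mult_ac)
  also have "\<dots> = (\<Sum>s<2. \<Sum>q<2. \<Sum>x\<in>X. \<Sum>c<2. \<Sum>c'<2. T s q x c c')"
    by (rule sum.cong[OF refl]) (rule sum.swap)
  also have "\<dots> = (\<Sum>s<2. \<Sum>q<2. \<Sum>c<2. \<Sum>c'<2. \<Sum>x\<in>X. T s q x c c')"
    by (simp only: sum.swap[of _ X])
  also have "\<dots> = (\<Sum>c<2. \<Sum>c'<2. \<Sum>s<2. \<Sum>q<2. \<Sum>x\<in>X. T s q x c c')"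
    by (rule sum_swap_pairs)
  also have "\<dots> = (\<Sum>c<2. \<Sum>c'<2. \<Sum>s<2. \<Sum>q<2. (cnj (readout n b j s q c) * readout n b j s q c') *
      ((cnj (prep j c p) * prep j c' p') * (\<Sum>x\<in>X. cnj (l c x y) * l c' x y')))"
    unfolding T_def by (simp only: sum_distrib_left)
  also have "\<dots> = (\<Sum>c<2. \<Sum>c'<2. (\<Sum>s<2. \<Sum>q<2. cnj (readout n b j s q c) * readout n b j s q c') *
      ((cnj (prep j c p) * prep j c' p') * (\<Sum>x\<in>X. cnj (l c x y) * l c' x y')))"
    by (simp only: sum_distrib_right)
  also have "\<dots> = (\<Sum>c<2. \<Sum>c'<2. delta c c' *
      ((cnj (prep j c p) * prep j c' p') * (\<Sum>x\<in>X. cnj (l c x y) * l c' x y')))"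
    by (intro sum.cong refl arg_cong2[where f = "(*)"] readout_orth) auto
  also have "\<dots> = (\<Sum>c<2. (cnj (prep j c p) * prep j c p') * (if y = y' then 1 else 0))"
    using l mem by (auto simp: sum_delta_left isometric_def intro!: sum.cong)
  also have "\<dots> = (if z = z' then 1 else 0)"
    unfolding sum_distrib_right[symmetric] prep_orth[OF mem(3,4)] by (auto simp: z delta_def)
  finally show "(\<Sum>k\<in>X \<times> {..<2}. cnj (?K 0 k z) * ?K 0 k z') + (\<Sum>k\<in>X \<times> {..<2}. cnj (?K 1 k z) * ?K 1 k z')
      = (if z = z' then 1 else 0)" .
qed

text \<open>The embedding concerns the main system only and so passes through the control.\<close>

lemma lift_op_controlled:
  assumes P: "finite P" and p: "p \<in> P" "p' \<in> P"
  shows "lift_op (X \<times> P) R (ancilla_embedding V) (controlled P h g l) (a, p) (a', p')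
    = (\<Sum>c\<in>P. (h p c * g c p') * lift_op X R V (l c) a a')"
proof -
  have "lift_op (X \<times> P) R (ancilla_embedding V) (controlled P h g l) (a, p) (a', p')
    = (\<Sum>x\<in>X. \<Sum>s\<in>P. \<Sum>r\<in>R. \<Sum>x'\<in>X. \<Sum>t\<in>P. cnj (V (x, r) a * delta s p) *
        (\<Sum>c\<in>P. h s c * g c t * l c x x') * (V (x', r) a' * delta t p'))"
    by (simp add: lift_op_def ancilla_embedding_def controlled_def sum.cartesian_product')
  also have "\<dots> = (\<Sum>x\<in>X. \<Sum>s\<in>P. delta p s * (\<Sum>r\<in>R. \<Sum>x'\<in>X. \<Sum>t\<in>P. delta p' t *
      (cnj (V (x, r) a) * (\<Sum>c\<in>P. h s c * g c t * l c x x') * V (x', r) a')))"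
    unfolding sum_distrib_left by (intro sum.cong refl) (auto simp: delta_def)
  also have "\<dots> = lift_op X R V (\<lambda>x x'. \<Sum>c\<in>P. (h p c * g c p') * l c x x') a a'"
    using P p by (simp add: sum_delta_left lift_op_def)
  finally show ?thesis
    by (simp add: lift_op_lin_comb)
qed

text \<open>Two local controlled operators form one operator controlled by the pair of ancillas, the
  shape that \<open>controlled_circuit\<close> requires.\<close>

lemma shuffle_kron_lift_op_controlled:
  fixes \<Gamma>
  defines "\<Gamma> \<equiv> {..<2::nat} \<times> {..<2::nat}"
  assumes "snd y \<in> \<Gamma>" "snd z \<in> \<Gamma>"
  shows "shuffle_kron (lift_op (X \<times> {..<2}) R (ancilla_embedding V) (controlled {..<2} h g l))
      (lift_op (Y \<times> {..<2}) R' (ancilla_embedding V') (controlled {..<2} h' g' r)) y z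
    = controlled \<Gamma> (\<lambda>\<pi> \<gamma>. h (fst \<pi>) (fst \<gamma>) * h' (snd \<pi>) (snd \<gamma>)) (\<lambda>\<gamma> \<pi>. g (fst \<gamma>) (fst \<pi>) * g' (snd \<gamma>) (snd \<pi>))
        (\<lambda>\<gamma>. kron (lift_op X R V (l (fst \<gamma>))) (lift_op Y R' V' (r (snd \<gamma>)))) y z"
proof -
  obtain a b p q where y: "y = ((a, b), (p, q))" by (metis surj_pair)
  obtain a' b' p' q' where z: "z = ((a', b'), (p', q'))" by (metis surj_pair)
  have mem: "p \<in> {..<2}" "q \<in> {..<2}" "p' \<in> {..<2}" "q' \<in> {..<2}"
    using assms by (auto simp: y z)
  show ?thesis
    unfolding y z shuffle_kron_def prod.case lift_op_controlled[OF finite_lessThan mem(1,3)] lift_op_controlled[OF finite_lessThan mem(2,4)]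
    unfolding sum_product controlled_def \<Gamma>_def
    by (simp add: sum.cartesian_product' mult_ac)
qed

lemma tensor_signed_map_expand:
  assumes fin: "finite X" "finite Y" and M: "M \<in> ops (X \<times> Y)"
  shows "tensor_map (signed_map X K) (signed_map Y J) M = (\<lambda>y y'. \<Sum>\<sigma>\<in>{..<2} \<times> {..<2}.
      complex_of_real (pair_sign (fst \<sigma>) * pair_sign (snd \<sigma>)) * conj_map (X \<times> Y) (X \<times> Y) (kron (K (fst \<sigma>)) (J (snd \<sigma>))) M y y')"
proof (rule linear_map_eqI[OF linear_map_tensor_map[OF linear_map_signed_map linear_map_signed_map] linear_map_sum_maps _ M])
  show finXY: "finite (X \<times> Y)" using fin by simp
  fix p p' y y' assume mem: "p \<in> X \<times> Y" "p' \<in> X \<times> Y" "y \<in> X \<times> Y" "y' \<in> X \<times> Y"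
  obtain a b a' b' c d c' d' where eq: "p = (a, b)" "p' = (a', b')" "y = (c, d)" "y' = (c', d')"
    by (metis surj_pair)
  have m: "a \<in> X" "b \<in> Y" "a' \<in> X" "b' \<in> Y" "c \<in> X" "d \<in> Y" "c' \<in> X" "d' \<in> Y"
    using mem by (auto simp: eq)
  show "tensor_map (signed_map X K) (signed_map Y J) (matrix_unit p p') y y' = (\<Sum>\<sigma>\<in>{..<2} \<times> {..<2}.
      complex_of_real (pair_sign (fst \<sigma>) * pair_sign (snd \<sigma>)) * conj_map (X \<times> Y) (X \<times> Y) (kron (K (fst \<sigma>)) (J (snd \<sigma>))) (matrix_unit p p') y y')"
    unfolding conj_map_eq_sandwich sandwich_unit[OF finXY mem(1,2)]
    unfolding eq tensor_map_unit[OF linear_map_signed_map linear_map_signed_map fin m(1,2,3,4)]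
    unfolding signed_map_def conj_map_eq_sandwich sandwich_unit[OF fin(1) m(1,3)] sandwich_unit[OF fin(2) m(2,4)]
    using m by (simp add: sum.cartesian_product' lessThan_2 pair_sign_def algebra_simps)
qed (intro linear_map_scale linear_map_conj_map)

lemma act_on_subsystem_cong:
  assumes "\<And>M. M \<in> ops X \<Longrightarrow> P M = Q M"
  shows "act_on_subsystem A X R W P M = act_on_subsystem A X R W Q M"
proof -
  have N: "conj_map A (X \<times> R) W M \<in> ops (X \<times> R)"
    by (simp add: conj_map_eq_sandwich)
  have "tensor_map P id (conj_map A (X \<times> R) W M) = tensor_map Q id (conj_map A (X \<times> R) W M)"
    using assms[OF block_in_ops(1)[OF N]] by (simp add: tensor_map_def)
  then show ?thesis
    by (simp add: act_on_subsystem_def)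
qed

context qubit_unitaries
begin

definition pick :: "('k \<Rightarrow> 'm) \<Rightarrow> 'k \<Rightarrow> 'k \<Rightarrow> nat \<Rightarrow> 'm" where
  "pick f k k' c = (if c = 0 then f k else f k')"

text \<open>Control value \<open>0\<close> selects the sequence \<open>\<kappa>\<close> and control
  value \<open>1\<close> the sequence \<open>\<kappa>'\<close>, for each party separately;
  \<open>b\<close> selects which quadrature of the coherence is read out.\<close>

definition gadget :: "(nat \<Rightarrow> nat) \<times> (nat \<Rightarrow> nat) \<times> bool \<Rightarrow> nat \<Rightarrow>
    ((bool \<times> nat) \<times> (bool \<times> nat), (bool \<times> nat) \<times> (bool \<times> nat)) opmap" where
  "gadget = (\<lambda>(\<kappa>, \<kappa>', b) j. tensor_map
     (signed_map (qubit \<times> {..<2}) (\<lambda>s. controlled {..<2} (readout n b j s) (prep j) (pick (L j) (\<kappa> j) (\<kappa>' j))))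
     (signed_map (qubit \<times> {..<2}) (\<lambda>s. controlled {..<2} (readout n b j s) (prep j) (pick (R j) (\<kappa> j) (\<kappa>' j)))))"

lemma gadget_mem:
  assumes S: "\<And>A B K J. finite A \<Longrightarrow> finite B \<Longrightarrow> kraus_pair A K \<Longrightarrow> kraus_pair B J \<Longrightarrow>
      tensor_map (signed_map A K) (signed_map B J) \<in> S A B"
    and t: "t \<in> terms" and j: "j \<in> {1..n}"
  shows "gadget t j \<in> S (qubit \<times> {..<2}) (qubit \<times> {..<2})"
proof -
  obtain \<kappa> \<kappa>' b where eq: "t = (\<kappa>, \<kappa>', b)" "\<kappa> \<in> multi_index n" "\<kappa>' \<in> multi_index n"
    using t by (auto simp: terms_def)
  have less: "\<kappa> j < 4" "\<kappa>' j < 4"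
    using multi_index_less[OF eq(2) j] multi_index_less[OF eq(3) j] by auto
  show ?thesis
    unfolding eq(1) gadget_def prod.case
    by (intro S kraus_pair_controlled) (auto simp: pick_def isoL[OF j] isoR[OF j] less)
qed

lemma act_on_subsystem_gadget:
  fixes \<Gamma>
  defines "\<Gamma> \<equiv> {..<2::nat} \<times> {..<2::nat}"
  assumes fin: "finite AB" "finite RA" "finite RB"
  shows "act_on_subsystem (AB \<times> \<Gamma>) ((qubit \<times> {..<2}) \<times> (qubit \<times> {..<2})) (RA \<times> RB) (joint_embedding_ancilla V V') (gadget (\<kappa>, \<kappa>', b) j) N
    = (\<lambda>y y'. \<Sum>\<sigma>\<in>\<Gamma>. complex_of_real (pair_sign (fst \<sigma>) * pair_sign (snd \<sigma>)) * conj_map (AB \<times> \<Gamma>) (AB \<times> \<Gamma>)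
        (controlled \<Gamma> (\<lambda>\<pi> \<gamma>. readout n b j (fst \<sigma>) (fst \<pi>) (fst \<gamma>) * readout n b j (snd \<sigma>) (snd \<pi>) (snd \<gamma>))
          (\<lambda>\<gamma> \<pi>. prep j (fst \<gamma>) (fst \<pi>) * prep j (snd \<gamma>) (snd \<pi>))
          (\<lambda>\<gamma>. kron (lift_op qubit RA V (pick (L j) (\<kappa> j) (\<kappa>' j) (fst \<gamma>))) (lift_op qubit RB V' (pick (R j) (\<kappa> j) (\<kappa>' j) (snd \<gamma>))))) N y y')"
proof -
  let ?X = "qubit \<times> {..<2::nat}" and ?Z = "(qubit \<times> {..<2::nat}) \<times> (qubit \<times> {..<2::nat})"
  let ?KL = "\<lambda>s. controlled {..<2} (readout n b j s) (prep j) (pick (L j) (\<kappa> j) (\<kappa>' j))"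
  let ?KR = "\<lambda>s. controlled {..<2} (readout n b j s) (prep j) (pick (R j) (\<kappa> j) (\<kappa>' j))"
  have finX: "finite ?X" "finite ?Z" "finite (RA \<times> RB)" "finite (AB \<times> \<Gamma>)" "finite \<Gamma>"
    using fin by (auto simp: \<Gamma>_def)
  have "act_on_subsystem (AB \<times> \<Gamma>) ?Z (RA \<times> RB) (joint_embedding_ancilla V V') (gadget (\<kappa>, \<kappa>', b) j) N
    = act_on_subsystem (AB \<times> \<Gamma>) ?Z (RA \<times> RB) (joint_embedding_ancilla V V')
       (\<lambda>M y y'. \<Sum>\<sigma>\<in>\<Gamma>. complex_of_real (pair_sign (fst \<sigma>) * pair_sign (snd \<sigma>)) *
          conj_map ?Z ?Z (kron (?KL (fst \<sigma>)) (?KR (snd \<sigma>))) M y y') N"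
    unfolding gadget_def prod.case \<Gamma>_def by (rule act_on_subsystem_cong) (rule tensor_signed_map_expand[OF finX(1) finX(1)])
  also have "\<dots> = (\<lambda>y y'. \<Sum>\<sigma>\<in>\<Gamma>. complex_of_real (pair_sign (fst \<sigma>) * pair_sign (snd \<sigma>)) *
      act_on_subsystem (AB \<times> \<Gamma>) ?Z (RA \<times> RB) (joint_embedding_ancilla V V') (conj_map ?Z ?Z (kron (?KL (fst \<sigma>)) (?KR (snd \<sigma>)))) N y y')"
    by (rule act_on_subsystem_lin_comb[OF linear_map_conj_map finX(5)])
  also have "\<dots> = (\<lambda>y y'. \<Sum>\<sigma>\<in>\<Gamma>. complex_of_real (pair_sign (fst \<sigma>) * pair_sign (snd \<sigma>)) * conj_map (AB \<times> \<Gamma>) (AB \<times> \<Gamma>)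
        (controlled \<Gamma> (\<lambda>\<pi> \<gamma>. readout n b j (fst \<sigma>) (fst \<pi>) (fst \<gamma>) * readout n b j (snd \<sigma>) (snd \<pi>) (snd \<gamma>))
          (\<lambda>\<gamma> \<pi>. prep j (fst \<gamma>) (fst \<pi>) * prep j (snd \<gamma>) (snd \<pi>))
          (\<lambda>\<gamma>. kron (lift_op qubit RA V (pick (L j) (\<kappa> j) (\<kappa>' j) (fst \<gamma>))) (lift_op qubit RB V' (pick (R j) (\<kappa> j) (\<kappa>' j) (snd \<gamma>))))) N y y')"
    unfolding act_on_subsystem_conj_map[OF finX(4,2,3)] lift_op_joint_embedding_ancilla
    by (intro ext sum.cong refl arg_cong2[where f = "(*)"] fun_cong[OF fun_cong[OF conj_map_cong]])
      (auto simp: shuffle_kron_lift_op_controlled \<Gamma>_def)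
  finally show ?thesis .
qed

text \<open>The channels in between act on the main system only. Hence the coherence between the
  control states \<open>(0, 0)\<close> and \<open>(1, 1)\<close> carries the cross term of the whole
  expanded circuit for \<open>\<kappa>\<close> and \<open>\<kappa>'\<close>, whatever these channels
  are.\<close>

lemma gadget_black_box:
  fixes dA dB :: nat and \<rho> :: "(nat \<times> nat) oper"
  defines "AB \<equiv> {..<dA} \<times> {..<dB}" and "\<Gamma> \<equiv> {..<2::nat} \<times> {..<2::nat}"
  assumes n: "1 \<le> n"
    and U: "\<And>j. j \<in> {1..n} \<Longrightarrow> U j = conj_map (qubit \<times> qubit) (qubit \<times> qubit) (W j)"
    and B: "\<And>k. k \<in> {1..<n} \<Longrightarrow> linear_map AB AB (B k)" and \<rho>: "\<rho> \<in> ops AB"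
  shows "circuit (\<lambda>j. act_on_subsystem AB (qubit \<times> qubit) ({..<rA j :: nat} \<times> {..<rB j :: nat}) (joint_embedding (V j) (V' j)) (U j)) B n \<rho>
    = (\<lambda>x x'. \<Sum>t\<in>terms. complex_of_real (term_coeff t) * partial_trace \<Gamma>
         (circuit (\<lambda>j. act_on_subsystem (AB \<times> \<Gamma>) ((qubit \<times> {..<2}) \<times> (qubit \<times> {..<2})) ({..<rA j} \<times> {..<rB j})
            (joint_embedding_ancilla (V j) (V' j)) (gadget t j)) (\<lambda>k. tensor_map (B k) id) n
            (attach_state (matrix_unit (0, 0) (0, 0)) \<rho>)) x x')"
proof -
  have finAB: "finite AB" and fin\<Gamma>: "finite \<Gamma>" by (simp_all add: AB_def \<Gamma>_def)
  define Q where "Q = (\<lambda>j c. kron (lift_op qubit {..<rA j} (V j) (L j c)) (lift_op qubit {..<rB j} (V' j) (R j c)))"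
  define M where "M = (\<lambda>\<kappa> \<kappa>' j \<gamma>. kron (lift_op qubit {..<rA j} (V j) (pick (L j) (\<kappa> j) (\<kappa>' j) (fst \<gamma>)))
      (lift_op qubit {..<rB j} (V' j) (pick (R j) (\<kappa> j) (\<kappa>' j) (snd \<gamma>))) :: nat \<times> nat \<Rightarrow> nat \<times> nat \<Rightarrow> complex)"
  define G where "G = (\<lambda>\<kappa> \<kappa>'. circuit (\<lambda>j. sandwich AB AB (Q j (\<kappa> j)) (Q j (\<kappa>' j))) B n \<rho>)"
  define C where "C = (\<lambda>\<kappa> \<kappa>' \<gamma> \<gamma>'. circuit (\<lambda>j. sandwich AB AB (M \<kappa> \<kappa>' j \<gamma>) (M \<kappa> \<kappa>' j \<gamma>')) B n \<rho>)"
  define Xt where "Xt = (\<lambda>t. partial_trace \<Gamma>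
         (circuit (\<lambda>j. act_on_subsystem (AB \<times> \<Gamma>) ((qubit \<times> {..<2}) \<times> (qubit \<times> {..<2})) ({..<rA j} \<times> {..<rB j})
            (joint_embedding_ancilla (V j) (V' j)) (gadget t j)) (\<lambda>k. tensor_map (B k) id) n
            (attach_state (matrix_unit (0, 0) (0, 0)) \<rho>)))"
  have "circuit (\<lambda>j. act_on_subsystem AB (qubit \<times> qubit) ({..<rA j} \<times> {..<rB j}) (joint_embedding (V j) (V' j)) (U j)) B n
      = circuit (\<lambda>j. sandwich AB AB (\<lambda>x y. \<Sum>c<4. complex_of_real (u j c) * Q j c x y) (\<lambda>x y. \<Sum>c<4. complex_of_real (u j c) * Q j c x y)) B n"
  proof (rule circuit_cong)
    fix j assume j: "j \<in> {1..n}"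
    have "lift_op (qubit \<times> qubit) ({..<rA j} \<times> {..<rB j}) (joint_embedding (V j) (V' j)) (W j) = (\<lambda>x y. \<Sum>c<4. complex_of_real (u j c) * Q j c x y)"
    proof (intro ext)
      fix x y :: "nat \<times> nat"
      obtain a b a' b' where xy: "x = (a, b)" "y = (a', b')" by (metis surj_pair)
      show "lift_op (qubit \<times> qubit) ({..<rA j} \<times> {..<rB j}) (joint_embedding (V j) (V' j)) (W j) x y = (\<Sum>c<4. complex_of_real (u j c) * Q j c x y)"
        unfolding xy lift_op_W[OF j] Q_def kron_apply ..
    qed
    then show "act_on_subsystem AB (qubit \<times> qubit) ({..<rA j} \<times> {..<rB j}) (joint_embedding (V j) (V' j)) (U j)
      = sandwich AB AB (\<lambda>x y. \<Sum>c<4. complex_of_real (u j c) * Q j c x y) (\<lambda>x y. \<Sum>c<4. complex_of_real (u j c) * Q j c x y)"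
      unfolding U[OF j] by (subst act_on_subsystem_conj_map) (auto simp: finAB conj_map_eq_sandwich)
  qed
  then have lhs: "circuit (\<lambda>j. act_on_subsystem AB (qubit \<times> qubit) ({..<rA j} \<times> {..<rB j}) (joint_embedding (V j) (V' j)) (U j)) B n \<rho>
      = (\<lambda>x x'. \<Sum>\<kappa>\<in>multi_index n. \<Sum>\<kappa>'\<in>multi_index n. complex_of_real (weight \<kappa> * weight \<kappa>') * G \<kappa> \<kappa>' x x')"
    unfolding G_def weight_def by (simp only: circuit_expand[OF finAB B \<rho>])
  \<comment> \<open>Each block is weighted by the readouts of both control qubits and by
    \<open>1 / 4\<close>, the product of four amplitudes \<open>1 / sqrt 2\<close> from the
    preparation.\<close>
  have Xt: "Xt (\<kappa>, \<kappa>', b) x x' = (\<Sum>\<gamma>\<in>\<Gamma>. \<Sum>\<gamma>'\<in>\<Gamma>. (\<lambda>Z. Z (fst \<gamma>) (fst \<gamma>') * Z (snd \<gamma>) (snd \<gamma>')) 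
      (\<lambda>c c'. (if c = c' then 0 else if c = 0 then phase b else cnj (phase b))) / 4 * C \<kappa> \<kappa>' \<gamma> \<gamma>' x x')" for \<kappa> \<kappa>' b x x'
  proof -
    define h where "h = (\<lambda>j \<sigma> \<pi> \<gamma>. readout n b j (fst \<sigma>) (fst \<pi>) (fst \<gamma>) * readout n b j (snd \<sigma>) (snd \<pi>) (snd \<gamma>))"
    define g where "g = (\<lambda>j \<gamma> \<pi>. prep j (fst \<gamma>) (fst \<pi>) * prep j (snd \<gamma>) (snd \<pi>))"
    define sg where "sg = (\<lambda>\<sigma>. complex_of_real (pair_sign (fst \<sigma>) * pair_sign (snd \<sigma>)))"
    define Z where "Z = (\<lambda>c c' :: nat. (if c = c' then 0 else if c = 0 then phase b else cnj (phase b)))"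
    have circ: "circuit (\<lambda>j. act_on_subsystem (AB \<times> \<Gamma>) ((qubit \<times> {..<2}) \<times> (qubit \<times> {..<2})) ({..<rA j} \<times> {..<rB j})
            (joint_embedding_ancilla (V j) (V' j)) (gadget (\<kappa>, \<kappa>', b) j)) (\<lambda>k. tensor_map (B k) id) n
            (attach_state (matrix_unit (0, 0) (0, 0)) \<rho>)
      = (\<lambda>(x, \<pi>) (x', \<pi>'). if \<pi> \<in> \<Gamma> \<and> \<pi>' \<in> \<Gamma> then (\<Sum>\<gamma>\<in>\<Gamma>. \<Sum>\<gamma>'\<in>\<Gamma>.
          (\<Sum>\<sigma>\<in>\<Gamma>. sg \<sigma> * h n \<sigma> \<pi> \<gamma> * cnj (h n \<sigma> \<pi>' \<gamma>')) * (g 1 \<gamma> (0, 0) * cnj (g 1 \<gamma>' (0, 0))) * C \<kappa> \<kappa>' \<gamma> \<gamma>' x x') else 0)"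
      unfolding C_def
    proof (rule controlled_circuit[OF finAB fin\<Gamma> _ _ _ _ _ B \<rho> n order_refl])
      show "(0, 0) \<in> \<Gamma>" by (simp add: \<Gamma>_def)
      show "sg (0, 0) = 1" by (simp add: sg_def pair_sign_def)
      show "act_on_subsystem (AB \<times> \<Gamma>) ((qubit \<times> {..<2}) \<times> (qubit \<times> {..<2})) ({..<rA j} \<times> {..<rB j})
            (joint_embedding_ancilla (V j) (V' j)) (gadget (\<kappa>, \<kappa>', b) j) N
          = (\<lambda>y y'. \<Sum>\<sigma>\<in>\<Gamma>. sg \<sigma> * conj_map (AB \<times> \<Gamma>) (AB \<times> \<Gamma>) (controlled \<Gamma> (h j \<sigma>) (g j) (M \<kappa> \<kappa>' j)) N y y')" for j N
        unfolding \<Gamma>_def sg_def h_def g_def M_def by (rule act_on_subsystem_gadget) (auto simp: finAB)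
      show "h j \<sigma> \<pi> \<gamma> = delta (0, 0) \<sigma> * delta \<pi> \<gamma>" if "j \<in> {1..<n}" for j \<sigma> \<pi> \<gamma>
        using that by (cases \<sigma>; cases \<pi>; cases \<gamma>) (auto simp: h_def readout_def delta_def)
      show "g j \<gamma> \<tau> = delta \<gamma> \<tau>" if "j \<in> {2..n}" for j \<gamma> \<tau>
        using that by (cases \<gamma>; cases \<tau>) (auto simp: g_def prep_def delta_def)
    qed
    have w: "(\<Sum>\<pi>\<in>\<Gamma>. \<Sum>\<sigma>\<in>\<Gamma>. sg \<sigma> * h n \<sigma> \<pi> \<gamma> * cnj (h n \<sigma> \<pi> \<gamma>')) * (g 1 \<gamma> (0, 0) * cnj (g 1 \<gamma>' (0, 0)))
        = Z (fst \<gamma>) (fst \<gamma>') * Z (snd \<gamma>) (snd \<gamma>') / 4" if "\<gamma> \<in> \<Gamma>" "\<gamma>' \<in> \<Gamma>" for \<gamma> \<gamma>'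
    proof -
      obtain c d c' d' where \<gamma>: "\<gamma> = (c, d)" "\<gamma>' = (c', d')" by (metis surj_pair)
      have less: "c < 2" "d < 2" "c' < 2" "d' < 2" using that by (auto simp: \<gamma> \<Gamma>_def)
      define z where "z = (\<lambda>c c' p s. complex_of_real (pair_sign s) * readout n b n s p c * cnj (readout n b n s p c'))"
      have "(\<Sum>\<pi>\<in>\<Gamma>. \<Sum>\<sigma>\<in>\<Gamma>. sg \<sigma> * h n \<sigma> \<pi> \<gamma> * cnj (h n \<sigma> \<pi> \<gamma>'))
          = (\<Sum>p<2. \<Sum>q<2. \<Sum>s<2. \<Sum>t<2. z c c' p s * z d d' q t)"
        by (simp add: \<Gamma>_def sum.cartesian_product' sg_def h_def \<gamma> z_def mult_ac)
      also have "\<dots> = (\<Sum>p<2. \<Sum>s<2. \<Sum>q<2. \<Sum>t<2. z c c' p s * z d d' q t)"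
        by (rule sum.cong[OF refl]) (rule sum.swap)
      also have "\<dots> = (\<Sum>p<2. \<Sum>s<2. z c c' p s) * (\<Sum>q<2. \<Sum>t<2. z d d' q t)"
        by (subst sum_distrib_right, subst sum_distrib_right) (simp only: sum_distrib_left)
      also have "\<dots> = Z c c' * Z d d'"
        unfolding z_def readout_weight[OF less(1,3)] readout_weight[OF less(2,4)] Z_def ..
      finally have 1: "(\<Sum>\<pi>\<in>\<Gamma>. \<Sum>\<sigma>\<in>\<Gamma>. sg \<sigma> * h n \<sigma> \<pi> \<gamma> * cnj (h n \<sigma> \<pi> \<gamma>')) = Z c c' * Z d d'" .
      have 2: "g 1 \<gamma> (0, 0) * cnj (g 1 \<gamma>' (0, 0)) = 1 / 4"
        unfolding g_def \<gamma> fst_conv snd_conv prep_weight[OF less(1)] prep_weight[OF less(2)] prep_weight[OF less(3)] prep_weight[OF less(4)]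
        by (simp add: sqrt2_mult)
      then show ?thesis
        unfolding 1 2 by (simp add: \<gamma>)
    qed
    have "Xt (\<kappa>, \<kappa>', b) x x' = (\<Sum>\<pi>\<in>\<Gamma>. \<Sum>\<gamma>\<in>\<Gamma>. \<Sum>\<gamma>'\<in>\<Gamma>.
          (\<Sum>\<sigma>\<in>\<Gamma>. sg \<sigma> * h n \<sigma> \<pi> \<gamma> * cnj (h n \<sigma> \<pi> \<gamma>')) * ((g 1 \<gamma> (0, 0) * cnj (g 1 \<gamma>' (0, 0))) * C \<kappa> \<kappa>' \<gamma> \<gamma>' x x'))"
      unfolding Xt_def circ by (simp add: partial_trace_def mult.assoc)
    also have "\<dots> = (\<Sum>\<gamma>\<in>\<Gamma>. \<Sum>\<pi>\<in>\<Gamma>. \<Sum>\<gamma>'\<in>\<Gamma>.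
          (\<Sum>\<sigma>\<in>\<Gamma>. sg \<sigma> * h n \<sigma> \<pi> \<gamma> * cnj (h n \<sigma> \<pi> \<gamma>')) * ((g 1 \<gamma> (0, 0) * cnj (g 1 \<gamma>' (0, 0))) * C \<kappa> \<kappa>' \<gamma> \<gamma>' x x'))"
      by (rule sum.swap)
    also have "\<dots> = (\<Sum>\<gamma>\<in>\<Gamma>. \<Sum>\<gamma>'\<in>\<Gamma>. \<Sum>\<pi>\<in>\<Gamma>.
          (\<Sum>\<sigma>\<in>\<Gamma>. sg \<sigma> * h n \<sigma> \<pi> \<gamma> * cnj (h n \<sigma> \<pi> \<gamma>')) * ((g 1 \<gamma> (0, 0) * cnj (g 1 \<gamma>' (0, 0))) * C \<kappa> \<kappa>' \<gamma> \<gamma>' x x'))"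
      by (rule sum.cong[OF refl]) (rule sum.swap)
    also have "\<dots> = (\<Sum>\<gamma>\<in>\<Gamma>. \<Sum>\<gamma>'\<in>\<Gamma>. Z (fst \<gamma>) (fst \<gamma>') * Z (snd \<gamma>) (snd \<gamma>') / 4 * C \<kappa> \<kappa>' \<gamma> \<gamma>' x x')"
      unfolding sum_distrib_right[symmetric] by (intro sum.cong refl) (rule trans[OF mult.assoc[symmetric] arg_cong2[where f = "(*)", OF w refl]]; assumption)
    finally show ?thesis
      by (simp add: Z_def)
  qed
  have C_eq: "C \<kappa> \<kappa>' (0, 0) (1, 1) = G \<kappa> \<kappa>'" "C \<kappa> \<kappa>' (1, 1) (0, 0) = G \<kappa>' \<kappa>" for \<kappa> \<kappa>'
    by (simp_all add: C_def G_def M_def Q_def pick_def)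
  have C_same: "C \<kappa> \<kappa> \<gamma> \<gamma>' = G \<kappa> \<kappa>" for \<kappa> \<gamma> \<gamma>'
    by (simp add: C_def G_def M_def Q_def pick_def)
  have sumX: "(\<Sum>t\<in>terms. complex_of_real (term_coeff t) * Xt t x x') = (\<Sum>\<kappa>\<in>multi_index n. \<Sum>\<kappa>'\<in>multi_index n. complex_of_real (weight \<kappa> * weight \<kappa>') * G \<kappa> \<kappa>' x x')" for x x'
  proof -
    have "(\<Sum>t\<in>terms. complex_of_real (term_coeff t) * Xt t x x')
        = (\<Sum>(\<kappa>, \<kappa>', b)\<in>multi_index n \<times> multi_index n \<times> UNIV.
        complex_of_real (if b then (if \<kappa> = \<kappa>' then 0 else - (weight \<kappa> * weight \<kappa>')) else weight \<kappa> * weight \<kappa>') * Xt (\<kappa>, \<kappa>', b) x x')"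
      unfolding terms_def by (intro sum.cong refl) (auto simp: term_coeff_def)
    also have "\<dots> = (\<Sum>\<kappa>\<in>multi_index n. \<Sum>\<kappa>'\<in>multi_index n. complex_of_real (weight \<kappa> * weight \<kappa>') * G \<kappa> \<kappa>' x x')"
    proof (rule weighted_pair_sum[OF finite_multi_index])
      fix \<kappa> \<kappa>'
      \<comment> \<open>Blocks between \<open>(0, 1)\<close> and \<open>(1, 0)\<close>, where the
        parties follow different sequences, carry \<open>phase b * cnj (phase b) = 1\<close> for
        both values of \<open>b\<close> and cancel. Those between \<open>(0, 0)\<close> and
        \<open>(1, 1)\<close> carry the square of the phase or of its conjugate, which is
        \<open>1\<close> or \<open>-1\<close>, and add up.\<close>
      show "Xt (\<kappa>, \<kappa>', False) x x' - Xt (\<kappa>, \<kappa>', True) x x' = (G \<kappa> \<kappa>' x x' + G \<kappa>' \<kappa> x x') / 2"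
        unfolding Xt \<Gamma>_def by (simp add: sum.cartesian_product' lessThan_2 phase_def C_eq[unfolded One_nat_def] field_simps)
      \<comment> \<open>For equal multi-indices all four blocks coincide, and their signs are
        \<open>-1\<close>, \<open>1\<close>, \<open>1\<close>, \<open>-1\<close>.\<close>
      show "Xt (\<kappa>, \<kappa>, True) x x' = 0"
        unfolding Xt \<Gamma>_def by (simp add: sum.cartesian_product' lessThan_2 phase_def C_same)
    qed
    finally show ?thesis .
  qed
  show ?thesis
    unfolding lhs by (intro ext) (rule sumX[symmetric, unfolded Xt_def])
qed

text \<open>Any class \<open>S\<close> of maps that contains the products of signed local maps and
  consists of separable contractions has the same extent. This treats \<open>lo_star\<close> and
  \<open>locc_star\<close> alike.\<close>

theorem black_box_extent_eq:
  assumes n: "1 \<le> n"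
    and U: "\<And>j. j \<in> {1..n} \<Longrightarrow> U j = conj_map (qubit \<times> qubit) (qubit \<times> qubit) (W j)"
    and S_upper: "\<And>A B F. finite A \<Longrightarrow> finite B \<Longrightarrow> F \<in> S A B \<Longrightarrow> sep_contr (A \<times> B) product_kraus F"
    and S_lower: "\<And>A B K J. finite A \<Longrightarrow> finite B \<Longrightarrow> kraus_pair A K \<Longrightarrow> kraus_pair B J \<Longrightarrow>
      tensor_map (signed_map A K) (signed_map B J) \<in> S A B"
  shows "black_box_extent S n (\<lambda>_. qubit) (\<lambda>_. qubit) U = ereal extent"
proof -
  obtain h where h: "bij_betw h {1..card terms} terms"
    using ex_bij_betw_nat_finite_1[OF finite_terms] by blast
  have h_sum: "(\<Sum>i=1..card terms. f (h i)) = (\<Sum>t\<in>terms. f t)" for f :: "_ \<Rightarrow> 'z::comm_monoid_add"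
    by (rule sum.reindex_bij_betw[OF h])
  have h_mem: "h i \<in> terms" if "i \<in> {1..card terms}" for i
    using bij_betwE[OF h] that by blast
  \<comment> \<open>One control qubit for each party, hence the ancilla dimensions 2 and 2.\<close>
  have bb: "black_box_decomposition S n (\<lambda>_. qubit) (\<lambda>_. qubit) U 2 2 (card terms) (\<lambda>i. term_coeff (h i)) (\<lambda>i. gadget (h i))"
    unfolding black_box_decomposition_def Let_def
  proof (intro conjI ballI allI impI)
    fix i j assume i: "i \<in> {1..card terms}" and j: "j \<in> {1..n}"
    show "gadget (h i) j \<in> S (qubit \<times> {..<2}) (qubit \<times> {..<2})"
      by (rule gadget_mem[OF S_lower h_mem[OF i] j])
  next
    fix dA dB :: nat and rA rB :: "nat \<Rightarrow> nat" and V V' B \<rho>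
    assume B: "\<forall>k\<in>{1..<n}. cptp ({..<dA} \<times> {..<dB}) ({..<dA} \<times> {..<dB}) (B k)"
      and \<rho>: "\<rho> \<in> ops ({..<dA} \<times> {..<dB})"
    have lin: "linear_map ({..<dA} \<times> {..<dB}) ({..<dA} \<times> {..<dB}) (B k)" if "k \<in> {1..<n}" for k
      using B that by (auto simp: cptp_def tp_def)
    show "circuit (\<lambda>j. act_on_subsystem ({..<dA} \<times> {..<dB}) (qubit \<times> qubit) ({..<rA j} \<times> {..<rB j}) (joint_embedding (V j) (V' j)) (U j)) B n \<rho>
      = (\<lambda>x x'. \<Sum>i=1..card terms. complex_of_real (term_coeff (h i)) * partial_trace ({..<2} \<times> {..<2})
         (circuit (\<lambda>j. act_on_subsystem (({..<dA} \<times> {..<dB}) \<times> ({..<2} \<times> {..<2})) ((qubit \<times> {..<2}) \<times> (qubit \<times> {..<2})) ({..<rA j} \<times> {..<rB j})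
            (joint_embedding_ancilla (V j) (V' j)) (gadget (h i) j)) (\<lambda>k. tensor_map (B k) id) n
            (attach_state (matrix_unit (0, 0) (0, 0)) \<rho>)) x x')"
      by (rule trans[OF gadget_black_box[OF n _ _ \<rho>]], rule U, assumption, rule lin, assumption, intro ext,
        rule h_sum[symmetric])
  qed auto
  show ?thesis
    unfolding black_box_extent_def
  proof (rule antisym, goal_cases)
    case 1
    show ?case
    proof (rule Inf_lower, intro CollectI exI conjI)
      show "ereal extent = ereal (\<Sum>i=1..card terms. \<bar>term_coeff (h i)\<bar>)"
        using h_sum[of "\<lambda>t. \<bar>term_coeff t\<bar>"] by (simp add: sum_term_coeff)
    qed (rule bb)
  next
    case 2
    show ?case
    proof (rule Inf_greatest, elim CollectE exE conjE)
      fix z p q m and a :: "nat \<Rightarrow> real" and F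
      assume z: "z = ereal (\<Sum>i=1..m. \<bar>a i\<bar>)"
        and bb: "black_box_decomposition S n (\<lambda>_. qubit) (\<lambda>_. qubit) U p q m a F"
      show "ereal extent \<le> z"
        unfolding z ereal_less_eq(3) by (rule black_box_lower_bound[OF n S_upper U bb])
    qed
  qed
qed

end

theorem theorem5p66:
  fixes n :: nat and W :: "nat \<Rightarrow> bool \<times> bool \<Rightarrow> bool \<times> bool \<Rightarrow> complex"
    and U :: "nat \<Rightarrow> (bool \<times> bool, bool \<times> bool) opmap"
  assumes "1 \<le> n"
    and "\<And>j. j \<in> {1..n} \<Longrightarrow> unitary (qubit \<times> qubit) (qubit \<times> qubit) (W j)"
    and "\<And>j. j \<in> {1..n} \<Longrightarrow> U j = conj_map (qubit \<times> qubit) (qubit \<times> qubit) (W j)"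
  shows "black_box_extent lo_star n (\<lambda>_. qubit) (\<lambda>_. qubit) U
           = black_box_extent locc_star n (\<lambda>_. qubit) (\<lambda>_. qubit) U
       \<and> black_box_extent locc_star n (\<lambda>_. qubit) (\<lambda>_. qubit) U
           = quasi_extent ((\<Pi>\<^sub>E j\<in>{1..n}. qubit) \<times> (\<Pi>\<^sub>E j\<in>{1..n}. qubit))
               (lo_star (\<Pi>\<^sub>E j\<in>{1..n}. qubit) (\<Pi>\<^sub>E j\<in>{1..n}. qubit))
               (tensor_maps n (\<lambda>_. qubit) (\<lambda>_. qubit) U)"
proof -
  \<comment> \<open>The three components of a decomposition are bundled into one object so that a
    single choice over \<open>j\<close> suffices.\<close>
  have "\<forall>j\<in>{1..n}. \<exists>d. qubit_schmidt (W j) (fst d) (fst (snd d)) (snd (snd d))"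
  proof
    fix j assume "j \<in> {1..n}"
    then have "unitary UNIV UNIV (W j)"
      using assms(2) by simp
    from qubit_schmidt_exists[OF this] obtain u L R where "qubit_schmidt (W j) u L R"
      by blast
    then show "\<exists>d. qubit_schmidt (W j) (fst d) (fst (snd d)) (snd (snd d))"
      by (intro exI[of _ "(u, L, R)"]) simp
  qed
  then obtain d where d: "\<forall>j\<in>{1..n}. qubit_schmidt (W j) (fst (d j)) (fst (snd (d j))) (snd (snd (d j)))"
    by (rule bchoice[THEN exE])
  interpret qubit_unitaries n W "\<lambda>j. fst (d j)" "\<lambda>j. fst (snd (d j))" "\<lambda>j. snd (snd (d j))"
    using d by unfold_locales blast
  have "black_box_extent lo_star n (\<lambda>_. qubit) (\<lambda>_. qubit) U = ereal extent"
    by (rule black_box_extent_eq[OF assms(1,3) lo_star_sep_contr signed_product_lo_star])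
  moreover have "black_box_extent locc_star n (\<lambda>_. qubit) (\<lambda>_. qubit) U = ereal extent"
    by (rule black_box_extent_eq[OF assms(1,3) locc_star_sep_contr signed_product_locc_star])
  ultimately show ?thesis
    using quasi_extent_eq[OF assms(3)] by simp
qed

end
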